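(* Let $r\ge 3$ and $\ell\ge 2$ be integers, let $0<\lambda<1$, and suppose that $\lambda^{1+2s}\ell>1$ for some real number $s$ with $0\le s<r-2$. Then there is an open dense subset of $C^r(S^1,\mathbb{R})$ such that, for every $f$ in this subset, the density with respect to Lebesgue measure of the SBR measure $\mu$ of the map $$T:S^1\times\mathbb{R}\to S^1\times\mathbb{R},\qquad T(x,y)=(\ell x,\lambda y+f(x)),$$ exists and is contained in the Sobolev space $W^s(S^1\times\mathbb{R})$.
   Context: $S^1=\mathbb{R}/\mathbb{Z}$; $C^r(S^1,\mathbb{R})$ has the usual $C^r$ topology. For every $f\in C^r(S^1,\mathbb{R})$ the map $T$ admits an ergodic invariant probability measure $\mu$ for which Lebesgue almost every point of $S^1\times\mathbb{R}$ is generic (i.e. the empirical measures $\frac1n\sum_{k<n}\delta_{T^k\mathbf{x}}$ converge weakly to $\mu$); $\mu$ is called the SBR measure of $T$. For $s\ge 0$, $W^s(S^1\times\mathbb{R})$ is the $L^2$ Sobolev space of order $s$: the functions $\varphi\in L^2(S^1\times\mathbb{R})$ with $\sum_{\xi\in\mathbb{Z}}\int_{\mathbb{R}}|\mathcal{F}\varphi(\xi,\eta)|^2((2\pi\xi)^2+\eta^2)^s\,d\eta<\infty$, where $\mathcal{F}\varphi(\xi,\eta)=\frac1{\sqrt{2\pi}}\int_{S^1\times\mathbb{R}}\varphi(x,y)e^{-\mathbf{i}(2\pi\xi x+\eta y)}\,dx\,dy$. *)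

theory Defs
  imports "HOL-Probability.Probability"
begin

section \<open>The circle\<close>

quotient_type circle = real / "\<lambda>x y :: real. x - y \<in> \<int>"
  morphisms of_circle to_circle
proof (rule equivpI)
  show "reflp (\<lambda>x y :: real. x - y \<in> \<int>)"
    by (simp add: reflp_def)
  show "symp (\<lambda>x y :: real. x - y \<in> \<int>)"
    unfolding symp_def by (metis Ints_minus minus_diff_eq)
  show "transp (\<lambda>x y :: real. x - y \<in> \<int>)"
    unfolding transp_def by (metis Ints_add diff_add_cancel add_diff_eq)
qed

lemma to_circle_eq_iff: "to_circle x = to_circle y \<longleftrightarrow> x - y \<in> \<int>"
  by (rule circle.abs_eq_iff)

lemma surj_to_circle: "surj to_circle"
  by (metis Quotient3_abs_rep Quotient3_circle surjI)

instantiation circle :: topological_space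
begin

definition open_circle :: "circle set \<Rightarrow> bool" where
  "open_circle U \<longleftrightarrow> open (to_circle -` U)"

instance
  by standard (auto simp: open_circle_def vimage_Union intro: open_Int)

end

lemma continuous_on_to_circle: "continuous_on UNIV to_circle"
  by (simp add: continuous_on_open_vimage open_circle_def)

lemma open_map_to_circle:
  assumes "open U"
  shows "open (to_circle ` U)"
proof -
  have "to_circle -` (to_circle ` U) = (\<Union>n\<in>\<int>. (\<lambda>x. n + x) ` U)"
  proof (intro equalityI subsetI)
    fix x assume "x \<in> to_circle -` (to_circle ` U)"
    then obtain u where "to_circle x = to_circle u" "u \<in> U"
      by auto
    then have "x - u \<in> \<int>" "x = (x - u) + u"
      by (auto simp: to_circle_eq_iff)
    with \<open>u \<in> U\<close> show "x \<in> (\<Union>n\<in>\<int>. (\<lambda>x. n + x) ` U)"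
      by blast
  next
    fix x assume "x \<in> (\<Union>n\<in>\<int>. (\<lambda>x. n + x) ` U)"
    then obtain n u where "n \<in> \<int>" "u \<in> U" "x = n + u"
      by blast
    then have "to_circle x = to_circle u"
      by (simp add: to_circle_eq_iff)
    with \<open>u \<in> U\<close> show "x \<in> to_circle -` (to_circle ` U)"
      by simp
  qed
  moreover have "open \<dots>"
    using assms by (intro open_UN ballI open_translation)
  ultimately show ?thesis
    by (simp add: open_circle_def)
qed

instance circle :: second_countable_topology
proof
  obtain B :: "real set set" where B: "countable B" "topological_basis B"
    using ex_countable_basis by blast
  have "topological_basis ((`) to_circle ` B)"
    unfolding topological_basis_def
  proof (intro conjI allI impI ballI)
    fix b assume "b \<in> (`) to_circle ` B"
    then show "open b"
      using B(2) by (auto intro: open_map_to_circle topological_basis_open)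
  next
    fix U :: "circle set" assume "open U"
    then obtain B' where B': "B' \<subseteq> B" "\<Union>B' = to_circle -` U"
      using B(2) unfolding open_circle_def topological_basis_def by metis
    have "\<Union>((`) to_circle ` B') = to_circle ` (to_circle -` U)"
      by (metis B'(2) image_Union)
    also have "\<dots> = U"
      by (simp add: surj_to_circle)
    finally show "\<exists>B''\<subseteq>(`) to_circle ` B. \<Union>B'' = U"
      using B'(1) by (intro exI[of _ "(`) to_circle ` B'"]) auto
  qed
  with B(1) show "\<exists>B :: circle set set. countable B \<and> open = generate_topology B"
    using topological_basis_imp_subbasis by blast
qed

definition circle_lborel :: "circle measure" where
  "circle_lborel = distr (restrict_space lborel {0..<1}) borel to_circle"

lift_definition circle_times :: "nat \<Rightarrow> circle \<Rightarrow> circle" is "\<lambda>l x. real l * x"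
  by (metis Ints_mult Ints_of_nat right_diff_distrib)

lift_definition circle_character :: "int \<Rightarrow> circle \<Rightarrow> complex" is
  "\<lambda>\<xi> x. exp (- (\<i> * complex_of_real (2 * pi * of_int \<xi> * x)))"
proof -
  fix \<xi> :: int and x y :: real assume "x - y \<in> \<int>"
  then obtain k :: int where "x = y + of_int k"
    by (metis Ints_cases add.commute diff_add_cancel)
  then have "- (\<i> * complex_of_real (2 * pi * of_int \<xi> * x)) =
      - (\<i> * complex_of_real (2 * pi * of_int \<xi> * y)) + of_int (2 * (- \<xi> * k)) * complex_of_real pi * \<i>"
    by (simp add: algebra_simps)
  then show "exp (- (\<i> * complex_of_real (2 * pi * of_int \<xi> * x))) =
      exp (- (\<i> * complex_of_real (2 * pi * of_int \<xi> * y)))"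
    unfolding exp_eq by (intro exI[of _ "- \<xi> * k"]) simp
qed

section \<open>The space of r times continuously differentiable functions on the circle\<close>

text \<open>A function on the circle is differentiated by differentiating its 1-periodic lift to the line.\<close>

definition circle_deriv :: "nat \<Rightarrow> (circle \<Rightarrow> real) \<Rightarrow> real \<Rightarrow> real" where
  "circle_deriv k f = (deriv ^^ k) (\<lambda>x. f (to_circle x))"

definition Cr_circle :: "nat \<Rightarrow> (circle \<Rightarrow> real) set" where
  "Cr_circle r = {f. (\<forall>k<r. circle_deriv k f differentiable_on UNIV) \<and>
                     (\<forall>k\<le>r. continuous_on UNIV (circle_deriv k f))}"

text \<open>The value 0 outside \<open>Cr_circle r\<close> is immaterial; it is there because
  \<^locale>\<open>Metric_space\<close> asks for nonnegativity on the whole type.\<close>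

definition Cr_dist :: "nat \<Rightarrow> (circle \<Rightarrow> real) \<Rightarrow> (circle \<Rightarrow> real) \<Rightarrow> real" where
  "Cr_dist r f g =
     (if f \<in> Cr_circle r \<and> g \<in> Cr_circle r
      then \<Sum>k\<le>r. SUP x. \<bar>circle_deriv k f x - circle_deriv k g x\<bar> else 0)"

definition Cr_topology :: "nat \<Rightarrow> (circle \<Rightarrow> real) topology" where
  "Cr_topology r = Metric_space.mtopology (Cr_circle r) (Cr_dist r)"

lemma circle_deriv_periodic: "circle_deriv k f (x + 1) = circle_deriv k f x"
proof (induction k arbitrary: x)
  case 0
  have "to_circle (x + 1) = to_circle x"
    by (simp add: to_circle_eq_iff)
  then show ?case
    by (simp add: circle_deriv_def)
next
  case (Suc k)
  have "deriv (circle_deriv k f) (x + 1) = deriv (\<lambda>x. circle_deriv k f (x + 1)) x"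
    unfolding deriv_def by (simp add: DERIV_shift)
  then show ?case
    by (simp add: Suc.IH) (simp add: circle_deriv_def)
qed

lemma circle_deriv_periodic_nat: "circle_deriv k f (x + real n) = circle_deriv k f x"
proof (induction n)
  case (Suc n)
  then show ?case
    using circle_deriv_periodic[of k f "x + real n"] by (simp add: algebra_simps)
qed simp

lemma circle_deriv_frac: "circle_deriv k f (frac x) = circle_deriv k f x"
proof (cases "\<lfloor>x\<rfloor> \<ge> 0")
  case True
  then have "x = frac x + real (nat \<lfloor>x\<rfloor>)"
    by (simp add: frac_def)
  then show ?thesis
    by (metis circle_deriv_periodic_nat)
next
  case False
  then have "frac x = x + real (nat (- \<lfloor>x\<rfloor>))"
    by (simp add: frac_def)
  then show ?thesis
    by (metis circle_deriv_periodic_nat)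
qed

lemma circle_deriv_bdd:
  assumes "f \<in> Cr_circle r" "g \<in> Cr_circle r" "k \<le> r"
  shows "bdd_above (range (\<lambda>x. \<bar>circle_deriv k f x - circle_deriv k g x\<bar>))"
proof -
  let ?h = "\<lambda>x. \<bar>circle_deriv k f x - circle_deriv k g x\<bar>"
  have "continuous_on UNIV ?h"
    using assms by (auto simp: Cr_circle_def intro!: continuous_intros)
  then have "compact (?h ` {0..1})"
    using compact_continuous_image continuous_on_subset by blast
  then have "bdd_above (?h ` {0..1})"
    by (simp add: bounded_imp_bdd_above compact_imp_bounded)
  moreover have "range ?h \<subseteq> ?h ` {0..1}"
  proof safe
    fix x :: real
    have "?h x = ?h (frac x)"
      by (simp add: circle_deriv_frac)
    moreover have "frac x \<in> {0..1}"
      by (simp add: frac_ge_0 frac_lt_1 less_imp_le)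
    ultimately show "?h x \<in> ?h ` {0..1}"
      by blast
  qed
  ultimately show ?thesis
    by (rule bdd_above_mono)
qed

lemma Metric_space_Cr: "Metric_space (Cr_circle r) (Cr_dist r)"
proof
  let ?D = "\<lambda>k f g x. \<bar>circle_deriv k f x - circle_deriv k g x\<bar>"
  have le: "?D k f g x \<le> (SUP x. ?D k f g x)"
    if "f \<in> Cr_circle r" "g \<in> Cr_circle r" "k \<le> r" for f g k x
    using circle_deriv_bdd[OF that] by (rule cSUP_upper[OF UNIV_I])
  have nn: "0 \<le> (SUP x. ?D k f g x)"
    if "f \<in> Cr_circle r" "g \<in> Cr_circle r" "k \<le> r" for f g k
    using le[OF that, of 0] by linarith
  show "0 \<le> Cr_dist r f g" for f g
    unfolding Cr_dist_def by (auto intro!: sum_nonneg nn)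
  show "Cr_dist r f g = Cr_dist r g f" for f g
    by (simp add: Cr_dist_def abs_minus_commute)
  show "Cr_dist r f g = 0 \<longleftrightarrow> f = g" if fg: "f \<in> Cr_circle r" "g \<in> Cr_circle r" for f g
  proof
    assume "Cr_dist r f g = 0"
    then have "(SUP x. ?D k f g x) = 0" if "k \<le> r" for k
      using fg that nn unfolding Cr_dist_def
      by (subst (asm) if_P, simp, subst (asm) sum_nonneg_eq_0_iff) auto
    then have "?D 0 f g x \<le> 0" for x
      using le[OF fg, of 0 x] by simp
    then have "f (to_circle x) = g (to_circle x)" for x
      by (simp add: circle_deriv_def)
    then show "f = g"
      using surj_to_circle by (metis ext surjD)
  next
    assume "f = g"
    then show "Cr_dist r f g = 0"
      by (simp add: Cr_dist_def)
  qed
  show "Cr_dist r f h \<le> Cr_dist r f g + Cr_dist r g h"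
    if fgh: "f \<in> Cr_circle r" "g \<in> Cr_circle r" "h \<in> Cr_circle r" for f g h
  proof -
    have "(SUP x. ?D k f h x) \<le> (SUP x. ?D k f g x) + (SUP x. ?D k g h x)" if "k \<le> r" for k
    proof (rule cSUP_least)
      fix x
      have "?D k f h x \<le> ?D k f g x + ?D k g h x"
        by linarith
      also have "\<dots> \<le> (SUP x. ?D k f g x) + (SUP x. ?D k g h x)"
        using fgh that by (intro add_mono le)
      finally show "?D k f h x \<le> \<dots>" .
    qed simp
    then show ?thesis
      using fgh by (simp add: Cr_dist_def flip: sum.distrib) (rule sum_mono, simp)
  qed
qed

section \<open>SBR measures of skew products on the cylinder\<close>

definition skew_product :: "nat \<Rightarrow> real \<Rightarrow> (circle \<Rightarrow> real) \<Rightarrow> circle \<times> real \<Rightarrow> circle \<times> real" where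
  "skew_product l a f = (\<lambda>(x, y). (circle_times l x, a * y + f x))"

definition cylinder_lborel :: "(circle \<times> real) measure" where
  "cylinder_lborel = circle_lborel \<Otimes>\<^sub>M lborel"

lemma sets_cylinder_lborel: "sets cylinder_lborel = sets borel"
proof -
  have "sets cylinder_lborel = sets (borel \<Otimes>\<^sub>M borel :: (circle \<times> real) measure)"
    unfolding cylinder_lborel_def circle_lborel_def by (intro sets_pair_measure_cong) auto
  then show ?thesis
    by (simp only: borel_prod)
qed

definition converges_weakly ::
  "(nat \<Rightarrow> 'a::topological_space measure) \<Rightarrow> 'a measure \<Rightarrow> bool" where
  "converges_weakly M N \<longleftrightarrow>
     (\<forall>\<phi> :: 'a \<Rightarrow> real. continuous_on UNIV \<phi> \<and> bounded (range \<phi>) \<longrightarrow>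
        (\<lambda>n. \<integral>z. \<phi> z \<partial>M n) \<longlonglongrightarrow> (\<integral>z. \<phi> z \<partial>N))"

definition empirical_measure ::
  "('a::topological_space \<Rightarrow> 'a) \<Rightarrow> 'a \<Rightarrow> nat \<Rightarrow> 'a measure" where
  "empirical_measure T z n = distr (uniform_count_measure {..<n}) borel (\<lambda>k. (T ^^ k) z)"

definition invariant_measure ::
  "('a::topological_space \<Rightarrow> 'a) \<Rightarrow> 'a measure \<Rightarrow> bool" where
  "invariant_measure T \<mu> \<longleftrightarrow>
     sets \<mu> = sets borel \<and> T \<in> borel \<rightarrow>\<^sub>M borel \<and> distr \<mu> borel T = \<mu>"

definition ergodic_measure ::
  "('a::topological_space \<Rightarrow> 'a) \<Rightarrow> 'a measure \<Rightarrow> bool" where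
  "ergodic_measure T \<mu> \<longleftrightarrow>
     invariant_measure T \<mu> \<and> prob_space \<mu> \<and>
     (\<forall>A\<in>sets borel. T -` A = A \<longrightarrow> measure \<mu> A = 0 \<or> measure \<mu> A = 1)"

definition is_SBR_measure ::
  "(circle \<times> real \<Rightarrow> circle \<times> real) \<Rightarrow> (circle \<times> real) measure \<Rightarrow> bool" where
  "is_SBR_measure T \<mu> \<longleftrightarrow>
     ergodic_measure T \<mu> \<and>
     (AE z in cylinder_lborel. converges_weakly (empirical_measure T z) \<mu>)"

section \<open>Sobolev spaces on the cylinder\<close>

definition square_integrable :: "(circle \<times> real \<Rightarrow> complex) \<Rightarrow> bool" where
  "square_integrable \<phi> \<longleftrightarrow>
     \<phi> \<in> borel_measurable cylinder_lborel \<and> integrable cylinder_lborel (\<lambda>z. (cmod (\<phi> z))\<^sup>2)"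

definition fourier :: "(circle \<times> real \<Rightarrow> complex) \<Rightarrow> int \<Rightarrow> real \<Rightarrow> complex" where
  "fourier \<phi> \<xi> \<eta> = complex_of_real (1 / sqrt (2 * pi)) *
     (\<integral>(x, y). \<phi> (x, y) * (circle_character \<xi> x * exp (- (\<i> * complex_of_real (\<eta> * y)))) \<partial>cylinder_lborel)"

text \<open>The integral defining \<open>fourier\<close> converges only for integrable functions. On square-integrable
  functions the transform is the extension by continuity from the functions that are both integrable
  and square-integrable; \<open>L2_fourier \<phi> g\<close> says that \<open>g\<close> represents the transform of \<open>\<phi>\<close>.
  By Plancherel, \<open>g\<close> exists and is unique up to null sets, and for integrable \<open>\<phi>\<close> it is
  \<open>fourier \<phi>\<close>.\<close>

definition L2_fourier :: "(circle \<times> real \<Rightarrow> complex) \<Rightarrow> (int \<Rightarrow> real \<Rightarrow> complex) \<Rightarrow> bool" where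
  "L2_fourier \<phi> g \<longleftrightarrow>
     square_integrable \<phi> \<and> (\<forall>\<xi>. g \<xi> \<in> borel_measurable borel) \<and>
     (\<exists>\<psi> :: nat \<Rightarrow> circle \<times> real \<Rightarrow> complex.
        (\<forall>n. integrable cylinder_lborel (\<psi> n) \<and> square_integrable (\<psi> n)) \<and>
        (\<lambda>n. \<integral>\<^sup>+z. ennreal ((cmod (\<psi> n z - \<phi> z))\<^sup>2) \<partial>cylinder_lborel) \<longlonglongrightarrow> 0 \<and>
        (\<lambda>n. \<integral>\<^sup>+\<xi>. (\<integral>\<^sup>+\<eta>. ennreal ((cmod (fourier (\<psi> n) \<xi> \<eta> - g \<xi> \<eta>))\<^sup>2) \<partial>lborel)
               \<partial>count_space UNIV) \<longlonglongrightarrow> 0)"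

definition sobolev_space :: "real \<Rightarrow> (circle \<times> real \<Rightarrow> complex) set" where
  "sobolev_space s =
     {\<phi>. square_integrable \<phi> \<and>
         (\<exists>g. L2_fourier \<phi> g \<and>
              (\<integral>\<^sup>+\<xi>. (\<integral>\<^sup>+\<eta>. ennreal ((cmod (g \<xi> \<eta>))\<^sup>2 * ((2 * pi * of_int \<xi>)\<^sup>2 + \<eta>\<^sup>2) powr s)
                  \<partial>lborel) \<partial>count_space UNIV) < \<infinity>)}"

end

theory Submission
  imports Defs
begin

text \<open>
  Write \<open>F\<close> for the lift of \<open>f\<close>. Over \<open>x\<close>, the image under \<open>T ^^ k\<close> of Lebesgue measure on the curve \<open>y = 0\<close> has
  the fibre characteristic function \<open>\<psi> k \<eta> x\<close>, the mean of \<open>cis (- \<eta> * S k (x + A))\<close> over the \<open>l ^ k\<close> inverse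
  branches \<open>A\<close>. By the SBR property the transform \<open>charfun \<mu>\<close> of \<open>\<mu>\<close> inherits every bound on the Fourier
  coefficients of \<open>\<psi> k \<eta>\<close> that is uniform in large \<open>k\<close>.

  There are two such bounds. For \<open>M * \<bar>\<eta>\<bar> \<le> \<bar>\<xi>\<bar>\<close> the phase has no stationary point and repeated integration
  by parts gives decay of order \<open>r - 1\<close> in \<open>\<xi>\<close>. In the remaining cone only the energy \<open>J k \<eta>\<close> over one period is
  used. Expanding the square over pairs of branches, pairs whose image curves are transversal contribute
  \<open>O (\<bar>\<eta>\<bar> powr (3 - 2 * r))\<close>; if every branch is tangent to at most \<open>e n\<close> others, the rest is at most
  \<open>e n / l ^ n\<close> times \<open>J k (lam ^ n * \<eta>)\<close>. When \<open>e n\<close> grows more slowly than \<open>(l * lam powr \<sigma>) ^ n\<close>, iterating this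
  gives decay of order \<open>\<sigma> > 1 + 2 * s\<close>.

  The slow growth of \<open>e n\<close> is submultiplicative in blocks of \<open>q\<close> digits, so it follows from an open condition
  on a single \<open>n\<close>: among more than \<open>K\<close> branches with pairwise distinct last \<open>q\<close> digits, two are transversal. The
  condition is dense: add small multiples of bumps to \<open>f'\<close> and count, on a grid of parameters, those for which a
  given tuple of branches is tangent. An independent set of branches makes the linear system for the parameters
  diagonally dominant, and the bad parameters do not exhaust the grid once \<open>n\<close> is large.

  Finally, decay of \<open>charfun \<mu>\<close> bounds the energy of \<open>\<mu>\<close> on dyadic cells, so the cell averages are a martingale
  bounded in the space of square-integrable functions; its limit is the density, and the two bounds above sum to
  its Sobolev norm.
\<close>

section \<open>Functions with bounded derivatives\<close>

text \<open>The two hypotheses on \<open>s\<close> leave room for a \<sigma> above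
  \<open>1 + 2 * s\<close>: the one on \<open>lam\<close> gives
  \<open>l * lam powr \<sigma> > 1\<close>, so that a tangency count growing at a small exponential
  rate is tolerable, and \<open>s < r - 2\<close> gives \<open>\<sigma> \<le> 2 * r - 3\<close>, the
  order of the transversal terms. The obstacle to density is that a perturbation of \<open>f\<close>
  moves all branches at once, and backward orbits may return to the support of a bump, so slopes
  cannot be adjusted one by one. What can be excluded are near tangencies of \<open>k + 1\<close>
  suitable branches at once. At precision \<open>(lam / l) ^ n\<close> there are about
  \<open>(l / lam) ^ n\<close> base points and \<open>l ^ (n * (k + 1))\<close> tuples to consider,
  each of which excludes a share of about \<open>(lam / l) ^ (n * k)\<close> of the parameters. The
  product of the three is \<open>(l ^ 2 * lam ^ (k - 1)) ^ n\<close>, so a large \<open>k\<close>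
  makes it small however close \<open>lam\<close> is to 1. The price is a tangency bound
  \<open>K\<close> above one; it is harmless because it grows linearly in \<open>q\<close> while the
  bound it must stay below is a \<open>q\<close>-th power.\<close>

fun bounded_derivs :: "real set \<Rightarrow> nat \<Rightarrow> real \<Rightarrow> (real \<Rightarrow> real) \<Rightarrow> bool" where
  "bounded_derivs U 0 M g \<longleftrightarrow> continuous_on U g \<and> (\<forall>x\<in>U. \<bar>g x\<bar> \<le> M)"
| "bounded_derivs U (Suc p) M g \<longleftrightarrow> (\<forall>x\<in>U. \<bar>g x\<bar> \<le> M) \<and>
     (\<exists>g'. (\<forall>x\<in>U. (g has_real_derivative g' x) (at x)) \<and> bounded_derivs U p M g')"

declare bounded_derivs.simps(2) [simp del]

lemma bounded_derivs_SucI: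
  assumes "\<And>x. x \<in> U \<Longrightarrow> \<bar>g x\<bar> \<le> M" "\<And>x. x \<in> U \<Longrightarrow> (g has_real_derivative g' x) (at x)"
    "bounded_derivs U p M g'"
  shows "bounded_derivs U (Suc p) M g"
  unfolding bounded_derivs.simps(2) using assms by blast

lemma bounded_derivs_SucE:
  assumes "bounded_derivs U (Suc p) M g"
  obtains g' where "\<forall>x\<in>U. (g has_real_derivative g' x) (at x)" "bounded_derivs U p M g'"
    "\<forall>x\<in>U. \<bar>g x\<bar> \<le> M"
  using assms unfolding bounded_derivs.simps(2) by blast

lemma bounded_derivs_bound: "bounded_derivs U p M g \<Longrightarrow> x \<in> U \<Longrightarrow> \<bar>g x\<bar> \<le> M"
  by (cases p) (auto elim: bounded_derivs_SucE)

lemma bounded_derivs_continuous: "bounded_derivs U p M g \<Longrightarrow> continuous_on U g"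
proof (cases p)
  case (Suc q)
  assume "bounded_derivs U p M g"
  then obtain g' where "\<forall>x\<in>U. (g has_real_derivative g' x) (at x)"
    unfolding Suc by (rule bounded_derivs_SucE) blast
  then show ?thesis by (blast intro: continuous_at_imp_continuous_on DERIV_isCont)
qed auto

lemma bounded_derivs_mono: "bounded_derivs U p M g \<Longrightarrow> M \<le> N \<Longrightarrow> bounded_derivs U p N g"
proof (induction p arbitrary: g)
  case 0 then show ?case by fastforce
next
  case (Suc p)
  obtain g' where g': "\<forall>x\<in>U. (g has_real_derivative g' x) (at x)" "bounded_derivs U p M g'"
    "\<forall>x\<in>U. \<bar>g x\<bar> \<le> M"
    using Suc.prems(1) by (rule bounded_derivs_SucE)
  show ?case
    by (rule bounded_derivs_SucI[of U g N g']) (use g' Suc.prems(2) Suc.IH[OF g'(2)] in \<open>auto intro: order_trans\<close>)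
qed

lemma bounded_derivs_Suc: "bounded_derivs U (Suc p) M g \<Longrightarrow> bounded_derivs U p M g"
proof (induction p arbitrary: g)
  case 0 then show ?case
    using bounded_derivs_continuous[OF 0] bounded_derivs_bound[OF 0] by simp
next
  case (Suc p)
  obtain g' where g': "\<forall>x\<in>U. (g has_real_derivative g' x) (at x)" "bounded_derivs U (Suc p) M g'"
    "\<forall>x\<in>U. \<bar>g x\<bar> \<le> M"
    using Suc.prems(1) by (rule bounded_derivs_SucE)
  show ?case
    by (rule bounded_derivs_SucI[of U g M g']) (use g' Suc.IH[OF g'(2)] in auto)
qed

lemma bounded_derivs_subset: "bounded_derivs U p M g \<Longrightarrow> V \<subseteq> U \<Longrightarrow> bounded_derivs V p M g"
proof (induction p arbitrary: g)
  case 0 then show ?case by (auto intro: continuous_on_subset)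
next
  case (Suc p)
  obtain g' where g': "\<forall>x\<in>U. (g has_real_derivative g' x) (at x)" "bounded_derivs U p M g'"
    "\<forall>x\<in>U. \<bar>g x\<bar> \<le> M"
    using Suc.prems(1) by (rule bounded_derivs_SucE)
  show ?case
    by (rule bounded_derivs_SucI[of V g M g']) (use g' Suc.prems(2) Suc.IH[OF g'(2)] in auto)
qed

lemma bounded_derivs_nonneg: "bounded_derivs U p M g \<Longrightarrow> U \<noteq> {} \<Longrightarrow> 0 \<le> M"
  using bounded_derivs_bound abs_ge_zero order_trans by (metis all_not_in_conv)

lemma bounded_derivs_const: "\<bar>c\<bar> \<le> M \<Longrightarrow> bounded_derivs U p M (\<lambda>x. c)"
proof (induction p arbitrary: c)
  case (Suc p)
  have "0 \<le> M" using Suc.prems by linarith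
  then show ?case using Suc by (intro bounded_derivs_SucI[of U _ M "\<lambda>x. 0"]) auto
qed simp

lemma bounded_derivs_add:
  "bounded_derivs U p M g \<Longrightarrow> bounded_derivs U p N h \<Longrightarrow> bounded_derivs U p (M + N) (\<lambda>x. g x + h x)"
proof (induction p arbitrary: g h)
  case 0 then show ?case by (fastforce intro: continuous_intros)
next
  case (Suc p)
  obtain g' where g': "\<forall>x\<in>U. (g has_real_derivative g' x) (at x)" "bounded_derivs U p M g'"
    "\<forall>x\<in>U. \<bar>g x\<bar> \<le> M"
    using Suc.prems(1) by (rule bounded_derivs_SucE)
  obtain h' where h': "\<forall>x\<in>U. (h has_real_derivative h' x) (at x)" "bounded_derivs U p N h'"
    "\<forall>x\<in>U. \<bar>h x\<bar> \<le> N"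
    using Suc.prems(2) by (rule bounded_derivs_SucE)
  show ?case
    by (rule bounded_derivs_SucI[of U _ _ "\<lambda>x. g' x + h' x"])
      (use g' h' Suc.IH[OF g'(2) h'(2)] in
        \<open>auto intro!: derivative_eq_intros order_trans[OF abs_triangle_ineq] add_mono\<close>)
qed

lemma bounded_derivs_cmult: "bounded_derivs U p M g \<Longrightarrow> bounded_derivs U p (\<bar>c\<bar> * M) (\<lambda>x. c * g x)"
proof (induction p arbitrary: g)
  case 0 then show ?case by (auto intro!: continuous_intros mult_left_mono simp: abs_mult)
next
  case (Suc p)
  obtain g' where g': "\<forall>x\<in>U. (g has_real_derivative g' x) (at x)" "bounded_derivs U p M g'"
    "\<forall>x\<in>U. \<bar>g x\<bar> \<le> M"
    using Suc.prems(1) by (rule bounded_derivs_SucE)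
  show ?case
    by (rule bounded_derivs_SucI[of U _ _ "\<lambda>x. c * g' x"])
      (use g' Suc.IH[OF g'(2)] in \<open>auto intro!: derivative_eq_intros mult_left_mono simp: abs_mult\<close>)
qed

lemma bounded_derivs_diff:
  "bounded_derivs U p M g \<Longrightarrow> bounded_derivs U p N h \<Longrightarrow> bounded_derivs U p (M + N) (\<lambda>x. g x - h x)"
  using bounded_derivs_add[of U p M g N "\<lambda>x. (-1) * h x"] bounded_derivs_cmult[of U p N h "-1"] by simp

lemma bounded_derivs_sum:
  "finite I \<Longrightarrow> (\<And>i. i \<in> I \<Longrightarrow> bounded_derivs U p (M i) (g i)) \<Longrightarrow>
    bounded_derivs U p (\<Sum>i\<in>I. M i) (\<lambda>x. \<Sum>i\<in>I. g i x)"
  by (induction rule: finite_induct) (auto intro!: bounded_derivs_const bounded_derivs_add simp del: bounded_derivs.simps)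

text \<open>The factor is the sum of the binomial coefficients in the Leibniz rule: each
  differentiation of the product yields two products of the lower order and so doubles the
  constant.\<close>

lemma bounded_derivs_mult:
  "bounded_derivs U p M g \<Longrightarrow> bounded_derivs U p N h \<Longrightarrow>
    bounded_derivs U p (2 ^ p * M * N) (\<lambda>x. g x * h x)"
proof (cases "U = {}")
  case True
  have "bounded_derivs {} p N f" for N f
    by (induction p arbitrary: f) (auto simp: bounded_derivs.simps(2))
  then show ?thesis using True by simp
next
  case False
  show "bounded_derivs U p M g \<Longrightarrow> bounded_derivs U p N h \<Longrightarrow>
    bounded_derivs U p (2 ^ p * M * N) (\<lambda>x. g x * h x)"
  proof (induction p arbitrary: g h)
    case 0 then show ?case
      by (auto intro!: continuous_intros mult_mono simp: abs_mult order_trans[OF abs_ge_zero])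
  next
    case (Suc p)
    obtain g' where g': "\<forall>x\<in>U. (g has_real_derivative g' x) (at x)" "bounded_derivs U p M g'"
      "\<forall>x\<in>U. \<bar>g x\<bar> \<le> M"
      using Suc.prems(1) by (rule bounded_derivs_SucE)
    obtain h' where h': "\<forall>x\<in>U. (h has_real_derivative h' x) (at x)" "bounded_derivs U p N h'"
      "\<forall>x\<in>U. \<bar>h x\<bar> \<le> N"
      using Suc.prems(2) by (rule bounded_derivs_SucE)
    have MN: "0 \<le> M" "0 \<le> N"
      using Suc.prems bounded_derivs_nonneg[OF _ False] by blast+
    have "\<bar>g x * h x\<bar> \<le> 2 ^ Suc p * M * N" if "x \<in> U" for x
    proof -
      have "\<bar>g x * h x\<bar> \<le> M * N"
        using g'(3) h'(3) that MN by (auto simp: abs_mult intro!: mult_mono)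
      also have "\<dots> \<le> 2 ^ Suc p * (M * N)"
        using MN mult_right_mono[of 1 "2 ^ Suc p" "M * N"] one_le_power[of "2::real" "Suc p"] by simp
      finally show ?thesis by (simp add: mult.assoc)
    qed
    moreover have "bounded_derivs U p (2 ^ p * M * N + 2 ^ p * M * N) (\<lambda>x. g x * h' x + g' x * h x)"
      by (intro bounded_derivs_add Suc.IH bounded_derivs_Suc[OF Suc.prems(1)] bounded_derivs_Suc[OF Suc.prems(2)] g'(2) h'(2))
    ultimately show ?case
      using g'(1) h'(1)
      by (intro bounded_derivs_SucI[of U _ _ "\<lambda>x. g x * h' x + g' x * h x"])
        (auto intro!: derivative_eq_intros simp: algebra_simps)
  qed
qed

text \<open>The constant is chosen before \<open>U\<close> and \<open>g\<close>, since
  non-stationary phase needs one constant for all phases at once. The recursion is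
  \<open>(1 / g)' = - g' / g ^ 2\<close>, and each of the two products in it costs
  \<open>2 ^ p\<close>.\<close>

lemma bounded_derivs_inverse:
  assumes "0 < c"
  shows "\<exists>M'. \<forall>U g. bounded_derivs U p M g \<and> (\<forall>x\<in>U. c \<le> \<bar>g x\<bar>) \<longrightarrow> bounded_derivs U p M' (\<lambda>x. inverse (g x))"
proof (induction p)
  case 0
  have "\<bar>inverse y\<bar> \<le> inverse c" if "c \<le> \<bar>y\<bar>" for y :: real
    using that assms by (metis abs_inverse le_imp_inverse_le)
  moreover have "y \<noteq> 0" if "c \<le> \<bar>y\<bar>" for y :: real
    using that assms by auto
  ultimately show ?case
    by (intro exI[of _ "inverse c"]) (auto intro!: continuous_intros)
next
  case (Suc p)
  then obtain M' where M': "\<And>U g. bounded_derivs U p M g \<Longrightarrow> (\<forall>x\<in>U. c \<le> \<bar>g x\<bar>) \<Longrightarrow> bounded_derivs U p M' (\<lambda>x. inverse (g x))"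
    by blast
  define M2 where "M2 = max (inverse c) \<bar>(-1) * (2 ^ p * M * (2 ^ p * M' * M'))\<bar>"
  show ?case
  proof (intro exI[of _ M2] allI impI, elim conjE)
    fix U g assume g: "bounded_derivs U (Suc p) M g" and c: "\<forall>x\<in>U. c \<le> \<bar>g x\<bar>"
    obtain g' where g': "\<forall>x\<in>U. (g has_real_derivative g' x) (at x)" "bounded_derivs U p M g'"
      using g by (rule bounded_derivs_SucE) blast
    have nz: "g x \<noteq> 0" if "x \<in> U" for x
      using c that assms by fastforce
    have "bounded_derivs U p (\<bar>-1\<bar> * (2 ^ p * M * (2 ^ p * M' * M'))) (\<lambda>x. (-1) * (g' x * (inverse (g x) * inverse (g x))))"
      by (intro bounded_derivs_cmult bounded_derivs_mult g' M' bounded_derivs_Suc[OF g] c)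
    then have "bounded_derivs U p M2 (\<lambda>x. (-1) * (g' x * (inverse (g x) * inverse (g x))))"
      by (rule bounded_derivs_mono) (simp add: M2_def)
    moreover have "((\<lambda>x. inverse (g x)) has_real_derivative (-1) * (g' x * (inverse (g x) * inverse (g x)))) (at x)" if "x \<in> U" for x
      using g' nz that by (auto intro!: derivative_eq_intros simp: mult_ac)
    moreover have "\<bar>inverse (g x)\<bar> \<le> M2" if "x \<in> U" for x
    proof -
      have "\<bar>inverse (g x)\<bar> \<le> inverse c"
        using that assms c by (metis abs_inverse le_imp_inverse_le)
      then show ?thesis by (simp add: M2_def)
    qed
    ultimately show "bounded_derivs U (Suc p) M2 (\<lambda>x. inverse (g x))"
      by (intro bounded_derivs_SucI) blast+
  qed
qed

lemma bounded_derivs_affine: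
  "bounded_derivs UNIV p M g \<Longrightarrow> bounded_derivs UNIV p (max 1 \<bar>a\<bar> ^ p * M) (\<lambda>x. g (a * x + b))"
proof (induction p arbitrary: g)
  case 0 then show ?case by (auto intro!: continuous_on_compose2[of UNIV g] continuous_intros)
next
  case (Suc p)
  obtain g' where *: "\<And>x. (g has_real_derivative g' x) (at x)" "bounded_derivs UNIV p M g'"
    "\<And>x. \<bar>g x\<bar> \<le> M"
    using Suc.prems(1) by (rule bounded_derivs_SucE) auto
  have M: "0 \<le> M" using Suc.prems bounded_derivs_nonneg by blast
  have a: "1 \<le> max 1 \<bar>a\<bar> ^ Suc p" by (rule one_le_power) simp
  have "bounded_derivs UNIV p (\<bar>a\<bar> * (max 1 \<bar>a\<bar> ^ p * M)) (\<lambda>x. a * g' (a * x + b))"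
    by (intro bounded_derivs_cmult Suc.IH *)
  moreover have "\<bar>a\<bar> * (max 1 \<bar>a\<bar> ^ p * M) \<le> max 1 \<bar>a\<bar> ^ Suc p * M"
    using M by (simp add: mult.assoc) (intro mult_right_mono, auto)
  ultimately have "bounded_derivs UNIV p (max 1 \<bar>a\<bar> ^ Suc p * M) (\<lambda>x. a * g' (a * x + b))"
    by (rule bounded_derivs_mono)
  moreover have "\<bar>g x\<bar> \<le> max 1 \<bar>a\<bar> ^ Suc p * M" for x
    using *(3) mult_right_mono[OF a M] by (smt (verit) mult_1)
  moreover have "((\<lambda>x. g (a * x + b)) has_real_derivative a * g' (a * x + b)) (at x)" for x
    by (rule DERIV_cong[OF DERIV_chain2[where f = g and g = "\<lambda>x. a * x + b", OF *(1)]])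
      (auto intro!: derivative_eq_intros)
  ultimately show ?case
    by (intro bounded_derivs_SucI) blast+
qed

text \<open>The level-\<open>i\<close> term of a slope is \<open>F'\<close> at
  \<open>u / l ^ (i + 1)\<close>; because such a rescaling costs nothing, the derivative bounds on
  the slopes do not depend on the level.\<close>

lemma bounded_derivs_affine_contract:
  assumes "bounded_derivs UNIV p M g" "\<bar>a\<bar> \<le> 1"
  shows "bounded_derivs UNIV p M (\<lambda>x. g (a * x + b))"
  using bounded_derivs_affine[OF assms(1), of a b] assms(2) by (simp add: max_absorb1)

lemma bounded_derivs_cos: "bounded_derivs UNIV p 1 (\<lambda>x. cos (x + b))"
proof (induction p arbitrary: b)
  case 0 show ?case by (auto intro!: continuous_intros)
next
  case (Suc p)
  have "((\<lambda>x. cos (x + b)) has_real_derivative cos (x + (b + pi / 2))) (at x)" for x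
    by (auto intro!: derivative_eq_intros simp: cos_add sin_add algebra_simps)
  then show ?case using Suc[of "b + pi/2"] by (intro bounded_derivs_SucI) auto
qed

lemma DERIV_max_0_power:
  "((\<lambda>v::real. max 0 v ^ Suc (Suc q)) has_real_derivative real (Suc (Suc q)) * max 0 v ^ Suc q) (at v)"
proof -
  consider "v < 0" | "v = 0" | "v > 0" by linarith
  then show ?thesis
  proof cases
    case 1
    have "((\<lambda>v::real. 0) has_real_derivative 0) (at v)" by simp
    then have "((\<lambda>v::real. max 0 v ^ Suc (Suc q)) has_real_derivative 0) (at v)"
      by (rule has_field_derivative_transform_within[where d = "-v"]) (use 1 in \<open>auto simp: dist_real_def max_def abs_if split: if_splits\<close>)
    then show ?thesis using 1 by simp
  next
    case 3
    have "((\<lambda>v::real. v ^ Suc (Suc q)) has_real_derivative real (Suc (Suc q)) * v ^ Suc q) (at v)"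
      by (rule derivative_eq_intros refl | simp)+
    then have "((\<lambda>v::real. max 0 v ^ Suc (Suc q)) has_real_derivative real (Suc (Suc q)) * v ^ Suc q) (at v)"
      by (rule has_field_derivative_transform_within[where d = "v"]) (use 3 in \<open>auto simp: dist_real_def max_def abs_if split: if_splits\<close>)
    then show ?thesis using 3 by simp
  next
    case 2
    have "((\<lambda>h::real. max 0 h ^ Suc q) \<longlongrightarrow> max 0 0 ^ Suc q) (at 0)"
      by (intro tendsto_intros)
    moreover have "max 0 h ^ Suc q = max 0 h ^ Suc (Suc q) / h" if "h \<noteq> 0" for h :: real
      using that by (cases "h > 0") (auto simp: max_def)
    ultimately have "((\<lambda>h::real. max 0 h ^ Suc (Suc q) / h) \<longlongrightarrow> 0) (at 0)"
      by (smt (verit) Lim_transform_eventually eventually_at_filter eventuallyI max.idem power_0_Suc)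
    then show ?thesis using 2 by (simp add: DERIV_def)
  qed
qed

text \<open>Truncated powers give all the cut-off functions of finite smoothness that occur: a
  positive part raised to a power above \<open>p\<close> keeps \<open>p\<close> continuous
  derivatives across its zeros.\<close>

lemma bounded_derivs_max_power:
  "bounded_derivs U p M g \<Longrightarrow> p < q \<Longrightarrow> \<exists>M'. bounded_derivs U p M' (\<lambda>x. max 0 (g x) ^ q)"
proof (induction p arbitrary: q)
  case 0
  have "\<bar>max 0 y ^ q\<bar> \<le> \<bar>M\<bar> ^ q" if "\<bar>y\<bar> \<le> M" for y
    using that by (auto simp: power_abs intro!: power_mono)
  then show ?case using 0 by (intro exI[of _ "\<bar>M\<bar> ^ q"]) (auto intro!: continuous_intros)
next
  case (Suc p)
  obtain g' where g': "\<forall>x\<in>U. (g has_real_derivative g' x) (at x)" "bounded_derivs U p M g'"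
    "\<forall>x\<in>U. \<bar>g x\<bar> \<le> M"
    using Suc.prems(1) by (rule bounded_derivs_SucE)
  define q' where "q' = q - 2"
  have q': "q = Suc (Suc q')" using Suc.prems(2) by (simp add: q'_def)
  obtain M1 where M1: "bounded_derivs U p M1 (\<lambda>x. max 0 (g x) ^ Suc q')"
    using Suc.IH[OF bounded_derivs_Suc[OF Suc.prems(1)], of "Suc q'"] Suc.prems q' by auto
  define M' where "M' = max (\<bar>M\<bar> ^ q) (\<bar>real q\<bar> * (2 ^ p * M1 * M))"
  have "bounded_derivs U p (\<bar>real q\<bar> * (2 ^ p * M1 * M)) (\<lambda>x. real q * (max 0 (g x) ^ Suc q' * g' x))"
    by (intro bounded_derivs_cmult bounded_derivs_mult M1 g')
  then have "bounded_derivs U p M' (\<lambda>x. real q * (max 0 (g x) ^ Suc q' * g' x))"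
    by (rule bounded_derivs_mono) (simp add: M'_def)
  moreover have "((\<lambda>x. max 0 (g x) ^ q) has_real_derivative real q * (max 0 (g x) ^ Suc q' * g' x)) (at x)" if "x \<in> U" for x
    using DERIV_chain2[OF DERIV_max_0_power[of q' "g x"] g'(1)[rule_format, OF that]]
    unfolding q' by (simp only: mult.assoc)
  moreover have "\<bar>max 0 (g x) ^ q\<bar> \<le> M'" if "x \<in> U" for x
  proof -
    have "\<bar>g x\<bar> \<le> M" using g' that by auto
    then have "\<bar>max 0 (g x) ^ q\<bar> \<le> \<bar>M\<bar> ^ q"
      by (auto simp: power_abs intro!: power_mono)
    then show ?thesis by (simp add: M'_def)
  qed
  ultimately show ?case
    by (intro exI bounded_derivs_SucI) blast+
qed

section \<open>Non-stationary phase\<close>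

definition phase_integral :: "real \<Rightarrow> real \<Rightarrow> (real \<Rightarrow> real) \<Rightarrow> (real \<Rightarrow> real) \<Rightarrow> complex" where
  "phase_integral a b g \<Phi> = integral {a..b} (\<lambda>x. complex_of_real (g x) * cis (\<Phi> x))"

text \<open>The two situations in which integration by parts leaves no boundary term and, as the
  induction requires, the new amplitude is of the same kind: an amplitude supported strictly inside
  the interval, for windowed coefficients, and periodicity over the interval, for coefficients over
  a full period of length \<open>l ^ k\<close>.\<close>

definition no_boundary :: "real set \<Rightarrow> real \<Rightarrow> real \<Rightarrow> (real \<Rightarrow> real) \<Rightarrow> (real \<Rightarrow> real) \<Rightarrow> (real \<Rightarrow> real) \<Rightarrow> bool" where
  "no_boundary U a b \<Phi> \<Phi>' g \<longleftrightarrow>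
     (\<exists>a0 b0. a < a0 \<and> b0 < b \<and> (\<forall>x\<in>U. x \<notin> {a0..b0} \<longrightarrow> g x = 0)) \<or>
     (U = UNIV \<and> (\<forall>x. g (x + (b - a)) = g x) \<and> (\<forall>x. \<Phi>' (x + (b - a)) = \<Phi>' x) \<and> cis (\<Phi> b) = cis (\<Phi> a))"

text \<open>\<open>w\<close> stands for \<open>\<lambda>y. inverse (y / \<Lambda>)\<close>: the new
  amplitude is the derivative of \<open>g\<close> divided by the normalised phase slope. It vanishes
  on every open set where \<open>g\<close> does, and inherits a period that \<open>g\<close> and
  \<open>\<Phi>'\<close> share.\<close>

lemma no_boundary_step:
  assumes nb: "no_boundary U a b \<Phi> \<Phi>' g" and U: "open U" "a \<in> U" "b \<in> U"
    and h: "\<And>x. x \<in> U \<Longrightarrow> h x = g x * w (\<Phi>' x)"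
    and h': "\<And>x. x \<in> U \<Longrightarrow> (h has_real_derivative h' x) (at x)"
  shows "no_boundary U a b \<Phi> \<Phi>' h'" "h b * cis (\<Phi> b) = h a * cis (\<Phi> a)"
proof -
  from nb consider
    a0 b0 where "a < a0" "b0 < b" "\<forall>x\<in>U. x \<notin> {a0..b0} \<longrightarrow> g x = 0"
  | "U = UNIV" "\<forall>x. g (x + (b - a)) = g x" "\<forall>x. \<Phi>' (x + (b - a)) = \<Phi>' x" "cis (\<Phi> b) = cis (\<Phi> a)"
    unfolding no_boundary_def by blast
  then have "no_boundary U a b \<Phi> \<Phi>' h' \<and> h b * cis (\<Phi> b) = h a * cis (\<Phi> a)"
  proof cases
    case 1
    have "h' x = 0" if x: "x \<in> U" "x \<notin> {a0..b0}" for x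
    proof -
      have op: "open (U - {a0..b0})" using U by (intro open_Diff) auto
      have "(h has_real_derivative 0) (at x)"
        by (rule has_field_derivative_transform_within_open[OF DERIV_const[of 0] op])
          (use x 1 h in auto)
      then show ?thesis using h'[OF x(1)] DERIV_unique by blast
    qed
    then have "no_boundary U a b \<Phi> \<Phi>' h'"
      unfolding no_boundary_def using 1 by blast
    moreover have "h a = 0" "h b = 0" using 1 h U by auto
    ultimately show ?thesis by simp
  next
    case 2
    have per: "h (x + (b - a)) = h x" for x using 2 h by simp
    have "h' (x + (b - a)) = h' x" for x
    proof -
      have "((\<lambda>x. h (x + (b - a))) has_real_derivative h' (x + (b - a))) (at x)"
        using h'[of "x + (b - a)"] 2 DERIV_shift[of h _ x "b - a"] by blast
      then have "(h has_real_derivative h' (x + (b - a))) (at x)" by (simp add: per)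
      then show ?thesis using h'[of x] 2 DERIV_unique by blast
    qed
    then have "no_boundary U a b \<Phi> \<Phi>' h'"
      unfolding no_boundary_def using 2 by blast
    moreover have "h b = h a" using per[of a] by simp
    ultimately show ?thesis using 2 by simp
  qed
  then show "no_boundary U a b \<Phi> \<Phi>' h'" "h b * cis (\<Phi> b) = h a * cis (\<Phi> a)" by auto
qed

lemma cis_has_vector_derivative:
  assumes "(\<Phi> has_real_derivative d) (at x within S)"
  shows "((\<lambda>x. cis (\<Phi> x)) has_vector_derivative \<i> * complex_of_real d * cis (\<Phi> x)) (at x within S)"
proof -
  have "((\<lambda>x. exp (\<i> * complex_of_real (\<Phi> x))) has_vector_derivative
      (\<i> * complex_of_real d) * exp (\<i> * complex_of_real (\<Phi> x))) (at x within S)"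
    by (rule has_vector_derivative_eq_rhs, rule field_vector_diff_chain_within[where g = exp, unfolded o_def])
      (use assms in \<open>auto intro!: derivative_eq_intros has_vector_derivative_mult_right
        simp: has_real_derivative_iff_has_vector_derivative has_vector_derivative_of_real DERIV_exp[THEN DERIV_subset]\<close>)
  then show ?thesis by (simp add: cis_conv_exp)
qed

lemma phase_integral_bound:
  assumes "a \<le> b" "continuous_on {a..b} g" "continuous_on {a..b} \<Phi>" "\<And>x. x \<in> {a..b} \<Longrightarrow> \<bar>g x\<bar> \<le> M"
  shows "cmod (phase_integral a b g \<Phi>) \<le> M * (b - a)"
  unfolding phase_integral_def
  by (rule integral_bound) (use assms in \<open>auto intro!: continuous_intros simp: norm_mult\<close>)

text \<open>\<open>C\<close> may depend on \<open>c\<close>, \<open>M\<close>, \<open>p\<close> and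
  \<open>N\<close> alone, so that one constant serves the phases of all levels and all branches.
  Dividing the phase slope by \<open>\<Lambda>\<close> makes the hypotheses scale-free; the size of
  the frequency then enters only through \<open>\<Lambda> ^ p\<close>.\<close>

definition nsp_bound :: "real \<Rightarrow> real \<Rightarrow> nat \<Rightarrow> real \<Rightarrow> real \<Rightarrow> bool" where
  "nsp_bound c M p N C \<longleftrightarrow> (\<forall>U \<Phi> \<Phi>' g \<Lambda> a b. open U \<longrightarrow> {a..b} \<subseteq> U \<longrightarrow> a \<le> b \<longrightarrow> 0 < \<Lambda> \<longrightarrow>
     (\<forall>x\<in>U. (\<Phi> has_real_derivative \<Phi>' x) (at x)) \<longrightarrow> bounded_derivs U p M (\<lambda>x. \<Phi>' x / \<Lambda>) \<longrightarrow>
     (\<forall>x\<in>U. c \<le> \<bar>\<Phi>' x / \<Lambda>\<bar>) \<longrightarrow> bounded_derivs U p N g \<longrightarrow> no_boundary U a b \<Phi> \<Phi>' g \<longrightarrow>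
     cmod (phase_integral a b g \<Phi>) \<le> C * (b - a) / \<Lambda> ^ p)"

lemmas nsp_boundD = nsp_bound_def[THEN iffD1, rule_format]

text \<open>Repeated integration by parts against \<open>\<i> \<Phi>' cis \<Phi>\<close>; each step trades one derivative for a factor \<open>1 / \<Lambda>\<close>.\<close>

lemma non_stationary_phase:
  assumes "0 < c"
  shows "\<exists>C\<ge>0. nsp_bound c M p N C"
proof (induction p arbitrary: N)
  case 0
  have "nsp_bound c M 0 N (max 0 N)"
    unfolding nsp_bound_def
  proof (intro allI impI)
    fix U \<Phi> \<Phi>' g a b and \<Lambda> :: real
    assume *: "open U" "{a..b} \<subseteq> U" "a \<le> b" "\<forall>x\<in>U. (\<Phi> has_real_derivative \<Phi>' x) (at x)"
      "bounded_derivs U 0 N g"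
    have "continuous_on {a..b} \<Phi>"
      by (intro continuous_at_imp_continuous_on ballI) (use * in \<open>blast intro: DERIV_isCont\<close>)
    moreover have "continuous_on {a..b} g" using * by (auto intro: continuous_on_subset)
    ultimately have "cmod (phase_integral a b g \<Phi>) \<le> max 0 N * (b - a)"
      using phase_integral_bound[OF *(3), of g \<Phi> "max 0 N"] * by (fastforce simp: le_max_iff_disj)
    then show "cmod (phase_integral a b g \<Phi>) \<le> max 0 N * (b - a) / \<Lambda> ^ 0" by simp
  qed
  then show ?case by (intro exI[of _ "max 0 N"]) simp
next
  case (Suc p)
  obtain M' where M': "\<And>U g. bounded_derivs U (Suc p) M g \<Longrightarrow> (\<forall>x\<in>U. c \<le> \<bar>g x\<bar>) \<Longrightarrow>
      bounded_derivs U (Suc p) M' (\<lambda>x. inverse (g x))"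
    using bounded_derivs_inverse[OF assms, of "Suc p" M] by blast
  obtain C where C: "0 \<le> C" "nsp_bound c M p (2 ^ Suc p * N * M') C"
    using Suc.IH[of "2 ^ Suc p * N * M'"] by blast
  have "nsp_bound c M (Suc p) N C"
    unfolding nsp_bound_def
  proof (intro allI impI)
    fix U \<Phi> \<Phi>' g a b and \<Lambda> :: real
    assume U: "open U" "{a..b} \<subseteq> U" and ab: "a \<le> b" and \<Lambda>: "0 < \<Lambda>"
      and \<Phi>': "\<forall>x\<in>U. (\<Phi> has_real_derivative \<Phi>' x) (at x)"
      and bd: "bounded_derivs U (Suc p) M (\<lambda>x. \<Phi>' x / \<Lambda>)" "\<forall>x\<in>U. c \<le> \<bar>\<Phi>' x / \<Lambda>\<bar>"
      and g: "bounded_derivs U (Suc p) N g" and nb: "no_boundary U a b \<Phi> \<Phi>' g"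
    define h where "h = (\<lambda>x. g x * inverse (\<Phi>' x / \<Lambda>))"
    have "bounded_derivs U (Suc p) (2 ^ Suc p * N * M') h"
      unfolding h_def by (intro bounded_derivs_mult g M' bd)
    then obtain h' where h': "\<forall>x\<in>U. (h has_real_derivative h' x) (at x)"
      "bounded_derivs U p (2 ^ Suc p * N * M') h'"
      by (rule bounded_derivs_SucE)
    have mem: "a \<in> U" "b \<in> U" using U ab by auto
    note step = no_boundary_step[OF nb U(1) mem, of h "\<lambda>y. inverse (y / \<Lambda>)" h', OF _ h'(1)[rule_format], unfolded h_def, folded h_def]
    have nb': "no_boundary U a b \<Phi> \<Phi>' h'" and bdry: "h b * cis (\<Phi> b) = h a * cis (\<Phi> a)"
      using step by (simp_all add: h_def)
    have nz: "\<Phi>' x \<noteq> 0" if "x \<in> U" for x using bd(2) that assms by fastforce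
    have hg: "h x * \<Phi>' x = \<Lambda> * g x" if "x \<in> U" for x
      using nz[OF that] \<Lambda> by (simp add: h_def)
    define I where "I = (\<lambda>x. complex_of_real (h' x) * cis (\<Phi> x))"
    have deriv: "((\<lambda>x. complex_of_real (h x) * cis (\<Phi> x)) has_vector_derivative
        I x + \<i> * complex_of_real \<Lambda> * (complex_of_real (g x) * cis (\<Phi> x))) (at x within {a..b})" if "x \<in> {a..b}" for x
    proof -
      have x: "x \<in> U" using that U by auto
      have 1: "((\<lambda>x. complex_of_real (h x)) has_vector_derivative complex_of_real (h' x)) (at x within {a..b})"
        using h'(1) x by (auto intro!: has_vector_derivative_of_real
            simp: has_real_derivative_iff_has_vector_derivative[symmetric] intro: has_field_derivative_at_within)
      have 2: "((\<lambda>x. cis (\<Phi> x)) has_vector_derivative \<i> * complex_of_real (\<Phi>' x) * cis (\<Phi> x)) (at x within {a..b})"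
        using \<Phi>' x by (intro cis_has_vector_derivative) (auto intro: has_field_derivative_at_within)
      have "complex_of_real (h x) * complex_of_real (\<Phi>' x) = complex_of_real \<Lambda> * complex_of_real (g x)"
        using hg[OF x] by (metis of_real_mult)
      then have "h x * (\<i> * complex_of_real (\<Phi>' x) * cis (\<Phi> x)) + h' x * cis (\<Phi> x)
          = I x + \<i> * complex_of_real \<Lambda> * (complex_of_real (g x) * cis (\<Phi> x))"
        by (simp add: I_def)
      then show ?thesis using has_vector_derivative_mult[OF 1 2] by simp
    qed
    have int: "((\<lambda>x. I x + \<i> * complex_of_real \<Lambda> * (complex_of_real (g x) * cis (\<Phi> x))) has_integral 0) {a..b}"
      using fundamental_theorem_of_calculus[OF ab deriv] bdry by simp
    have cont\<Phi>: "continuous_on {a..b} \<Phi>"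
      by (intro continuous_at_imp_continuous_on ballI) (use U \<Phi>' in \<open>blast intro: DERIV_isCont\<close>)
    have contg: "continuous_on {a..b} g" "continuous_on {a..b} h'"
      using bounded_derivs_continuous[OF g] bounded_derivs_continuous[OF h'(2)] U continuous_on_subset by blast+
    have i1: "I integrable_on {a..b}" unfolding I_def
      by (intro integrable_continuous_interval continuous_intros cont\<Phi> contg)
    have i2: "(\<lambda>x. complex_of_real (g x) * cis (\<Phi> x)) integrable_on {a..b}"
      by (intro integrable_continuous_interval continuous_intros cont\<Phi> contg)
    have "((\<lambda>x. I x + \<i> * complex_of_real \<Lambda> * (complex_of_real (g x) * cis (\<Phi> x))) has_integral
        integral {a..b} I + \<i> * complex_of_real \<Lambda> * phase_integral a b g \<Phi>) {a..b}"
      unfolding phase_integral_def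
      by (intro has_integral_add has_integral_mult_right integrable_integral i1 i2)
    then have "integral {a..b} I + \<i> * complex_of_real \<Lambda> * phase_integral a b g \<Phi> = 0"
      using int has_integral_unique by blast
    then have "\<i> * complex_of_real \<Lambda> * phase_integral a b g \<Phi> = - phase_integral a b h' \<Phi>"
      unfolding phase_integral_def I_def by (simp add: add_eq_0_iff)
    then have "\<Lambda> * cmod (phase_integral a b g \<Phi>) = cmod (phase_integral a b h' \<Phi>)"
      using \<Lambda> by (metis abs_of_pos mult_1 norm_ii norm_minus_cancel norm_mult norm_of_real)
    also have "\<dots> \<le> C * (b - a) / \<Lambda> ^ p"
      using nsp_boundD[OF C(2) U ab \<Lambda> _ bounded_derivs_Suc[OF bd(1)] _ h'(2) nb'] \<Phi>' bd(2) by blast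
    finally show "cmod (phase_integral a b g \<Phi>) \<le> C * (b - a) / \<Lambda> ^ Suc p"
      using \<Lambda> by (simp add: field_simps)
  qed
  with C(1) show ?case by blast
qed

section \<open>Fourier coefficients on an interval of length one\<close>

definition fcoef :: "real \<Rightarrow> (real \<Rightarrow> complex) \<Rightarrow> int \<Rightarrow> complex" where
  "fcoef a H \<xi> = integral {a..a+1} (\<lambda>x. H x * cis (- (2 * pi * of_int \<xi> * x)))"

lemma continuous_on_cis_linear [continuous_intros]:
  "continuous_on S (\<lambda>x. cis (- (2 * pi * of_int \<xi> * x)))" "continuous_on S (\<lambda>x. cis (2 * pi * of_int \<xi> * x))"
  by (intro continuous_intros)+

lemma integral_character:
  "integral {a..a+1} (\<lambda>x. cis (2 * pi * of_int \<xi> * x)) = (if \<xi> = 0 then 1 else 0)"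
proof (cases "\<xi> = 0")
  case False
  define c where "c = 2 * pi * of_int \<xi>"
  have c: "c \<noteq> 0" using False by (simp add: c_def)
  have "((\<lambda>x. cis (c * x)) has_integral (cis (c * (a + 1)) / (\<i> * c) - cis (c * a) / (\<i> * c))) {a..a+1}"
  proof (rule fundamental_theorem_of_calculus)
    fix x :: real assume "x \<in> {a..a+1}"
    have "((\<lambda>x. cis (c * x)) has_vector_derivative \<i> * complex_of_real c * cis (c * x)) (at x within {a..a+1})"
      by (rule cis_has_vector_derivative) (auto intro!: derivative_eq_intros)
    then have "((\<lambda>x. cis (c * x) / (\<i> * c)) has_vector_derivative \<i> * complex_of_real c * cis (c * x) / (\<i> * c)) (at x within {a..a+1})"
      by (rule has_vector_derivative_divide)
    then show "((\<lambda>x. cis (c * x) / (\<i> * c)) has_vector_derivative cis (c * x)) (at x within {a..a+1})"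
      using c by simp
  qed simp
  moreover have "cis (c * (a + 1)) = cis (c * a)"
    by (simp add: c_def distrib_left flip: cis_mult)
  ultimately show ?thesis using False by (simp add: c_def has_integral_iff)
qed simp

lemma integral_norm_sq_diff_character:
  assumes H: "continuous_on {a..a+1} H"
  shows "integral {a..a+1} (\<lambda>x. (cmod (H x - fcoef a H \<xi> * cis (2 * pi * of_int \<xi> * x)))\<^sup>2) =
    integral {a..a+1} (\<lambda>x. (cmod (H x))\<^sup>2) - (cmod (fcoef a H \<xi>))\<^sup>2"
proof -
  define c where "c = fcoef a H \<xi>"
  have 1: "((\<lambda>x. H x * cis (- (2 * pi * of_int \<xi> * x))) has_integral c) {a..a+1}"
    unfolding c_def fcoef_def by (intro integrable_integral integrable_continuous_interval continuous_intros H)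
  have "((\<lambda>x. cnj c * (H x * cis (- (2 * pi * of_int \<xi> * x)))) has_integral cnj c * c) {a..a+1}"
    by (rule has_integral_mult_right[OF 1])
  from has_integral_linear[OF this bounded_linear_Re]
  have "((\<lambda>x. Re (cnj c * (H x * cis (- (2 * pi * of_int \<xi> * x))))) has_integral Re (cnj c * c)) {a..a+1}"
    by (simp only: o_def)
  moreover have "Re (cnj c * c) = (cmod c)\<^sup>2" unfolding cmod_power2 by (simp add: power2_eq_square)
  ultimately have 2: "((\<lambda>x. Re (cnj c * (H x * cis (- (2 * pi * of_int \<xi> * x))))) has_integral (cmod c)\<^sup>2) {a..a+1}"
    by (simp only:)
  have 3: "((\<lambda>x. (cmod (H x))\<^sup>2) has_integral integral {a..a+1} (\<lambda>x. (cmod (H x))\<^sup>2)) {a..a+1}"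
    by (intro integrable_integral integrable_continuous_interval continuous_intros H)
  have "((\<lambda>x. (cmod (H x))\<^sup>2 - 2 * Re (cnj c * (H x * cis (- (2 * pi * of_int \<xi> * x)))) + (cmod c)\<^sup>2) has_integral
    (integral {a..a+1} (\<lambda>x. (cmod (H x))\<^sup>2) - 2 * (cmod c)\<^sup>2 + (cmod c)\<^sup>2)) {a..a+1}"
    using has_integral_const_real[of "(cmod c)\<^sup>2" a "a + 1"]
    by (intro has_integral_add has_integral_diff has_integral_mult_right 2 3) auto
  moreover have "(cmod (H x))\<^sup>2 - 2 * Re (cnj c * (H x * cis (- (2 * pi * of_int \<xi> * x)))) + (cmod c)\<^sup>2
      = (cmod (H x - c * cis (2 * pi * of_int \<xi> * x)))\<^sup>2" for x
  proof -
    define e where "e = cis (2 * pi * of_int \<xi> * x)"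
    have e: "(Re e)\<^sup>2 + (Im e)\<^sup>2 = 1" "cis (- (2 * pi * of_int \<xi> * x)) = cnj e"
      by (simp_all add: e_def cis_cnj)
    have "(cmod c)\<^sup>2 = (cmod c)\<^sup>2 * ((Re e)\<^sup>2 + (Im e)\<^sup>2)" by (simp add: e)
    then show ?thesis
      unfolding e(2) e_def[symmetric] cmod_power2
      by (simp add: power2_eq_square algebra_simps)
  qed
  ultimately show ?thesis by (auto simp: has_integral_iff c_def)
qed

lemma fcoef_diff_character:
  assumes H: "continuous_on {a..a+1} H"
  shows "fcoef a (\<lambda>x. H x - c * cis (2 * pi * of_int \<zeta> * x)) \<xi> = fcoef a H \<xi> - (if \<xi> = \<zeta> then c else 0)"
proof -
  have "fcoef a (\<lambda>x. H x - c * cis (2 * pi * of_int \<zeta> * x)) \<xi> =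
      integral {a..a+1} (\<lambda>x. H x * cis (- (2 * pi * of_int \<xi> * x)) - c * cis (2 * pi * of_int (\<zeta> - \<xi>) * x))"
    unfolding fcoef_def
    by (intro integral_cong) (simp add: left_diff_distrib cis_mult mult.assoc ring_distribs)
  also have "\<dots> = fcoef a H \<xi> - c * integral {a..a+1} (\<lambda>x. cis (2 * pi * of_int (\<zeta> - \<xi>) * x))"
    unfolding fcoef_def integral_mult_right[symmetric]
    by (intro integral_diff integrable_continuous_interval continuous_intros H)
  finally show ?thesis unfolding integral_character by auto
qed

text \<open>Subtracting the component along one character lowers the energy by the squared modulus
  of its coefficient and leaves all other coefficients as they were, so the frequencies can be
  removed one at a time.\<close>

lemma Bessel_inequality:
  assumes "finite I" "continuous_on {a..a+1} H"
  shows "(\<Sum>\<xi>\<in>I. (cmod (fcoef a H \<xi>))\<^sup>2) \<le> integral {a..a+1} (\<lambda>x. (cmod (H x))\<^sup>2)"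
  using assms
proof (induction I arbitrary: H)
  case empty
  show ?case by (auto intro!: integral_nonneg integrable_continuous_interval continuous_intros empty)
next
  case (insert \<zeta> I)
  define G where "G = (\<lambda>x. H x - fcoef a H \<zeta> * cis (2 * pi * of_int \<zeta> * x))"
  have G: "continuous_on {a..a+1} G" unfolding G_def by (intro continuous_intros insert.prems)
  have "(\<Sum>\<xi>\<in>I. (cmod (fcoef a H \<xi>))\<^sup>2) = (\<Sum>\<xi>\<in>I. (cmod (fcoef a G \<xi>))\<^sup>2)"
    unfolding G_def fcoef_diff_character[OF insert.prems] using insert.hyps by (intro sum.cong) auto
  also have "\<dots> \<le> integral {a..a+1} (\<lambda>x. (cmod (G x))\<^sup>2)" by (rule insert.IH[OF G])
  also have "\<dots> = integral {a..a+1} (\<lambda>x. (cmod (H x))\<^sup>2) - (cmod (fcoef a H \<zeta>))\<^sup>2"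
    unfolding G_def by (rule integral_norm_sq_diff_character[OF insert.prems])
  finally show ?case using insert.hyps by simp
qed

text \<open>Injectivity makes the frequencies distinct, so Bessel bounds the sum of the squared
  coefficients. It is applied to the two ends of a telescoping sum.\<close>

lemma Riemann_Lebesgue_fcoef:
  assumes "continuous_on {a..a+1} H" "inj \<sigma>"
  shows "(\<lambda>n::nat. fcoef a H (\<sigma> n)) \<longlonglongrightarrow> 0"
proof -
  have "summable (\<lambda>n. (cmod (fcoef a H (\<sigma> n)))\<^sup>2)"
  proof (rule summableI_nonneg_bounded)
    fix n
    have "(\<Sum>i<n. (cmod (fcoef a H (\<sigma> i)))\<^sup>2) = (\<Sum>\<xi>\<in>\<sigma> ` {..<n}. (cmod (fcoef a H \<xi>))\<^sup>2)"
      using assms(2) by (subst sum.reindex) (auto intro: inj_on_subset)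
    also have "\<dots> \<le> integral {a..a+1} (\<lambda>x. (cmod (H x))\<^sup>2)"
      by (intro Bessel_inequality assms) auto
    finally show "(\<Sum>i<n. (cmod (fcoef a H (\<sigma> i)))\<^sup>2) \<le> integral {a..a+1} (\<lambda>x. (cmod (H x))\<^sup>2)" .
  qed auto
  then have "(\<lambda>n. (cmod (fcoef a H (\<sigma> n)))\<^sup>2) \<longlonglongrightarrow> 0" by (rule summable_LIMSEQ_zero)
  then have "(\<lambda>n. sqrt ((cmod (fcoef a H (\<sigma> n)))\<^sup>2)) \<longlonglongrightarrow> sqrt 0" by (intro tendsto_intros)
  then show ?thesis by (simp add: tendsto_norm_zero_iff)
qed

lemma sum_int_telescope:
  fixes q :: "int \<Rightarrow> complex"
  shows "(\<Sum>\<xi>\<in>{- int N..int N}. q (\<xi> - 1) - q \<xi>) = q (- int N - 1) - q (int N)"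
proof (induction N)
  case (Suc N)
  have A: "{- int (Suc N)..int (Suc N)} = insert (- int (Suc N)) (insert (int (Suc N)) {- int N..int N})"
    by auto
  have "- int (Suc N) \<notin> insert (int (Suc N)) {- int N..int N}" "int (Suc N) \<notin> {- int N..int N}"
    by auto
  then have "(\<Sum>\<xi>\<in>{- int (Suc N)..int (Suc N)}. q (\<xi> - 1) - q \<xi>) =
      (q (- int (Suc N) - 1) - q (- int (Suc N))) + ((q (int (Suc N) - 1) - q (int (Suc N))) + (q (- int N - 1) - q (int N)))"
    unfolding A by (subst sum.insert, simp, blast, subst sum.insert, simp, blast, simp only: Suc)
  moreover have "int (Suc N) - 1 = int N" "- int N - 1 = - int (Suc N)" by auto
  ultimately show ?case by (simp only:) simp
qed simp

lemma has_vector_derivative_quotient: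
  fixes f :: "real \<Rightarrow> 'a::real_normed_vector"
  assumes "(f has_vector_derivative d) (at 0)"
  shows "((\<lambda>x. (f x - f 0) /\<^sub>R x) \<longlongrightarrow> d) (at 0)"
proof -
  have "(\<lambda>h. norm (f (0 + h) - f 0 - h *\<^sub>R d) / norm h) \<midarrow>0\<rightarrow> 0"
    using assms unfolding has_vector_derivative_def has_derivative_at by blast
  moreover have "\<forall>\<^sub>F h in at 0. norm (f (0 + h) - f 0 - h *\<^sub>R d) / norm h = norm ((f h - f 0) /\<^sub>R h - d)"
    unfolding eventually_at_filter
  proof (intro always_eventually allI impI)
    fix h :: real assume "h \<noteq> 0"
    then have "(f h - f 0) /\<^sub>R h - d = (f h - f 0 - h *\<^sub>R d) /\<^sub>R h" by (simp add: scaleR_diff_right)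
    then show "norm (f (0 + h) - f 0 - h *\<^sub>R d) / norm h = norm ((f h - f 0) /\<^sub>R h - d)"
      by (simp add: divide_inverse mult.commute)
  qed
  ultimately have "((\<lambda>h. norm ((f h - f 0) /\<^sub>R h - d)) \<longlongrightarrow> 0) (at 0)"
    by (rule Lim_transform_eventually)
  then show ?thesis using LIM_zero_cancel tendsto_norm_zero_iff by blast
qed

lemma integral_supported:
  fixes k :: "real \<Rightarrow> complex"
  assumes "{c..d} \<subseteq> {a..b}" "\<And>x. x \<in> {a..b} \<Longrightarrow> x \<notin> {c..d} \<Longrightarrow> k x = 0"
  shows "integral {a..b} k = integral {c..d} k"
proof -
  have "integral {c..d} k = integral {a..b} (\<lambda>x. if x \<in> {c..d} then k x else 0)"
    unfolding integral_restrict_Int using assms(1) by (simp only: Int_absorb2)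
  also have "\<dots> = integral {a..b} k" using assms(2) by (intro integral_cong) auto
  finally show ?thesis by simp
qed

text \<open>Chernoff's argument: after subtracting \<open>C 0\<close>, dividing by \<open>cis (2 * pi * x) - 1\<close> makes the partial sums telescope.\<close>

lemma fourier_inversion_at_0:
  assumes C: "continuous_on {-1/2..1/2} C" and d: "(C has_vector_derivative d) (at 0)"
  shows "(\<lambda>N. \<Sum>\<xi>\<in>{- int N..int N}. fcoef (-1/2) C \<xi>) \<longlonglongrightarrow> C 0"
proof -
  \<comment> \<open>The value at 0 is the limit \<open>d / (2 * pi * \<i>)\<close> of the quotient,
    which makes \<open>q\<close> continuous; only here does differentiability at 0 enter.\<close>
  define q where "q = (\<lambda>x. if x = 0 then d / (2 * pi * \<i>) else (C x - C 0) / (cis (2 * pi * x) - 1))"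
  have nz: "cis (2 * pi * x) \<noteq> 1" if "x \<in> {-1/2..1/2}" "x \<noteq> 0" for x
  proof
    assume "cis (2 * pi * x) = 1"
    then have "cos (2 * pi * x) = 1" by (metis cis.simps(1) one_complex.simps(1))
    then obtain n :: int where "2 * pi * x = of_int n * 2 * pi" using cos_one_2pi_int by blast
    then have "x = of_int n" by simp
    then show False using that by auto
  qed
  have q0: "isCont q 0"
  proof -
    have "((\<lambda>x. (C x - C 0) /\<^sub>R x) \<longlongrightarrow> d) (at 0)"
      by (rule has_vector_derivative_quotient[OF d])
    moreover have "((\<lambda>x. (cis (2 * pi * x) - 1) /\<^sub>R x) \<longlongrightarrow> \<i> * complex_of_real (2 * pi)) (at 0)"
    proof -
      have "((\<lambda>x. cis (2 * pi * x)) has_vector_derivative \<i> * complex_of_real (2 * pi) * cis (2 * pi * 0)) (at 0)"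
        by (rule cis_has_vector_derivative) (auto intro!: derivative_eq_intros)
      from has_vector_derivative_quotient[OF this] show ?thesis by simp
    qed
    ultimately have "((\<lambda>x. ((C x - C 0) /\<^sub>R x) / ((cis (2 * pi * x) - 1) /\<^sub>R x)) \<longlongrightarrow> d / (\<i> * complex_of_real (2 * pi))) (at 0)"
      by (intro tendsto_divide) auto
    moreover have "\<forall>\<^sub>F x in at 0. ((C x - C 0) /\<^sub>R x) / ((cis (2 * pi * x) - 1) /\<^sub>R x) = q x"
      unfolding eventually_at_filter by (auto simp: q_def divide_simps scaleR_conv_of_real)
    ultimately have "(q \<longlongrightarrow> d / (\<i> * complex_of_real (2 * pi))) (at 0)"
      by (rule Lim_transform_eventually)
    then show ?thesis by (simp add: isCont_def q_def mult.commute)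
  qed
  have q: "continuous_on {-1/2..-1/2+1} q"
  proof -
    have "continuous_on ({-1/2..1/2} - {0}) (\<lambda>x. (C x - C 0) / (cis (2 * pi * x) - 1))"
      using nz by (intro continuous_intros continuous_on_subset[OF C]) auto
    then have *: "continuous_on ({-1/2..1/2} - {0}) q"
      by (rule continuous_on_eq) (auto simp: q_def)
    show ?thesis
      unfolding continuous_on_eq_continuous_within
    proof
      fix x :: real assume x: "x \<in> {-1/2..-1/2+1}"
      show "continuous (at x within {-1/2..-1/2+1}) q"
      proof (cases "x = 0")
        case True then show ?thesis using q0 continuous_at_imp_continuous_at_within by blast
      next
        case False
        then have "continuous (at x within {-1/2..1/2} - {0}) q"
          using * x by (auto simp: continuous_on_eq_continuous_within)
        moreover have "at x within {-1/2..1/2} - {0} = at x within {-1/2..-1/2+1}"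
          using False by (intro at_within_nhd[of x "-{0}"]) auto
        ultimately show ?thesis by simp
      qed
    qed
  qed
  have C': "continuous_on {-1/2..-1/2+1} C" using C by simp
  have eq: "fcoef (-1/2) C \<xi> - (if \<xi> = 0 then C 0 else 0) = fcoef (-1/2) q (\<xi> - 1) - fcoef (-1/2) q \<xi>" for \<xi>
  proof -
    have "fcoef (-1/2) q (\<xi> - 1) - fcoef (-1/2) q \<xi> =
      integral {-1/2..-1/2+1} (\<lambda>x. q x * cis (- (2 * pi * of_int (\<xi> - 1) * x)) - q x * cis (- (2 * pi * of_int \<xi> * x)))"
      unfolding fcoef_def by (intro integral_diff[symmetric] integrable_continuous_interval continuous_intros q)
    also have "\<dots> = integral {-1/2..-1/2+1} (\<lambda>x. (C x - C 0 * cis (2 * pi * of_int 0 * x)) * cis (- (2 * pi * of_int \<xi> * x)))"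
    proof (rule integral_cong)
      fix x :: real assume x: "x \<in> {-1/2..-1/2+1}"
      have "cis (- (2 * pi * of_int (\<xi> - 1) * x)) = cis (2 * pi * x) * cis (- (2 * pi * of_int \<xi> * x))"
        by (simp add: cis_mult algebra_simps)
      then have "q x * cis (- (2 * pi * of_int (\<xi> - 1) * x)) - q x * cis (- (2 * pi * of_int \<xi> * x)) =
          (q x * (cis (2 * pi * x) - 1)) * cis (- (2 * pi * of_int \<xi> * x))"
        by (simp only: right_diff_distrib left_diff_distrib mult_1_right mult.assoc)
      moreover have "q x * (cis (2 * pi * x) - 1) = C x - C 0 * cis (2 * pi * of_int 0 * x)"
        using nz[of x] x by (auto simp: q_def)
      ultimately show "q x * cis (- (2 * pi * of_int (\<xi> - 1) * x)) - q x * cis (- (2 * pi * of_int \<xi> * x)) =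
          (C x - C 0 * cis (2 * pi * of_int 0 * x)) * cis (- (2 * pi * of_int \<xi> * x))"
        by (simp only:)
    qed
    also have "\<dots> = fcoef (-1/2) (\<lambda>x. C x - C 0 * cis (2 * pi * of_int 0 * x)) \<xi>"
      by (simp only: fcoef_def)
    also have "\<dots> = fcoef (-1/2) C \<xi> - (if \<xi> = 0 then C 0 else 0)"
      by (rule fcoef_diff_character[OF C'])
    finally show ?thesis by simp
  qed
  have "(\<lambda>N. fcoef (-1/2) q (- int N - 1) - fcoef (-1/2) q (int N)) \<longlonglongrightarrow> 0 - 0"
    by (intro tendsto_diff Riemann_Lebesgue_fcoef[OF q]) (auto simp: inj_def)
  moreover have "(\<Sum>\<xi>\<in>{- int N..int N}. fcoef (-1/2) C \<xi>) - C 0 = fcoef (-1/2) q (- int N - 1) - fcoef (-1/2) q (int N)" for N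
  proof -
    have "(\<Sum>\<xi>\<in>{- int N..int N}. fcoef (-1/2) C \<xi> - (if \<xi> = 0 then C 0 else 0)) = (\<Sum>\<xi>\<in>{- int N..int N}. fcoef (-1/2) C \<xi>) - C 0"
      by (subst sum_subtractf) (simp add: sum.delta)
    then show ?thesis unfolding eq sum_int_telescope by simp
  qed
  ultimately have "(\<lambda>N. (\<Sum>\<xi>\<in>{- int N..int N}. fcoef (-1/2) C \<xi>) - C 0) \<longlonglongrightarrow> 0" by simp
  then show ?thesis by (rule LIM_zero_cancel)
qed

text \<open>Parseval for the pair is Fourier inversion at 0 for the correlation function of
  \<open>f\<close> and \<open>g\<close>: its coefficients are the products of theirs, its value at 0
  is the pairing, and it inherits differentiability from \<open>f\<close>. Supports of radius 1/4
  keep a shifted window from cutting off mass; the interval of radius 2 leaves room for the shifts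
  \<open>x + y\<close>.\<close>

lemma parseval_window:
  fixes f g f' :: "real \<Rightarrow> complex"
  assumes f: "\<And>x. x \<in> {-2<..<2} \<Longrightarrow> (f has_vector_derivative f' x) (at x)" and f': "continuous_on {-2<..<2} f'"
    and g: "continuous_on {-2<..<2} g"
    and supp: "\<And>x. x \<in> {-2<..<2} \<Longrightarrow> 1/4 < \<bar>x\<bar> \<Longrightarrow> f x = 0" "\<And>x. x \<in> {-2<..<2} \<Longrightarrow> 1/4 < \<bar>x\<bar> \<Longrightarrow> g x = 0"
  shows "(\<lambda>N. \<Sum>\<xi>\<in>{- int N..int N}. fcoef (-1/2) f \<xi> * cnj (fcoef (-1/2) g \<xi>))
    \<longlonglongrightarrow> integral {-1/2..1/2} (\<lambda>x. f x * cnj (g x))"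
proof -
  have contf: "continuous_on {-2<..<2} f"
    by (intro continuous_at_imp_continuous_on ballI) (use f has_vector_derivative_continuous in blast)
  define C where "C = (\<lambda>y. integral {-1/2..1/2} (\<lambda>x. f (x + y) * cnj (g x)))"
  have deriv: "(C has_vector_derivative integral {-1/2..1/2} (\<lambda>x. f' (x + y) * cnj (g x))) (at y within {-1..1})"
    if y: "y \<in> {-1..1}" for y
    unfolding C_def
  proof (rule leibniz_rule_vector_derivative[where a = "-1/2::real" and b = "1/2", unfolded cbox_interval])
    fix y x :: real assume "y \<in> {-1..1}" "x \<in> {-1/2..1/2}"
    then have "x + y \<in> {-2<..<2}" by auto
    then have "((\<lambda>y. f (x + y)) has_vector_derivative f' (x + y)) (at y)"
    proof -
      have "((\<lambda>y. x + y) has_vector_derivative 1) (at y)"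
        unfolding has_real_derivative_iff_has_vector_derivative[symmetric]
        by (auto intro!: derivative_eq_intros)
      from vector_diff_chain_at[OF this, of f "f' (x + y)"] show ?thesis
        using f[of "x + y"] \<open>x + y \<in> {-2<..<2}\<close> by (simp add: o_def)
    qed
    then have "((\<lambda>y. f (x + y) * cnj (g x)) has_vector_derivative f' (x + y) * cnj (g x)) (at y)"
      by (rule has_vector_derivative_mult_left)
    then show "((\<lambda>y. f (x + y) * cnj (g x)) has_vector_derivative f' (x + y) * cnj (g x)) (at y within {-1..1})"
      by (rule has_vector_derivative_at_within)
  next
    fix y :: real assume "y \<in> {-1..1}"
    then show "(\<lambda>x. f (x + y) * cnj (g x)) integrable_on {-1/2..1/2}"
      by (intro integrable_continuous_interval continuous_intros continuous_on_compose2[OF contf]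
          continuous_on_subset[OF g]) auto
  next
    show "continuous_on ({-1..1} \<times> {-1/2..1/2}) (\<lambda>(y, x). f' (x + y) * cnj (g x))"
    proof -
      have 1: "continuous_on ({-1..1} \<times> {-1/2..1/2}) (\<lambda>z. f' (snd z + fst z))"
        by (rule continuous_on_compose2[OF f']) (auto intro!: continuous_on_add continuous_on_fst continuous_on_snd continuous_on_id)
      have 2: "continuous_on ({-1..1} \<times> {-1/2..1/2}) (\<lambda>z::real \<times> real. g (snd z))"
        by (rule continuous_on_compose2[OF g]) (auto intro!: continuous_on_snd continuous_on_id)
      show ?thesis
        unfolding case_prod_unfold by (rule continuous_on_mult[OF 1 continuous_on_cnj[OF 2]])
    qed
  qed (use y in auto)
  have "(C has_vector_derivative integral {-1/2..1/2} (\<lambda>x. f' (x + 0) * cnj (g x))) (at 0)"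
  proof -
    have "at 0 within {-1..1} = at (0::real)" by (rule at_within_interior) auto
    then show ?thesis using deriv[of 0] by (simp only: atLeastAtMost_iff) simp
  qed
  moreover have "continuous_on {-1/2..1/2} C"
  proof (rule continuous_on_subset[of "{-1..1}"])
    show "continuous_on {-1..1} C"
      using deriv has_vector_derivative_continuous by (auto simp: continuous_on_eq_continuous_within) blast
  qed auto
  ultimately have lim: "(\<lambda>N. \<Sum>\<xi>\<in>{- int N..int N}. fcoef (-1/2) C \<xi>) \<longlonglongrightarrow> C 0"
    by (intro fourier_inversion_at_0)
  have "fcoef (-1/2) C \<xi> = fcoef (-1/2) f \<xi> * cnj (fcoef (-1/2) g \<xi>)" for \<xi>
  proof -
    define e where "e = (\<lambda>x. cis (- (2 * pi * of_int \<xi> * x)))"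
    have e: "e x * cnj (e x) = 1" "e (x + y) = e x * e y" for x y
      by (simp_all add: e_def cis_cnj cis_mult algebra_simps)
    have conte: "continuous_on S e" for S unfolding e_def by (intro continuous_intros)
    have contC: "continuous_on ({-1/2..1/2} \<times> {-1/2..1/2}) (\<lambda>z. f (snd z + fst z) * cnj (g (snd z)) * e (fst z))"
    proof -
      have 1: "continuous_on ({-1/2..1/2} \<times> {-1/2..1/2}) (\<lambda>z. f (snd z + fst z))"
        by (rule continuous_on_compose2[OF contf]) (auto intro!: continuous_on_add continuous_on_fst continuous_on_snd continuous_on_id)
      have 2: "continuous_on ({-1/2..1/2} \<times> {-1/2..1/2}) (\<lambda>z::real \<times> real. g (snd z))"
        by (rule continuous_on_compose2[OF g]) (auto intro!: continuous_on_snd continuous_on_id)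
      have 3: "continuous_on ({-1/2..1/2} \<times> {-1/2..1/2}) (\<lambda>z::real \<times> real. e (fst z))"
        by (rule continuous_on_compose2[OF conte[of UNIV]]) (auto intro!: continuous_on_fst continuous_on_id)
      show ?thesis by (rule continuous_on_mult[OF continuous_on_mult[OF 1 continuous_on_cnj[OF 2]] 3])
    qed
    have "fcoef (-1/2) C \<xi> = integral {-1/2..1/2} (\<lambda>y. integral {-1/2..1/2} (\<lambda>x. f (x + y) * cnj (g x) * e y))"
      unfolding fcoef_def C_def e_def by (simp add: integral_mult_left)
    also have "\<dots> = integral {-1/2..1/2} (\<lambda>x. integral {-1/2..1/2} (\<lambda>y. f (x + y) * cnj (g x) * e y))"
      by (rule integral_swap_continuous[where a = "-1/2::real" and b = "1/2" and c = "-1/2::real" and d = "1/2",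
              unfolded cbox_Pair_eq, unfolded cbox_interval case_prod_unfold])
        (rule contC)
    also have "\<dots> = integral {-1/2..1/2} (\<lambda>x. fcoef (-1/2) f \<xi> * (cnj (g x) * cnj (e x)))"
    proof (rule integral_cong)
      fix x :: real assume x: "x \<in> {-1/2..1/2}"
      show "integral {-1/2..1/2} (\<lambda>y. f (x + y) * cnj (g x) * e y) = fcoef (-1/2) f \<xi> * (cnj (g x) * cnj (e x))"
      proof (cases "\<bar>x\<bar> > 1/4")
        case True
        then have "g x = 0" using x supp(2) by auto
        then show ?thesis by simp
      next
        case False
        have "f (x + y) * cnj (g x) * e y = f (y + x) * e (y + x) * (cnj (g x) * cnj (e x))" for y
        proof -
          have "f (y + x) * e (y + x) * (cnj (g x) * cnj (e x)) = f (y + x) * cnj (g x) * e y * (e x * cnj (e x))"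
            by (simp only: e(2) mult_ac)
          then show ?thesis unfolding e(1) mult_1_right add.commute[of y x] by (rule sym)
        qed
        then have "integral {-1/2..1/2} (\<lambda>y. f (x + y) * cnj (g x) * e y) =
            integral {-1/2..1/2} (\<lambda>y. f (y + x) * e (y + x)) * (cnj (g x) * cnj (e x))"
          by (simp only: integral_mult_left)
        also have "integral {-1/2..1/2} (\<lambda>y. f (y + x) * e (y + x)) = integral {-1/2+x..1/2+x} (\<lambda>y. f y * e y)"
          using integral_shift_real_ivl[of "-1/2+x" x "1/2+x" "\<lambda>y. f y * e y"] by simp
        \<comment> \<open>For \<open>\<bar>x\<bar> \<le> 1/4\<close> the shifted interval still
          contains the support of \<open>f\<close>.\<close>
        also have "\<dots> = integral {-1/4..1/4} (\<lambda>y. f y * e y)"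
          by (rule integral_supported) (use False x supp(1) in auto)
        also have "\<dots> = integral {-1/2..1/2} (\<lambda>y. f y * e y)"
          by (rule integral_supported[symmetric]) (use supp(1) in auto)
        finally show ?thesis by (simp add: fcoef_def e_def)
      qed
    qed
    also have "\<dots> = fcoef (-1/2) f \<xi> * cnj (fcoef (-1/2) g \<xi>)"
      by (simp add: fcoef_def e_def integral_cnj)
    finally show ?thesis .
  qed
  with lim show ?thesis by (simp add: C_def)
qed

section \<open>Periodic functions\<close>

lemma periodic_nat:
  fixes h :: "real \<Rightarrow> 'a"
  assumes "\<And>x. h (x + c) = h x"
  shows "h (x + real n * c) = h x"
proof (induction n)
  case (Suc n)
  have "h (x + real (Suc n) * c) = h (x + real n * c + c)" by (simp add: algebra_simps)
  then show ?case using assms Suc by simp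
qed simp

lemma periodic_int:
  fixes h :: "real \<Rightarrow> 'a"
  assumes "\<And>x. h (x + c) = h x"
  shows "h (x + of_int n * c) = h x"
proof (cases "n \<ge> 0")
  case True
  then show ?thesis using periodic_nat[of h c x "nat n", OF assms] by simp
next
  case False
  then have "h (x + of_int n * c + real (nat (- n)) * c) = h (x + of_int n * c)"
    by (intro periodic_nat assms)
  then show ?thesis using False by simp
qed

lemma integral_periodic_shift:
  fixes h :: "real \<Rightarrow> 'a::euclidean_space"
  assumes per: "\<And>x. h (x + 1) = h x" and cont: "continuous_on UNIV h"
  shows "integral {0..1} (\<lambda>t. h (t + v)) = integral {0..1} h"
proof -
  define w where "w = v - of_int \<lfloor>v\<rfloor>"
  have w: "0 \<le> w" "w \<le> 1" unfolding w_def by linarith+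
  have int: "h integrable_on {a..b}" for a b
    by (intro integrable_continuous_interval continuous_on_subset[OF cont]) auto
  have "h (t + v) = h (t + w)" for t
    using periodic_int[of h 1 "t + w" "\<lfloor>v\<rfloor>", OF per] by (simp add: w_def)
  then have "integral {0..1} (\<lambda>t. h (t + v)) = integral {w - w..(1 + w) - w} (\<lambda>t. h (t + w))" by simp
  also have "\<dots> = integral {w..1 + w} h" by (rule integral_shift_real_ivl)
  also have "\<dots> = integral {w..1} h + integral {1..1 + w} h"
    using Henstock_Kurzweil_Integration.integral_combine[where a = w and c = 1 and b = "1 + w" and f = h] w int by simp
  also have "integral {1..1 + w} h = integral {0..w} h"
    using integral_shift_real_ivl[of 1 1 "1 + w" h] per by simp
  also have "integral {w..1} h + integral {0..w} h = integral {0..1} h"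
    using Henstock_Kurzweil_Integration.integral_combine[OF w int[of 0 1]] by (simp only: add.commute)
  finally show ?thesis .
qed

text \<open>Swapping the integrals and using periodicity shows that the average over all positions
  of a window sees a full period, weighted by the mass of the window. This turns estimates in a
  window, where phase slopes are nearly constant, into estimates of \<open>J\<close>.\<close>

lemma integral_average_window:
  fixes h w :: "real \<Rightarrow> real"
  assumes per: "\<And>x. h (x + 1) = h x" and cont: "continuous_on UNIV h" and w: "continuous_on UNIV w"
  shows "((\<lambda>t. integral {-1/2..1/2} (\<lambda>v. w v * h (t + v))) has_integral
    integral {-1/2..1/2} w * integral {0..1} h) {0..1}"
proof -
  have c: "continuous_on S (\<lambda>z. w (snd z) * h (fst z + snd z))" for S :: "(real \<times> real) set"
    by (rule continuous_on_mult; rule continuous_on_compose2[OF w] continuous_on_compose2[OF cont])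
      (auto intro!: continuous_on_add continuous_on_fst continuous_on_snd continuous_on_id)
  have "integral {0..1} (\<lambda>t. integral {-1/2..1/2} (\<lambda>v. w v * h (t + v))) =
      integral {-1/2..1/2} (\<lambda>v. integral {0..1} (\<lambda>t. w v * h (t + v)))"
    by (rule integral_swap_continuous[where a = "0::real" and b = 1 and c = "-1/2::real" and d = "1/2",
          unfolded cbox_Pair_eq, unfolded cbox_interval case_prod_unfold]) (rule c)
  also have "\<dots> = integral {-1/2..1/2} (\<lambda>v. w v * integral {0..1} h)"
    by (simp add: integral_periodic_shift[OF per cont] del: times_divide_eq_left)
  also have "\<dots> = integral {-1/2..1/2} w * integral {0..1} h" by simp
  finally have eq: "integral {0..1} (\<lambda>t. integral {-1/2..1/2} (\<lambda>v. w v * h (t + v))) =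
    integral {-1/2..1/2} w * integral {0..1} h" .
  have "continuous_on {0..1} (\<lambda>t. integral {-1/2..1/2} (\<lambda>v. w v * h (t + v)))"
    by (rule integral_continuous_on_param[where a = "-1/2::real" and b = "1/2", unfolded cbox_interval, unfolded case_prod_unfold])
      (use c in \<open>simp add: case_prod_unfold\<close>)
  then show ?thesis unfolding eq[symmetric]
    by (intro integrable_integral integrable_continuous_interval)
qed

lemma sum_shift_periodic:
  fixes h :: "nat \<Rightarrow> 'a::comm_monoid_add"
  assumes "h L = h 0"
  shows "(\<Sum>c<L. h (Suc c)) = (\<Sum>c<L. h c)"
proof (cases L)
  case (Suc m)
  have "(\<Sum>c<L. h (Suc c)) = (\<Sum>c<m. h (Suc c)) + h 0"
    using assms by (simp add: Suc)
  also have "\<dots> = (\<Sum>c<L. h c)"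
    unfolding Suc sum.lessThan_Suc_shift by (simp add: add.commute)
  finally show ?thesis .
qed simp

lemma sum_lessThan_mult:
  fixes h :: "nat \<Rightarrow> 'a::comm_monoid_add"
  shows "(\<Sum>b<m * k. h b) = (\<Sum>a<m. \<Sum>c<k. h (a + m * c))"
proof -
  have "(\<Sum>b<m * k. h b) = (\<Sum>c<k. \<Sum>b\<in>{c*m..<c*m+m}. h b)"
    by (simp add: sum.nat_group mult.commute)
  also have "\<dots> = (\<Sum>c<k. \<Sum>a<m. h (a + m * c))"
  proof (rule sum.cong[OF refl])
    fix c
    show "(\<Sum>b\<in>{c*m..<c*m+m}. h b) = (\<Sum>a<m. h (a + m * c))"
      using sum.shift_bounds_nat_ivl[of h 0 "c * m" m]
      by (simp add: lessThan_atLeast0 add.commute mult.commute)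
  qed
  finally show ?thesis by (subst sum.swap)
qed

text \<open>At every frequency at least one of the two coefficients is at most
  \<open>d \<xi>\<close>. The weighted inequality
  \<open>u * v \<le> \<epsilon> * v ^ 2 + u ^ 2 / (4 * \<epsilon>)\<close> charges the small factor
  to \<open>B\<close> and the other, by Bessel, to \<epsilon> times the energies, which the
  recursion can absorb.\<close>

lemma cross_term_bound:
  fixes f g f' :: "real \<Rightarrow> complex" and d :: "int \<Rightarrow> real"
  assumes f: "\<And>x. x \<in> {-2<..<2} \<Longrightarrow> (f has_vector_derivative f' x) (at x)" and f': "continuous_on {-2<..<2} f'"
    and g: "continuous_on {-2<..<2} g"
    and supp: "\<And>x. x \<in> {-2<..<2} \<Longrightarrow> 1/4 < \<bar>x\<bar> \<Longrightarrow> f x = 0" "\<And>x. x \<in> {-2<..<2} \<Longrightarrow> 1/4 < \<bar>x\<bar> \<Longrightarrow> g x = 0"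
    and d: "\<And>\<xi>. cmod (fcoef (-1/2) f \<xi>) \<le> d \<xi> \<or> cmod (fcoef (-1/2) g \<xi>) \<le> d \<xi>"
    and B: "\<And>N. (\<Sum>\<xi>\<in>{- int N..int N}. (d \<xi>)\<^sup>2) \<le> B" and \<epsilon>: "0 < \<epsilon>"
  shows "cmod (integral {-1/2..1/2} (\<lambda>x. f x * cnj (g x))) \<le>
    \<epsilon> * (integral {-1/2..1/2} (\<lambda>x. (cmod (f x))\<^sup>2) + integral {-1/2..1/2} (\<lambda>x. (cmod (g x))\<^sup>2)) + B / (4 * \<epsilon>)"
proof -
  let ?f = "fcoef (-1/2) f" and ?g = "fcoef (-1/2) g"
  have contf: "continuous_on {-2<..<2} f"
    by (intro continuous_at_imp_continuous_on ballI) (use f has_vector_derivative_continuous in blast)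
  have pt: "cmod (?f \<xi> * cnj (?g \<xi>)) \<le> \<epsilon> * ((cmod (?f \<xi>))\<^sup>2 + (cmod (?g \<xi>))\<^sup>2) + (d \<xi>)\<^sup>2 / (4 * \<epsilon>)" for \<xi>
  proof -
    have am: "u * v \<le> \<epsilon> * (u\<^sup>2 + v\<^sup>2) + D\<^sup>2 / (4 * \<epsilon>)" if "0 \<le> u" "0 \<le> v" "u \<le> D" for u v D :: real
    proof -
      have "0 \<le> (2 * \<epsilon> * v - D)\<^sup>2 / (4 * \<epsilon>)" using \<epsilon> by simp
      also have "\<dots> = \<epsilon> * v\<^sup>2 - D * v + D\<^sup>2 / (4 * \<epsilon>)"
        using \<epsilon> by (simp add: power2_eq_square field_simps)
      finally have "D * v \<le> \<epsilon> * v\<^sup>2 + D\<^sup>2 / (4 * \<epsilon>)" by simp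
      moreover have "u * v \<le> D * v" using that by (intro mult_right_mono)
      moreover have "\<epsilon> * v\<^sup>2 \<le> \<epsilon> * (u\<^sup>2 + v\<^sup>2)" using \<epsilon> by simp
      ultimately show ?thesis by linarith
    qed
    from d[of \<xi>] show ?thesis
    proof
      assume "cmod (?f \<xi>) \<le> d \<xi>"
      from am[OF _ _ this, of "cmod (?g \<xi>)"] show ?thesis by (simp add: norm_mult)
    next
      assume "cmod (?g \<xi>) \<le> d \<xi>"
      from am[OF _ _ this, of "cmod (?f \<xi>)"] show ?thesis by (simp add: norm_mult ac_simps)
    qed
  qed
  show ?thesis
  proof (rule LIMSEQ_le_const2[OF tendsto_norm[OF parseval_window[OF f f' g supp]]], assumption+, intro exI allI impI)
    fix N :: nat
    have "cmod (\<Sum>\<xi>\<in>{- int N..int N}. ?f \<xi> * cnj (?g \<xi>)) \<le>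
        (\<Sum>\<xi>\<in>{- int N..int N}. \<epsilon> * ((cmod (?f \<xi>))\<^sup>2 + (cmod (?g \<xi>))\<^sup>2) + (d \<xi>)\<^sup>2 / (4 * \<epsilon>))"
      by (intro order_trans[OF norm_sum] sum_mono pt)
    also have "\<dots> = \<epsilon> * ((\<Sum>\<xi>\<in>{- int N..int N}. (cmod (?f \<xi>))\<^sup>2) + (\<Sum>\<xi>\<in>{- int N..int N}. (cmod (?g \<xi>))\<^sup>2)) +
        (\<Sum>\<xi>\<in>{- int N..int N}. (d \<xi>)\<^sup>2) / (4 * \<epsilon>)"
      by (simp add: sum.distrib sum_divide_distrib flip: sum_distrib_left)
    also have "\<dots> \<le> \<epsilon> * (integral {-1/2..-1/2+1} (\<lambda>x. (cmod (f x))\<^sup>2) + integral {-1/2..-1/2+1} (\<lambda>x. (cmod (g x))\<^sup>2)) + B / (4 * \<epsilon>)"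
      using \<epsilon> by (intro add_mono mult_left_mono Bessel_inequality divide_right_mono B
          continuous_on_subset[OF contf] continuous_on_subset[OF g]) auto
    finally show "cmod (\<Sum>\<xi>\<in>{- int N..int N}. ?f \<xi> * cnj (?g \<xi>)) \<le>
        \<epsilon> * (integral {-1/2..1/2} (\<lambda>x. (cmod (f x))\<^sup>2) + integral {-1/2..1/2} (\<lambda>x. (cmod (g x))\<^sup>2)) + B / (4 * \<epsilon>)"
      by simp
  qed
qed

text \<open>Two of the \<open>2 * p\<close> factors are kept and summed by telescoping, giving
  \<open>3 / y\<close>; the others are bounded by \<open>y\<close>. Hence the sum over the
  frequencies loses one power of \<open>y\<close>.\<close>

lemma sum_inverse_power_bound:
  fixes y :: real
  assumes y: "1 \<le> y" and p: "1 \<le> p"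
  shows "(\<Sum>\<xi>\<in>{- int N..int N}. (C / (y + \<bar>of_int \<xi>\<bar>) ^ p)\<^sup>2) \<le> 3 * C\<^sup>2 / y ^ (2 * p - 1)"
proof -
  have 1: "(\<Sum>\<xi>\<in>{- int N..int N}. 1 / (y + \<bar>of_int \<xi>\<bar>)\<^sup>2) \<le> 1 / y\<^sup>2 + 2 * (1 / y - 1 / (y + real N))"
  proof (induction N)
    case (Suc N)
    have A: "{- int (Suc N)..int (Suc N)} = insert (- int (Suc N)) (insert (int (Suc N)) {- int N..int N})"
      by auto
    have "- int (Suc N) \<notin> insert (int (Suc N)) {- int N..int N}" "int (Suc N) \<notin> {- int N..int N}"
      by auto
    then have eq: "(\<Sum>\<xi>\<in>{- int (Suc N)..int (Suc N)}. 1 / (y + \<bar>of_int \<xi>\<bar>)\<^sup>2) =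
       1 / (y + real (Suc N))\<^sup>2 + (1 / (y + real (Suc N))\<^sup>2 + (\<Sum>\<xi>\<in>{- int N..int N}. 1 / (y + \<bar>of_int \<xi>\<bar>)\<^sup>2))"
      unfolding A by (subst sum.insert, simp, blast, subst sum.insert, simp, blast, simp add: add_ac)
    have "2 / (y + real (Suc N))\<^sup>2 \<le> 2 / ((y + real N) * (y + real (Suc N)))"
      using y by (intro divide_left_mono) (auto simp: power2_eq_square intro!: mult_right_mono mult_pos_pos)
    also have "\<dots> = 2 * (1 / (y + real N) - 1 / (y + real (Suc N)))"
      using y by (simp add: field_simps)
    finally show ?case unfolding eq using Suc by (simp add: add_divide_distrib[symmetric])
  qed simp
  have "(\<Sum>\<xi>\<in>{- int N..int N}. (C / (y + \<bar>of_int \<xi>\<bar>) ^ p)\<^sup>2) \<le>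
      (\<Sum>\<xi>\<in>{- int N..int N}. C\<^sup>2 / y ^ (2 * p - 2) * (1 / (y + \<bar>of_int \<xi>\<bar>)\<^sup>2))"
  proof (rule sum_mono)
    fix \<xi> :: int
    define z where "z = y + \<bar>of_int \<xi>\<bar>"
    have z: "y \<le> z" "0 < z" using y by (auto simp: z_def)
    have "(z ^ p)\<^sup>2 = z ^ (2 * p - 2) * z\<^sup>2"
      using p by (cases p) (auto simp: power_mult_distrib power2_eq_square power_add[symmetric] mult_2)
    moreover have "y ^ (2 * p - 2) \<le> z ^ (2 * p - 2)" using y z by (intro power_mono) auto
    ultimately have "y ^ (2 * p - 2) * z\<^sup>2 \<le> (z ^ p)\<^sup>2" by (simp add: mult_right_mono)
    then have "C\<^sup>2 / (z ^ p)\<^sup>2 \<le> C\<^sup>2 / (y ^ (2 * p - 2) * z\<^sup>2)"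
      using y z by (intro divide_left_mono) auto
    then show "(C / (y + \<bar>of_int \<xi>\<bar>) ^ p)\<^sup>2 \<le> C\<^sup>2 / y ^ (2 * p - 2) * (1 / (y + \<bar>of_int \<xi>\<bar>)\<^sup>2)"
      by (simp add: z_def power_divide)
  qed
  also have "\<dots> = C\<^sup>2 / y ^ (2 * p - 2) * (\<Sum>\<xi>\<in>{- int N..int N}. 1 / (y + \<bar>of_int \<xi>\<bar>)\<^sup>2)"
    by (simp add: sum_distrib_left)
  also have "\<dots> \<le> C\<^sup>2 / y ^ (2 * p - 2) * (3 / y)"
  proof (rule mult_left_mono)
    have "1 / y\<^sup>2 \<le> 1 / y" using y by (intro divide_left_mono) (auto simp: power2_eq_square)
    moreover have "2 * (1 / y - 1 / (y + real N)) \<le> 2 * (1 / y)" using y by simp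
    ultimately have "1 / y\<^sup>2 + 2 * (1 / y - 1 / (y + real N)) \<le> 1 / y + 2 * (1 / y)" by (rule add_mono)
    also have "\<dots> = 3 / y" by simp
    finally show "(\<Sum>\<xi>\<in>{- int N..int N}. 1 / (y + \<bar>of_int \<xi>\<bar>)\<^sup>2) \<le> 3 / y"
      by (rule order_trans[OF 1])
  qed (use y in auto)
  also have "\<dots> = 3 * C\<^sup>2 / (y ^ (2 * p - 2) * y)" by simp
  also have "y ^ (2 * p - 2) * y = y ^ (2 * p - 1)" using p by (cases p) auto
  finally show ?thesis .
qed

section \<open>The skew product and its fibre characteristic functions\<close>

lemma sum_lessThan_add:
  fixes f :: "nat \<Rightarrow> 'a::comm_monoid_add"
  shows "(\<Sum>i<n + k. f i) = (\<Sum>i<n. f i) + (\<Sum>i<k. f (n + i))"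
  by (induction k) (simp_all add: add.assoc)

text \<open>\<open>F\<close> is the lift of \<open>f\<close>; \<open>p\<close> counts the
  derivatives of \<open>F'\<close>, not of \<open>F\<close>, and is \<open>r - 1\<close> in the
  application.\<close>

locale skew =
  fixes l :: nat and lam :: real and F F' :: "real \<Rightarrow> real" and p :: nat and M :: real
  assumes l: "2 \<le> l" and lam: "0 < lam" "lam < 1" and p: "1 \<le> p"
    and periodic: "\<And>x. F (x + 1) = F x"
    and deriv: "\<And>x. (F has_real_derivative F' x) (at x)"
    and bounded: "bounded_derivs UNIV p M F'"
begin

text \<open>A point \<open>u = x + A\<close> encodes both a base point \<open>x\<close> and an
  inverse branch \<open>A\<close>: \<open>S n u\<close> is the height over \<open>x\<close> of the
  \<open>n\<close>-th image of the zero section along that branch, and \<open>Y n u / l\<close> is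
  its slope. Only the residue of \<open>A\<close> modulo \<open>l ^ n\<close> matters.\<close>

definition S :: "nat \<Rightarrow> real \<Rightarrow> real" where
  "S n u = (\<Sum>i<n. lam ^ i * F (u / real l ^ Suc i))"

definition Y :: "nat \<Rightarrow> real \<Rightarrow> real" where
  "Y n u = (\<Sum>i<n. (lam / real l) ^ i * F' (u / real l ^ Suc i))"

definition \<psi> :: "nat \<Rightarrow> real \<Rightarrow> real \<Rightarrow> complex" where
  "\<psi> k \<eta> x = (\<Sum>c<l ^ k. cis (- (\<eta> * S k (x + real c)))) / of_nat (l ^ k)"

definition J :: "nat \<Rightarrow> real \<Rightarrow> real" where
  "J k \<eta> = integral {0..1} (\<lambda>x. (cmod (\<psi> k \<eta> x))\<^sup>2)"

abbreviation \<tau> :: real where "\<tau> \<equiv> lam / real l"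

lemma l_pos: "0 < real l" "1 \<le> real l" "real l \<noteq> 0" using l by auto

lemma lpow_pos: "0 < real l ^ n" "1 \<le> real l ^ n" "real l ^ n \<noteq> 0"
  using l_pos by auto

lemma tau: "0 < \<tau>" "\<tau> \<le> 1 / 2" "\<tau> < 1"
proof -
  show "0 < \<tau>" using lam l_pos by simp
  have "\<tau> \<le> 1 / real l" using lam l_pos by (intro divide_right_mono) auto
  also have "\<dots> \<le> 1 / 2" using l by (intro divide_left_mono) auto
  finally show "\<tau> \<le> 1 / 2" .
  then show "\<tau> < 1" by linarith
qed

lemma M_nonneg: "0 \<le> M" using bounded_derivs_nonneg[OF bounded] by simp

lemma periodic': "F' (x + 1) = F' x"
proof -
  have "((\<lambda>x. F (x + 1)) has_real_derivative F' (x + 1)) (at x)"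
    using deriv DERIV_shift by blast
  then show ?thesis using deriv[of x] DERIV_unique unfolding periodic by blast
qed

lemma geometric_tau: "(\<Sum>i<n. \<tau> ^ i) \<le> 2"
proof -
  have "(\<Sum>i<n. \<tau> ^ i) \<le> (\<Sum>i. \<tau> ^ i)"
    using tau by (intro sum_le_suminf summable_geometric) auto
  also have "\<dots> = 1 / (1 - \<tau>)" using tau by (intro suminf_geometric) auto
  also have "\<dots> \<le> 1 / (1 / 2)" using tau by (intro divide_left_mono) auto
  finally show ?thesis by simp
qed

lemma Y_bounded_derivs: "bounded_derivs UNIV p (2 * M) (Y n)"
proof -
  have "bounded_derivs UNIV p (\<Sum>i<n. \<bar>\<tau> ^ i\<bar> * M) (Y n)"
    unfolding Y_def
  proof (intro bounded_derivs_sum bounded_derivs_cmult)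
    fix i
    have "\<bar>1 / real l ^ Suc i\<bar> \<le> 1" using lpow_pos[of "Suc i"] by (simp add: divide_le_eq_1)
    from bounded_derivs_affine_contract[OF bounded this, of 0]
    show "bounded_derivs UNIV p M (\<lambda>x. F' (x / real l ^ Suc i))" by simp
  qed simp
  moreover have "(\<Sum>i<n. \<bar>\<tau> ^ i\<bar> * M) = (\<Sum>i<n. \<tau> ^ i) * M"
    using lam by (simp add: sum_distrib_right power_abs)
  moreover have "\<dots> \<le> 2 * M" using geometric_tau M_nonneg by (rule mult_right_mono)
  ultimately show ?thesis using bounded_derivs_mono by simp
qed

lemma Y_bound: "\<bar>Y n u\<bar> \<le> 2 * M"
  using bounded_derivs_bound[OF Y_bounded_derivs] by simp

lemma Y_lipschitz: "\<bar>Y n u - Y n v\<bar> \<le> 2 * M * \<bar>u - v\<bar>"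
proof -
  obtain q where q: "p = Suc q" using p by (cases p) auto
  obtain y' where y': "\<forall>x\<in>UNIV. (Y n has_real_derivative y' x) (at x)" "bounded_derivs UNIV q (2 * M) y'"
    using Y_bounded_derivs[of n] unfolding q by (rule bounded_derivs_SucE)
  have b: "norm (y' x) \<le> 2 * M" for x using bounded_derivs_bound[OF y'(2)] by simp
  have "norm (Y n u - Y n v) \<le> 2 * M * norm (u - v)"
    using field_differentiable_bound[of UNIV "Y n" y' "2 * M" u v] y'(1) b by simp
  then show ?thesis by simp
qed

lemma S_deriv: "(S n has_real_derivative Y n u / real l) (at u)"
proof -
  have "((\<lambda>u. lam ^ i * F (u / real l ^ Suc i)) has_real_derivative \<tau> ^ i * F' (u / real l ^ Suc i) / real l) (at u)" for i
  proof -
    have "((\<lambda>u. F (u / real l ^ Suc i)) has_real_derivative F' (u / real l ^ Suc i) * (1 / real l ^ Suc i)) (at u)"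
      by (rule DERIV_chain2[where f = F and g = "\<lambda>u. u / real l ^ Suc i", OF deriv]) (rule DERIV_cdivide[OF DERIV_ident])
    from DERIV_cmult[OF this, of "lam ^ i"]
    show ?thesis by (simp add: power_divide mult.commute)
  qed
  then have "((\<lambda>u. \<Sum>i<n. lam ^ i * F (u / real l ^ Suc i)) has_real_derivative (\<Sum>i<n. \<tau> ^ i * F' (u / real l ^ Suc i) / real l)) (at u)"
    by (intro DERIV_sum)
  then show ?thesis unfolding S_def[abs_def] Y_def by (simp add: sum_divide_distrib)
qed

lemma S_continuous: "continuous_on A (S n)"
  by (intro continuous_at_imp_continuous_on ballI DERIV_isCont[OF S_deriv])

lemma continuous_on_S [continuous_intros]: "continuous_on A h \<Longrightarrow> continuous_on A (\<lambda>x. S n (h x))"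
  by (rule continuous_on_compose2[OF S_continuous[of UNIV]]) auto

lemma continuous_on_Y [continuous_intros]: "continuous_on A h \<Longrightarrow> continuous_on A (\<lambda>x. Y n (h x))"
  by (rule continuous_on_compose2[OF bounded_derivs_continuous[OF Y_bounded_derivs]]) auto

lemma continuous_on_psi [continuous_intros]: "continuous_on A h \<Longrightarrow> continuous_on A (\<lambda>x. \<psi> k \<eta> (h x))"
  unfolding \<psi>_def by (intro continuous_intros) (use lpow_pos in auto)

lemma S_periodic: "S n (u + real l ^ n) = S n u"
  unfolding S_def
proof (rule sum.cong[OF refl])
  fix i assume "i \<in> {..<n}"
  then have "real l ^ n = real l ^ ((n - Suc i) + Suc i)" by simp
  then have "real l ^ n = real (l ^ (n - Suc i)) * real l ^ Suc i"
    by (simp only: power_add of_nat_power)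
  then have "(u + real l ^ n) / real l ^ Suc i = u / real l ^ Suc i + real (l ^ (n - Suc i)) * 1"
    using lpow_pos[of "Suc i"] by (simp add: add_divide_distrib del: of_nat_power)
  then have "F ((u + real l ^ n) / real l ^ Suc i) = F (u / real l ^ Suc i)"
    using periodic_nat[of F 1, OF periodic] by metis
  then show "lam ^ i * F ((u + real l ^ n) / real l ^ Suc i) = lam ^ i * F (u / real l ^ Suc i)" by simp
qed

lemma Y_periodic: "Y n (u + real l ^ n) = Y n u"
  unfolding Y_def
proof (rule sum.cong[OF refl])
  fix i assume "i \<in> {..<n}"
  then have "real l ^ n = real l ^ ((n - Suc i) + Suc i)" by simp
  then have "real l ^ n = real (l ^ (n - Suc i)) * real l ^ Suc i"
    by (simp only: power_add of_nat_power)
  then have "(u + real l ^ n) / real l ^ Suc i = u / real l ^ Suc i + real (l ^ (n - Suc i)) * 1"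
    using lpow_pos[of "Suc i"] by (simp add: add_divide_distrib del: of_nat_power)
  then have "F' ((u + real l ^ n) / real l ^ Suc i) = F' (u / real l ^ Suc i)"
    using periodic_nat[of F' 1, OF periodic'] by metis
  then show "\<tau> ^ i * F' ((u + real l ^ n) / real l ^ Suc i) = \<tau> ^ i * F' (u / real l ^ Suc i)" by simp
qed

text \<open>Heights form a cocycle: the first \<open>n\<close> preimages contribute
  \<open>S n\<close>, the others a copy of \<open>S k\<close> at the \<open>n\<close>-th preimage
  shrunk by \<open>lam ^ n\<close>. This factor is what lowers the frequency from \<eta> to
  \<open>lam ^ n * \<eta>\<close> in the recursion.\<close>

lemma S_add: "S (n + k) u = S n u + lam ^ n * S k (u / real l ^ n)"
  unfolding S_def sum_distrib_left
  by (simp add: sum_lessThan_add power_add mult_ac)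

lemma Y_add: "Y (n + k) u = Y n u + \<tau> ^ n * Y k (u / real l ^ n)"
  unfolding Y_def sum_distrib_left
  by (simp add: sum_lessThan_add power_add mult_ac)

lemma S_split: "S (n + k) (x + real a + real l ^ n * real c) =
    S n (x + real a) + lam ^ n * S k ((x + real a) / real l ^ n + real c)"
proof -
  have "S n (x + real a + real c * real l ^ n) = S n (x + real a)"
    by (rule periodic_nat[of "S n", OF S_periodic])
  moreover have "(x + real a + real l ^ n * real c) / real l ^ n = (x + real a) / real l ^ n + real c"
    using lpow_pos by (simp add: add_divide_distrib)
  ultimately show ?thesis unfolding S_add by (simp add: mult.commute)
qed

lemma psi_periodic: "\<psi> k \<eta> (x + 1) = \<psi> k \<eta> x"
proof -
  have "(\<Sum>c<l ^ k. cis (- (\<eta> * S k (x + 1 + real c)))) = (\<Sum>c<l ^ k. cis (- (\<eta> * S k (x + real (Suc c)))))"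
    by (simp add: add_ac)
  also have "\<dots> = (\<Sum>c<l ^ k. cis (- (\<eta> * S k (x + real c))))"
    by (rule sum_shift_periodic[of "\<lambda>c. cis (- (\<eta> * S k (x + real c)))"]) (simp add: S_periodic)
  finally show ?thesis by (simp add: \<psi>_def)
qed

text \<open>The part of \<psi> coming from the branches in a common residue class modulo
  \<open>l ^ n\<close>. These share the curve \<open>S n\<close>, which enters as a factor of
  modulus one, so \<open>G\<close> has the size of \<psi> at the lower frequency.\<close>

definition G :: "nat \<Rightarrow> nat \<Rightarrow> real \<Rightarrow> nat \<Rightarrow> real \<Rightarrow> complex" where
  "G n k \<eta> a x = (\<Sum>c<l ^ k. cis (- (\<eta> * S (n + k) (x + real a + real l ^ n * real c)))) / of_nat (l ^ k)"

lemma psi_eq_sum_G: "\<psi> (n + k) \<eta> x = (\<Sum>a<l ^ n. G n k \<eta> a x) / of_nat (l ^ n)"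
  unfolding \<psi>_def G_def power_add sum_lessThan_mult
  by (simp add: sum_divide_distrib add_ac mult.commute)

lemma G_eq: "G n k \<eta> a x = cis (- (\<eta> * S n (x + real a))) * \<psi> k (lam ^ n * \<eta>) ((x + real a) / real l ^ n)"
  unfolding G_def \<psi>_def S_split
  by (simp add: sum_distrib_left cis_mult algebra_simps sum_divide_distrib)

lemma cmod_G: "cmod (G n k \<eta> a x) = cmod (\<psi> k (lam ^ n * \<eta>) ((x + real a) / real l ^ n))"
  by (simp add: G_eq norm_mult)

lemma cmod_psi_le: "cmod (\<psi> k \<eta> x) \<le> 1"
proof -
  have "cmod (\<Sum>c<l ^ k. cis (- (\<eta> * S k (x + real c)))) \<le> (\<Sum>c<l ^ k. 1)"
    by (rule sum_norm_le) simp
  then show ?thesis using lpow_pos[of k] by (simp add: \<psi>_def norm_divide norm_power)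
qed

lemma J_le_1: "J k \<eta> \<le> 1"
proof -
  have "J k \<eta> \<le> integral {0..1} (\<lambda>x::real. 1)"
    unfolding J_def
    by (intro integral_le integrable_continuous_interval continuous_intros)
      (use cmod_psi_le in \<open>auto simp: power_le_one\<close>)
  then show ?thesis by simp
qed

lemma continuous_on_G [continuous_intros]: "continuous_on A h \<Longrightarrow> continuous_on A (\<lambda>x. G n k \<eta> a (h x))"
  unfolding G_eq by (intro continuous_intros) (use lpow_pos in auto)

definition Q :: "nat \<Rightarrow> nat \<Rightarrow> real \<Rightarrow> real \<Rightarrow> real" where
  "Q n k \<eta> x = (\<Sum>a<l ^ n. (cmod (G n k \<eta> a x))\<^sup>2)"

lemma Q_periodic: "Q n k \<eta> (x + 1) = Q n k \<eta> x"
proof -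
  have "Q n k \<eta> (x + 1) = (\<Sum>a<l ^ n. (cmod (\<psi> k (lam ^ n * \<eta>) ((x + real (Suc a)) / real l ^ n)))\<^sup>2)"
    by (simp add: Q_def cmod_G add_ac)
  also have "\<dots> = (\<Sum>a<l ^ n. (cmod (\<psi> k (lam ^ n * \<eta>) ((x + real a) / real l ^ n)))\<^sup>2)"
    by (rule sum_shift_periodic[of "\<lambda>a. (cmod (\<psi> k (lam ^ n * \<eta>) ((x + real a) / real l ^ n)))\<^sup>2"])
      (use lpow_pos[of n] in \<open>simp add: add_divide_distrib psi_periodic\<close>)
  finally show ?thesis by (simp add: Q_def cmod_G)
qed

lemma integral_unfold_interval:
  fixes h :: "real \<Rightarrow> 'a::banach"
  assumes cont: "continuous_on UNIV h"
  shows "(\<Sum>a<N. integral {0..1} (\<lambda>x. h (x + real a))) = integral {0..real N} h"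
proof (induction N)
  case (Suc N)
  have "integral {0..1} (\<lambda>x. h (x + real N)) = integral {real N..real N + 1} h"
    using integral_shift_real_ivl[of "real N" "real N" "real N + 1" h] by simp
  moreover have "integral {0..real N} h + integral {real N..real N + 1} h = integral {0..real N + 1} h"
    by (intro Henstock_Kurzweil_Integration.integral_combine integrable_continuous_interval continuous_on_subset[OF cont]) auto
  ultimately show ?case using Suc by (simp add: add.commute)
qed simp

text \<open>The translates by \<open>a\<close> tile an interval of length \<open>l ^ n\<close>,
  which division by \<open>l ^ n\<close> carries to one period. The factor \<open>l ^ n\<close>
  later cancels one of the two that the squared mean over branches has in its denominator.\<close>

lemma integral_Q: "integral {0..1} (Q n k \<eta>) = real l ^ n * J k (lam ^ n * \<eta>)"
proof -
  define h where "h = (\<lambda>y. (cmod (\<psi> k (lam ^ n * \<eta>) y))\<^sup>2)"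
  have conth: "continuous_on A (\<lambda>x. h (g x))" if "continuous_on A g" for A and g :: "real \<Rightarrow> real"
    unfolding h_def by (intro continuous_intros that)
  have L: "real l ^ n \<noteq> 0" "0 < real l ^ n" using lpow_pos by auto
  have "integral {0..1} (Q n k \<eta>) = integral {0..1} (\<lambda>x. \<Sum>a<l ^ n. h ((x + real a) / real l ^ n))"
    by (simp add: Q_def[abs_def] cmod_G h_def)
  also have "\<dots> = (\<Sum>a<l ^ n. integral {0..1} (\<lambda>x. h ((x + real a) / real l ^ n)))"
    by (intro integral_sum integrable_continuous_interval conth continuous_intros) (use L in auto)
  also have "\<dots> = integral {0..real (l ^ n)} (\<lambda>x. h (x / real l ^ n))"
    by (rule integral_unfold_interval[of "\<lambda>x. h (x / real l ^ n)"]) (intro conth continuous_intros, use L in auto)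
  also have "\<dots> = real l ^ n * integral {0..1} h"
  proof -
    have hi: "(h has_integral integral {0..1} h) (cbox 0 1)"
      unfolding cbox_interval by (intro integrable_integral integrable_continuous_interval conth[of _ "\<lambda>x. x", unfolded eta_contract_eq]) (auto intro: continuous_on_id)
    from has_integral_affinity[OF hi, of "1 / real l ^ n" 0]
    have "((\<lambda>x. h (x / real l ^ n)) has_integral real l ^ n * integral {0..1} h) ((\<lambda>x. x * real l ^ n) ` {0..1})"
      using L by (simp add: mult.commute)
    moreover have "(\<lambda>x. x * real l ^ n) ` {0..1} = {0..real (l ^ n)}"
      using L image_mult_atLeastAtMost[of "real l ^ n" 0 1] by (simp add: mult.commute)
    ultimately show ?thesis by (simp add: integral_unique)
  qed
  finally show ?thesis by (simp add: J_def h_def)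
qed

end

section \<open>Windows and decay of the Fourier coefficients of single branches\<close>

definition bump :: "real \<Rightarrow> nat \<Rightarrow> real \<Rightarrow> real" where
  "bump \<rho> q v = max 0 (\<rho>\<^sup>2 - v\<^sup>2) ^ q"

lemma bump_bounded_derivs: "\<exists>N. bounded_derivs {-2<..<2} m N (bump \<rho> (Suc m))"
proof -
  let ?U = "{-2<..<2::real}"
  have id: "bounded_derivs ?U m 2 (\<lambda>v. v)"
  proof (cases m)
    case (Suc q)
    then show ?thesis
      by (auto intro!: bounded_derivs_SucI[of _ _ _ "\<lambda>_. 1"] bounded_derivs_const derivative_eq_intros)
  qed (auto intro: continuous_intros)
  have "bounded_derivs ?U m (\<bar>\<rho>\<^sup>2\<bar> + 2 ^ m * 2 * 2) (\<lambda>v. \<rho>\<^sup>2 - v * v)"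
    by (intro bounded_derivs_diff bounded_derivs_const bounded_derivs_mult id) simp
  from bounded_derivs_max_power[OF this, of "Suc m"] show ?thesis
    by (simp add: bump_def[abs_def] power2_eq_square)
qed

lemma continuous_on_bump [continuous_intros]: "continuous_on A (bump \<rho> q)"
  unfolding bump_def[abs_def] by (intro continuous_intros)

lemma bump_eq_0: "0 < \<rho> \<Longrightarrow> 0 < q \<Longrightarrow> \<rho> \<le> \<bar>v\<bar> \<Longrightarrow> bump \<rho> q v = 0"
  using power_mono[of \<rho> "\<bar>v\<bar>" 2] by (simp add: bump_def)

lemma bump_integral_pos:
  assumes "0 < \<rho>"
  shows "0 < integral {-1/2..1/2} (\<lambda>v. (bump \<rho> q v)\<^sup>2)"
proof -
  have c: "continuous_on {-1/2..1/2} (\<lambda>v. (bump \<rho> q v)\<^sup>2)" by (intro continuous_intros)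
  have i: "((\<lambda>v. (bump \<rho> q v)\<^sup>2) has_integral integral {-1/2..1/2} (\<lambda>v. (bump \<rho> q v)\<^sup>2)) {-1/2..1/2}"
    by (intro integrable_integral integrable_continuous_interval c)
  have "integral {-1/2..1/2} (\<lambda>v. (bump \<rho> q v)\<^sup>2) \<noteq> 0"
  proof
    assume "integral {-1/2..1/2} (\<lambda>v. (bump \<rho> q v)\<^sup>2) = 0"
    with i have "((\<lambda>v. (bump \<rho> q v)\<^sup>2) has_integral 0) (cbox (-1/2) (1/2))" by simp
    then have "(bump \<rho> q 0)\<^sup>2 = 0"
      by (rule has_integral_0_cbox_imp_0[rotated 2]) (use c in auto)
    then show False using assms by (simp add: bump_def max_def)
  qed
  moreover have "0 \<le> integral {-1/2..1/2} (\<lambda>v. (bump \<rho> q v)\<^sup>2)"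
    using i by (rule has_integral_nonneg) simp
  ultimately show ?thesis by simp
qed

lemma half_abs_le: "\<bar>a - b\<bar> \<le> \<bar>x + b\<bar> / 2 \<Longrightarrow> \<bar>x + b\<bar> / 2 \<le> \<bar>x + a\<bar>" for a b x :: real
  using abs_triangle_ineq[of "x + a" "b - a"] by (simp add: abs_minus_commute)

context skew
begin

definition \<Phi> :: "nat \<Rightarrow> real \<Rightarrow> int \<Rightarrow> real \<Rightarrow> real \<Rightarrow> real" where
  "\<Phi> k \<eta> \<xi> b v = - (\<eta> * S k (v + b)) - 2 * pi * of_int \<xi> * v"

definition \<Phi>' :: "nat \<Rightarrow> real \<Rightarrow> int \<Rightarrow> real \<Rightarrow> real \<Rightarrow> real" where
  "\<Phi>' k \<eta> \<xi> b v = - (\<eta> * (Y k (v + b) / real l)) - 2 * pi * of_int \<xi>"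

lemma Phi_deriv: "(\<Phi> k \<eta> \<xi> b has_real_derivative \<Phi>' k \<eta> \<xi> b v) (at v)"
proof -
  have "((\<lambda>v. S k (v + b)) has_real_derivative Y k (v + b) / real l) (at v)"
    using S_deriv DERIV_shift by blast
  then show ?thesis unfolding \<Phi>_def[abs_def] \<Phi>'_def
    by (auto intro!: derivative_eq_intros)
qed

lemma cis_Phi: "cis (\<Phi> k \<eta> \<xi> b v) = cis (- (\<eta> * S k (v + b))) * cis (- (2 * pi * of_int \<xi> * v))"
  by (simp add: \<Phi>_def cis_mult)

text \<open>The bound does not involve \<open>k\<close>: the slopes \<open>Y k\<close> have uniform
  derivative bounds, \<open>K\<close> absorbs their contribution and \<open>7 > 2 * pi\<close> that
  of the character.\<close>

lemma Phi_bounded_derivs: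
  assumes "0 < \<Lambda>" "\<bar>\<eta>\<bar> * M \<le> K * \<Lambda>" "\<bar>of_int \<xi>\<bar> \<le> \<Lambda>"
  shows "bounded_derivs UNIV p (K + 7) (\<lambda>v. \<Phi>' k \<eta> \<xi> b v / \<Lambda>)"
proof -
  have "bounded_derivs UNIV p (\<bar>- (\<eta> / (real l * \<Lambda>))\<bar> * (2 * M) + 7)
      (\<lambda>v. - (\<eta> / (real l * \<Lambda>)) * Y k (1 * v + b) + (- 2 * pi * of_int \<xi> / \<Lambda>))"
  proof (intro bounded_derivs_add bounded_derivs_cmult bounded_derivs_const bounded_derivs_affine_contract Y_bounded_derivs)
    have "\<bar>- 2 * pi * of_int \<xi> / \<Lambda>\<bar> = 2 * pi * (\<bar>of_int \<xi>\<bar> / \<Lambda>)"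
      using assms(1) by (simp add: abs_mult)
    also have "\<dots> \<le> 2 * pi * 1" using assms by (intro mult_left_mono) auto
    also have "\<dots> \<le> 7" using pi_less_4 pi_approx by simp
    finally show "\<bar>- 2 * pi * of_int \<xi> / \<Lambda>\<bar> \<le> 7" .
  qed simp
  moreover have "\<bar>- (\<eta> / (real l * \<Lambda>))\<bar> * (2 * M) + 7 \<le> K + 7"
  proof -
    have "\<bar>- (\<eta> / (real l * \<Lambda>))\<bar> * (2 * M) = 2 / real l * (\<bar>\<eta>\<bar> * M / \<Lambda>)"
      using assms(1) l_pos by (simp add: abs_mult field_simps)
    also have "\<dots> \<le> 1 * (\<bar>\<eta>\<bar> * M / \<Lambda>)"
      using l M_nonneg assms(1) by (intro mult_right_mono) auto
    also have "\<dots> \<le> K" using assms by (simp add: divide_le_eq)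
    finally show ?thesis by simp
  qed
  ultimately have "bounded_derivs UNIV p (K + 7) (\<lambda>v. - (\<eta> / (real l * \<Lambda>)) * Y k (1 * v + b) + (- 2 * pi * of_int \<xi> / \<Lambda>))"
    by (rule bounded_derivs_mono)
  moreover have "\<Phi>' k \<eta> \<xi> b v / \<Lambda> = - (\<eta> / (real l * \<Lambda>)) * Y k (1 * v + b) + (- 2 * pi * of_int \<xi> / \<Lambda>)" for v
    using assms(1) by (simp add: \<Phi>'_def diff_divide_distrib)
  ultimately show ?thesis by presburger
qed

text \<open>Characters do not notice integer shifts, so the mean over the branches unfolds to one
  integral over the common period \<open>l ^ k\<close>, to which integration by parts without
  boundary terms applies.\<close>

lemma fcoef_psi_eq:
  "fcoef 0 (\<psi> k \<eta>) \<xi> = phase_integral 0 (real l ^ k) (\<lambda>_. 1) (\<Phi> k \<eta> \<xi> 0) / of_nat (l ^ k)"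
proof -
  define h where "h = (\<lambda>u. cis (\<Phi> k \<eta> \<xi> 0 u))"
  have conth: "continuous_on A (\<lambda>x. h (g x))" if "continuous_on A g" for A and g :: "real \<Rightarrow> real"
    unfolding h_def \<Phi>_def by (intro continuous_intros that)
  have h: "cis (- (\<eta> * S k (x + real c))) * cis (- (2 * pi * of_int \<xi> * x)) = h (x + real c)" for x c
  proof -
    have "cis (- (2 * pi * of_int \<xi> * (x + real c))) = cis (- (2 * pi * of_int \<xi> * x)) * cis (2 * pi * of_int (- \<xi> * int c))"
      by (simp add: cis_mult algebra_simps)
    also have "cis (2 * pi * of_int (- \<xi> * int c)) = 1" by (rule cis_multiple_2pi) (rule Ints_of_int)
    finally show ?thesis by (simp add: h_def cis_Phi)
  qed
  have "fcoef 0 (\<psi> k \<eta>) \<xi> = integral {0..1} (\<lambda>x. (\<Sum>c<l ^ k. h (x + real c)) / of_nat (l ^ k))"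
    unfolding fcoef_def \<psi>_def by (simp add: sum_distrib_right h)
  also have "\<dots> = (\<Sum>c<l ^ k. integral {0..1} (\<lambda>x. h (x + real c))) / of_nat (l ^ k)"
    by (subst integral_divide, subst integral_sum)
      (auto intro!: integrable_continuous_interval conth continuous_intros)
  also have "\<dots> = integral {0..real (l ^ k)} h / of_nat (l ^ k)"
    by (subst integral_unfold_interval) (use conth[of UNIV "\<lambda>x. x"] in auto)
  finally show ?thesis by (simp add: phase_integral_def h_def)
qed

text \<open>In the cone the \<eta>-part of the phase slope is at most
  \<open>\<bar>\<xi>\<bar>\<close>, because the bound \<open>2 * M\<close> on the slopes is divided
  by \<open>l \<ge> 2\<close>, while the character contributes at least
  \<open>2 * \<bar>\<xi>\<bar>\<close>. No stationary point is left, and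
  \<open>\<Lambda> = \<bar>\<xi>\<bar>\<close> is admissible for every level.\<close>

lemma cone_decay:
  "\<exists>C\<ge>0. \<forall>k \<eta> \<xi>. \<xi> \<noteq> 0 \<longrightarrow> M * \<bar>\<eta>\<bar> \<le> \<bar>of_int \<xi>\<bar> \<longrightarrow> cmod (fcoef 0 (\<psi> k \<eta>) \<xi>) \<le> C / \<bar>of_int \<xi>\<bar> ^ p"
proof -
  obtain C where C: "0 \<le> C" "nsp_bound 1 (1 + 7) p 1 C"
    using non_stationary_phase[of 1 "1 + 7" p 1] by auto
  show ?thesis
  proof (intro exI[of _ C] conjI C(1) allI impI)
    fix k \<eta> and \<xi> :: int
    assume \<xi>: "\<xi> \<noteq> 0" and cone: "M * \<bar>\<eta>\<bar> \<le> \<bar>of_int \<xi>\<bar>"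
    define \<Lambda> :: real where "\<Lambda> = \<bar>of_int \<xi>\<bar>"
    have \<Lambda>: "0 < \<Lambda>" using \<xi> by (simp add: \<Lambda>_def)
    define L where "L = real l ^ k"
    have L: "0 < L" using lpow_pos by (simp add: L_def)
    have "cmod (phase_integral 0 L (\<lambda>_. 1) (\<Phi> k \<eta> \<xi> 0)) \<le> C * (L - 0) / \<Lambda> ^ p"
    proof (rule nsp_boundD[OF C(2), where U = UNIV and \<Phi>' = "\<Phi>' k \<eta> \<xi> 0"])
      show "bounded_derivs UNIV p (1 + 7) (\<lambda>v. \<Phi>' k \<eta> \<xi> 0 v / \<Lambda>)"
        by (rule Phi_bounded_derivs) (use \<Lambda> cone in \<open>auto simp: \<Lambda>_def mult.commute\<close>)
      fix v
      have "\<bar>\<eta> * (Y k v / real l)\<bar> \<le> \<bar>\<eta>\<bar> * (2 * M / real l)"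
        unfolding abs_mult abs_divide using Y_bound[of k v] l_pos by (intro mult_left_mono) (auto intro: divide_right_mono)
      also have "\<dots> = 2 / real l * (M * \<bar>\<eta>\<bar>)" by simp
      also have "\<dots> \<le> 1 * (M * \<bar>\<eta>\<bar>)" using l M_nonneg by (intro mult_right_mono) auto
      finally have "\<bar>\<eta> * (Y k v / real l)\<bar> \<le> \<Lambda>" using cone by (simp add: \<Lambda>_def)
      moreover have "\<bar>2 * pi * of_int \<xi>\<bar> \<ge> 2 * \<Lambda>"
        using pi_gt3 \<Lambda> by (simp add: \<Lambda>_def abs_mult)
      ultimately have "\<Lambda> \<le> \<bar>\<Phi>' k \<eta> \<xi> 0 v\<bar>" unfolding \<Phi>'_def add_0_right by linarith
      then show "1 \<le> \<bar>\<Phi>' k \<eta> \<xi> 0 v / \<Lambda>\<bar>" using \<Lambda> by (simp add: abs_divide)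
    next
      show "no_boundary UNIV 0 L (\<Phi> k \<eta> \<xi> 0) (\<Phi>' k \<eta> \<xi> 0) (\<lambda>_. 1)"
      proof -
        have "cis (- (2 * pi * of_int \<xi> * L)) = cis (2 * pi * of_int (- \<xi> * int (l ^ k)))" by (simp add: L_def mult.assoc)
        also have "\<dots> = 1" by (rule cis_multiple_2pi) (rule Ints_of_int)
        finally have "cis (\<Phi> k \<eta> \<xi> 0 L) = cis (\<Phi> k \<eta> \<xi> 0 0)"
          using S_periodic[of k 0] by (simp add: cis_Phi L_def)
        moreover have "\<Phi>' k \<eta> \<xi> 0 (x + (L - 0)) = \<Phi>' k \<eta> \<xi> 0 x" for x
          using Y_periodic[of k x] by (simp add: \<Phi>'_def L_def)
        ultimately show ?thesis unfolding no_boundary_def by blast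
      qed
    qed (use L \<Lambda> Phi_deriv in \<open>auto intro: bounded_derivs_const\<close>)
    then show "cmod (fcoef 0 (\<psi> k \<eta>) \<xi>) \<le> C / \<bar>of_int \<xi>\<bar> ^ p"
      unfolding fcoef_psi_eq L_def[symmetric] \<Lambda>_def[symmetric]
      using L by (simp add: norm_divide norm_power L_def divide_le_eq mult.commute)
  qed
qed

lemma local_decay:
  assumes \<rho>: "0 < \<rho>" "\<rho> \<le> 1 / 12" and \<delta>: "0 < \<delta>" "6 * M * \<rho> + 2 * M * \<tau> ^ n \<le> 2 * \<delta>"
  shows "\<exists>C\<ge>0. \<forall>k \<eta> \<xi> t a. \<eta> \<noteq> 0 \<longrightarrow> 4 * \<delta> * \<bar>\<eta>\<bar> / real l \<le> \<bar>2 * pi * of_int \<xi> + \<eta> * Y n (t + real a) / real l\<bar> \<longrightarrow>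
     cmod (fcoef (-1/2) (\<lambda>v. complex_of_real (bump \<rho> (p + 2) v) * G n k \<eta> a (t + v)) \<xi>) \<le> C / (\<bar>\<eta>\<bar> + \<bar>of_int \<xi>\<bar>) ^ p"
proof -
  define \<omega> where "\<omega> = bump \<rho> (p + 2)"
  \<comment> \<open>\<open>q\<close> compares sizes: with \<open>w\<close> the distance to
    stationarity, \<open>\<bar>\<eta>\<bar> \<le> w * l / (4 * \<delta>)\<close> and
    \<open>\<bar>\<xi>\<bar> \<le> w + M * \<bar>\<eta>\<bar>\<close>, hence
    \<open>\<bar>\<eta>\<bar> + \<bar>\<xi>\<bar> \<le> w * q\<close>.\<close>
  define q where "q = real l / (4 * \<delta>) * (1 + M) + 1"
  have q: "0 < q" using \<delta>(1) M_nonneg by (simp add: q_def add_nonneg_pos)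
  obtain N where N: "bounded_derivs {-2<..<2} (Suc p) N \<omega>"
    using bump_bounded_derivs[of "Suc p" \<rho>] by (auto simp: \<omega>_def)
  have \<omega>0: "\<omega> v = 0" if "\<rho> \<le> \<bar>v\<bar>" for v using bump_eq_0[OF \<rho>(1) _ that] by (simp add: \<omega>_def)
  have cont\<omega>: "continuous_on A \<omega>" for A unfolding \<omega>_def by (intro continuous_intros)
  obtain C where C: "0 \<le> C" "nsp_bound (1 / (2 * q)) (M + 7) p N C"
    using non_stationary_phase[of "1 / (2 * q)" "M + 7" p N] q by auto
  show ?thesis
    unfolding \<omega>_def[symmetric]
  proof (intro exI[of _ C] conjI C(1) allI impI)
    fix k a and \<eta> t :: real and \<xi> :: int
    assume \<eta>: "\<eta> \<noteq> 0" and far: "4 * \<delta> * \<bar>\<eta>\<bar> / real l \<le> \<bar>2 * pi * of_int \<xi> + \<eta> * Y n (t + real a) / real l\<bar>"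
    define y0 where "y0 = Y n (t + real a)"
    define w where "w = \<bar>2 * pi * of_int \<xi> + \<eta> * y0 / real l\<bar>"
    define \<Lambda> where "\<Lambda> = \<bar>\<eta>\<bar> + \<bar>of_int \<xi>\<bar>"
    have \<Lambda>: "0 < \<Lambda>" using \<eta> by (simp add: \<Lambda>_def)
    have w: "\<bar>\<eta>\<bar> \<le> w * (real l / (4 * \<delta>))"
      using far \<delta>(1) l_pos unfolding w_def y0_def by (simp add: field_simps)
    have "\<bar>\<eta> * y0 / real l\<bar> \<le> \<bar>\<eta>\<bar> * M"
    proof -
      have "\<bar>\<eta> * y0 / real l\<bar> = \<bar>\<eta>\<bar> * (\<bar>y0\<bar> / real l)" using l_pos by (simp add: abs_mult)
      also have "\<dots> \<le> \<bar>\<eta>\<bar> * (2 * M / 2)"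
        unfolding y0_def using Y_bound[of n "t + real a"] l by (intro mult_left_mono frac_le) auto
      finally show ?thesis by simp
    qed
    then have "\<bar>2 * pi * of_int \<xi>\<bar> \<le> w + \<bar>\<eta>\<bar> * M" unfolding w_def by linarith
    moreover have "\<bar>of_int \<xi>\<bar> \<le> \<bar>2 * pi * of_int \<xi>\<bar>" using pi_gt3 by (simp add: abs_mult mult_le_cancel_right1)
    ultimately have "\<Lambda> \<le> w + \<bar>\<eta>\<bar> * (1 + M)" by (simp add: \<Lambda>_def algebra_simps)
    also have "\<dots> \<le> w + w * (real l / (4 * \<delta>)) * (1 + M)"
      using w M_nonneg by (intro add_mono mult_right_mono) auto
    also have "\<dots> = w * q" by (simp add: q_def algebra_simps)
    finally have \<Lambda>w: "\<Lambda> \<le> w * q" .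
    have main: "cmod (phase_integral (- (2 * \<rho>)) (2 * \<rho>) \<omega> (\<Phi> (n + k) \<eta> \<xi> b)) \<le> C / \<Lambda> ^ p"
      if b: "b = t + real a + real l ^ n * real c" for b c
    proof -
      \<comment> \<open>The amplitude lives on radius \<rho>, the integral runs over radius
        \<open>2 * \<rho>\<close> so that it vanishes near the ends, and the open set has radius
        \<open>3 * \<rho>\<close>.\<close>
      have "cmod (phase_integral (- (2 * \<rho>)) (2 * \<rho>) \<omega> (\<Phi> (n + k) \<eta> \<xi> b)) \<le> C * (2 * \<rho> - (- (2 * \<rho>))) / \<Lambda> ^ p"
      proof (rule nsp_boundD[OF C(2), where U = "{-3*\<rho><..<3*\<rho>}" and \<Phi>' = "\<Phi>' (n + k) \<eta> \<xi> b"])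
        have "bounded_derivs UNIV p (M + 7) (\<lambda>v. \<Phi>' (n + k) \<eta> \<xi> b v / \<Lambda>)"
          by (rule Phi_bounded_derivs) (use \<Lambda> M_nonneg in \<open>auto simp: \<Lambda>_def mult.commute intro: mult_left_mono\<close>)
        then show "bounded_derivs {-3*\<rho><..<3*\<rho>} p (M + 7) (\<lambda>v. \<Phi>' (n + k) \<eta> \<xi> b v / \<Lambda>)"
          by (rule bounded_derivs_subset) simp
        show "bounded_derivs {-3*\<rho><..<3*\<rho>} p N \<omega>"
          by (rule bounded_derivs_subset[OF bounded_derivs_Suc[OF N]]) (use \<rho> in auto)
        show "no_boundary {-3*\<rho><..<3*\<rho>} (- (2 * \<rho>)) (2 * \<rho>) (\<Phi> (n + k) \<eta> \<xi> b) (\<Phi>' (n + k) \<eta> \<xi> b) \<omega>"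
          unfolding no_boundary_def
          by (intro disjI1 exI[of _ "- \<rho>"] exI[of _ \<rho>]) (use \<rho> \<omega>0 in auto)
        fix v assume v: "v \<in> {-3*\<rho><..<3*\<rho>}"
        have per: "Y n (v + b) = Y n (v + t + real a)"
          using periodic_nat[of "Y n", OF Y_periodic, of "v + t + real a" c] b by (simp add: mult.commute add_ac)
        have "\<bar>Y (n + k) (v + b) - y0\<bar> \<le> \<bar>Y n (v + t + real a) - Y n (t + real a)\<bar> + \<bar>\<tau> ^ n * Y k ((v + b) / real l ^ n)\<bar>"
          unfolding Y_add per y0_def by simp
        also have "\<dots> \<le> 2 * M * (3 * \<rho>) + \<tau> ^ n * (2 * M)"
        proof (rule add_mono)
          have "\<bar>Y n (v + t + real a) - Y n (t + real a)\<bar> \<le> 2 * M * \<bar>v\<bar>"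
            using Y_lipschitz[of n "v + t + real a" "t + real a"] by simp
          also have "\<dots> \<le> 2 * M * (3 * \<rho>)" using v M_nonneg by (intro mult_left_mono) auto
          finally show "\<bar>Y n (v + t + real a) - Y n (t + real a)\<bar> \<le> 2 * M * (3 * \<rho>)" .
          show "\<bar>\<tau> ^ n * Y k ((v + b) / real l ^ n)\<bar> \<le> \<tau> ^ n * (2 * M)"
            unfolding abs_mult using Y_bound tau(1) by (simp add: mult_left_mono)
        qed
        also have "\<dots> \<le> 2 * \<delta>" using \<delta>(2) by (simp add: mult_ac)
        finally have Yd: "\<bar>Y (n + k) (v + b) - y0\<bar> \<le> 2 * \<delta>" .
        have "\<bar>\<eta> * Y (n + k) (v + b) / real l - \<eta> * y0 / real l\<bar> = \<bar>\<eta>\<bar> / real l * \<bar>Y (n + k) (v + b) - y0\<bar>"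
          using l_pos by (simp add: abs_mult right_diff_distrib diff_divide_distrib flip: abs_divide)
            (simp add: abs_mult abs_divide flip: right_diff_distrib diff_divide_distrib)
        also have "\<dots> \<le> \<bar>\<eta>\<bar> / real l * (2 * \<delta>)" using Yd l_pos by (intro mult_left_mono) auto
        also have "\<dots> \<le> w / 2" using far unfolding w_def y0_def by (simp add: mult_ac)
        finally have "w / 2 \<le> \<bar>2 * pi * of_int \<xi> + \<eta> * Y (n + k) (v + b) / real l\<bar>"
          unfolding w_def by (rule half_abs_le)
        moreover have "\<bar>\<Phi>' (n + k) \<eta> \<xi> b v\<bar> = \<bar>2 * pi * of_int \<xi> + \<eta> * Y (n + k) (v + b) / real l\<bar>"
          unfolding \<Phi>'_def by (simp add: abs_if)
        ultimately have "w / 2 \<le> \<bar>\<Phi>' (n + k) \<eta> \<xi> b v\<bar>" by simp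
        moreover have "\<Lambda> / (2 * q) \<le> w / 2" using \<Lambda>w q by (simp add: field_simps)
        ultimately have "\<Lambda> / (2 * q) \<le> \<bar>\<Phi>' (n + k) \<eta> \<xi> b v\<bar>" by linarith
        then show "1 / (2 * q) \<le> \<bar>\<Phi>' (n + k) \<eta> \<xi> b v / \<Lambda>\<bar>" using \<Lambda> q by (simp add: abs_divide field_simps)
      qed (use \<rho> \<Lambda> Phi_deriv in auto)
      also have "\<dots> \<le> C * 1 / \<Lambda> ^ p"
        using \<rho> C(1) \<Lambda> by (intro divide_right_mono mult_left_mono) auto
      finally show ?thesis by simp
    qed
    define B where "B = (\<lambda>c. t + real a + real l ^ n * real c)"
    have "fcoef (-1/2) (\<lambda>v. complex_of_real (\<omega> v) * G n k \<eta> a (t + v)) \<xi> =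
        integral {-1/2..1/2} (\<lambda>v. (\<Sum>c<l ^ k. complex_of_real (\<omega> v) * cis (\<Phi> (n + k) \<eta> \<xi> (B c) v)) / of_nat (l ^ k))"
      unfolding fcoef_def G_def cis_Phi B_def
      by (simp add: sum_distrib_left sum_distrib_right add_ac mult_ac)
    also have "\<dots> = (\<Sum>c<l ^ k. integral {-1/2..1/2} (\<lambda>v. complex_of_real (\<omega> v) * cis (\<Phi> (n + k) \<eta> \<xi> (B c) v))) / of_nat (l ^ k)"
      unfolding \<Phi>_def by (subst integral_divide, subst integral_sum)
        (auto intro!: integrable_continuous_interval continuous_intros cont\<omega>)
    also have "\<dots> = (\<Sum>c<l ^ k. phase_integral (- (2 * \<rho>)) (2 * \<rho>) \<omega> (\<Phi> (n + k) \<eta> \<xi> (B c))) / of_nat (l ^ k)"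
      unfolding phase_integral_def
      by (intro arg_cong2[of _ _ _ _ "(/)"] sum.cong refl integral_supported) (use \<rho> \<omega>0 in auto)
    finally have "cmod (fcoef (-1/2) (\<lambda>v. complex_of_real (\<omega> v) * G n k \<eta> a (t + v)) \<xi>) =
        cmod (\<Sum>c<l ^ k. phase_integral (- (2 * \<rho>)) (2 * \<rho>) \<omega> (\<Phi> (n + k) \<eta> \<xi> (B c))) / real (l ^ k)"
      by (simp only: norm_divide norm_of_nat)
    also have "\<dots> \<le> (\<Sum>c<l ^ k. C / \<Lambda> ^ p) / real (l ^ k)"
      by (intro divide_right_mono sum_norm_le main) (auto simp: B_def)
    also have "\<dots> = C / \<Lambda> ^ p" using lpow_pos[of k] by simp
    finally show "cmod (fcoef (-1/2) (\<lambda>v. complex_of_real (\<omega> v) * G n k \<eta> a (t + v)) \<xi>) \<le> C / (\<bar>\<eta>\<bar> + \<bar>of_int \<xi>\<bar>) ^ p"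
      by (simp add: \<Lambda>_def)
  qed
qed

end

text \<open>A Schur test. Related pairs get the trivial bound, which is charged to the diagonal:
  every index pays for at most \<open>E\<close> partners. Unrelated pairs cost an \<epsilon>-share
  of the diagonal and \<open>B\<close> each.\<close>

lemma sum_pairs_bound:
  fixes m :: "'i \<Rightarrow> real" and I :: "'i \<Rightarrow> 'i \<Rightarrow> real"
  assumes A: "finite A" and m: "\<And>a. a \<in> A \<Longrightarrow> 0 \<le> m a" and sym: "\<And>a b. R a b \<longleftrightarrow> R b a"
    and I1: "\<And>a b. a \<in> A \<Longrightarrow> b \<in> A \<Longrightarrow> R a b \<Longrightarrow> I a b \<le> (m a + m b) / 2"
    and I2: "\<And>a b. a \<in> A \<Longrightarrow> b \<in> A \<Longrightarrow> \<not> R a b \<Longrightarrow> I a b \<le> \<epsilon> * (m a + m b) + B"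
    and card: "\<And>a. a \<in> A \<Longrightarrow> card {b\<in>A. R a b} \<le> E" and \<epsilon>: "0 \<le> \<epsilon>" "0 \<le> B"
  shows "(\<Sum>a\<in>A. \<Sum>b\<in>A. I a b) \<le> (real E + 2 * \<epsilon> * real (card A)) * (\<Sum>a\<in>A. m a) + (real (card A))\<^sup>2 * B"
proof -
  let ?h = "\<lambda>a b. if R a b then m a / 2 else 0"
  have "I a b \<le> (\<epsilon> * (m a + m b) + B) + (?h a b + ?h b a)" if "a \<in> A" "b \<in> A" for a b
  proof (cases "R a b")
    case True
    then have "R b a" using sym by simp
    moreover have "0 \<le> \<epsilon> * (m a + m b) + B" using m that \<epsilon> by simp
    ultimately show ?thesis using I1[OF that True] True by (simp add: add_divide_distrib)
  next
    case False
    then have "\<not> R b a" using sym by simp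
    then show ?thesis using I2[OF that False] False by simp
  qed
  then have "(\<Sum>a\<in>A. \<Sum>b\<in>A. I a b) \<le> (\<Sum>a\<in>A. \<Sum>b\<in>A. (\<epsilon> * (m a + m b) + B) + (?h a b + ?h b a))"
    by (intro sum_mono)
  also have "\<dots> = (\<Sum>a\<in>A. \<Sum>b\<in>A. \<epsilon> * (m a + m b) + B) + ((\<Sum>a\<in>A. \<Sum>b\<in>A. ?h a b) + (\<Sum>a\<in>A. \<Sum>b\<in>A. ?h b a))"
    by (simp only: sum.distrib)
  also have "(\<Sum>a\<in>A. \<Sum>b\<in>A. ?h b a) = (\<Sum>a\<in>A. \<Sum>b\<in>A. ?h a b)" by (rule sum.swap)
  also have "(\<Sum>a\<in>A. \<Sum>b\<in>A. \<epsilon> * (m a + m b) + B) = 2 * \<epsilon> * real (card A) * (\<Sum>a\<in>A. m a) + (real (card A))\<^sup>2 * B"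
    by (simp add: sum.distrib power2_eq_square algebra_simps flip: sum_distrib_left sum_distrib_right)
  also have "(\<Sum>a\<in>A. \<Sum>b\<in>A. ?h a b) \<le> real E * (\<Sum>a\<in>A. m a) / 2"
  proof -
    have "(\<Sum>b\<in>A. ?h a b) \<le> real E * (m a / 2)" if "a \<in> A" for a
    proof -
      have "(\<Sum>b\<in>A. ?h a b) = (\<Sum>b\<in>{b\<in>A. R a b}. m a / 2)"
        using A by (intro sum.inter_filter[symmetric])
      also have "\<dots> = real (card {b\<in>A. R a b}) * (m a / 2)" by simp
      also have "\<dots> \<le> real E * (m a / 2)" using card[OF that] m[OF that] by (intro mult_right_mono) auto
      finally show ?thesis .
    qed
    then have "(\<Sum>a\<in>A. \<Sum>b\<in>A. ?h a b) \<le> (\<Sum>a\<in>A. real E * (m a / 2))" by (rule sum_mono)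
    also have "\<dots> = real E * (\<Sum>a\<in>A. m a) / 2" by (simp add: sum_distrib_left sum_divide_distrib)
    finally show ?thesis .
  qed
  finally show ?thesis by (simp add: algebra_simps)
qed

context skew
begin

lemma G_has_vector_derivative:
  "\<exists>G'. continuous_on UNIV G' \<and> (\<forall>v. ((\<lambda>v. G n k \<eta> a (t + v)) has_vector_derivative G' v) (at v))"
proof -
  define B where "B = (\<lambda>c. t + real a + real l ^ n * real c)"
  define G' where "G' = (\<lambda>v. (\<Sum>c<l ^ k. \<i> * complex_of_real (- (\<eta> * (Y (n + k) (v + B c) / real l))) * cis (- (\<eta> * S (n + k) (v + B c)))) / of_nat (l ^ k))"
  have "((\<lambda>v. cis (- (\<eta> * S (n + k) (v + B c)))) has_vector_derivative
      \<i> * complex_of_real (- (\<eta> * (Y (n + k) (v + B c) / real l))) * cis (- (\<eta> * S (n + k) (v + B c)))) (at v)" for c v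
  proof (rule cis_has_vector_derivative)
    have "((\<lambda>v. S (n + k) (v + B c)) has_real_derivative Y (n + k) (v + B c) / real l) (at v)"
      using S_deriv DERIV_shift by blast
    from DERIV_minus[OF DERIV_cmult[OF this]]
    show "((\<lambda>v. - (\<eta> * S (n + k) (v + B c))) has_real_derivative - (\<eta> * (Y (n + k) (v + B c) / real l))) (at v)" .
  qed
  then have "((\<lambda>v. (\<Sum>c<l ^ k. cis (- (\<eta> * S (n + k) (v + B c)))) / of_nat (l ^ k)) has_vector_derivative G' v) (at v)" for v
    unfolding G'_def by (intro has_vector_derivative_divide has_vector_derivative_sum)
  moreover have "(\<lambda>v. (\<Sum>c<l ^ k. cis (- (\<eta> * S (n + k) (v + B c)))) / of_nat (l ^ k)) = (\<lambda>v. G n k \<eta> a (t + v))"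
    unfolding G_def B_def by (simp add: add_ac)
  moreover have "continuous_on UNIV G'" unfolding G'_def by (intro continuous_intros) (use l_pos in auto)
  ultimately show ?thesis by auto
qed

lemma bump_deriv: "\<exists>\<omega>'. continuous_on {-2<..<2} \<omega>' \<and> (\<forall>x\<in>{-2<..<2}. (bump \<rho> (p + 2) has_real_derivative \<omega>' x) (at x))"
proof -
  obtain N where N: "bounded_derivs {-2<..<2} (Suc p) N (bump \<rho> (p + 2))"
    using bump_bounded_derivs[of "Suc p" \<rho>] by auto
  then show ?thesis using bounded_derivs_continuous by (elim bounded_derivs_SucE) blast
qed

text \<open>The square of \<psi> is expanded over pairs of residue classes. Slopes that differ by at
  least \<open>8 * \<delta>\<close> give frozen phase slopes at distance at least
  \<open>8 * \<delta> * \<bar>\<eta>\<bar> / l\<close>, so no frequency is closer than half of that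
  to stationarity for both, and one of the two windowed coefficients decays. The remaining pairs are
  few by \<open>E\<close> and get the arithmetic-geometric bound.\<close>

lemma local_recursion:
  assumes \<rho>: "0 < \<rho>" "\<rho> \<le> 1 / 12" and \<delta>: "0 < \<delta>" "6 * M * \<rho> + 2 * M * \<tau> ^ n \<le> 2 * \<delta>" and \<epsilon>: "0 < \<epsilon>"
    and E: "\<And>t a. t \<in> {0..1} \<Longrightarrow> a < l ^ n \<Longrightarrow> card {b\<in>{..<l ^ n}. \<bar>Y n (t + real a) - Y n (t + real b)\<bar> < 8 * \<delta>} \<le> E"
  shows "\<exists>B\<ge>0. \<forall>k \<eta> t. 1 \<le> \<bar>\<eta>\<bar> \<longrightarrow> t \<in> {0..1} \<longrightarrow>
    integral {-1/2..1/2} (\<lambda>v. (bump \<rho> (p + 2) v)\<^sup>2 * (cmod (\<psi> (n + k) \<eta> (t + v)))\<^sup>2) \<le>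
    (real E + 2 * \<epsilon> * real l ^ n) / (real l ^ n)\<^sup>2 * integral {-1/2..1/2} (\<lambda>v. (bump \<rho> (p + 2) v)\<^sup>2 * Q n k \<eta> (t + v))
      + B / \<bar>\<eta>\<bar> ^ (2 * p - 1)"
proof -
  define \<omega> where "\<omega> = bump \<rho> (p + 2)"
  have \<omega>0: "\<omega> v = 0" if "\<rho> \<le> \<bar>v\<bar>" for v using bump_eq_0[OF \<rho>(1) _ that] by (simp add: \<omega>_def)
  have cont\<omega> [continuous_intros]: "continuous_on A \<omega>" for A unfolding \<omega>_def by (intro continuous_intros)
  obtain \<omega>' where \<omega>': "continuous_on {-2<..<2} \<omega>'" "\<forall>x\<in>{-2<..<2}. (\<omega> has_real_derivative \<omega>' x) (at x)"
    using bump_deriv unfolding \<omega>_def by blast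
  define H where "H = (\<lambda>k \<eta> t a v. complex_of_real (\<omega> v) * G n k \<eta> a (t + v))"
  have contH: "continuous_on A (H k \<eta> t a)" for A k \<eta> t a unfolding H_def by (intro continuous_intros)
  obtain C where C: "0 \<le> C" "\<And>k \<eta> \<xi> t a. \<eta> \<noteq> 0 \<Longrightarrow>
     4 * \<delta> * \<bar>\<eta>\<bar> / real l \<le> \<bar>2 * pi * of_int \<xi> + \<eta> * Y n (t + real a) / real l\<bar> \<Longrightarrow>
     cmod (fcoef (-1/2) (H k \<eta> t a) \<xi>) \<le> C / (\<bar>\<eta>\<bar> + \<bar>of_int \<xi>\<bar>) ^ p"
    using local_decay[OF \<rho> \<delta>] unfolding H_def \<omega>_def by blast
  define B where "B = 3 * C\<^sup>2 / (4 * \<epsilon>)"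
  have main: "integral {-1/2..1/2} (\<lambda>v. (\<omega> v)\<^sup>2 * (cmod (\<psi> (n + k) \<eta> (t + v)))\<^sup>2) \<le>
    (real E + 2 * \<epsilon> * real l ^ n) / (real l ^ n)\<^sup>2 * integral {-1/2..1/2} (\<lambda>v. (\<omega> v)\<^sup>2 * Q n k \<eta> (t + v))
      + B / \<bar>\<eta>\<bar> ^ (2 * p - 1)" if \<eta>: "1 \<le> \<bar>\<eta>\<bar>" and t: "t \<in> {0..1}" for k \<eta> t
  proof -
    let ?W = "{-1/2..1/2::real}"
    define h where "h = H k \<eta> t"
    define m where "m = (\<lambda>a. integral ?W (\<lambda>v. (cmod (h a v))\<^sup>2))"
    define I where "I = (\<lambda>a b. integral ?W (\<lambda>v. h a v * cnj (h b v)))"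
    define R where "R = (\<lambda>a b. \<bar>Y n (t + real a) - Y n (t + real b)\<bar> < 8 * \<delta>)"
    define Bk where "Bk = B / \<bar>\<eta>\<bar> ^ (2 * p - 1)"
    have conth: "continuous_on A (h a)" for A a unfolding h_def by (rule contH)
    have Bk: "0 \<le> Bk" using \<epsilon> by (simp add: Bk_def B_def)
    have inth: "(\<lambda>v. (cmod (h a v))\<^sup>2) integrable_on ?W" for a
      by (intro integrable_continuous_interval continuous_intros conth)
    have supp: "h a x = 0" if "1/4 < \<bar>x\<bar>" for a x
      using \<omega>0[of x] that \<rho> by (simp add: h_def H_def)
    have hderiv: "\<exists>h'. continuous_on {-2<..<2} h' \<and> (\<forall>x\<in>{-2<..<2}. (h a has_vector_derivative h' x) (at x))" for a
    proof -
      obtain G' where G': "continuous_on UNIV G'" "\<And>v. ((\<lambda>v. G n k \<eta> a (t + v)) has_vector_derivative G' v) (at v)"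
        using G_has_vector_derivative by blast
      have "(h a has_vector_derivative complex_of_real (\<omega> x) * G' x + complex_of_real (\<omega>' x) * G n k \<eta> a (t + x)) (at x)"
        if "x \<in> {-2<..<2}" for x
        unfolding h_def H_def
        by (intro has_vector_derivative_mult G' has_vector_derivative_of_real)
          (use \<omega>'(2) that in \<open>simp add: has_real_derivative_iff_has_vector_derivative\<close>)
      moreover have "continuous_on {-2<..<2} (\<lambda>x. complex_of_real (\<omega> x) * G' x + complex_of_real (\<omega>' x) * G n k \<eta> a (t + x))"
        by (intro continuous_intros \<omega>'(1) continuous_on_subset[OF G'(1)]) auto
      ultimately show ?thesis by blast
    qed
    have "(\<Sum>a<l ^ n. \<Sum>b<l ^ n. cmod (I a b)) \<le>
        (real E + 2 * \<epsilon> * real (card {..<l ^ n})) * (\<Sum>a<l ^ n. m a) + (real (card {..<l ^ n}))\<^sup>2 * Bk"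
    proof (rule sum_pairs_bound[where R = R])
      show "0 \<le> m a" for a unfolding m_def by (intro integral_nonneg inth) simp
      show "R a b \<longleftrightarrow> R b a" for a b by (simp add: R_def abs_minus_commute)
      show "cmod (I a b) \<le> (m a + m b) / 2" for a b
      proof -
        have "cmod (I a b) \<le> integral ?W (\<lambda>v. ((cmod (h a v))\<^sup>2 + (cmod (h b v))\<^sup>2) / 2)"
          unfolding I_def
        proof (rule integral_norm_bound_integral)
          fix v
          show "cmod (h a v * cnj (h b v)) \<le> ((cmod (h a v))\<^sup>2 + (cmod (h b v))\<^sup>2) / 2"
            using sum_squares_bound[of "cmod (h a v)" "cmod (h b v)"] by (simp add: norm_mult)
        qed (intro integrable_continuous_interval continuous_intros conth; simp)+
        also have "\<dots> = (m a + m b) / 2"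
          using Henstock_Kurzweil_Integration.integral_add[OF inth[of a] inth[of b]] by (simp add: m_def)
        finally show ?thesis .
      qed
      show "card {b \<in> {..<l ^ n}. R a b} \<le> E" if "a \<in> {..<l ^ n}" for a
        unfolding R_def using E[OF t] that by simp
      fix a b assume "\<not> R a b"
      then have nR: "8 * \<delta> \<le> \<bar>Y n (t + real a) - Y n (t + real b)\<bar>" by (simp add: R_def)
      obtain h' where h': "continuous_on {-2<..<2} h'" "\<forall>x\<in>{-2<..<2}. (h a has_vector_derivative h' x) (at x)"
        using hderiv by blast
      have "cmod (I a b) \<le> \<epsilon> * (m a + m b) + (3 * C\<^sup>2 / \<bar>\<eta>\<bar> ^ (2 * p - 1)) / (4 * \<epsilon>)"
        unfolding I_def m_def
      proof (rule cross_term_bound[where d = "\<lambda>\<xi>. C / (\<bar>\<eta>\<bar> + \<bar>of_int \<xi>\<bar>) ^ p"])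
        show "(\<Sum>\<xi>\<in>{- int N..int N}. (C / (\<bar>\<eta>\<bar> + \<bar>of_int \<xi>\<bar>) ^ p)\<^sup>2) \<le> 3 * C\<^sup>2 / \<bar>\<eta>\<bar> ^ (2 * p - 1)" for N
          by (rule sum_inverse_power_bound[OF \<eta> p])
        fix \<xi> :: int
        let ?w = "\<lambda>c. 2 * pi * of_int \<xi> + \<eta> * Y n (t + real c) / real l"
        have "?w a - ?w b = \<eta> / real l * (Y n (t + real a) - Y n (t + real b))"
          by (simp add: right_diff_distrib diff_divide_distrib)
        then have "\<bar>?w a - ?w b\<bar> = \<bar>\<eta>\<bar> / real l * \<bar>Y n (t + real a) - Y n (t + real b)\<bar>"
          by (simp only: abs_mult abs_divide)
        also have "\<dots> \<ge> \<bar>\<eta>\<bar> / real l * (8 * \<delta>)" using nR l_pos by (intro mult_left_mono) auto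
        finally have "2 * (4 * \<delta> * \<bar>\<eta>\<bar> / real l) \<le> \<bar>?w a - ?w b\<bar>" by (simp add: mult_ac)
        then have "4 * \<delta> * \<bar>\<eta>\<bar> / real l \<le> \<bar>?w a\<bar> \<or> 4 * \<delta> * \<bar>\<eta>\<bar> / real l \<le> \<bar>?w b\<bar>" by linarith
        moreover have "\<eta> \<noteq> 0" using \<eta> by auto
        ultimately show "cmod (fcoef (-1/2) (h a) \<xi>) \<le> C / (\<bar>\<eta>\<bar> + \<bar>of_int \<xi>\<bar>) ^ p \<or>
            cmod (fcoef (-1/2) (h b) \<xi>) \<le> C / (\<bar>\<eta>\<bar> + \<bar>of_int \<xi>\<bar>) ^ p"
          unfolding h_def using C(2) by blast
      qed (use h' conth supp \<epsilon> in auto)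
      then show "cmod (I a b) \<le> \<epsilon> * (m a + m b) + Bk" by (simp add: Bk_def B_def mult_ac)
    qed (use \<epsilon> Bk in auto)
    then have bound: "(\<Sum>a<l ^ n. \<Sum>b<l ^ n. cmod (I a b)) \<le>
        (real E + 2 * \<epsilon> * real l ^ n) * (\<Sum>a<l ^ n. m a) + (real l ^ n)\<^sup>2 * Bk" by simp
    have sm: "(\<Sum>a<l ^ n. m a) = integral ?W (\<lambda>v. (\<omega> v)\<^sup>2 * Q n k \<eta> (t + v))"
    proof -
      have "(\<Sum>a<l ^ n. m a) = integral ?W (\<lambda>v. \<Sum>a<l ^ n. (cmod (h a v))\<^sup>2)"
        unfolding m_def by (intro integral_sum[symmetric] inth) simp
      then show ?thesis by (simp add: Q_def sum_distrib_left h_def H_def norm_mult power_mult_distrib)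
    qed
    have L: "real l ^ n \<noteq> 0" "0 < real l ^ n" using lpow_pos by auto
    have "complex_of_real ((\<omega> v)\<^sup>2 * (cmod (\<psi> (n + k) \<eta> (t + v)))\<^sup>2) =
        (\<Sum>a<l ^ n. \<Sum>b<l ^ n. h a v * cnj (h b v)) / (complex_of_real (real l ^ n))\<^sup>2" for v
    proof -
      have "complex_of_real ((\<omega> v)\<^sup>2 * (cmod (\<psi> (n + k) \<eta> (t + v)))\<^sup>2) =
         (complex_of_real (\<omega> v) * \<psi> (n + k) \<eta> (t + v)) * cnj (complex_of_real (\<omega> v) * \<psi> (n + k) \<eta> (t + v))"
        by (simp add: complex_norm_square[symmetric] power2_eq_square mult_ac flip: of_real_mult)
      also have "complex_of_real (\<omega> v) * \<psi> (n + k) \<eta> (t + v) = (\<Sum>a<l ^ n. h a v) / complex_of_real (real l ^ n)"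
        unfolding psi_eq_sum_G h_def H_def by (simp add: sum_distrib_left)
      also have "(\<Sum>a<l ^ n. h a v) / complex_of_real (real l ^ n) * cnj ((\<Sum>a<l ^ n. h a v) / complex_of_real (real l ^ n)) =
          (\<Sum>a<l ^ n. \<Sum>b<l ^ n. h a v * cnj (h b v)) / (complex_of_real (real l ^ n))\<^sup>2"
        by (simp add: sum_product power2_eq_square)
      finally show ?thesis .
    qed
    then have "complex_of_real (integral ?W (\<lambda>v. (\<omega> v)\<^sup>2 * (cmod (\<psi> (n + k) \<eta> (t + v)))\<^sup>2)) =
        integral ?W (\<lambda>v. (\<Sum>a<l ^ n. \<Sum>b<l ^ n. h a v * cnj (h b v)) / (complex_of_real (real l ^ n))\<^sup>2)"
      by (subst integral_linear[OF _ bounded_linear_of_real, symmetric])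
        (auto simp: o_def intro!: integrable_continuous_interval continuous_intros)
    also have "\<dots> = (\<Sum>a<l ^ n. \<Sum>b<l ^ n. I a b) / (complex_of_real (real l ^ n))\<^sup>2"
    proof -
      have i: "(\<lambda>v. h a v * cnj (h b v)) integrable_on ?W" for a b
        by (intro integrable_continuous_interval continuous_intros conth)
      have "integral ?W (\<lambda>v. \<Sum>a<l ^ n. \<Sum>b<l ^ n. h a v * cnj (h b v)) = (\<Sum>a<l ^ n. integral ?W (\<lambda>v. \<Sum>b<l ^ n. h a v * cnj (h b v)))"
        by (intro integral_sum integrable_sum i) auto
      also have "\<dots> = (\<Sum>a<l ^ n. \<Sum>b<l ^ n. I a b)"
        unfolding I_def by (intro sum.cong refl integral_sum i) auto
      finally show ?thesis by simp
    qed
    finally have "cmod (complex_of_real (integral ?W (\<lambda>v. (\<omega> v)\<^sup>2 * (cmod (\<psi> (n + k) \<eta> (t + v)))\<^sup>2))) =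
       cmod (\<Sum>a<l ^ n. \<Sum>b<l ^ n. I a b) / (real l ^ n)\<^sup>2"
      by (simp add: norm_divide norm_power)
    moreover have "cmod (\<Sum>a<l ^ n. \<Sum>b<l ^ n. I a b) \<le> (\<Sum>a<l ^ n. \<Sum>b<l ^ n. cmod (I a b))"
      by (intro order_trans[OF norm_sum] sum_mono norm_sum)
    ultimately have "integral ?W (\<lambda>v. (\<omega> v)\<^sup>2 * (cmod (\<psi> (n + k) \<eta> (t + v)))\<^sup>2) \<le>
       ((real E + 2 * \<epsilon> * real l ^ n) * (\<Sum>a<l ^ n. m a) + (real l ^ n)\<^sup>2 * Bk) / (real l ^ n)\<^sup>2"
      using bound L by (smt (verit) divide_right_mono norm_of_real zero_le_power2)
    moreover have "(K * x + y\<^sup>2 * b) / y\<^sup>2 = K / y\<^sup>2 * x + b" if "y \<noteq> 0" for K x y b :: real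
      using that by (simp add: add_divide_distrib)
    ultimately show ?thesis unfolding sm Bk_def[symmetric] using L(1) by simp
  qed
  have "0 \<le> B" using \<epsilon> by (simp add: B_def)
  with main show ?thesis unfolding \<omega>_def by blast
qed

text \<open>Averaging the local estimate over \<open>t\<close> replaces windows by full periods, and
  the mass \<open>W\<close> of the window cancels; the energy of \<open>Q\<close> then returns one
  factor \<open>l ^ n\<close>.\<close>

lemma J_recursion:
  assumes \<rho>: "0 < \<rho>" "\<rho> \<le> 1 / 12" and \<delta>: "0 < \<delta>" "6 * M * \<rho> + 2 * M * \<tau> ^ n \<le> 2 * \<delta>" and \<epsilon>: "0 < \<epsilon>"
    and E: "\<And>t a. t \<in> {0..1} \<Longrightarrow> a < l ^ n \<Longrightarrow> card {b\<in>{..<l ^ n}. \<bar>Y n (t + real a) - Y n (t + real b)\<bar> < 8 * \<delta>} \<le> E"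
  shows "\<exists>B\<ge>0. \<forall>k \<eta>. 1 \<le> \<bar>\<eta>\<bar> \<longrightarrow>
    J (n + k) \<eta> \<le> (real E + 2 * \<epsilon> * real l ^ n) / real l ^ n * J k (lam ^ n * \<eta>) + B / \<bar>\<eta>\<bar> ^ (2 * p - 1)"
proof -
  define w where "w = (\<lambda>v. (bump \<rho> (p + 2) v)\<^sup>2)"
  define W where "W = integral {-1/2..1/2} w"
  have W: "0 < W" unfolding W_def w_def by (rule bump_integral_pos[OF \<rho>(1)])
  have contw: "continuous_on UNIV w" unfolding w_def by (intro continuous_intros)
  obtain B where B: "0 \<le> B" "\<And>k \<eta> t. 1 \<le> \<bar>\<eta>\<bar> \<Longrightarrow> t \<in> {0..1} \<Longrightarrow>
    integral {-1/2..1/2} (\<lambda>v. w v * (cmod (\<psi> (n + k) \<eta> (t + v)))\<^sup>2) \<le>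
    (real E + 2 * \<epsilon> * real l ^ n) / (real l ^ n)\<^sup>2 * integral {-1/2..1/2} (\<lambda>v. w v * Q n k \<eta> (t + v))
      + B / \<bar>\<eta>\<bar> ^ (2 * p - 1)"
    using local_recursion[OF assms] unfolding w_def by blast
  define T where "T = (real E + 2 * \<epsilon> * real l ^ n) / (real l ^ n)\<^sup>2"
  have L: "real l ^ n \<noteq> 0" "0 < real l ^ n" using lpow_pos by auto
  have "J (n + k) \<eta> \<le> (real E + 2 * \<epsilon> * real l ^ n) / real l ^ n * J k (lam ^ n * \<eta>) + (B / W) / \<bar>\<eta>\<bar> ^ (2 * p - 1)"
    if \<eta>: "1 \<le> \<bar>\<eta>\<bar>" for k \<eta>
  proof -
    define Bk where "Bk = B / \<bar>\<eta>\<bar> ^ (2 * p - 1)"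
    have 1: "((\<lambda>t. integral {-1/2..1/2} (\<lambda>v. w v * (cmod (\<psi> (n + k) \<eta> (t + v)))\<^sup>2)) has_integral W * J (n + k) \<eta>) {0..1}"
      unfolding W_def J_def
      by (rule integral_average_window[of "\<lambda>x. (cmod (\<psi> (n + k) \<eta> x))\<^sup>2" w]) (auto simp: psi_periodic intro!: continuous_intros contw)
    have 2: "((\<lambda>t. integral {-1/2..1/2} (\<lambda>v. w v * Q n k \<eta> (t + v))) has_integral W * (real l ^ n * J k (lam ^ n * \<eta>))) {0..1}"
      unfolding W_def integral_Q[symmetric]
    proof (rule integral_average_window[of "Q n k \<eta>" w, OF Q_periodic _ contw])
      show "continuous_on UNIV (Q n k \<eta>)" unfolding Q_def[abs_def] by (intro continuous_intros)
    qed
    have 3: "((\<lambda>t. T * integral {-1/2..1/2} (\<lambda>v. w v * Q n k \<eta> (t + v)) + Bk) has_integral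
        T * (W * (real l ^ n * J k (lam ^ n * \<eta>))) + Bk) {0..1}"
      using has_integral_const_real[of Bk 0 1] by (intro has_integral_add has_integral_mult_right 2) simp
    have "W * J (n + k) \<eta> \<le> T * (W * (real l ^ n * J k (lam ^ n * \<eta>))) + Bk"
      by (rule has_integral_le[OF 1 3]) (use B(2)[OF \<eta>] in \<open>simp add: T_def Bk_def\<close>)
    also have "\<dots> = W * ((real E + 2 * \<epsilon> * real l ^ n) / real l ^ n * J k (lam ^ n * \<eta>) + Bk / W)"
      using W L by (simp add: T_def power2_eq_square field_simps)
    finally have "J (n + k) \<eta> \<le> (real E + 2 * \<epsilon> * real l ^ n) / real l ^ n * J k (lam ^ n * \<eta>) + Bk / W"
      using W by simp
    then show ?thesis by (simp add: Bk_def mult.commute)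
  qed
  then show ?thesis using B(1) W by (intro exI[of _ "B / W"]) auto
qed

text \<open>Each use of the recursion consumes \<open>n\<close> levels and multiplies the frequency
  by \<open>lam ^ n\<close>, so enough uses reduce to \<open>\<bar>\<eta>\<bar> \<le> 1\<close>,
  where \<open>J \<le> 1\<close> suffices. Hence the bound holds only from a level depending on
  \<eta>, but with one constant.\<close>

lemma J_decay:
  assumes \<rho>: "0 < \<rho>" "\<rho> \<le> 1 / 12" and \<delta>: "0 < \<delta>" "6 * M * \<rho> + 2 * M * \<tau> ^ n \<le> 2 * \<delta>"
    and n: "0 < n" and \<sigma>: "0 < \<sigma>" "\<sigma> \<le> 2 * real p - 1"
    and E: "\<And>t a. t \<in> {0..1} \<Longrightarrow> a < l ^ n \<Longrightarrow> card {b\<in>{..<l ^ n}. \<bar>Y n (t + real a) - Y n (t + real b)\<bar> < 8 * \<delta>} \<le> E"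
    and gap: "real E < (real l * lam powr \<sigma>) ^ n"
  shows "\<exists>C>0. \<forall>\<eta>. \<eta> \<noteq> 0 \<longrightarrow> (\<exists>k0. \<forall>k\<ge>k0. J k \<eta> \<le> C * \<bar>\<eta>\<bar> powr (- \<sigma>))"
proof -
  define g where "g = (lam powr \<sigma>) ^ n"
  have L: "real l ^ n \<noteq> 0" "0 < real l ^ n" using lpow_pos by auto
  have g: "0 < g" using lam by (simp add: g_def)
  have gap': "real E / real l ^ n < g" using gap L by (simp add: g_def power_mult_distrib divide_less_eq mult.commute)
  \<comment> \<open>A quarter of the gap: then \<open>\<theta> = E / l ^ n + 2 * \<epsilon>\<close>
    lies half way between \<open>E / l ^ n\<close> and \<open>g\<close>, where \<open>1 / g\<close>
    is the factor by which the target bound grows when \<eta> is replaced by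
    \<open>lam ^ n * \<eta>\<close>.\<close>
  define \<epsilon> where "\<epsilon> = (g - real E / real l ^ n) / 4"
  have \<epsilon>: "0 < \<epsilon>" using gap' by (simp add: \<epsilon>_def)
  obtain B where B: "0 \<le> B" "\<And>k \<eta>. 1 \<le> \<bar>\<eta>\<bar> \<Longrightarrow>
    J (n + k) \<eta> \<le> (real E + 2 * \<epsilon> * real l ^ n) / real l ^ n * J k (lam ^ n * \<eta>) + B / \<bar>\<eta>\<bar> ^ (2 * p - 1)"
    using J_recursion[OF \<rho> \<delta> \<epsilon> E] by blast
  define \<theta> where "\<theta> = (real E + 2 * \<epsilon> * real l ^ n) / real l ^ n"
  have \<theta>: "\<theta> = real E / real l ^ n + 2 * \<epsilon>" using L by (simp add: \<theta>_def add_divide_distrib)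
  have \<theta>g: "\<theta> < g" 
  proof -
    have "e + 2 * ((g - e) / 4) < g" if "e < g" for e using that by (simp add: field_simps)
    from this[OF gap'] show ?thesis unfolding \<theta> \<epsilon>_def .
  qed
  have \<theta>0: "0 \<le> \<theta>" using \<epsilon> L by (simp add: \<theta>)
  \<comment> \<open>\<open>C\<close> reproduces itself in the induction if
    \<open>C * \<theta> / g + B \<le> C\<close>; the 1 covers the frequencies with
    \<open>\<bar>\<eta>\<bar> \<le> 1\<close>.\<close>
  define C where "C = max 1 (B / (1 - \<theta> / g))"
  have d: "0 < 1 - \<theta> / g" using \<theta>g g by (simp add: divide_less_eq)
  have C: "1 \<le> C" "B \<le> C * (1 - \<theta> / g)"
    using d by (auto simp: C_def max_def divide_le_eq mult.commute split: if_splits)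
  have small: "J k \<eta> \<le> C * \<bar>\<eta>\<bar> powr (- \<sigma>)" if "\<eta> \<noteq> 0" "\<bar>\<eta>\<bar> \<le> 1" for k \<eta>
  proof -
    have "\<bar>\<eta>\<bar> powr \<sigma> \<le> 1" using that \<sigma> powr_mono2[of \<sigma> "\<bar>\<eta>\<bar>" 1] by simp
    then have "1 \<le> \<bar>\<eta>\<bar> powr (- \<sigma>)" using that by (simp add: powr_minus one_le_inverse)
    then have "1 * 1 \<le> C * \<bar>\<eta>\<bar> powr (- \<sigma>)" using C(1) by (intro mult_mono) auto
    then show ?thesis using J_le_1[of k \<eta>] by linarith
  qed
  have claim: "\<eta> \<noteq> 0 \<Longrightarrow> (lam ^ n) ^ m * \<bar>\<eta>\<bar> \<le> 1 \<Longrightarrow> n * m \<le> k \<Longrightarrow> J k \<eta> \<le> C * \<bar>\<eta>\<bar> powr (- \<sigma>)" for m k \<eta>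
  proof (induction m arbitrary: \<eta> k)
    case 0 then show ?case using small by simp
  next
    case (Suc m)
    show ?case
    proof (cases "\<bar>\<eta>\<bar> \<le> 1")
      case True then show ?thesis using small Suc.prems by simp
    next
      case False
      define j where "j = k - n"
      have k: "k = n + j" "n * m \<le> j" using Suc.prems(3) by (auto simp: j_def)
      have ln: "0 < lam ^ n" using lam by simp
      have "J j (lam ^ n * \<eta>) \<le> C * \<bar>lam ^ n * \<eta>\<bar> powr (- \<sigma>)"
        by (rule Suc.IH) (use Suc.prems k ln lam in \<open>auto simp: abs_mult mult_ac\<close>)
      also have "\<bar>lam ^ n * \<eta>\<bar> powr (- \<sigma>) = \<bar>\<eta>\<bar> powr (- \<sigma>) / g"
        using ln lam by (simp add: abs_mult powr_mult powr_minus g_def powr_power powr_realpow[symmetric] powr_powr divide_inverse mult_ac)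
      finally have IH: "J j (lam ^ n * \<eta>) \<le> C * (\<bar>\<eta>\<bar> powr (- \<sigma>) / g)" .
      have "\<bar>\<eta>\<bar> ^ (2 * p - 1) = \<bar>\<eta>\<bar> powr (2 * real p - 1)"
        using False p by (subst powr_realpow[symmetric]) (auto simp: of_nat_diff)
      then have "\<bar>\<eta>\<bar> powr \<sigma> \<le> \<bar>\<eta>\<bar> ^ (2 * p - 1)"
        using False \<sigma> by (simp add: powr_mono)
      then have "B / \<bar>\<eta>\<bar> ^ (2 * p - 1) \<le> B / \<bar>\<eta>\<bar> powr \<sigma>"
        using False B(1) by (intro divide_left_mono mult_pos_pos zero_less_power) auto
      then have "B / \<bar>\<eta>\<bar> ^ (2 * p - 1) \<le> B * \<bar>\<eta>\<bar> powr (- \<sigma>)" by (simp add: powr_minus divide_inverse)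
      also have "\<dots> \<le> C * (1 - \<theta> / g) * \<bar>\<eta>\<bar> powr (- \<sigma>)" using C(2) by (intro mult_right_mono) auto
      finally have b: "B / \<bar>\<eta>\<bar> ^ (2 * p - 1) \<le> C * (1 - \<theta> / g) * \<bar>\<eta>\<bar> powr (- \<sigma>)" .
      have "J k \<eta> \<le> \<theta> * J j (lam ^ n * \<eta>) + B / \<bar>\<eta>\<bar> ^ (2 * p - 1)"
        unfolding k \<theta>_def using False by (intro B(2)) simp
      also have "\<dots> \<le> \<theta> * (C * (\<bar>\<eta>\<bar> powr (- \<sigma>) / g)) + C * (1 - \<theta> / g) * \<bar>\<eta>\<bar> powr (- \<sigma>)"
        using IH b \<theta>0 by (intro add_mono mult_left_mono)
      also have "\<dots> = C * \<bar>\<eta>\<bar> powr (- \<sigma>)" using g by (simp add: field_simps)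
      finally show ?thesis .
    qed
  qed
  show ?thesis
  proof (intro exI[of _ C] conjI allI impI)
    show "0 < C" using C(1) by simp
    fix \<eta> :: real assume \<eta>: "\<eta> \<noteq> 0"
    have "0 < lam ^ n" "lam ^ n < 1" using lam n by (auto simp: power_less_one_iff)
    then have "(\<lambda>m. (lam ^ n) ^ m * \<bar>\<eta>\<bar>) \<longlonglongrightarrow> 0 * \<bar>\<eta>\<bar>" by (intro tendsto_intros LIMSEQ_realpow_zero) auto
    then have "\<forall>\<^sub>F m in sequentially. (lam ^ n) ^ m * \<bar>\<eta>\<bar> < 1" by (rule order_tendstoD) simp
    then obtain m where "(lam ^ n) ^ m * \<bar>\<eta>\<bar> < 1" by (auto simp: eventually_sequentially)
    then show "\<exists>k0. \<forall>k\<ge>k0. J k \<eta> \<le> C * \<bar>\<eta>\<bar> powr (- \<sigma>)"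
      using claim[OF \<eta>, of m] by (intro exI[of _ "n * m"]) auto
  qed
qed

end

section \<open>Clusters of nearly tangent branches\<close>

definition wsum :: "real \<Rightarrow> nat \<Rightarrow> (real \<Rightarrow> real) \<Rightarrow> nat \<Rightarrow> real \<Rightarrow> real" where
  "wsum a l g n u = (\<Sum>i<n. a ^ i * g (u / real l ^ Suc i))"

text \<open>The residue \<open>b mod l ^ q\<close> determines the point \<open>(t + b) / l ^ q\<close> modulo 1, that is, the first \<open>q\<close> preimages
  along the branch \<open>b\<close>; \<open>wsum a l F' n (t + b) / l\<close> with \<open>a = lam / l\<close> is the slope over \<open>t\<close> of its image curve.\<close>

definition separated :: "nat \<Rightarrow> real \<Rightarrow> (real \<Rightarrow> real) \<Rightarrow> nat \<Rightarrow> nat \<Rightarrow> nat \<Rightarrow> real \<Rightarrow> bool" where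
  "separated l a g q K n d \<longleftrightarrow>
     (\<forall>t\<in>{0..1}. \<forall>B\<subseteq>{..<l ^ n}. inj_on (\<lambda>b. b mod l ^ q) B \<longrightarrow>
        (\<forall>b\<in>B. \<forall>b'\<in>B. \<bar>wsum a l g n (t + real b) - wsum a l g n (t + real b')\<bar> < d) \<longrightarrow> card B \<le> K)"

context skew
begin

lemma Y_eq_wsum: "Y n u = wsum \<tau> l F' n u"
  by (simp add: Y_def wsum_def)

text \<open>The radius is of the order of the slope tail beyond level \<open>n\<close>, so that a
  cluster of level \<open>n\<close> stays one after truncation to a lower level; two members differ
  by less than the threshold \<open>32 * M * \<tau> ^ n\<close> of separation.\<close>

definition cluster :: "nat \<Rightarrow> real \<Rightarrow> real \<Rightarrow> nat set" where
  "cluster n t z = {b\<in>{..<l ^ n}. \<bar>Y n (t + real b) - z\<bar> < 16 * M * \<tau> ^ n}"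

lemma finite_cluster [simp]: "finite (cluster n t z)"
  by (simp add: cluster_def)

lemma card_cluster_le: "card (cluster n t z) \<le> l ^ n"
  using card_mono[of "{..<l ^ n}" "cluster n t z"] by (auto simp: cluster_def)

lemma Y_periodic_mod: "Y n (t + real (b mod l ^ n)) = Y n (t + real b)"
proof -
  have "real b = real (b mod l ^ n) + real (b div l ^ n) * real l ^ n"
    by (metis mod_div_mult_eq mult.commute of_nat_add of_nat_mult of_nat_power)
  then show ?thesis using periodic_nat[of "Y n", OF Y_periodic, of "t + real (b mod l ^ n)" "b div l ^ n"]
    by (simp add: add.assoc)
qed

text \<open>Truncation costs \<open>2 * M * \<tau> ^ m\<close>, and since
  \<open>\<tau> \<le> 1 / 2\<close> the finer radius is at most \<open>8 * M * \<tau> ^ m\<close>;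
  the sum stays below the radius of level \<open>m\<close>.\<close>

lemma Y_truncate:
  assumes "m \<le> n" "\<bar>Y n u - z\<bar> < 16 * M * \<tau> ^ n"
  shows "\<bar>Y m u - z\<bar> < 16 * M * \<tau> ^ m"
proof (cases "m = n")
  case False
  then obtain j where j: "n = m + Suc j" using assms(1) by (metis add_Suc_right less_imp_Suc_add nat_less_le)
  have "0 < 16 * M * \<tau> ^ n" using assms(2) by (meson abs_ge_zero le_less_trans)
  then have M: "0 < M" using tau by (simp add: zero_less_mult_iff)
  have "\<bar>Y n u - Y m u\<bar> = \<tau> ^ m * \<bar>Y (Suc j) (u / real l ^ m)\<bar>"
    unfolding j Y_add using tau(1) by (simp add: abs_mult)
  also have "\<dots> \<le> \<tau> ^ m * (2 * M)" using Y_bound tau(1) by (intro mult_left_mono) auto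
  finally have 1: "\<bar>Y n u - Y m u\<bar> \<le> 2 * M * \<tau> ^ m" by (simp add: mult_ac)
  have "\<tau> ^ n = \<tau> ^ m * \<tau> ^ Suc j" by (simp add: j power_add)
  also have "\<dots> \<le> \<tau> ^ m * (1 / 2)"
  proof (rule mult_left_mono)
    have "\<tau> ^ Suc j \<le> \<tau> ^ 1" by (rule power_decreasing) (simp, rule less_imp_le[OF tau(1)], rule less_imp_le[OF tau(3)])
    then show "\<tau> ^ Suc j \<le> 1 / 2" unfolding power_one_right using tau(2) by (rule order_trans)
  qed (use tau in auto)
  finally have "16 * M * \<tau> ^ n \<le> 8 * M * \<tau> ^ m" using M by simp
  with 1 assms(2) have "\<bar>Y m u - z\<bar> < 10 * M * \<tau> ^ m" by linarith
  moreover have "10 * M * \<tau> ^ m \<le> 16 * M * \<tau> ^ m" using M tau by (intro mult_right_mono) auto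
  ultimately show ?thesis by linarith
qed (use assms in auto)

text \<open>Truncated to level \<open>n0\<close>, a cluster is a set of nearly tangent branches, so
  separation leaves at most \<open>K\<close> residues modulo \<open>l ^ q\<close>. Branches with a
  given residue \<open>x\<close> share their first \<open>q\<close> terms; what remains is a cluster
  of level \<open>n - q\<close> over the preimage \<open>(t + x) / l ^ q\<close>, rescaled by
  \<open>\<tau> ^ q\<close>.\<close>

lemma cluster_step:
  assumes q: "q \<le> n0" "n0 \<le> n" and sep: "separated l \<tau> F' q K n0 (32 * M * \<tau> ^ n0)"
    and E: "\<And>t z. t \<in> {0..1} \<Longrightarrow> card (cluster (n - q) t z) \<le> E" and t: "t \<in> {0..1}"
  shows "card (cluster n t z) \<le> K * E"
proof -
  let ?W = "cluster n t z"
  let ?r = "\<lambda>b. b mod l ^ q"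
  define P where "P = ?r ` ?W"
  have finP: "finite P" by (simp add: P_def)
  define sec where "sec = (\<lambda>x. SOME b. b \<in> ?W \<and> ?r b = x)"
  have sec: "sec x \<in> ?W \<and> ?r (sec x) = x" if "x \<in> P" for x
  proof -
    have "\<exists>b. b \<in> ?W \<and> ?r b = x" using that by (auto simp: P_def)
    then show ?thesis unfolding sec_def by (rule someI_ex)
  qed
  \<comment> \<open>One representative per residue, reduced modulo \<open>l ^ n0\<close> so as to be
    a branch of level \<open>n0\<close>; by periodicity this changes neither \<open>Y n0\<close>
    nor, as \<open>q \<le> n0\<close>, the residue.\<close>
  define B where "B = (\<lambda>x. sec x mod l ^ n0) ` P"
  have dvd: "l ^ q dvd l ^ n0" using q by (simp add: le_imp_power_dvd)
  have modmod: "(sec x mod l ^ n0) mod l ^ q = x" if "x \<in> P" for x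
    using sec[OF that] dvd by (simp add: mod_mod_cancel)
  have injB: "inj_on (\<lambda>x. sec x mod l ^ n0) P" by (rule inj_on_inverseI[of _ ?r]) (rule modmod)
  have "card B \<le> K"
  proof (rule sep[unfolded separated_def, rule_format, OF t])
    show "B \<subseteq> {..<l ^ n0}" using l by (auto simp: B_def)
    show "inj_on ?r B" unfolding B_def by (auto simp: inj_on_def modmod)
    fix b b' assume "b \<in> B" "b' \<in> B"
    then obtain x x' where x: "x \<in> P" "b = sec x mod l ^ n0" "x' \<in> P" "b' = sec x' mod l ^ n0"
      by (auto simp: B_def)
    have "\<bar>Y n0 (t + real (sec y mod l ^ n0)) - z\<bar> < 16 * M * \<tau> ^ n0" if "y \<in> P" for y
      using sec[OF that] Y_truncate[OF q(2), of "t + real (sec y)" z] unfolding Y_periodic_mod cluster_def by auto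
    from this[OF x(1)] this[OF x(3)] show "\<bar>wsum \<tau> l F' n0 (t + real b) - wsum \<tau> l F' n0 (t + real b')\<bar> < 32 * M * \<tau> ^ n0"
      unfolding x Y_eq_wsum by linarith
  qed
  then have cardP: "card P \<le> K" unfolding B_def by (simp add: card_image[OF injB])
  have fib: "card {b\<in>?W. ?r b = x} \<le> E" if x: "x \<in> P" for x
  proof -
    have xl: "x < l ^ q" using sec[OF x] l by (metis mod_less_divisor pos2 power_eq_0_iff gr0I not_numeral_le_zero)
    define t' where "t' = (t + real x) / real l ^ q"
    define z' where "z' = (z - Y q (t + real x)) / \<tau> ^ q"
    have t': "t' \<in> {0..1}"
    proof -
      have "real x + 1 \<le> real (l ^ q)" using xl by linarith
      then have "t + real x \<le> real l ^ q" using t by simp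
      then show ?thesis using t lpow_pos[of q] by (simp add: t'_def)
    qed
    have "card {b\<in>?W. ?r b = x} \<le> card (cluster (n - q) t' z')"
    proof (rule card_inj_on_le[where f = "\<lambda>b. b div l ^ q"])
      show "inj_on (\<lambda>b. b div l ^ q) {b\<in>?W. ?r b = x}"
        by (rule inj_onI) (metis (mono_tags, lifting) div_mult_mod_eq mem_Collect_eq)
      show "(\<lambda>b. b div l ^ q) ` {b\<in>?W. ?r b = x} \<subseteq> cluster (n - q) t' z'"
      proof safe
        fix b assume b: "b \<in> ?W" "x = b mod l ^ q"
        define b' where "b' = b div l ^ q"
        have nq: "n = q + (n - q)" using q by simp
        have "b < l ^ q * l ^ (n - q)" using b(1) nq by (simp add: cluster_def flip: power_add)
        then have b'l: "b' < l ^ (n - q)" unfolding b'_def by (simp add: less_mult_imp_div_less mult.commute)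
        have rb: "real b = real x + real l ^ q * real b'"
          unfolding b(2) b'_def by (metis add.commute mult_div_mod_eq of_nat_add of_nat_mult of_nat_power)
        have "Y n (t + real b) = Y q (t + real b) + \<tau> ^ q * Y (n - q) ((t + real b) / real l ^ q)"
          using Y_add[of q "n - q"] nq by simp
        also have "Y q (t + real b) = Y q (t + real x)" using Y_periodic_mod[of q t b] b(2) by simp
        also have "(t + real b) / real l ^ q = t' + real b'"
          using lpow_pos[of q] by (simp add: rb t'_def add_divide_distrib)
        finally have "Y n (t + real b) - z = \<tau> ^ q * (Y (n - q) (t' + real b') - z')"
        proof -
          have "a + c * y - z = c * (y - (z - a) / c)" if "c \<noteq> 0" for a c y :: real
            using that by (simp add: field_simps)
          moreover have "\<tau> ^ q \<noteq> 0" using tau(1) by (metis less_irrefl power_not_zero)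
          ultimately show "Y n (t + real b) = Y q (t + real x) + \<tau> ^ q * Y (n - q) (t' + real b') \<Longrightarrow> ?thesis"
            by (simp only: z'_def)
        qed
        then have "\<tau> ^ q * \<bar>Y (n - q) (t' + real b') - z'\<bar> = \<bar>Y n (t + real b) - z\<bar>"
          using tau(1) by (simp add: abs_mult)
        also have "\<dots> < 16 * M * \<tau> ^ n" using b(1) by (simp add: cluster_def)
        also have "\<dots> = \<tau> ^ q * (16 * M * \<tau> ^ (n - q))" by (subst nq, subst power_add) (simp add: mult_ac)
        finally have "\<bar>Y (n - q) (t' + real b') - z'\<bar> < 16 * M * \<tau> ^ (n - q)"
          using tau(1) by (simp add: mult_less_cancel_left_pos)
        then show "b div l ^ q \<in> cluster (n - q) t' z'" using b'l by (simp add: cluster_def b'_def)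
      qed
    qed simp
    then show ?thesis using E[OF t', of z'] by linarith
  qed
  have "?W = (\<Union>x\<in>P. {b\<in>?W. ?r b = x})" by (auto simp: P_def)
  then have "card ?W \<le> (\<Sum>x\<in>P. card {b\<in>?W. ?r b = x})" using card_UN_le[OF finP] by metis
  also have "\<dots> \<le> (\<Sum>x\<in>P. E)" by (intro sum_mono fib)
  also have "\<dots> \<le> K * E" using cardP by simp
  finally show ?thesis .
qed

lemma cluster_bound:
  assumes q: "q \<le> n0" and sep: "separated l \<tau> F' q K n0 (32 * M * \<tau> ^ n0)" and t: "t \<in> {0..1}"
  shows "card (cluster (n0 + j * q) t z) \<le> K ^ j * l ^ n0"
  using t
proof (induction j arbitrary: t z)
  case 0 then show ?case using card_cluster_le by simp
next
  case (Suc j)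
  have eq: "n0 + Suc j * q - q = n0 + j * q" by simp
  have "card (cluster (n0 + Suc j * q) t z) \<le> K * (K ^ j * l ^ n0)"
  proof (rule cluster_step[OF q _ sep _ Suc.prems])
    show "card (cluster (n0 + Suc j * q - q) t z) \<le> K ^ j * l ^ n0" if "t \<in> {0..1}" for t z
      unfolding eq by (rule Suc.IH[OF that])
  qed simp
  then show ?case by (simp add: mult.assoc)
qed

lemma separated_imp_J_decay:
  assumes q: "0 < q" "q \<le> n0" and sep: "separated l \<tau> F' q K n0 (32 * M * \<tau> ^ n0)" and M: "0 < M"
    and \<sigma>: "0 < \<sigma>" "\<sigma> \<le> 2 * real p - 1" and gap: "real K < (real l * lam powr \<sigma>) ^ q"
  shows "\<exists>C>0. \<forall>\<eta>. \<eta> \<noteq> 0 \<longrightarrow> (\<exists>k0. \<forall>k\<ge>k0. J k \<eta> \<le> C * \<bar>\<eta>\<bar> powr (- \<sigma>))"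
proof -
  define \<Gamma> where "\<Gamma> = real l * lam powr \<sigma>"
  have \<Gamma>: "0 < \<Gamma>" using l_pos lam by (simp add: \<Gamma>_def)
  have "real K / \<Gamma> ^ q < 1" using gap \<Gamma> by (simp add: \<Gamma>_def)
  then have "(\<lambda>j. (real K / \<Gamma> ^ q) ^ j * (real l ^ n0 / \<Gamma> ^ n0)) \<longlonglongrightarrow> 0 * (real l ^ n0 / \<Gamma> ^ n0)"
    using \<Gamma> by (intro tendsto_intros LIMSEQ_realpow_zero) auto
  then have "\<forall>\<^sub>F j in sequentially. (real K / \<Gamma> ^ q) ^ j * (real l ^ n0 / \<Gamma> ^ n0) < 1" by (rule order_tendstoD) simp
  then obtain j where j: "(real K / \<Gamma> ^ q) ^ j * (real l ^ n0 / \<Gamma> ^ n0) < 1" by (auto simp: eventually_sequentially)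
  define n where "n = n0 + j * q"
  define E where "E = K ^ j * l ^ n0"
  have "real E < \<Gamma> ^ n"
    using j \<Gamma> by (simp add: E_def n_def power_add power_divide divide_less_eq power_mult[symmetric] mult.commute)
  then have gapn: "real E < (real l * lam powr \<sigma>) ^ n" by (simp add: \<Gamma>_def)
  define \<rho> where "\<rho> = min (1 / 12) (\<tau> ^ n / 3)"
  have \<rho>: "0 < \<rho>" "\<rho> \<le> 1 / 12" "\<rho> \<le> \<tau> ^ n / 3" using tau(1) by (auto simp: \<rho>_def)
  \<comment> \<open>\<open>8 * \<delta>\<close> is the cluster radius at level \<open>n\<close>. Of
    \<open>2 * \<delta> = 4 * M * \<tau> ^ n\<close>, half pays for the window, as
    \<open>\<rho> \<le> \<tau> ^ n / 3\<close>, and half for the tail.\<close>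
  define \<delta> where "\<delta> = 2 * M * \<tau> ^ n"
  have \<delta>: "0 < \<delta>" using M tau(1) by (simp add: \<delta>_def)
  have "6 * M * \<rho> \<le> 6 * M * (\<tau> ^ n / 3)" using M \<rho> by (intro mult_left_mono) auto
  then have \<delta>2: "6 * M * \<rho> + 2 * M * \<tau> ^ n \<le> 2 * \<delta>" by (simp add: \<delta>_def)
  have n: "0 < n" using q by (simp add: n_def)
  have "card {b\<in>{..<l ^ n}. \<bar>Y n (t + real a) - Y n (t + real b)\<bar> < 8 * \<delta>} \<le> E" if "t \<in> {0..1}" for t a
    using cluster_bound[OF q(2) sep that, of j "Y n (t + real a)"]
    by (simp add: cluster_def n_def[symmetric] E_def \<delta>_def abs_minus_commute mult.assoc)
  then show ?thesis by (intro J_decay[OF \<rho>(1,2) \<delta> \<delta>2 n \<sigma> _ gapn])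
qed

end

section \<open>A counting argument for generic perturbations\<close>

text \<open>The out-degrees bound the number of edges, so some vertex has in-degree at most
  \<open>R\<close>. It is kept and its at most \<open>2 * R\<close> neighbours in either direction
  are discarded, which uses up at most \<open>2 * R + 1\<close> vertices per chosen one.\<close>

lemma independent_set:
  fixes E :: "'a \<Rightarrow> 'a \<Rightarrow> bool"
  assumes "finite V" "\<And>v. v \<in> V \<Longrightarrow> card {w\<in>V. w \<noteq> v \<and> E v w} \<le> R" "(2 * R + 1) * m \<le> card V"
  shows "\<exists>I\<subseteq>V. card I = m \<and> (\<forall>v\<in>I. \<forall>w\<in>I. v \<noteq> w \<longrightarrow> \<not> E v w)"
  using assms
proof (induction m arbitrary: V)
  case 0
  show ?case by (intro exI[of _ "{}"]) auto
next
  case (Suc m)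
  have Vne: "V \<noteq> {}" using Suc.prems(3) by auto
  let ?out = "\<lambda>v. {w\<in>V. w \<noteq> v \<and> E v w}" and ?in = "\<lambda>w. {v\<in>V. w \<noteq> v \<and> E v w}"
  have count: "card {v\<in>V. P v} = (\<Sum>v\<in>V. if P v then 1 else 0)" for P
    using sum.inter_filter[OF Suc.prems(1), of "\<lambda>_. 1::nat" P] by simp
  have "\<exists>w\<in>V. card (?in w) \<le> R"
  proof (rule ccontr)
    assume "\<not> ?thesis"
    then have "Suc R \<le> card (?in w)" if "w \<in> V" for w using that by (simp add: not_le Suc_leI)
    then have "(\<Sum>w\<in>V. Suc R) \<le> (\<Sum>w\<in>V. card (?in w))" by (rule sum_mono)
    also have "\<dots> = (\<Sum>w\<in>V. \<Sum>v\<in>V. if w \<noteq> v \<and> E v w then 1 else 0)"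
      by (simp only: count)
    also have "\<dots> = (\<Sum>v\<in>V. \<Sum>w\<in>V. if w \<noteq> v \<and> E v w then 1 else 0)" by (rule sum.swap)
    also have "\<dots> = (\<Sum>v\<in>V. card (?out v))"
      by (simp only: count)
    also have "\<dots> \<le> (\<Sum>v\<in>V. R)" by (intro sum_mono Suc.prems(2))
    finally show False using Vne Suc.prems(1) by simp
  qed
  then obtain w where w: "w \<in> V" "card (?in w) \<le> R" by blast
  define N where "N = insert w (?out w \<union> ?in w)"
  define V' where "V' = V - N"
  have "card N \<le> Suc (card (?out w \<union> ?in w))" unfolding N_def by (rule card_insert_le_m1) auto
  also have "\<dots> \<le> Suc (R + R)" using card_Un_le[of "?out w" "?in w"] w Suc.prems(2)[OF w(1)] by simp
  finally have cN: "card N \<le> 2 * R + 1" by simp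
  have finN: "finite N" using Suc.prems(1) by (simp add: N_def)
  have "card V - card N \<le> card V'" unfolding V'_def by (rule diff_card_le_card_Diff[OF finN])
  then have cV': "(2 * R + 1) * m \<le> card V'" using Suc.prems(3) cN by simp
  have "\<exists>I\<subseteq>V'. card I = m \<and> (\<forall>v\<in>I. \<forall>w\<in>I. v \<noteq> w \<longrightarrow> \<not> E v w)"
  proof (rule Suc.IH[OF _ _ cV'])
    show "finite V'" using Suc.prems(1) by (simp add: V'_def)
    fix v assume v: "v \<in> V'"
    have "card {w\<in>V'. w \<noteq> v \<and> E v w} \<le> card (?out v)"
      using Suc.prems(1) by (intro card_mono) (auto simp: V'_def)
    also have "\<dots> \<le> R" using v by (intro Suc.prems(2)) (simp add: V'_def)
    finally show "card {w\<in>V'. w \<noteq> v \<and> E v w} \<le> R" .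
  qed
  then obtain I where I: "I \<subseteq> V'" "card I = m" "\<forall>v\<in>I. \<forall>w\<in>I. v \<noteq> w \<longrightarrow> \<not> E v w" by blast
  have finI: "finite I" using I(1) Suc.prems(1) finite_subset by (auto simp: V'_def)
  have "w \<notin> I" using I(1) by (auto simp: V'_def N_def)
  have nE: "\<not> E w v \<and> \<not> E v w" if "v \<in> I" "v \<noteq> w" for v
    using that I(1) w(1) by (auto simp: V'_def N_def)
  have "insert w I \<subseteq> V" using w(1) I(1) by (auto simp: V'_def)
  moreover have "card (insert w I) = Suc m" using \<open>w \<notin> I\<close> finI I(2) by simp
  moreover have "\<forall>u\<in>insert w I. \<forall>v\<in>insert w I. u \<noteq> v \<longrightarrow> \<not> E u v" using nE I(3) by blast
  ultimately show ?case by blast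
qed

text \<open>A power of the positive part of \<open>cos (2 * pi * u) - cos (2 * pi * \<rho>)\<close>
  is periodic by construction, is supported within \<rho> of the integers, and has the finite
  smoothness of truncated powers; the normalisation gives it the value 1 at the integers.\<close>

lemma periodic_bump:
  assumes \<rho>: "0 < \<rho>" "\<rho> < 1 / 2"
  shows "\<exists>\<beta> N \<rho>1. (\<forall>u::real. \<beta> (u + 1) = (\<beta> u :: real)) \<and> (\<forall>u. 0 \<le> \<beta> u \<and> \<beta> u \<le> 1) \<and>
    (\<forall>u. \<beta> u \<noteq> 0 \<longrightarrow> (\<exists>z::int. \<bar>u - of_int z\<bar> < \<rho>)) \<and> 0 < \<rho>1 \<and> (\<forall>u. \<bar>u\<bar> \<le> \<rho>1 \<longrightarrow> 1 / 2 \<le> \<beta> u) \<and>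
    bounded_derivs UNIV p N \<beta>"
proof -
  define c where "c = cos (2 * pi * \<rho>)"
  have c: "c < 1"
  proof -
    have "cos (2 * pi * \<rho>) < cos 0" by (rule cos_monotone_0_pi) (use \<rho> in auto)
    then show ?thesis by (simp add: c_def)
  qed
  define \<beta> where "\<beta> = (\<lambda>u. max 0 (1 / (1 - c) * (cos (2 * pi * u) - c)) ^ Suc p)"
  have "bounded_derivs UNIV p (\<bar>1 / (1 - c)\<bar> * (max 1 \<bar>2 * pi\<bar> ^ p * 1 + \<bar>c\<bar>)) (\<lambda>u. 1 / (1 - c) * (cos (2 * pi * u + 0) - c))"
    using bounded_derivs_affine[OF bounded_derivs_cos[of p 0], of "2 * pi" 0]
    by (intro bounded_derivs_cmult bounded_derivs_diff bounded_derivs_const) simp_all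
  from bounded_derivs_max_power[OF this, of "Suc p"]
  obtain N where N: "bounded_derivs UNIV p N \<beta>" unfolding \<beta>_def by auto
  have per: "\<beta> (u + 1) = \<beta> u" for u
    by (simp add: \<beta>_def distrib_left)
  have "1 / (1 - c) * (cos (2 * pi * u) - c) \<le> 1" for u
    using c by (simp add: divide_le_eq)
  then have "max 0 (1 / (1 - c) * (cos (2 * pi * u) - c)) \<le> 1" for u by (simp only: max.bounded_iff) simp
  then have le: "0 \<le> \<beta> u" "\<beta> u \<le> 1" for u
    unfolding \<beta>_def by (intro zero_le_power power_le_one; simp only: max.cobounded1)+
  have "\<beta> 0 = 1" using c by (simp add: \<beta>_def)
  moreover have "isCont \<beta> 0" using bounded_derivs_continuous[OF N] by (simp add: continuous_on_eq_continuous_at)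
  ultimately obtain d where d: "d > 0" "\<And>u. \<bar>u\<bar> < d \<Longrightarrow> \<bar>\<beta> u - 1\<bar> < 1 / 2"
    unfolding continuous_at_eps_delta by (metis (no_types, lifting) diff_zero dist_real_def half_gt_zero_iff zero_less_one dist_norm real_norm_def)
  have near: "1 / 2 \<le> \<beta> u" if "\<bar>u\<bar> \<le> d / 2" for u using d(2)[of u] d(1) that by (simp add: abs_if split: if_splits)
  have supp: "\<exists>z::int. \<bar>u - of_int z\<bar> < \<rho>" if "\<beta> u \<noteq> 0" for u
  proof (rule ccontr)
    assume *: "\<not> ?thesis"
    define x where "x = \<bar>u - of_int (round u)\<bar>"
    have x: "\<rho> \<le> x" using * by (auto simp: x_def not_less)
    have x2: "x \<le> 1 / 2" using of_int_round_abs_le[of u] by (simp add: x_def abs_minus_commute)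
    have "cos (2 * pi * u) = cos (2 * pi * (u - of_int (round u)) + 2 * pi * of_int (round u))"
      by (simp add: algebra_simps)
    also have "\<dots> = cos (2 * pi * (u - of_int (round u)))"
      unfolding cos_add using cos_int_2pin[of "round u"] sin_int_2pin[of "round u"] by (simp add: mult_ac)
    also have "\<dots> = cos \<bar>2 * pi * (u - of_int (round u))\<bar>" by simp
    also have "\<dots> = cos (2 * pi * x)" by (simp add: x_def abs_mult)
    also have "\<dots> \<le> c" unfolding c_def by (rule cos_monotone_0_pi_le) (use x x2 \<rho> in auto)
    finally have "1 / (1 - c) * (cos (2 * pi * u) - c) \<le> 0" using c by (simp add: divide_nonpos_pos)
    then have "\<beta> u = 0" by (simp add: \<beta>_def max_def)
    then show False using that by simp
  qed
  show ?thesis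
    by (intro exI[of _ \<beta>] exI[of _ N] exI[of _ "d / 2"]) (use per le supp d(1) near N in auto)
qed

section \<open>Slopes under perturbation and the resulting linear systems\<close>

lemma wsum_lipschitz:
  assumes g: "\<And>u v. \<bar>g u - g v\<bar> \<le> A * \<bar>u - v\<bar>" and a: "0 \<le> a" "a \<le> 1 / 2" and l: "1 \<le> l"
  shows "\<bar>wsum a l g n u - wsum a l g n v\<bar> \<le> 2 * A * \<bar>u - v\<bar>"
proof -
  have A: "0 \<le> A" using g[of 1 0] by simp
  have "\<bar>wsum a l g n u - wsum a l g n v\<bar> \<le> (\<Sum>i<n. a ^ i * (A * \<bar>u - v\<bar>))"
    unfolding wsum_def sum_subtractf[symmetric]
  proof (rule order_trans[OF sum_abs], rule sum_mono)
    fix i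
    have L: "1 \<le> real l ^ Suc i" using l by (intro one_le_power) simp
    have "\<bar>a ^ i * g (u / real l ^ Suc i) - a ^ i * g (v / real l ^ Suc i)\<bar> =
        a ^ i * \<bar>g (u / real l ^ Suc i) - g (v / real l ^ Suc i)\<bar>"
      using a by (simp add: abs_mult flip: right_diff_distrib)
    also have "\<dots> \<le> a ^ i * (A * \<bar>u / real l ^ Suc i - v / real l ^ Suc i\<bar>)"
      using a g by (intro mult_left_mono) auto
    also have "\<bar>u / real l ^ Suc i - v / real l ^ Suc i\<bar> = \<bar>u - v\<bar> / real l ^ Suc i"
      using L by (simp add: abs_divide flip: diff_divide_distrib)
    also have "a ^ i * (A * (\<bar>u - v\<bar> / real l ^ Suc i)) \<le> a ^ i * (A * (\<bar>u - v\<bar> / 1))"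
      using a A L by (intro mult_left_mono divide_left_mono) auto
    finally show "\<bar>a ^ i * g (u / real l ^ Suc i) - a ^ i * g (v / real l ^ Suc i)\<bar> \<le> a ^ i * (A * \<bar>u - v\<bar>)" by simp
  qed
  also have "\<dots> = (\<Sum>i<n. a ^ i) * (A * \<bar>u - v\<bar>)" by (simp add: sum_distrib_right)
  also have "\<dots> \<le> 2 * (A * \<bar>u - v\<bar>)"
  proof (rule mult_right_mono)
    have "(\<Sum>i<n. a ^ i) \<le> (\<Sum>i. a ^ i)" using a by (intro sum_le_suminf summable_geometric) auto
    also have "\<dots> = 1 / (1 - a)" using a by (intro suminf_geometric) auto
    also have "\<dots> \<le> 2" using a by (simp add: divide_le_eq)
    finally show "(\<Sum>i<n. a ^ i) \<le> 2" .
  qed (use A in auto)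
  finally show ?thesis by simp
qed

text \<open>Perturbations of \<open>f\<close> are periodic, so their derivatives have mean zero and
  a bump \<phi> enters as \<open>\<phi> - c\<close>. Differences of slopes do not see
  \<open>c\<close> and are affine in the parameters \<open>s\<close>.\<close>

lemma wsum_perturbation:
  "wsum a l (\<lambda>u. g u + (\<Sum>x<N. s x * (\<phi> x u - c))) n u - wsum a l (\<lambda>u. g u + (\<Sum>x<N. s x * (\<phi> x u - c))) n v =
   (wsum a l g n u - wsum a l g n v) + (\<Sum>x<N. s x * (wsum a l (\<phi> x) n u - wsum a l (\<phi> x) n v))"
proof -
  have "wsum a l (\<lambda>u. g u + (\<Sum>x<N. s x * (\<phi> x u - c))) n w =
      wsum a l g n w + (\<Sum>x<N. s x * (wsum a l (\<phi> x) n w - c * (\<Sum>i<n. a ^ i)))" for w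
  proof -
    have "wsum a l (\<lambda>u. g u + (\<Sum>x<N. s x * (\<phi> x u - c))) n w =
      wsum a l g n w + (\<Sum>i<n. \<Sum>x<N. s x * (a ^ i * \<phi> x (w / real l ^ Suc i) - c * a ^ i))"
      unfolding wsum_def sum.distrib[symmetric] by (simp add: distrib_left sum_distrib_left algebra_simps)
    also have "(\<Sum>i<n. \<Sum>x<N. s x * (a ^ i * \<phi> x (w / real l ^ Suc i) - c * a ^ i)) =
       (\<Sum>x<N. \<Sum>i<n. s x * (a ^ i * \<phi> x (w / real l ^ Suc i) - c * a ^ i))" by (rule sum.swap)
    also have "\<dots> = (\<Sum>x<N. s x * (wsum a l (\<phi> x) n w - c * (\<Sum>i<n. a ^ i)))"
      by (simp add: wsum_def sum_subtractf flip: sum_distrib_left)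
    finally show ?thesis .
  qed
  then show ?thesis by (simp add: sum_subtractf[symmetric] algebra_simps)
qed

text \<open>The row belonging to the largest \<open>\<bar>\<delta> j\<bar>\<close> suffices: there
  the diagonal outweighs the other terms by at least
  \<open>D * \<bar>\<delta> j\<bar>\<close>.\<close>

lemma diag_dominant_bound:
  fixes W :: "'i \<Rightarrow> 'i \<Rightarrow> real"
  assumes I: "finite I" and dom: "\<And>j. j \<in> I \<Longrightarrow> D + (\<Sum>j'\<in>I - {j}. \<bar>W j j'\<bar>) \<le> W j j"
    and r: "\<And>j. j \<in> I \<Longrightarrow> \<bar>\<Sum>j'\<in>I. W j j' * \<delta> j'\<bar> \<le> r" and D: "0 < D" and i: "i \<in> I"
  shows "\<bar>\<delta> i\<bar> \<le> r / D"
proof -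
  obtain j where j: "j \<in> I" "\<And>i. i \<in> I \<Longrightarrow> \<bar>\<delta> i\<bar> \<le> \<bar>\<delta> j\<bar>"
  proof -
    have "Max ((\<lambda>i. \<bar>\<delta> i\<bar>) ` I) \<in> (\<lambda>i. \<bar>\<delta> i\<bar>) ` I" using I i by (intro Max_in) auto
    then obtain j where "j \<in> I" "Max ((\<lambda>i. \<bar>\<delta> i\<bar>) ` I) = \<bar>\<delta> j\<bar>" by auto
    then show ?thesis using that I by (metis Max_ge finite_imageI imageI)
  qed
  have Wjj: "0 \<le> W j j" 
  proof -
    have "0 \<le> (\<Sum>j'\<in>I - {j}. \<bar>W j j'\<bar>)" by (rule sum_nonneg) simp
    then show ?thesis using dom[OF j(1)] D by linarith
  qed
  have "(\<Sum>j'\<in>I. W j j' * \<delta> j') = W j j * \<delta> j + (\<Sum>j'\<in>I - {j}. W j j' * \<delta> j')"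
    by (rule sum.remove[OF I j(1)])
  then have "\<bar>W j j * \<delta> j\<bar> \<le> r + \<bar>\<Sum>j'\<in>I - {j}. W j j' * \<delta> j'\<bar>" using r[OF j(1)] by linarith
  also have "\<bar>\<Sum>j'\<in>I - {j}. W j j' * \<delta> j'\<bar> \<le> (\<Sum>j'\<in>I - {j}. \<bar>W j j'\<bar> * \<bar>\<delta> j\<bar>)"
    by (rule order_trans[OF sum_abs], rule sum_mono) (use j in \<open>auto simp: abs_mult intro!: mult_left_mono\<close>)
  also have "\<dots> = (\<Sum>j'\<in>I - {j}. \<bar>W j j'\<bar>) * \<bar>\<delta> j\<bar>" by (simp add: sum_distrib_right)
  also have "\<dots> \<le> (W j j - D) * \<bar>\<delta> j\<bar>" using dom[OF j(1)] by (intro mult_right_mono) auto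
  finally have "D * \<bar>\<delta> j\<bar> \<le> r" using Wjj by (simp add: abs_mult algebra_simps)
  then have "\<bar>\<delta> j\<bar> \<le> r / D" using D by (simp add: le_divide_eq mult.commute)
  then show ?thesis using j(2)[OF i] by linarith
qed

text \<open>Two solutions that agree in the coordinates outside the image of \<open>m\<close> differ
  by a vector that the dominant system sends to entries of size at most \<open>2 * r\<close>; its
  own entries are then below the mesh \<open>h\<close>, hence zero. So a solution is determined by
  the \<open>N - card I\<close> free coordinates.\<close>

lemma card_lattice_solutions:
  fixes W :: "'i \<Rightarrow> nat \<Rightarrow> real" and S :: "(nat \<Rightarrow> nat) set"
  assumes I: "finite I" and m: "m ` I \<subseteq> {..<N}" "inj_on m I" and S: "S \<subseteq> PiE {..<N} (\<lambda>_. {..<L})"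
    and dom: "\<And>j. j \<in> I \<Longrightarrow> D + (\<Sum>j'\<in>I - {j}. \<bar>W j (m j')\<bar>) \<le> W j (m j)" and D: "0 < D"
    and small: "\<And>s j. s \<in> S \<Longrightarrow> j \<in> I \<Longrightarrow> \<bar>base j + (\<Sum>x<N. h * real (s x) * W j x)\<bar> < r" and h: "2 * r < h * D"
  shows "card S \<le> L ^ (N - card I)"
proof -
  let ?C = "{..<N} - m ` I"
  have inj: "inj_on (\<lambda>s. restrict s ?C) S"
  proof (rule inj_onI)
    fix s s' assume s: "s \<in> S" "s' \<in> S" "restrict s ?C = restrict s' ?C"
    have off: "s x = s' x" if "x \<in> ?C" for x using s(3) that by (metis restrict_apply')
    define \<delta> where "\<delta> = (\<lambda>j. h * (real (s (m j)) - real (s' (m j))))"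
    have "\<bar>\<delta> j\<bar> \<le> 2 * r / D" if "j \<in> I" for j
    proof (rule diag_dominant_bound[OF I dom _ D that])
      fix j assume j: "j \<in> I"
      have "(\<Sum>x<N. h * real (s x) * W j x) - (\<Sum>x<N. h * real (s' x) * W j x) =
          (\<Sum>x<N. h * (real (s x) - real (s' x)) * W j x)"
        by (simp add: sum_subtractf[symmetric] algebra_simps)
      also have "\<dots> = (\<Sum>x\<in>m ` I. h * (real (s x) - real (s' x)) * W j x)"
        using m(1) off by (intro sum.mono_neutral_right) auto
      also have "\<dots> = (\<Sum>j'\<in>I. W j (m j') * \<delta> j')"
        unfolding sum.reindex[OF m(2)] by (simp add: \<delta>_def mult_ac)
      finally show "\<bar>\<Sum>j'\<in>I. W j (m j') * \<delta> j'\<bar> \<le> 2 * r"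
        using small[OF s(1) j] small[OF s(2) j] by linarith
    qed
    moreover have hpos: "0 < h" if "j \<in> I" for j
      using small[OF s(1) that] h D by (smt (verit) abs_ge_zero zero_less_mult_pos2)
    moreover have "2 * r / D < h" using h D by (simp add: divide_less_eq)
    ultimately have lt: "\<bar>h * (real (s (m j)) - real (s' (m j)))\<bar> < h" if "j \<in> I" for j
      unfolding \<delta>_def using that by fastforce
    have on: "s (m j) = s' (m j)" if j: "j \<in> I" for j
    proof -
      have "h * \<bar>real (s (m j)) - real (s' (m j))\<bar> < h * 1"
        using lt[OF j] hpos[OF j] by (simp add: abs_mult)
      then have "\<bar>real (s (m j)) - real (s' (m j))\<bar> < 1" using hpos[OF j] by (simp only: mult_less_cancel_left_pos)
      then show ?thesis by linarith
    qed
    have "s x = s' x" if "x \<in> {..<N}" for x using on off that by (cases "x \<in> m ` I") auto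
    moreover have "s \<in> PiE {..<N} (\<lambda>_. {..<L})" "s' \<in> PiE {..<N} (\<lambda>_. {..<L})" using S s by auto
    ultimately show "s = s'" by (intro PiE_ext) auto
  qed
  have "card S \<le> card (PiE ?C (\<lambda>_. {..<L}))"
  proof (rule card_inj_on_le[OF inj])
    show "(\<lambda>s. restrict s ?C) ` S \<subseteq> PiE ?C (\<lambda>_. {..<L})"
    proof (rule image_subsetI)
      fix s assume "s \<in> S"
      then have "s \<in> PiE {..<N} (\<lambda>_. {..<L})" using S by blast
      then show "restrict s ?C \<in> PiE ?C (\<lambda>_. {..<L})"
        unfolding restrict_PiE_iff by (meson DiffD1 PiE_mem)
    qed
  qed (auto simp: finite_PiE)
  also have "\<dots> = L ^ card ?C" by (simp add: card_PiE)
  also have "card ?C = N - card I" using m I by (simp add: card_Diff_subset card_image)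
  finally show ?thesis .
qed

lemma wsum_nonneg: "0 \<le> a \<Longrightarrow> (\<And>u. 0 \<le> g u) \<Longrightarrow> 0 \<le> wsum a l g n u"
  unfolding wsum_def by (intro sum_nonneg) simp

lemma wsum_tail_bound:
  assumes a: "0 < a" "a \<le> 1 / 2" and g: "\<And>u. 0 \<le> g u \<and> g u \<le> 1"
    and z: "\<And>i. i < R \<Longrightarrow> g (u / real l ^ Suc i) = 0"
  shows "wsum a l g n u \<le> 2 * a ^ R"
proof (cases "n \<le> R")
  case True
  then have "wsum a l g n u = 0" unfolding wsum_def using z by (intro sum.neutral) auto
  then show ?thesis using a by simp
next
  case False
  then obtain j where j: "n = R + j" by (metis le_add_diff_inverse nle_le)
  have "wsum a l g n u = (\<Sum>i<j. a ^ (R + i) * g (u / real l ^ Suc (R + i)))"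
    unfolding wsum_def j sum_lessThan_add using z by simp
  also have "\<dots> \<le> (\<Sum>i<j. a ^ R * a ^ i)"
    using a g by (intro sum_mono) (simp add: power_add mult_left_le)
  also have "\<dots> = a ^ R * (\<Sum>i<j. a ^ i)" by (simp add: sum_distrib_left)
  also have "\<dots> \<le> a ^ R * 2"
  proof (rule mult_left_mono)
    have "(\<Sum>i<j. a ^ i) \<le> (\<Sum>i. a ^ i)" using a by (intro sum_le_suminf summable_geometric) auto
    also have "\<dots> = 1 / (1 - a)" using a by (intro suminf_geometric) auto
    also have "\<dots> \<le> 2" using a by (simp add: divide_le_eq)
    finally show "(\<Sum>i<j. a ^ i) \<le> 2" .
  qed (use a in auto)
  finally show ?thesis by simp
qed


text \<open>Branch \<open>b 0\<close> is the reference, and row \<open>j\<close> of the matrix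
  belongs to the difference of the slopes of \<open>b j\<close> and \<open>b 0\<close>. The map
  \<open>m\<close> selects for each row the bump that acts as its unknown; the inequality is
  diagonal dominance with margin \<open>D\<close> of this \<open>k\<close> by \<open>k\<close>
  system.\<close>

definition transversal_tuple :: "nat \<Rightarrow> real \<Rightarrow> (nat \<Rightarrow> real \<Rightarrow> real) \<Rightarrow> nat \<Rightarrow> nat \<Rightarrow> nat \<Rightarrow> real \<Rightarrow> real \<Rightarrow> (nat \<Rightarrow> nat) \<Rightarrow> bool" where
  "transversal_tuple l a \<phi> N k n D t b \<longleftrightarrow> (\<exists>m. m ` {1..k} \<subseteq> {..<N} \<and> inj_on m {1..k} \<and>
     (\<forall>j\<in>{1..k}. D + (\<Sum>j'\<in>{1..k} - {j}. \<bar>wsum a l (\<phi> (m j')) n (t + real (b j)) - wsum a l (\<phi> (m j')) n (t + real (b 0))\<bar>)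
        \<le> wsum a l (\<phi> (m j)) n (t + real (b j)) - wsum a l (\<phi> (m j)) n (t + real (b 0))))"

text \<open>Words are chosen so that the bump at the level-\<open>q\<close> preimage belonging to one of them is not visited by
  the backward orbits of the others up to level \<open>R\<close>; an independent set in the visiting graph provides this.\<close>

lemma exists_transversal_tuple:
  fixes \<beta> :: "real \<Rightarrow> real"
  assumes a: "0 < a" "a \<le> 1 / 2" and l: "1 \<le> l" and per: "\<And>u. \<beta> (u + 1) = \<beta> u"
    and \<beta>: "\<And>u. 0 \<le> \<beta> u \<and> \<beta> u \<le> 1" and supp: "\<And>u. \<beta> u \<noteq> 0 \<Longrightarrow> \<exists>z::int. \<bar>u - of_int z\<bar> < \<rho>"
    and near: "\<And>u. \<bar>u\<bar> \<le> \<rho>1 \<Longrightarrow> 1 / 2 \<le> \<beta> u"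
    and N: "0 < N" "1 / real N \<le> \<rho>1" "1 / real N \<le> \<rho>" and \<rho>: "4 * \<rho> * real l ^ q \<le> 1" and q: "1 \<le> q" "q \<le> R" "q \<le> n"
    and kR: "2 * real k * a ^ R \<le> a ^ (q - 1) / 4"
    and B: "finite B" "inj_on (\<lambda>b. b mod l ^ q) B" "(2 * R + 1) * (k + 1) \<le> card B"
  shows "\<exists>b. b ` {..k} \<subseteq> B \<and> transversal_tuple l a (\<lambda>x u. \<beta> (u - real x / real N)) N k n (a ^ (q - 1) / 4) t b"
proof -
  define \<phi> where "\<phi> = (\<lambda>x u. \<beta> (u - real x / real N))"
  define w where "w = (\<lambda>b. (t + real b) / real l ^ q)"
  \<comment> \<open>The bumps are centred at the points \<open>x / N\<close>; \<open>m b\<close> is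
    the centre just below the level-\<open>q\<close> preimage \<open>w b\<close>, hence within
    \<open>1 / N\<close> of it modulo 1.\<close>
  define m where "m = (\<lambda>b. nat \<lfloor>frac (w b) * real N\<rfloor>)"
  have perz: "\<beta> (u + of_int z) = \<beta> u" for u z using periodic_int[of \<beta> 1 u z, OF per] by simp
  have mN: "m b < N" for b
  proof -
    have "frac (w b) * real N < 1 * real N" using N frac_lt_1 by (intro mult_strict_right_mono) auto
    then show ?thesis unfolding m_def using frac_ge_0[of "w b"] by (simp add: nat_less_iff floor_less_iff)
  qed
  have mclose: "\<bar>frac (w b) - real (m b) / real N\<bar> \<le> 1 / real N" for b
  proof -
    have "real (m b) = of_int \<lfloor>frac (w b) * real N\<rfloor>" unfolding m_def using frac_ge_0[of "w b"] by simp
    then have "\<bar>frac (w b) * real N - real (m b)\<bar> \<le> 1" by linarith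
    then have "\<bar>(frac (w b) * real N - real (m b)) / real N\<bar> \<le> 1 / real N" using N(1) by (simp add: abs_divide divide_right_mono)
    then show ?thesis using N(1) by (simp add: diff_divide_distrib)
  qed
  have \<phi>1: "1 / 2 \<le> \<phi> (m b) (w b)" for b
  proof -
    have "\<phi> (m b) (w b) = \<beta> (frac (w b) - real (m b) / real N + of_int \<lfloor>w b\<rfloor>)"
      by (simp add: \<phi>_def frac_def)
    also have "\<dots> = \<beta> (frac (w b) - real (m b) / real N)" by (rule perz)
    finally show ?thesis using near[OF order_trans[OF mclose N(2)]] by simp
  qed
  \<comment> \<open>Level-\<open>q\<close> preimages with different residues are at least
    \<open>1 / l ^ q\<close> apart modulo 1. Centres miss them by at most
    \<open>1 / N \<le> \<rho>\<close> and supports have radius \<rho>, so a common point would bring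
    two of them closer than \<open>4 * \<rho>\<close>.\<close>
  have uniq: "b = b'" if BB: "b \<in> B" "b' \<in> B" and nz: "\<phi> (m b) x \<noteq> 0" "\<phi> (m b') x \<noteq> 0" for b b' x
  proof -
    obtain z z' :: int where z: "\<bar>x - real (m b) / real N - of_int z\<bar> < \<rho>" "\<bar>x - real (m b') / real N - of_int z'\<bar> < \<rho>"
      using supp nz unfolding \<phi>_def by blast
    define y where "y = z - z' - \<lfloor>w b\<rfloor> + \<lfloor>w b'\<rfloor>"
    have "w b - w b' + of_int y = (frac (w b) - real (m b) / real N) - (frac (w b') - real (m b') / real N)
        - (x - real (m b) / real N - of_int z) + (x - real (m b') / real N - of_int z')"
      by (simp add: y_def frac_def)
    then have "\<bar>w b - w b' + of_int y\<bar> < 1 / real N + 1 / real N + \<rho> + \<rho>"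
      using mclose[of b] mclose[of b'] z by linarith
    then have "\<bar>w b - w b' + of_int y\<bar> < 4 * \<rho>" using N(3) by linarith
    moreover have L: "0 < real l ^ q" using l by simp
    ultimately have "\<bar>w b - w b' + of_int y\<bar> * real l ^ q < 4 * \<rho> * real l ^ q" by simp
    also have "\<dots> \<le> 1" by (rule \<rho>)
    finally have "\<bar>(w b - w b' + of_int y) * real l ^ q\<bar> < 1" using L by (simp add: abs_mult)
    moreover have "(w b - w b' + of_int y) * real l ^ q = of_int (int b - int b' + y * int l ^ q)"
      using L by (simp add: w_def field_simps)
    ultimately have "\<bar>of_int (int b - int b' + y * int l ^ q) :: real\<bar> < 1" by simp
    then have "int b - int b' + y * int l ^ q = 0" by linarith
    then have "int b' = int b + y * int l ^ q" by simp
    then have "int b' mod int (l ^ q) = int b mod int (l ^ q)" by simp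
    then have "b' mod l ^ q = b mod l ^ q" by (metis of_nat_eq_iff zmod_int)
    then show "b = b'" using inj_onD[OF B(2)] BB by metis
  qed
  \<comment> \<open>An edge from \<open>b\<close> to \<open>b'\<close> means that one of the first
    \<open>R\<close> preimages along \<open>b\<close> meets the bump of \<open>b'\<close>. By
    \<open>uniq\<close> each of these points lies in at most one of the chosen bumps, which bounds
    the out-degree.\<close>
  define E where "E = (\<lambda>b b'. \<exists>i<R. \<phi> (m b') ((t + real b) / real l ^ Suc i) \<noteq> 0)"
  have "\<exists>I\<subseteq>B. card I = k + 1 \<and> (\<forall>v\<in>I. \<forall>w\<in>I. v \<noteq> w \<longrightarrow> \<not> E v w)"
  proof (rule independent_set[OF B(1) _ B(3)])
    fix b assume "b \<in> B"
    define T where "T = {b'\<in>B. b' \<noteq> b \<and> E b b'}"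
    define f where "f = (\<lambda>b'. SOME i. i < R \<and> \<phi> (m b') ((t + real b) / real l ^ Suc i) \<noteq> 0)"
    have f: "f b' < R \<and> \<phi> (m b') ((t + real b) / real l ^ Suc (f b')) \<noteq> 0" if "b' \<in> T" for b'
    proof -
      have "\<exists>i. i < R \<and> \<phi> (m b') ((t + real b) / real l ^ Suc i) \<noteq> 0" using that unfolding T_def E_def by blast
      then show ?thesis unfolding f_def by (rule someI_ex)
    qed
    have "inj_on f T"
    proof (rule inj_onI)
      fix x y assume xy: "x \<in> T" "y \<in> T" "f x = f y"
      show "x = y" by (rule uniq[of x y "(t + real b) / real l ^ Suc (f x)"])
        (use xy f[OF xy(1)] f[OF xy(2)] in \<open>simp_all add: T_def\<close>)
    qed
    then have "card T \<le> card {..<R}" by (rule card_inj_on_le) (use f in auto)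
    then show "card {w \<in> B. w \<noteq> b \<and> E b w} \<le> R" by (simp add: T_def)
  qed
  then obtain I where I: "I \<subseteq> B" "card I = k + 1" and indep: "\<And>v w. v \<in> I \<Longrightarrow> w \<in> I \<Longrightarrow> v \<noteq> w \<Longrightarrow> \<not> E v w"
    by blast
  have "finite I" using I(1) B(1) finite_subset by blast
  then obtain b where b: "bij_betw b {0..<card I} I" using ex_bij_betw_nat_finite by blast
  have set: "{0..<card I} = {..k}" using I(2) by auto
  have binj: "inj_on b {..k}" and bI: "b j \<in> I" if "j \<le> k" for j
    using b that unfolding set bij_betw_def by auto
  define e where "e = 2 * a ^ R"
  define V where "V = (\<lambda>j j'. wsum a l (\<phi> (m (b j'))) n (t + real (b j)))"
  have \<phi>01: "0 \<le> \<phi> x u \<and> \<phi> x u \<le> 1" for x u using \<beta> by (simp add: \<phi>_def)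
  have V0: "0 \<le> V j j'" for j j' unfolding V_def using a \<phi>01 by (intro wsum_nonneg) auto
  have Ve: "V j j' \<le> e" if "j \<le> k" "j' \<le> k" "j \<noteq> j'" for j j'
    unfolding V_def e_def
  proof (rule wsum_tail_bound[OF a \<phi>01])
    fix i assume "i < R"
    have "b j \<noteq> b j'" using inj_onD[OF binj[OF le_refl]] that by (metis atMost_iff)
    then have "\<not> E (b j) (b j')" using indep bI that by blast
    then show "\<phi> (m (b j')) ((t + real (b j)) / real l ^ Suc i) = 0" using \<open>i < R\<close> by (auto simp: E_def)
  qed
  have Vd: "a ^ (q - 1) / 2 \<le> V j j" if "j \<le> k" for j
  proof -
    have "a ^ (q - 1) / 2 \<le> a ^ (q - 1) * \<phi> (m (b j)) ((t + real (b j)) / real l ^ Suc (q - 1))"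
      using \<phi>1[of "b j"] a q by (simp add: w_def)
    also have "\<dots> \<le> V j j" unfolding V_def wsum_def
      by (rule member_le_sum[of "q - 1" "{..<n}"]) (use q a \<phi>01 in auto)
    finally show ?thesis .
  qed
  have "inj_on (\<lambda>j. m (b j)) {1..k}"
  proof (rule inj_onI, rule ccontr)
    fix j j' assume j: "j \<in> {1..k}" "j' \<in> {1..k}" "m (b j) = m (b j')" "j \<noteq> j'"
    have "V j j' = V j j" using j(3) by (simp add: V_def)
    then have "a ^ (q - 1) / 2 \<le> 2 * a ^ R" using Ve[of j j'] Vd[of j] j by (simp add: e_def)
    moreover have "2 * a ^ R \<le> 2 * real k * a ^ R" using j a by (intro mult_right_mono) auto
    moreover have "0 < a ^ (q - 1)" using a by simp
    ultimately show False using kR by linarith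
  qed
  \<comment> \<open>The diagonal gets at least \<open>a ^ (q - 1) / 2\<close> from the visit at
    level \<open>q\<close>; the \<open>k - 1\<close> other entries and the contribution of the
    reference branch are tails of size at most \<open>2 * a ^ R\<close>, together at most half of
    that.\<close>
  moreover have "a ^ (q - 1) / 4 + (\<Sum>j'\<in>{1..k} - {j}. \<bar>V j j' - V 0 j'\<bar>) \<le> V j j - V 0 j" if j: "j \<in> {1..k}" for j
  proof -
    have "(\<Sum>j'\<in>{1..k} - {j}. \<bar>V j j' - V 0 j'\<bar>) \<le> (\<Sum>j'\<in>{1..k} - {j}. e)"
    proof (rule sum_mono)
      fix j' assume "j' \<in> {1..k} - {j}"
      then show "\<bar>V j j' - V 0 j'\<bar> \<le> e" using V0[of j j'] V0[of 0 j'] Ve[of j j'] Ve[of 0 j'] j by auto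
    qed
    also have "\<dots> = real (k - 1) * e" using j by simp
    finally have "(\<Sum>j'\<in>{1..k} - {j}. \<bar>V j j' - V 0 j'\<bar>) \<le> real (k - 1) * e" .
    moreover have "V 0 j \<le> e" using Ve[of 0 j] j by auto
    moreover have "a ^ (q - 1) / 2 \<le> V j j" using Vd[of j] j by auto
    moreover have "real (k - 1) * e + e \<le> a ^ (q - 1) / 4" using kR j by (simp add: e_def of_nat_diff algebra_simps)
    ultimately show ?thesis by linarith
  qed
  ultimately have "transversal_tuple l a \<phi> N k n (a ^ (q - 1) / 4) t b"
    unfolding transversal_tuple_def V_def using mN by (intro exI[of _ "\<lambda>j. m (b j)"]) auto
  moreover have "b ` {..k} \<subseteq> B" using bI I(1) by auto
  ultimately show ?thesis unfolding \<phi>_def by blast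
qed


lemma not_separatedE:
  assumes "\<not> separated l a g q K n d"
  obtains t B where "t \<in> {0..1}" "B \<subseteq> {..<l ^ n}" "inj_on (\<lambda>b. b mod l ^ q) B" "\<not> card B \<le> K"
    "\<forall>b\<in>B. \<forall>b'\<in>B. \<bar>wsum a l g n (t + real b) - wsum a l g n (t + real b')\<bar> < d"
proof -
  have "\<exists>t\<in>{0..1}. \<exists>B\<subseteq>{..<l ^ n}. inj_on (\<lambda>b. b mod l ^ q) B \<and>
      (\<forall>b\<in>B. \<forall>b'\<in>B. \<bar>wsum a l g n (t + real b) - wsum a l g n (t + real b')\<bar> < d) \<and> \<not> card B \<le> K"
    using assms unfolding separated_def by (simp only: not_all not_imp Bex_def Ball_def)
  then show ?thesis using that by fast
qed

text \<open>If every point of a parameter grid failed, each would satisfy a dominant system of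
  \<open>k\<close> inequalities for some base point on a grid of about \<open>1 / a ^ n\<close>
  points and some tuple of \<open>k + 1\<close> branches. One such system leaves at most
  \<open>L ^ (N - k)\<close> of the \<open>L ^ N\<close> parameters, with \<open>L\<close> of order
  \<open>1 / a ^ n\<close>, so the count would keep the \<open>n\<close>-th power of
  \<open>l ^ (k + 1) * a ^ (k - 1)\<close> away from 0.\<close>

lemma generic_separated:
  fixes \<beta> g :: "real \<Rightarrow> real"
  assumes a: "0 < a" "a \<le> 1 / 2" and l: "1 \<le> l" and per: "\<And>u. \<beta> (u + 1) = \<beta> u"
    and \<beta>: "\<And>u. 0 \<le> \<beta> u \<and> \<beta> u \<le> 1" and supp: "\<And>u. \<beta> u \<noteq> 0 \<Longrightarrow> \<exists>z::int. \<bar>u - of_int z\<bar> < \<rho>"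
    and near: "\<And>u. \<bar>u\<bar> \<le> \<rho>1 \<Longrightarrow> 1 / 2 \<le> \<beta> u"
    and N: "0 < N" "1 / real N \<le> \<rho>1" "1 / real N \<le> \<rho>" and \<rho>: "4 * \<rho> * real l ^ q \<le> 1" and q: "1 \<le> q" "q \<le> R"
    and kR: "2 * real k * a ^ R \<le> a ^ (q - 1) / 4"
    and k: "1 \<le> k" "real l ^ (k + 1) * a ^ (k - 1) < 1"
    and lipg: "\<And>u v. \<bar>g u - g v\<bar> \<le> A * \<bar>u - v\<bar>" and lip\<beta>: "\<And>u v. \<bar>\<beta> u - \<beta> v\<bar> \<le> N\<beta> * \<bar>u - v\<bar>"
    and \<epsilon>: "0 < \<epsilon>" and A1: "0 < A1"
  shows "\<exists>n1. \<forall>n\<ge>n1. \<exists>s. (\<forall>x<N. 0 \<le> s x \<and> s x \<le> \<epsilon>) \<and>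
    separated l a (\<lambda>u. g u + (\<Sum>x<N. s x * (\<beta> (u - real x / real N) - c))) q ((2 * R + 1) * (k + 1)) n (A1 * a ^ n)"
proof -
  define \<phi> where "\<phi> = (\<lambda>x u. \<beta> (u - real x / real N))"
  define K where "K = (2 * R + 1) * (k + 1)"
  \<comment> \<open>\<open>A2\<close> is a Lipschitz constant of every perturbed derivative. Moving
    \<open>t\<close> to the grid changes each of the two compared slopes by at most
    \<open>2 * A2 * a ^ n\<close>, whence the \<open>4 * A2\<close> in \<open>A3\<close>.\<close>
  define A2 where "A2 = A + real N * (\<epsilon> * N\<beta>)"
  define A3 where "A3 = A1 + 4 * A2"
  define D where "D = a ^ (q - 1) / 4"
  define c1 where "c1 = \<epsilon> * D / (3 * A3)"
  have A: "0 \<le> A" using lipg[of 1 0] by simp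
  have N\<beta>: "0 \<le> N\<beta>" using lip\<beta>[of 1 0] by simp
  have A2: "0 \<le> A2" using A N\<beta> \<epsilon> by (simp add: A2_def)
  have A3: "0 < A3" using A1 A2 by (simp add: A3_def)
  have D: "0 < D" using a by (simp add: D_def)
  have c1: "0 < c1" using \<epsilon> D A3 by (simp add: c1_def)
  have "(\<lambda>n. 3 * (2 / c1) ^ k * (real l ^ (k + 1) * a ^ (k - 1)) ^ n) \<longlonglongrightarrow> 3 * (2 / c1) ^ k * 0"
    using k a by (intro tendsto_intros LIMSEQ_realpow_zero) auto
  then have ev1: "\<forall>\<^sub>F n in sequentially. 3 * (2 / c1) ^ k * (real l ^ (k + 1) * a ^ (k - 1)) ^ n < 1"
    by (rule order_tendstoD) simp
  have "(\<lambda>n. a ^ n) \<longlonglongrightarrow> 0" using a by (intro LIMSEQ_realpow_zero) auto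
  then have ev2: "\<forall>\<^sub>F n in sequentially. a ^ n < c1 / 2" by (rule order_tendstoD) (use c1 in simp)
  from eventually_conj[OF ev1 eventually_conj[OF ev2 eventually_ge_at_top[of q]]]
  obtain n1 where n1: "\<And>n. n \<ge> n1 \<Longrightarrow> 3 * (2 / c1) ^ k * (real l ^ (k + 1) * a ^ (k - 1)) ^ n < 1 \<and> a ^ n < c1 / 2 \<and> q \<le> n"
    by (auto simp: eventually_sequentially)
  have main: "\<exists>s. (\<forall>x<N. 0 \<le> s x \<and> s x \<le> \<epsilon>) \<and>
    separated l a (\<lambda>u. g u + (\<Sum>x<N. s x * (\<phi> x u - c))) q K n (A1 * a ^ n)" if n: "n \<ge> n1" for n
  proof (rule ccontr)
    assume contra: "\<not> ?thesis"
    have nc: "\<not> separated l a (\<lambda>u. g u + (\<Sum>x<N. s x * (\<phi> x u - c))) q K n (A1 * a ^ n)"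
      if "\<And>x. x < N \<Longrightarrow> 0 \<le> s x \<and> s x \<le> \<epsilon>" for s
      using contra that by blast
    have n': "3 * (2 / c1) ^ k * (real l ^ (k + 1) * a ^ (k - 1)) ^ n < 1" "a ^ n < c1 / 2" "q \<le> n" using n1[OF n] by auto
    define \<alpha> where "\<alpha> = a ^ n"
    have \<alpha>: "0 < \<alpha>" "\<alpha> \<le> 1" using a by (auto simp: \<alpha>_def intro: power_le_one)
    \<comment> \<open>The factor 3 makes \<open>h * D\<close> exceed
      \<open>2 * A3 * \<alpha>\<close>, as needed for solutions on the grid with equal free
      coordinates to coincide.\<close>
    define h where "h = 3 * A3 * \<alpha> / D"
    have h: "0 < h" using A3 \<alpha> D by (simp add: h_def)
    have eh: "\<epsilon> / h = c1 / \<alpha>" using D A3 \<alpha> by (simp add: h_def c1_def field_simps)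
    define L where "L = nat \<lfloor>\<epsilon> / h\<rfloor>"
    have "2 < c1 / \<alpha>" using n'(2) \<alpha> by (simp add: \<alpha>_def less_divide_eq)
    then have e2: "2 < \<epsilon> / h" by (simp add: eh)
    have Lle: "real L \<le> \<epsilon> / h" unfolding L_def using e2 by simp
    have Lge: "c1 / (2 * \<alpha>) \<le> real L"
    proof -
      have "real L = of_int \<lfloor>\<epsilon> / h\<rfloor>" unfolding L_def using e2 by simp
      then have "\<epsilon> / h - 1 \<le> real L" by linarith
      moreover have "y / 2 \<le> x" if "y - 1 \<le> x" "2 < y" for x y :: real using that by linarith
      ultimately have "(\<epsilon> / h) / 2 \<le> real L" using e2 by blast
      then show ?thesis by (simp add: eh mult.commute)
    qed
    have L0: "0 < L" using Lge c1 \<alpha> by (metis divide_pos_pos gr0I less_le_not_le mult_pos_pos of_nat_0 zero_less_numeral)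
    define P where "P = nat \<lceil>1 / \<alpha>\<rceil>"
    have P1: "1 / \<alpha> \<le> real P" unfolding P_def using \<alpha> by (simp add: real_nat_ceiling_ge)
    have P0: "0 < real P" using P1 \<alpha> by (smt (verit) divide_pos_pos)
    have P3: "real P + 1 \<le> 3 / \<alpha>"
    proof -
      have "real P \<le> 1 / \<alpha> + 1" unfolding P_def using \<alpha> by (smt (verit) ceiling_correct divide_pos_pos of_nat_nat zero_le_ceiling)
      moreover have "1 \<le> 1 / \<alpha>" using \<alpha> by simp
      moreover have "x + 1 \<le> 3 * y" if "x \<le> y + 1" "1 \<le> y" for x y :: real using that by linarith
      ultimately have "real P + 1 \<le> 3 * (1 / \<alpha>)" by blast
      then show ?thesis by simp
    qed
    define Grid where "Grid = PiE {..<N} (\<lambda>_. {..<L})"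
    define gs where "gs = (\<lambda>s u. g u + (\<Sum>x<N. (h * real (s x)) * (\<phi> x u - c)))"
    define W where "W = (\<lambda>i b j x. wsum a l (\<phi> x) n (real i / real P + real (b j)) - wsum a l (\<phi> x) n (real i / real P + real (b (0::nat))))"
    define base where "base = (\<lambda>i b j. wsum a l g n (real i / real P + real (b j :: nat)) - wsum a l g n (real i / real P + real (b (0::nat))))"
    define Tr where "Tr = (\<lambda>i b. transversal_tuple l a \<phi> N k n D (real i / real P) b)"
    define Bad where "Bad = (\<lambda>i b. {s\<in>Grid. \<forall>j\<in>{1..k}. \<bar>base i b j + (\<Sum>x<N. h * real (s x) * W i b j x)\<bar> < A3 * \<alpha>})"
    define Idx where "Idx = {(i, b). i \<in> {..P} \<and> b \<in> PiE {..k} (\<lambda>_. {..<l ^ n}) \<and> Tr i b}"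
    have cover: "\<exists>(i, b)\<in>Idx. s \<in> Bad i b" if s: "s \<in> Grid" for s
    proof -
      have sL: "s x < L" if "x < N" for x using s that by (auto simp: Grid_def)
      have hs: "0 \<le> h * real (s x) \<and> h * real (s x) \<le> \<epsilon>" if "x < N" for x
      proof -
        have "h * real (s x) \<le> h * (\<epsilon> / h)" using sL[OF that] Lle h by (intro mult_left_mono) auto
        then show ?thesis using h by simp
      qed
      have "\<not> separated l a (gs s) q K n (A1 * a ^ n)"
        unfolding gs_def by (rule nc) (rule hs)
      then obtain t B where t: "t \<in> {0..1}" and B: "B \<subseteq> {..<l ^ n}" "inj_on (\<lambda>b. b mod l ^ q) B" "\<not> card B \<le> K"
        and close': "\<forall>b\<in>B. \<forall>b'\<in>B. \<bar>wsum a l (gs s) n (t + real b) - wsum a l (gs s) n (t + real b')\<bar> < A1 * a ^ n"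
        by (rule not_separatedE)
      have close: "\<bar>wsum a l (gs s) n (t + real b) - wsum a l (gs s) n (t + real b')\<bar> < A1 * \<alpha>" if "b \<in> B" "b' \<in> B" for b b'
        using close' that unfolding \<alpha>_def by (elim ballE) auto
      define i where "i = nat \<lfloor>t * real P\<rfloor>"
      define ti where "ti = real i / real P"
      have ireal: "real i = of_int \<lfloor>t * real P\<rfloor>" unfolding i_def using t by simp
      have "real i \<le> t * real P" unfolding ireal by linarith
      also have "\<dots> \<le> 1 * real P" using t by (intro mult_right_mono) auto
      finally have iP: "i \<le> P" by simp
      have "\<bar>t * real P - real i\<bar> \<le> 1" unfolding ireal by linarith
      then have "\<bar>(t * real P - real i) / real P\<bar> \<le> 1 / real P" using P0 by (simp add: abs_divide divide_right_mono)
      then have "\<bar>t - ti\<bar> \<le> 1 / real P" using P0 by (simp add: ti_def diff_divide_distrib)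
      also have "\<dots> \<le> \<alpha>" using P1 P0 \<alpha> by (simp add: field_simps)
      finally have tti: "\<bar>t - ti\<bar> \<le> \<alpha>" .
      have finB: "finite B" using B(1) finite_subset by blast
      have cB: "(2 * R + 1) * (k + 1) \<le> card B" using B(3) by (simp add: K_def)
      have "\<exists>b. b ` {..k} \<subseteq> B \<and> transversal_tuple l a \<phi> N k n D ti b"
        unfolding \<phi>_def D_def
        by (rule exists_transversal_tuple[where \<beta> = \<beta> and \<rho> = \<rho> and ?\<rho>1.0 = \<rho>1 and q = q and R = R];
            fact a l per \<beta> supp near N \<rho> q n' kR finB B cB)
      then obtain b where b: "b ` {..k} \<subseteq> B" "transversal_tuple l a \<phi> N k n D ti b" by blast
      define b' where "b' = restrict b {..k}"
      have b'P: "b' \<in> PiE {..k} (\<lambda>_. {..<l ^ n})" unfolding b'_def using b(1) B(1) by auto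
      have "Tr i b'"
        using b(2) unfolding Tr_def ti_def[symmetric] b'_def transversal_tuple_def by (elim exE) (intro exI, simp)
      then have idx: "(i, b') \<in> Idx" using iP b'P by (simp add: Idx_def)
      have lip: "\<bar>gs s u - gs s v\<bar> \<le> A2 * \<bar>u - v\<bar>" for u v
      proof -
        have "gs s u - gs s v = (g u - g v) + (\<Sum>x<N. (h * real (s x)) * (\<phi> x u - \<phi> x v))"
          unfolding gs_def by (simp add: sum_subtractf[symmetric] algebra_simps)
        also have "\<bar>\<dots>\<bar> \<le> A * \<bar>u - v\<bar> + (\<Sum>x<N. \<epsilon> * (N\<beta> * \<bar>u - v\<bar>))"
        proof (rule order_trans[OF abs_triangle_ineq], rule add_mono[OF lipg], rule order_trans[OF sum_abs], rule sum_mono)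
          fix x assume "x \<in> {..<N}"
          then have "\<bar>h * real (s x)\<bar> \<le> \<epsilon>" using hs[of x] by auto
          moreover have "\<bar>\<phi> x u - \<phi> x v\<bar> \<le> N\<beta> * \<bar>u - v\<bar>"
            unfolding \<phi>_def using lip\<beta>[of "u - real x / real N" "v - real x / real N"] by simp
          ultimately show "\<bar>h * real (s x) * (\<phi> x u - \<phi> x v)\<bar> \<le> \<epsilon> * (N\<beta> * \<bar>u - v\<bar>)"
            unfolding abs_mult[of "h * real (s x)"] using \<epsilon> by (intro mult_mono) auto
        qed
        also have "\<dots> = A2 * \<bar>u - v\<bar>" by (simp add: A2_def algebra_simps)
        finally show ?thesis .
      qed
      have wl: "\<bar>wsum a l (gs s) n (t + x) - wsum a l (gs s) n (ti + x)\<bar> \<le> 2 * A2 * \<alpha>" for x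
      proof -
        have "\<bar>wsum a l (gs s) n (t + x) - wsum a l (gs s) n (ti + x)\<bar> \<le> 2 * A2 * \<bar>(t + x) - (ti + x)\<bar>"
          using a l by (intro wsum_lipschitz lip) auto
        also have "\<dots> \<le> 2 * A2 * \<alpha>" using tti A2 by (intro mult_left_mono) auto
        finally show ?thesis .
      qed
      have "\<bar>base i b' j + (\<Sum>x<N. h * real (s x) * W i b' j x)\<bar> < A3 * \<alpha>" if j: "j \<in> {1..k}" for j
      proof -
        have "base i b' j + (\<Sum>x<N. h * real (s x) * W i b' j x) =
            wsum a l (gs s) n (ti + real (b j)) - wsum a l (gs s) n (ti + real (b 0))"
          unfolding gs_def wsum_perturbation base_def W_def ti_def b'_def using j by simp
        moreover have "\<bar>wsum a l (gs s) n (t + real (b j)) - wsum a l (gs s) n (t + real (b 0))\<bar> < A1 * \<alpha>"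
          using b(1) j by (intro close) auto
        ultimately show ?thesis using wl[of "real (b j)"] wl[of "real (b 0)"]
          unfolding A3_def by (simp add: distrib_right abs_less_iff abs_le_iff)
      qed
      then have "s \<in> Bad i b'" using s by (simp add: Bad_def)
      then show ?thesis using idx by blast
    qed
    have cardBad: "card (Bad i b) \<le> L ^ (N - k) \<and> k \<le> N" if ib: "(i, b) \<in> Idx" for i b
    proof -
      obtain m where m: "m ` {1..k} \<subseteq> {..<N}" "inj_on m {1..k}"
        "\<And>j. j \<in> {1..k} \<Longrightarrow> D + (\<Sum>j'\<in>{1..k} - {j}. \<bar>W i b j (m j')\<bar>) \<le> W i b j (m j)"
        using ib unfolding Idx_def Tr_def transversal_tuple_def W_def by blast
      have "card (Bad i b) \<le> L ^ (N - card {1..k})"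
      proof (rule card_lattice_solutions[OF _ m(1,2) _ m(3) D])
        show "2 * (A3 * \<alpha>) < h * D" using D A3 \<alpha> by (simp add: h_def)
      qed (auto simp: Bad_def Grid_def)
      moreover have "card {1..k} \<le> card {..<N}" using m by (intro card_inj_on_le) auto
      ultimately show ?thesis by simp
    qed
    have finIdx: "finite Idx" and cardIdx: "card Idx \<le> Suc P * (l ^ n) ^ (k + 1)"
    proof -
      have sub: "Idx \<subseteq> {..P} \<times> PiE {..k} (\<lambda>_. {..<l ^ n})" by (auto simp: Idx_def)
      have fin: "finite ({..P} \<times> PiE {..k} (\<lambda>_. {..<l ^ n}))" by (intro finite_cartesian_product finite_PiE) auto
      show "finite Idx" using finite_subset[OF sub fin] .
      have "card Idx \<le> card ({..P} \<times> PiE {..k} (\<lambda>_. {..<l ^ n}))" by (rule card_mono[OF fin sub])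
      also have "\<dots> = Suc P * (l ^ n) ^ (k + 1)" by (simp add: card_cartesian_product card_PiE)
      finally show "card Idx \<le> Suc P * (l ^ n) ^ (k + 1)" .
    qed
    have finGrid: "finite Grid" unfolding Grid_def by (intro finite_PiE) auto
    have cardGrid: "card Grid = L ^ N" by (simp add: Grid_def card_PiE)
    have "Grid \<noteq> {}" using L0 cardGrid by (metis card.empty less_numeral_extra(3) zero_less_power)
    then obtain i0 b0 where i0: "(i0, b0) \<in> Idx" using cover by blast
    have kN: "k \<le> N" using cardBad[OF i0] by simp
    have "L ^ N \<le> card (\<Union>(i, b)\<in>Idx. Bad i b)"
      unfolding cardGrid[symmetric]
    proof (rule card_mono)
      show "finite (\<Union>(i, b)\<in>Idx. Bad i b)" using finIdx finGrid by (auto simp: Bad_def)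
      show "Grid \<subseteq> (\<Union>(i, b)\<in>Idx. Bad i b)" using cover by blast
    qed
    also have "\<dots> \<le> (\<Sum>(i, b)\<in>Idx. card (Bad i b))"
      using card_UN_le[OF finIdx, of "\<lambda>(i, b). Bad i b"] by (simp add: case_prod_unfold)
    also have "\<dots> \<le> (\<Sum>(i, b)\<in>Idx. L ^ (N - k))" by (rule sum_mono) (use cardBad in auto)
    also have "\<dots> = card Idx * L ^ (N - k)" by simp
    also have "\<dots> \<le> Suc P * (l ^ n) ^ (k + 1) * L ^ (N - k)" using cardIdx by (rule mult_right_mono) simp
    finally have "L ^ k * L ^ (N - k) \<le> Suc P * (l ^ n) ^ (k + 1) * L ^ (N - k)" using kN by (simp flip: power_add)
    then have "L ^ k \<le> Suc P * (l ^ n) ^ (k + 1)" using L0 by simp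
    then have "real (L ^ k) \<le> real (Suc P * (l ^ n) ^ (k + 1))" by (simp only: of_nat_le_iff)
    then have up: "real L ^ k \<le> (real P + 1) * (real l ^ n) ^ (k + 1)" by (simp add: algebra_simps)
    have "(c1 / (2 * \<alpha>)) ^ k \<le> real L ^ k" using Lge c1 \<alpha> by (intro power_mono) auto
    also have "\<dots> \<le> 3 / \<alpha> * (real l ^ n) ^ (k + 1)"
      using up P3 by (rule order_trans[OF _ mult_right_mono]) simp
    finally have "(2 * \<alpha> / c1) ^ k * (c1 / (2 * \<alpha>)) ^ k \<le> (2 * \<alpha> / c1) ^ k * (3 / \<alpha> * (real l ^ n) ^ (k + 1))"
      using c1 \<alpha> by (intro mult_left_mono) auto
    moreover have "(2 * \<alpha> / c1) ^ k * (c1 / (2 * \<alpha>)) ^ k = 1"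
      using c1 \<alpha> by (simp add: power_mult_distrib[symmetric])
    ultimately have "1 \<le> (2 * \<alpha> / c1) ^ k * (3 / \<alpha> * (real l ^ n) ^ (k + 1))" by simp
    also have "(2 * \<alpha> / c1) ^ k * (3 / \<alpha> * (real l ^ n) ^ (k + 1)) = 3 * (2 / c1) ^ k * ((real l ^ n) ^ (k + 1) * \<alpha> ^ (k - 1))"
    proof -
      have "\<alpha> ^ k = \<alpha> * \<alpha> ^ (k - 1)" using k(1) by (cases k) auto
      then show ?thesis using \<alpha> by (simp add: power_divide power_mult_distrib)
    qed
    also have "(real l ^ n) ^ (k + 1) * \<alpha> ^ (k - 1) = (real l ^ (k + 1) * a ^ (k - 1)) ^ n"
      by (simp add: \<alpha>_def power_mult_distrib power_mult[symmetric] mult.commute)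
    finally show False using n'(1) by simp
  qed
  then show ?thesis unfolding \<phi>_def K_def by blast
qed

section \<open>Openness and density\<close>

lemma bounded_derivs_lipschitz:
  assumes "bounded_derivs UNIV (Suc p) M g"
  shows "\<bar>g u - g v\<bar> \<le> M * \<bar>u - v\<bar>"
proof -
  obtain g' where g': "\<forall>x\<in>UNIV. (g has_real_derivative g' x) (at x)" "bounded_derivs UNIV p M g'"
    using assms by (rule bounded_derivs_SucE)
  have b: "norm (g' x) \<le> M" for x using bounded_derivs_bound[OF g'(2)] by simp
  have "norm (g u - g v) \<le> M * norm (u - v)"
    using field_differentiable_bound[of UNIV g g' M u v] g'(1) b by simp
  then show ?thesis by simp
qed

section \<open>Lifts of functions on the circle\<close>

lemma of_circle_to_circle: "of_circle (to_circle x) - x \<in> \<int>"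
proof -
  have "to_circle (of_circle (to_circle x)) = to_circle x" using Quotient3_abs_rep[OF Quotient3_circle] by metis
  then show ?thesis by (simp add: to_circle_eq_iff)
qed

lemma circle_deriv_Suc: "circle_deriv (Suc k) f = deriv (circle_deriv k f)"
  by (simp add: circle_deriv_def)

lemma Cr_circle_has_deriv:
  assumes "f \<in> Cr_circle r" "k < r"
  shows "(circle_deriv k f has_real_derivative circle_deriv (Suc k) f x) (at x)"
proof -
  have "circle_deriv k f differentiable (at x)" using assms by (auto simp: Cr_circle_def differentiable_on_def)
  then have "circle_deriv k f field_differentiable (at x)" by (simp add: real_differentiable_def field_differentiable_def)
  then show ?thesis unfolding circle_deriv_Suc by (simp add: field_differentiable_derivI)
qed

lemma bounded_derivs_circle_deriv:
  assumes f: "f \<in> Cr_circle r" and B: "\<And>k x. k \<le> r \<Longrightarrow> \<bar>circle_deriv k f x\<bar> \<le> B"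
  shows "j \<le> r \<Longrightarrow> bounded_derivs UNIV (r - j) B (circle_deriv j f)"
proof (induction "r - j" arbitrary: j)
  case 0
  then have "j = r" by simp
  then show ?case using f B by (simp add: Cr_circle_def)
next
  case (Suc m)
  then have "bounded_derivs UNIV (r - Suc j) B (circle_deriv (Suc j) f)" by simp
  moreover have "r - j = Suc (r - Suc j)" using Suc by simp
  ultimately show ?case using Suc B Cr_circle_has_deriv[OF f]
    by (auto intro!: bounded_derivs_SucI[where g' = "circle_deriv (Suc j) f"])
qed

lemma circle_deriv_bounded_derivs:
  assumes "bounded_derivs UNIV r B (\<lambda>x. f (to_circle x))"
  shows "k \<le> r \<Longrightarrow> bounded_derivs UNIV (r - k) B (circle_deriv k f)"
proof (induction k)
  case 0 then show ?case using assms by (simp add: circle_deriv_def)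
next
  case (Suc k)
  have rk: "r - k = Suc (r - Suc k)" using Suc by simp
  obtain g' where g': "\<forall>x\<in>UNIV. (circle_deriv k f has_real_derivative g' x) (at x)" "bounded_derivs UNIV (r - Suc k) B g'"
    using Suc.IH Suc.prems unfolding rk by (auto elim: bounded_derivs_SucE)
  then have "circle_deriv (Suc k) f = g'" unfolding circle_deriv_Suc by (auto intro!: ext DERIV_imp_deriv)
  then show ?case using g' by simp
qed

lemma Cr_circleI:
  assumes "bounded_derivs UNIV r B (\<lambda>x. f (to_circle x))"
  shows "f \<in> Cr_circle r"
proof -
  have "circle_deriv k f differentiable_on UNIV" if kr: "k < r" for k
  proof -
    have rk: "r - k = Suc (r - Suc k)" using kr by simp
    obtain g' where "\<forall>x\<in>UNIV. (circle_deriv k f has_real_derivative g' x) (at x)"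
      using circle_deriv_bounded_derivs[OF assms less_imp_le[OF kr]] unfolding rk by (rule bounded_derivs_SucE) blast
    then show ?thesis unfolding differentiable_on_def real_differentiable_def by auto
  qed
  moreover have "continuous_on UNIV (circle_deriv k f)" if "k \<le> r" for k
    using bounded_derivs_continuous[OF circle_deriv_bounded_derivs[OF assms that]] .
  ultimately show ?thesis by (simp add: Cr_circle_def)
qed

lemma circle_deriv_bound:
  assumes "bounded_derivs UNIV r B (\<lambda>x. f (to_circle x))" "k \<le> r"
  shows "\<bar>circle_deriv k f x\<bar> \<le> B"
  using bounded_derivs_bound[OF circle_deriv_bounded_derivs[OF assms]] by simp

lemma Cr_circle_bounded:
  assumes f: "f \<in> Cr_circle r"
  obtains B where "\<And>k x. k \<le> r \<Longrightarrow> \<bar>circle_deriv k f x\<bar> \<le> B"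
proof -
  \<comment> \<open>The available bound concerns differences; comparison with the zero function
    yields one for \<open>f\<close> alone.\<close>
  have zero: "bounded_derivs UNIV r 0 (\<lambda>x. (\<lambda>_::circle. 0::real) (to_circle x))" by (rule bounded_derivs_const) simp
  have z0: "circle_deriv k (\<lambda>_. 0) x = 0" if "k \<le> r" for k x using circle_deriv_bound[OF zero that, of x] by simp
  have "\<exists>b. \<forall>x. \<bar>circle_deriv k f x\<bar> \<le> b" if "k \<le> r" for k
    using circle_deriv_bdd[OF f Cr_circleI[OF zero] that] z0[OF that] by (auto simp: bdd_above_def)
  then have "\<exists>b. \<forall>k\<le>r. \<forall>x. \<bar>circle_deriv k f x\<bar> \<le> b k" by metis
  then obtain b where b: "\<And>k x. k \<le> r \<Longrightarrow> \<bar>circle_deriv k f x\<bar> \<le> b k" by blast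
  show ?thesis
  proof (rule that[of "Max (b ` {..r})"])
    fix k x assume "k \<le> r"
    then show "\<bar>circle_deriv k f x\<bar> \<le> Max (b ` {..r})" using b[of k x] by (meson Max_ge atMost_iff finite_atMost finite_imageI imageI order_trans)
  qed
qed

lemma circle_deriv_add:
  assumes f: "f \<in> Cr_circle r" and g: "g \<in> Cr_circle r"
  shows "k \<le> r \<Longrightarrow> circle_deriv k (\<lambda>z. f z + g z) = (\<lambda>x. circle_deriv k f x + circle_deriv k g x)"
proof (induction k)
  case (Suc k)
  have "((\<lambda>x. circle_deriv k f x + circle_deriv k g x) has_real_derivative circle_deriv (Suc k) f x + circle_deriv (Suc k) g x) (at x)" for x
    using Suc by (intro DERIV_add Cr_circle_has_deriv[OF f] Cr_circle_has_deriv[OF g]) auto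
  then show ?case using Suc unfolding circle_deriv_Suc[of k "\<lambda>z. f z + g z"] by (auto intro!: ext DERIV_imp_deriv)
qed (simp add: circle_deriv_def)

lemma Cr_dist_pointwise:
  assumes "f \<in> Cr_circle r" "g \<in> Cr_circle r" "k \<le> r"
  shows "\<bar>circle_deriv k f x - circle_deriv k g x\<bar> \<le> Cr_dist r f g"
proof -
  let ?S = "\<lambda>k. SUP x. \<bar>circle_deriv k f x - circle_deriv k g x\<bar>"
  have le: "\<bar>circle_deriv k f x - circle_deriv k g x\<bar> \<le> ?S k" if "k \<le> r" for k x
    using circle_deriv_bdd[OF assms(1,2) that] by (rule cSUP_upper[OF UNIV_I])
  have "0 \<le> ?S k" if "k \<le> r" for k using le[OF that, of 0] by linarith
  then have "?S k \<le> (\<Sum>k\<le>r. ?S k)" using assms(3) by (intro member_le_sum) auto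
  then show ?thesis using le[OF assms(3), of x] assms by (simp add: Cr_dist_def)
qed

lemma Cr_dist_le:
  assumes "f \<in> Cr_circle r" "g \<in> Cr_circle r" "\<And>k x. k \<le> r \<Longrightarrow> \<bar>circle_deriv k f x - circle_deriv k g x\<bar> \<le> B"
  shows "Cr_dist r f g \<le> real (Suc r) * B"
proof -
  have "(\<Sum>k\<le>r. SUP x. \<bar>circle_deriv k f x - circle_deriv k g x\<bar>) \<le> (\<Sum>k\<le>r. B)"
    by (rule sum_mono, rule cSUP_least) (use assms in auto)
  then show ?thesis using assms by (simp add: Cr_dist_def)
qed

lemma periodic_antiderivative:
  assumes per: "\<And>u::real. \<beta> (u + 1) = (\<beta> u :: real)" and bd: "bounded_derivs UNIV p N \<beta>"
  shows "\<exists>\<Phi> c N'. (\<forall>u::real. \<Phi> (u + 1) = \<Phi> u) \<and> (\<forall>u. (\<Phi> has_real_derivative \<beta> u - c) (at u)) \<and> bounded_derivs UNIV (Suc p) N' \<Phi>"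
proof -
  have cont: "continuous_on UNIV \<beta>" using bounded_derivs_continuous[OF bd] .
  define c where "c = integral {0..1} \<beta>"
  have "\<exists>\<Phi>. \<forall>x. -\<infinity> < ereal x \<longrightarrow> ereal x < \<infinity> \<longrightarrow> (\<Phi> has_vector_derivative (\<beta> x - c)) (at x)"
    by (rule einterval_antiderivative) (use cont in \<open>auto simp: continuous_on_eq_continuous_at intro!: continuous_intros\<close>)
  then obtain \<Phi> where \<Phi>: "\<And>x. (\<Phi> has_real_derivative \<beta> x - c) (at x)"
    by (auto simp: has_real_derivative_iff_has_vector_derivative)
  have "((\<lambda>u. \<beta> u - c) has_integral \<Phi> 1 - \<Phi> 0) {0..1}"
    by (rule fundamental_theorem_of_calculus) (use \<Phi> in \<open>auto simp: has_real_derivative_iff_has_vector_derivative[symmetric] intro: has_field_derivative_at_within\<close>)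
  moreover have "((\<lambda>u. \<beta> u - c) has_integral c - c) {0..1}"
    using has_integral_const_real[of c 0 1] unfolding c_def
    by (intro has_integral_diff integrable_integral integrable_continuous_interval continuous_on_subset[OF cont]) auto
  ultimately have "\<Phi> 1 - \<Phi> 0 = c - c" by (rule has_integral_unique)
  then have eq: "\<Phi> 1 = \<Phi> 0" by simp
  have "((\<lambda>u. \<Phi> (u + 1) - \<Phi> u) has_real_derivative 0) (at u)" for u
  proof -
    have "((\<lambda>u. \<Phi> (u + 1)) has_real_derivative \<beta> u - c) (at u)"
      using \<Phi>[of "u + 1"] per[of u] DERIV_shift[of \<Phi> _ u 1] by simp
    from DERIV_diff[OF this \<Phi>] show ?thesis by simp
  qed
  then have "\<Phi> (u + 1) - \<Phi> u = \<Phi> (0 + 1) - \<Phi> 0" for u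
    using DERIV_isconst_all[of "\<lambda>u. \<Phi> (u + 1) - \<Phi> u" u 0] by blast
  then have per\<Phi>: "\<Phi> (u + 1) = \<Phi> u" for u using eq by simp
  have cont\<Phi>: "continuous_on {0..1} \<Phi>" by (intro continuous_at_imp_continuous_on ballI DERIV_isCont[OF \<Phi>])
  then have "bounded (\<Phi> ` {0..1})" by (intro compact_imp_bounded compact_continuous_image) auto
  then obtain b where "\<forall>x\<in>{0..1}. \<bar>\<Phi> x\<bar> \<le> b" by (auto simp: bounded_iff)
  then have b: "\<bar>\<Phi> x\<bar> \<le> b" if "x \<in> {0..1}" for x using that by blast
  have b': "\<bar>\<Phi> x\<bar> \<le> b" for x
  proof -
    have "\<Phi> x = \<Phi> (frac x + of_int \<lfloor>x\<rfloor> * 1)" by (simp add: frac_def)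
    also have "\<dots> = \<Phi> (frac x)" by (rule periodic_int[of \<Phi> 1, OF per\<Phi>])
    finally show ?thesis using b[of "frac x"] by (simp add: frac_ge_0 frac_lt_1 less_imp_le)
  qed
  have "bounded_derivs UNIV (Suc p) (max b (N + \<bar>c\<bar>)) \<Phi>"
  proof (rule bounded_derivs_SucI)
    show "bounded_derivs UNIV p (max b (N + \<bar>c\<bar>)) (\<lambda>u. \<beta> u - c)"
      by (rule bounded_derivs_mono[OF bounded_derivs_diff[OF bd bounded_derivs_const[OF order_refl]]]) simp
  qed (use b' \<Phi> in \<open>auto simp: le_max_iff_disj\<close>)
  then show ?thesis using per\<Phi> \<Phi> by blast
qed

text \<open>The order of choice matters. \<open>k\<close> depends only on \<open>l\<close> and
  \<open>lam\<close>, since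
  \<open>l ^ (k + 1) * (lam / l) ^ (k - 1) = l ^ 2 * lam ^ (k - 1)\<close>; then
  \<open>R - q\<close> is fixed in terms of \<open>k\<close>; after that
  \<open>(2 * R + 1) * (k + 1)\<close> is linear in \<open>q\<close> and falls below
  \<open>\<Gamma> ^ q\<close>.\<close>

lemma exists_parameters:
  assumes l: "2 \<le> l" and lam: "0 < lam" "lam < 1" and \<Gamma>: "1 < (\<Gamma>::real)"
  shows "\<exists>k q R. 1 \<le> k \<and> 1 \<le> q \<and> q \<le> R \<and> real l ^ (k + 1) * (lam / real l) ^ (k - 1) < 1 \<and>
    2 * real k * (lam / real l) ^ R \<le> (lam / real l) ^ (q - 1) / 4 \<and> real ((2 * R + 1) * (k + 1)) < \<Gamma> ^ q"
proof -
  define a where "a = lam / real l"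
  have l0: "0 < real l" using l by simp
  have a: "0 < a" "a < 1" using lam l by (auto simp: a_def divide_less_eq)
  have "(\<lambda>k. (real l)\<^sup>2 * lam ^ k) \<longlonglongrightarrow> (real l)\<^sup>2 * 0"
    using lam by (intro tendsto_intros LIMSEQ_realpow_zero) auto
  then have "\<forall>\<^sub>F k in sequentially. (real l)\<^sup>2 * lam ^ k < 1" by (rule order_tendstoD) simp
  then obtain k0 where k0: "(real l)\<^sup>2 * lam ^ k0 < 1" by (auto simp: eventually_sequentially)
  define k where "k = Suc k0"
  have k: "real l ^ (k + 1) * a ^ (k - 1) < 1"
    using k0 l0 by (simp add: k_def a_def power_divide power2_eq_square)
  have "(\<lambda>R. 8 * real k * a ^ R) \<longlonglongrightarrow> 8 * real k * 0"
    using a by (intro tendsto_intros LIMSEQ_realpow_zero) auto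
  then have "\<forall>\<^sub>F R in sequentially. 8 * real k * a ^ R < 1" by (rule order_tendstoD) simp
  then obtain R0 where R0: "8 * real k * a ^ R0 < 1" by (auto simp: eventually_sequentially)
  have "(\<lambda>q. (2 * (real q * (1 / \<Gamma>) ^ q) + (2 * real R0 + 1) * (1 / \<Gamma>) ^ q) * real (k + 1)) \<longlonglongrightarrow> (2 * 0 + (2 * real R0 + 1) * 0) * real (k + 1)"
    using \<Gamma> by (intro tendsto_intros LIMSEQ_realpow_zero powser_times_n_limit_0) auto
  then have "\<forall>\<^sub>F q in sequentially. (2 * (real q * (1 / \<Gamma>) ^ q) + (2 * real R0 + 1) * (1 / \<Gamma>) ^ q) * real (k + 1) < 1"
    by (rule order_tendstoD) simp
  from eventually_conj[OF this eventually_ge_at_top[of 1]]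
  obtain q where q: "(2 * (real q * (1 / \<Gamma>) ^ q) + (2 * real R0 + 1) * (1 / \<Gamma>) ^ q) * real (k + 1) < 1" "1 \<le> q"
    by (auto simp: eventually_sequentially)
  define R where "R = q + R0"
  have "real ((2 * R + 1) * (k + 1)) / \<Gamma> ^ q < 1"
    using q(1) by (simp add: R_def power_divide add_divide_distrib algebra_simps)
  then have 1: "real ((2 * R + 1) * (k + 1)) < \<Gamma> ^ q" using \<Gamma> by (simp add: divide_less_eq)
  have "a ^ R = a ^ (q - 1) * (a * a ^ R0)" using q(2) by (cases q) (simp_all add: R_def power_add)
  also have "\<dots> \<le> a ^ (q - 1) * a ^ R0" using a by (intro mult_left_mono) (auto simp: mult_left_le_one_le)
  finally have "2 * real k * a ^ R \<le> 2 * real k * (a ^ (q - 1) * a ^ R0)" by (intro mult_left_mono) auto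
  also have "\<dots> = a ^ (q - 1) / 4 * (8 * real k * a ^ R0)" by simp
  also have "\<dots> \<le> a ^ (q - 1) / 4 * 1" using R0 a by (intro mult_left_mono) auto
  finally have 2: "2 * real k * a ^ R \<le> a ^ (q - 1) / 4" by simp
  show ?thesis unfolding a_def[symmetric]
    using 1 2 k q(2) by (intro exI[of _ k] exI[of _ q] exI[of _ R]) (auto simp: k_def R_def)
qed

lemma wsum_uniform_bound:
  assumes g: "\<And>u. \<bar>g u - g' u\<bar> \<le> \<delta>" and a: "0 \<le> a" "a \<le> 1 / 2"
  shows "\<bar>wsum a l g n u - wsum a l g' n u\<bar> \<le> 2 * \<delta>"
proof -
  have \<delta>: "0 \<le> \<delta>" using g[of 0] by linarith
  have "\<bar>wsum a l g n u - wsum a l g' n u\<bar> \<le> (\<Sum>i<n. a ^ i * \<delta>)"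
    unfolding wsum_def sum_subtractf[symmetric] right_diff_distrib[symmetric]
    by (rule order_trans[OF sum_abs], rule sum_mono) (use a g in \<open>auto simp: abs_mult intro!: mult_left_mono\<close>)
  also have "\<dots> = (\<Sum>i<n. a ^ i) * \<delta>" by (simp add: sum_distrib_right)
  also have "\<dots> \<le> 2 * \<delta>"
  proof (rule mult_right_mono[OF _ \<delta>])
    have "(\<Sum>i<n. a ^ i) \<le> (\<Sum>i. a ^ i)" using a by (intro sum_le_suminf summable_geometric) auto
    also have "\<dots> = 1 / (1 - a)" using a by (intro suminf_geometric) auto
    also have "\<dots> \<le> 2" using a by (simp add: divide_le_eq)
    finally show "(\<Sum>i<n. a ^ i) \<le> 2" .
  qed
  finally show ?thesis .
qed

text \<open>The threshold \<open>32 * M * a ^ n\<close> absorbs the tail of the slope series beyond level \<open>n\<close>; the margin \<open>\<epsilon>\<close> makes the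
  condition open.\<close>

definition generic_set :: "nat \<Rightarrow> real \<Rightarrow> nat \<Rightarrow> nat \<Rightarrow> nat \<Rightarrow> (circle \<Rightarrow> real) set" where
  "generic_set l a r q K = {f \<in> Cr_circle r. \<exists>M>0. \<exists>n\<ge>q. \<exists>\<epsilon>>0. (\<forall>k\<le>r. \<forall>x. \<bar>circle_deriv k f x\<bar> \<le> M) \<and>
     separated l a (circle_deriv 1 f) q K n (32 * M * a ^ n + \<epsilon>)}"

lemma separated_mono: "separated l a g q K n d \<Longrightarrow> d' \<le> d \<Longrightarrow> separated l a g q K n d'"
  unfolding separated_def by (meson less_le_trans)

lemma openin_generic_set:
  assumes a: "0 < a" "a \<le> 1 / 2" and r: "1 \<le> r"
  shows "openin (Cr_topology r) (generic_set l a r q K)"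
  unfolding Cr_topology_def Metric_space.openin_mtopology[OF Metric_space_Cr]
proof (intro conjI allI impI)
  show "generic_set l a r q K \<subseteq> Cr_circle r" by (auto simp: generic_set_def)
  fix f assume "f \<in> generic_set l a r q K"
  then obtain M n \<epsilon> where f: "f \<in> Cr_circle r" and M: "0 < M" and n: "q \<le> n" and \<epsilon>: "0 < \<epsilon>"
    and bound: "\<And>k x. k \<le> r \<Longrightarrow> \<bar>circle_deriv k f x\<bar> \<le> M"
    and sep: "separated l a (circle_deriv 1 f) q K n (32 * M * a ^ n + \<epsilon>)"
    unfolding generic_set_def by blast
  \<comment> \<open>\<open>32 * \<delta> * a ^ n\<close> from the larger derivative bound and
    \<open>4 * \<delta>\<close> from two slopes, each off by \<open>2 * \<delta>\<close>, add up to
    at most \<open>36 * \<delta> = \<epsilon> / 2\<close>.\<close>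
  define \<delta> where "\<delta> = \<epsilon> / 72"
  have \<delta>: "0 < \<delta>" using \<epsilon> by (simp add: \<delta>_def)
  have "g \<in> generic_set l a r q K" if g: "g \<in> Cr_circle r" "Cr_dist r f g < \<delta>" for g
  proof -
    have close: "\<bar>circle_deriv k f x - circle_deriv k g x\<bar> \<le> \<delta>" if "k \<le> r" for k x
      using Cr_dist_pointwise[OF f g(1) that, of x] g(2) by linarith
    have "\<bar>circle_deriv k g x\<bar> \<le> M + \<delta>" if "k \<le> r" for k x
      using close[OF that, of x] bound[OF that, of x] by linarith
    moreover have "separated l a (circle_deriv 1 g) q K n (32 * (M + \<delta>) * a ^ n + \<epsilon> / 2)"
    proof (rule ccontr)
      assume "\<not> ?thesis"
      then obtain t B where tB: "t \<in> {0..1}" "B \<subseteq> {..<l ^ n}" "inj_on (\<lambda>b. b mod l ^ q) B" "\<not> card B \<le> K"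
        and cl: "\<forall>b\<in>B. \<forall>b'\<in>B. \<bar>wsum a l (circle_deriv 1 g) n (t + real b) - wsum a l (circle_deriv 1 g) n (t + real b')\<bar>
          < 32 * (M + \<delta>) * a ^ n + \<epsilon> / 2"
        by (rule not_separatedE)
      have an: "a ^ n \<le> 1" using a by (intro power_le_one) auto
      have "32 * \<delta> * a ^ n \<le> 32 * \<delta> * 1" using an \<delta> by (intro mult_left_mono) auto
      then have sm: "32 * (M + \<delta>) * a ^ n + \<epsilon> / 2 + 4 * \<delta> \<le> 32 * M * a ^ n + \<epsilon>"
        by (simp add: \<delta>_def algebra_simps)
      have w: "\<bar>wsum a l (circle_deriv 1 f) n u - wsum a l (circle_deriv 1 g) n u\<bar> \<le> 2 * \<delta>" for u
        using a close r by (intro wsum_uniform_bound) auto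
      have "\<bar>wsum a l (circle_deriv 1 f) n (t + real b) - wsum a l (circle_deriv 1 f) n (t + real b')\<bar> < 32 * M * a ^ n + \<epsilon>"
        if "b \<in> B" "b' \<in> B" for b b'
        using w[of "t + real b"] w[of "t + real b'"] cl[rule_format, OF that] sm by linarith
      then have "card B \<le> K" using sep tB(1-3) unfolding separated_def by blast
      then show False using tB(4) by blast
    qed
    ultimately show ?thesis unfolding generic_set_def mem_Collect_eq using g(1) M \<delta> n \<epsilon>
      by (intro conjI exI[of _ "M + \<delta>"] exI[of _ n] exI[of _ "\<epsilon> / 2"]) auto
  qed
  then show "\<exists>e>0. Metric_space.mball (Cr_circle r) (Cr_dist r) f e \<subseteq> generic_set l a r q K"
    using \<delta> by (intro exI[of _ \<delta>]) (auto simp: Metric_space.in_mball[OF Metric_space_Cr])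
qed

lemma dense_generic_set:
  assumes l: "2 \<le> l" and lam: "0 < lam" "lam < 1" and r: "2 \<le> r" and k: "1 \<le> k" "real l ^ (k + 1) * (lam / real l) ^ (k - 1) < 1"
    and q: "1 \<le> q" "q \<le> R" and kR: "2 * real k * (lam / real l) ^ R \<le> (lam / real l) ^ (q - 1) / 4"
  shows "Cr_topology r closure_of (generic_set l (lam / real l) r q ((2 * R + 1) * (k + 1))) = Cr_circle r"
proof -
  define a where "a = lam / real l"
  define K where "K = (2 * R + 1) * (k + 1)"
  define p where "p = r - 1"
  have rp: "r = Suc p" using r by (simp add: p_def)
  have a: "0 < a" "a \<le> 1 / 2"
  proof -
    show "0 < a" using lam l by (simp add: a_def)
    have "a \<le> 1 / real l" unfolding a_def using lam l by (intro divide_right_mono) auto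
    also have "\<dots> \<le> 1 / 2" using l by (intro divide_left_mono) auto
    finally show "a \<le> 1 / 2" .
  qed
  \<comment> \<open>\<open>4 * \<rho>\<close> is the spacing of the level-\<open>q\<close> preimages
    modulo 1.\<close>
  define \<rho> where "\<rho> = 1 / (4 * real l ^ q)"
  have lq: "1 \<le> real l ^ q" using l by (intro one_le_power) simp
  have lq0: "0 < real l ^ q" using lq by linarith
  have "1 / (4 * real l ^ q) \<le> 1 / (4 * 1)" using lq lq0 by (intro divide_left_mono mult_left_mono mult_pos_pos) simp_all
  then have \<rho>: "0 < \<rho>" "\<rho> < 1 / 2" "4 * \<rho> * real l ^ q \<le> 1" using lq0 unfolding \<rho>_def by simp_all
  obtain \<beta> N0 \<rho>1 where B: "(\<forall>u::real. \<beta> (u + 1) = (\<beta> u :: real)) \<and> (\<forall>u. 0 \<le> \<beta> u \<and> \<beta> u \<le> 1) \<and>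
    (\<forall>u. \<beta> u \<noteq> 0 \<longrightarrow> (\<exists>z::int. \<bar>u - of_int z\<bar> < \<rho>)) \<and> 0 < \<rho>1 \<and> (\<forall>u. \<bar>u\<bar> \<le> \<rho>1 \<longrightarrow> 1 / 2 \<le> \<beta> u) \<and>
    bounded_derivs UNIV p N0 \<beta>"
    using periodic_bump[OF \<rho>(1,2), of p] by (elim exE)
  have per: "\<beta> (u + 1) = \<beta> u" and \<beta>: "0 \<le> \<beta> u \<and> \<beta> u \<le> 1"
    and supp: "\<beta> u \<noteq> 0 \<Longrightarrow> \<exists>z::int. \<bar>u - of_int z\<bar> < \<rho>" and near: "\<bar>u\<bar> \<le> \<rho>1 \<Longrightarrow> 1 / 2 \<le> \<beta> u" for u
    using B by blast+
  have \<rho>1: "0 < \<rho>1" and bd: "bounded_derivs UNIV p N0 \<beta>" using B by blast+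
  obtain \<Phi> c N1 where P: "(\<forall>u::real. \<Phi> (u + 1) = \<Phi> u) \<and> (\<forall>u. (\<Phi> has_real_derivative \<beta> u - c) (at u)) \<and> bounded_derivs UNIV r N1 \<Phi>"
    using periodic_antiderivative[OF per bd] unfolding rp by (elim exE)
  have per\<Phi>: "\<Phi> (u + 1) = \<Phi> u" and \<Phi>': "(\<Phi> has_real_derivative \<beta> u - c) (at u)" for u
    using P by blast+
  have bd\<Phi>: "bounded_derivs UNIV r N1 \<Phi>" using P by blast
  have N1: "0 \<le> N1" using bounded_derivs_nonneg[OF bd\<Phi>] by simp
  obtain N where N: "0 < N" "1 / real N \<le> \<rho>1" "1 / real N \<le> \<rho>"
  proof -
    obtain N where N: "0 < N" "1 / real N < min \<rho>1 \<rho>"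
      using real_arch_invD[of "min \<rho>1 \<rho>"] \<rho>1 \<rho>(1) by (auto simp: inverse_eq_divide)
    then show ?thesis using that by auto
  qed
  have lip\<beta>: "\<bar>\<beta> u - \<beta> v\<bar> \<le> N0 * \<bar>u - v\<bar>" for u v
  proof -
    have "p = Suc (p - 1)" using r by (simp add: p_def)
    then show ?thesis using bounded_derivs_lipschitz[of "p - 1" N0 \<beta> u v] bd by metis
  qed
  have "\<exists>f\<in>generic_set l a r q K. Cr_dist r f0 f < e" if f0: "f0 \<in> Cr_circle r" and e: "0 < e" for f0 e
  proof -
    obtain M0 where M0: "\<And>k x. k \<le> r \<Longrightarrow> \<bar>circle_deriv k f0 x\<bar> \<le> M0" using Cr_circle_bounded[OF f0] by blast
    have M00: "0 \<le> M0" using M0[of 0 0] by simp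
    \<comment> \<open>The bound \<open>M\<close> enters the threshold of separation and so must be
      fixed before the perturbation, whose derivatives are kept at most 1.\<close>
    define M where "M = M0 + 1"
    \<comment> \<open>\<open>N1\<close> bounds the primitive of a bump together with its
      derivatives; summed over \<open>N\<close> bumps the perturbation stays at most 1, and at most
      half of \<open>e\<close> in the metric, which adds up \<open>r + 1\<close> suprema.\<close>
    define \<epsilon> where "\<epsilon> = min 1 (e / (2 * real (Suc r))) / (real N * (N1 + 1))"
    have NN: "0 < real N * (N1 + 1)" using N(1) N1 by simp
    have \<epsilon>: "0 < \<epsilon>" unfolding \<epsilon>_def using e NN by (intro divide_pos_pos) auto
    have \<epsilon>b: "real N * (\<epsilon> * N1) \<le> min 1 (e / (2 * real (Suc r)))"
    proof -
      have "real N * (\<epsilon> * N1) \<le> \<epsilon> * (real N * (N1 + 1))" using \<epsilon> N1 by (simp add: algebra_simps)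
      also have "\<dots> = min 1 (e / (2 * real (Suc r)))"
        unfolding \<epsilon>_def by (rule nonzero_eq_divide_eq[THEN iffD1, OF _ refl]) (use NN in linarith)
      finally show ?thesis .
    qed
    have lipg: "\<bar>circle_deriv 1 f0 u - circle_deriv 1 f0 v\<bar> \<le> M0 * \<bar>u - v\<bar>" for u v
    proof -
      have "bounded_derivs UNIV (r - 1) M0 (circle_deriv 1 f0)"
        using r by (intro bounded_derivs_circle_deriv[OF f0 M0]) auto
      moreover have "r - 1 = Suc (r - 2)" using r by simp
      ultimately show ?thesis using bounded_derivs_lipschitz by metis
    qed
    \<comment> \<open>The threshold is one \<open>a ^ n\<close> above the required one; the surplus
      becomes the margin \<epsilon> in \<open>generic_set\<close>.\<close>
    obtain n1 where n1: "\<And>n. n \<ge> n1 \<Longrightarrow> \<exists>s. (\<forall>x<N. 0 \<le> s x \<and> s x \<le> \<epsilon>) \<and>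
      separated l a (\<lambda>u. circle_deriv 1 f0 u + (\<Sum>x<N. s x * (\<beta> (u - real x / real N) - c))) q K n ((32 * M + 1) * a ^ n)"
    proof -
      have "\<exists>n1. \<forall>n\<ge>n1. \<exists>s. (\<forall>x<N. 0 \<le> s x \<and> s x \<le> \<epsilon>) \<and>
        separated l a (\<lambda>u. circle_deriv 1 f0 u + (\<Sum>x<N. s x * (\<beta> (u - real x / real N) - c))) q ((2 * R + 1) * (k + 1)) n ((32 * M + 1) * a ^ n)"
      proof (rule generic_separated[where \<rho> = \<rho> and ?\<rho>1.0 = \<rho>1])
        show "1 \<le> l" using l by simp
        show "0 < 32 * M + 1" using M00 by (simp add: M_def)
        show "2 * real k * a ^ R \<le> a ^ (q - 1) / 4" "real l ^ (k + 1) * a ^ (k - 1) < 1"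
          using kR k(2) by (simp_all add: a_def)
      qed (fact a per \<beta> supp near N \<rho> q k lipg lip\<beta> \<epsilon>)+
      then show ?thesis using that unfolding K_def by blast
    qed
    define n where "n = max n1 q"
    obtain s where s: "\<And>x. x < N \<Longrightarrow> 0 \<le> s x \<and> s x \<le> \<epsilon>"
      and sep: "separated l a (\<lambda>u. circle_deriv 1 f0 u + (\<Sum>x<N. s x * (\<beta> (u - real x / real N) - c))) q K n ((32 * M + 1) * a ^ n)"
      using n1[of n] by (auto simp: n_def)
    \<comment> \<open>\<open>of_circle\<close> selects some representative; periodicity of \<Phi>
      makes the choice immaterial, as \<open>lift\<close> records.\<close>
    define g where "g = (\<lambda>z. \<Sum>x<N. s x * \<Phi> (of_circle z - real x / real N))"
    have lift: "(\<lambda>x. g (to_circle x)) = (\<lambda>u. \<Sum>x<N. s x * \<Phi> (u - real x / real N))"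
    proof
      fix u
      obtain z :: int where z: "of_circle (to_circle u) = u + of_int z"
        using of_circle_to_circle[of u] by (metis Ints_cases add.commute diff_add_cancel)
      have "\<Phi> (of_circle (to_circle u) - real x / real N) = \<Phi> (u - real x / real N)" for x
        using periodic_int[of \<Phi> 1 "u - real x / real N" z, OF per\<Phi>] by (simp add: z algebra_simps)
      then show "g (to_circle u) = (\<Sum>x<N. s x * \<Phi> (u - real x / real N))" by (simp add: g_def)
    qed
    have "bounded_derivs UNIV r (\<Sum>x<N. \<bar>s x\<bar> * N1) (\<lambda>u. \<Sum>x<N. s x * \<Phi> (1 * u + (- (real x / real N))))"
      by (intro bounded_derivs_sum bounded_derivs_cmult bounded_derivs_affine_contract bd\<Phi>) auto
    then have "bounded_derivs UNIV r (\<Sum>x<N. \<bar>s x\<bar> * N1) (\<lambda>x. g (to_circle x))" unfolding lift by simp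
    moreover have "(\<Sum>x<N. \<bar>s x\<bar> * N1) \<le> real N * (\<epsilon> * N1)"
    proof -
      have "(\<Sum>x<N. \<bar>s x\<bar> * N1) \<le> (\<Sum>x<N. \<epsilon> * N1)"
        by (rule sum_mono) (use s N1 in \<open>auto intro!: mult_right_mono\<close>)
      then show ?thesis by simp
    qed
    ultimately have bdg: "bounded_derivs UNIV r (real N * (\<epsilon> * N1)) (\<lambda>x. g (to_circle x))"
      by (rule bounded_derivs_mono)
    have g: "g \<in> Cr_circle r" by (rule Cr_circleI[OF bdg])
    define f where "f = (\<lambda>z. f0 z + g z)"
    have dadd: "circle_deriv k f = (\<lambda>x. circle_deriv k f0 x + circle_deriv k g x)" if "k \<le> r" for k
      unfolding f_def by (rule circle_deriv_add[OF f0 g that])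
    have gb: "\<bar>circle_deriv k g x\<bar> \<le> min 1 (e / (2 * real (Suc r)))" if "k \<le> r" for k x
      using circle_deriv_bound[OF bdg that, of x] \<epsilon>b by linarith
    have fb: "\<bar>circle_deriv k f x\<bar> \<le> M" if "k \<le> r" for k x
      unfolding dadd[OF that] M_def using gb[OF that, of x] M0[OF that, of x] by linarith
    have f: "f \<in> Cr_circle r"
    proof (rule Cr_circleI)
      have "bounded_derivs UNIV (r - 0) M0 (circle_deriv 0 f0)" by (rule bounded_derivs_circle_deriv[OF f0 M0]) auto
      then have "bounded_derivs UNIV r M0 (\<lambda>x. f0 (to_circle x))" by (simp add: circle_deriv_def)
      from bounded_derivs_add[OF this bdg]
      show "bounded_derivs UNIV r (M0 + real N * (\<epsilon> * N1)) (\<lambda>x. f (to_circle x))" by (simp add: f_def)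
    qed
    have "Cr_dist r f0 f \<le> real (Suc r) * (e / (2 * real (Suc r)))"
    proof (rule Cr_dist_le[OF f0 f])
      fix k x assume k: "k \<le> r"
      have "\<bar>circle_deriv k f0 x - circle_deriv k f x\<bar> = \<bar>circle_deriv k g x\<bar>" unfolding dadd[OF k] by simp
      then show "\<bar>circle_deriv k f0 x - circle_deriv k f x\<bar> \<le> e / (2 * real (Suc r))" using gb[OF k, of x] by linarith
    qed
    also have "\<dots> = e / 2"
    proof -
      have "x * (e / (2 * x)) = e / 2" if "x \<noteq> 0" for x :: real using that by simp
      from this[of "real (Suc r)"] show ?thesis by linarith
    qed
    also have "\<dots> < e" using e by simp
    finally have dist: "Cr_dist r f0 f < e" .
    have "circle_deriv 1 g u = (\<Sum>x<N. s x * (\<beta> (u - real x / real N) - c))" for u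
    proof -
      have "((\<lambda>u. \<Sum>x<N. s x * \<Phi> (u - real x / real N)) has_real_derivative (\<Sum>x<N. s x * (\<beta> (u - real x / real N) - c))) (at u)"
      proof (intro DERIV_sum DERIV_cmult)
        fix x
        show "((\<lambda>u. \<Phi> (u - real x / real N)) has_real_derivative \<beta> (u - real x / real N) - c) (at u)"
          using \<Phi>'[of "u + (- (real x / real N))"] DERIV_shift[of \<Phi> _ u "- (real x / real N)"] by simp
      qed
      then show ?thesis unfolding circle_deriv_def by (simp add: lift DERIV_imp_deriv)
    qed
    then have "circle_deriv 1 f = (\<lambda>u. circle_deriv 1 f0 u + (\<Sum>x<N. s x * (\<beta> (u - real x / real N) - c)))"
      using dadd[of 1] r by simp
    then have "separated l a (circle_deriv 1 f) q K n (32 * M * a ^ n + a ^ n)"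
      using sep by (simp add: distrib_right)
    moreover have "q \<le> n" "0 < a ^ n" "0 < M" using a M00 by (auto simp: n_def M_def)
    ultimately have "f \<in> generic_set l a r q K"
      unfolding generic_set_def mem_Collect_eq using f fb
      by (intro conjI exI[of _ M] exI[of _ n] exI[of _ "a ^ n"]) auto
    then show ?thesis using dist by blast
  qed
  then show ?thesis
    unfolding Cr_topology_def Metric_space.metric_closure_of[OF Metric_space_Cr] a_def[symmetric] K_def[symmetric]
    by (fastforce simp: Metric_space.in_mball[OF Metric_space_Cr] generic_set_def)
qed

section \<open>Fourier transform of the SBR measure\<close>

lemma continuous_on_circle_iff:
  "continuous_on UNIV (g :: circle \<Rightarrow> 'a::topological_space) \<longleftrightarrow> continuous_on UNIV (\<lambda>x. g (to_circle x))"
proof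
  assume "continuous_on UNIV g"
  then show "continuous_on UNIV (\<lambda>x. g (to_circle x))"
    using continuous_on_compose2[OF _ continuous_on_to_circle, of UNIV g] by simp
next
  assume c: "continuous_on UNIV (\<lambda>x. g (to_circle x))"
  show "continuous_on UNIV g"
  proof (rule continuous_on_open_vimage[OF open_UNIV, THEN iffD2], intro allI impI)
    fix B :: "'a set" assume "open B"
    then have "open ((\<lambda>x. g (to_circle x)) -` B \<inter> UNIV)"
      using c continuous_on_open_vimage[OF open_UNIV] by blast
    then show "open (g -` B \<inter> UNIV)" by (simp add: open_circle_def vimage_def)
  qed
qed

lemma to_circle_measurable [measurable]: "to_circle \<in> borel_measurable borel"
  by (rule borel_measurable_continuous_onI[OF continuous_on_to_circle])

interpretation restricted_unit: prob_space "restrict_space lborel {0..<1::real}"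
  by (rule prob_spaceI) (simp add: emeasure_restrict_space space_restrict_space)

lemma prob_space_circle_lborel: "prob_space circle_lborel"
  unfolding circle_lborel_def
  by (rule restricted_unit.prob_space_distr) (simp add: measurable_restrict_space1)

interpretation circle_lborel: prob_space circle_lborel by (rule prob_space_circle_lborel)

interpretation cylinder: pair_sigma_finite circle_lborel "lborel :: real measure" ..

lemma sets_circle_lborel [measurable_cong, simp]: "sets circle_lborel = sets borel"
  by (simp add: circle_lborel_def)

lemma space_circle_lborel [simp]: "space circle_lborel = UNIV"
  by (simp add: circle_lborel_def)

lemma integral_circle_lborel:
  fixes u :: "circle \<Rightarrow> complex"
  assumes u: "u \<in> borel_measurable borel" and c: "continuous_on UNIV (\<lambda>x. u (to_circle x))"
  shows "(\<integral>c. u c \<partial>circle_lborel) = integral {0..1} (\<lambda>x. u (to_circle x))"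
proof -
  have cm: "(\<lambda>x. u (to_circle x)) \<in> borel_measurable borel" using u by simp
  have "(\<integral>c. u c \<partial>circle_lborel) = (\<integral>x. u (to_circle x) \<partial>restrict_space lborel {0..<1})"
    unfolding circle_lborel_def
    by (rule integral_distr) (use u in \<open>auto intro: measurable_restrict_space1\<close>)
  also have "\<dots> = (\<integral>x. indicator {0..<1} x *\<^sub>R u (to_circle x) \<partial>lborel)"
    by (rule integral_restrict_space) simp
  also have "\<dots> = (\<integral>x. indicator {0..1} x *\<^sub>R u (to_circle x) \<partial>lborel)"
  proof (rule integral_cong_AE)
    have "AE x in lborel. x \<noteq> (1::real)" by (rule AE_lborel_singleton)
    then show "AE x in lborel. indicator {0..<1} x *\<^sub>R u (to_circle x) = indicator {0..1} x *\<^sub>R u (to_circle x)"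
      by eventually_elim (auto simp: indicator_def)
  qed (use cm in measurable)
  also have "\<dots> = (LINT x : {0..1} | lborel. u (to_circle x))" by (simp add: set_lebesgue_integral_def)
  also have "\<dots> = integral {0..1} (\<lambda>x. u (to_circle x))"
    by (intro set_borel_integral_eq_integral borel_integrable_atLeastAtMost' continuous_on_subset[OF c]) auto
  finally show ?thesis .
qed

definition mode :: "int \<Rightarrow> real \<Rightarrow> circle \<times> real \<Rightarrow> complex" where
  "mode \<xi> \<eta> z = circle_character \<xi> (fst z) * exp (- (\<i> * complex_of_real (\<eta> * snd z)))"

definition charfun :: "(circle \<times> real) measure \<Rightarrow> int \<Rightarrow> real \<Rightarrow> complex" where
  "charfun \<mu> \<xi> \<eta> = (\<integral>z. mode \<xi> \<eta> z \<partial>\<mu>)"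

lemma circle_character_eq: "circle_character \<xi> (to_circle x) = cis (- (2 * pi * of_int \<xi> * x))"
  by (simp add: circle_character.abs_eq cis_conv_exp)

lemma continuous_on_circle_character: "continuous_on UNIV (circle_character \<xi>)"
  unfolding continuous_on_circle_iff circle_character_eq by (intro continuous_intros)

lemma circle_times_eq: "circle_times l (to_circle x) = to_circle (real l * x)"
  by (simp add: circle_times.abs_eq)

lemma continuous_on_mode: "continuous_on A (mode \<xi> \<eta>)"
  unfolding mode_def[abs_def]
  by (intro continuous_intros continuous_on_compose2[OF continuous_on_circle_character]) auto

lemma mode_measurable [measurable]: "mode \<xi> \<eta> \<in> borel_measurable borel"
  by (intro borel_measurable_continuous_onI continuous_on_mode)

lemma mode_eq: "mode \<xi> \<eta> (c, y) = circle_character \<xi> c * cis (- (\<eta> * y))"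
  by (simp add: mode_def cis_conv_exp)

lemma cmod_circle_character [simp]: "cmod (circle_character \<xi> c) = 1"
proof -
  obtain x where "c = to_circle x" using surj_to_circle by (metis surjD)
  then show ?thesis by (simp add: circle_character_eq)
qed

lemma cmod_mode [simp]: "cmod (mode \<xi> \<eta> z) = 1"
  by (cases z) (simp add: mode_eq norm_mult)

lemma integral_empirical_measure:
  fixes \<phi> :: "'a::topological_space \<Rightarrow> real"
  assumes "\<phi> \<in> borel_measurable borel"
  shows "(\<integral>z. \<phi> z \<partial>empirical_measure T z0 n) = (\<Sum>k<n. \<phi> ((T ^^ k) z0)) / real n"
  unfolding empirical_measure_def
  by (subst integral_distr) (use assms in \<open>auto simp: integral_uniform_count_measure measurable_def sets_uniform_count_measure space_uniform_count_measure\<close>)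

text \<open>Initial points range over a product set of mass one, so that the fibre coordinate splits
  off in the integrals of the modes.\<close>

definition test_box :: "(circle \<times> real) set" where "test_box = UNIV \<times> {0..1}"

lemma test_box_sets [measurable]: "test_box \<in> sets cylinder_lborel"
  unfolding test_box_def cylinder_lborel_def by (intro pair_measureI) auto

lemma emeasure_test_box: "emeasure cylinder_lborel test_box = 1"
  unfolding test_box_def cylinder_lborel_def
  using lborel.emeasure_pair_measure_Times[of UNIV circle_lborel "{0..1::real}"] circle_lborel.emeasure_space_1 by simp

lemma measure_test_box [simp]: "measure cylinder_lborel test_box = 1"
  by (simp add: measure_def emeasure_test_box)

lemma integrable_test_box:
  fixes g :: "circle \<times> real \<Rightarrow> 'b::{banach, second_countable_topology}"
  assumes "g \<in> borel_measurable cylinder_lborel" "\<And>z. norm (g z) \<le> B"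
  shows "integrable cylinder_lborel (\<lambda>z. indicator test_box z *\<^sub>R g z)"
proof (rule Bochner_Integration.integrable_bound)
  show "integrable cylinder_lborel (\<lambda>z. indicator test_box z * B)"
    by (intro integrable_mult_left integrable_real_indicator) (auto simp: emeasure_test_box)
  show "(\<lambda>z. indicator test_box z *\<^sub>R g z) \<in> borel_measurable cylinder_lborel" using assms by measurable
  show "AE z in cylinder_lborel. norm (indicator test_box z *\<^sub>R g z) \<le> norm (indicator test_box z * B)"
    by (rule AE_I2) (use assms(2) in \<open>auto simp: indicator_def intro: order_trans[OF _ abs_ge_self]\<close>)
qed

text \<open>The SBR property, integrated over initial points in the box, identifies the integrals of \<open>\<mu>\<close> as Cesaro limits.\<close>

lemma SBR_cesaro:
  fixes \<phi> :: "circle \<times> real \<Rightarrow> real"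
  assumes SBR: "is_SBR_measure T \<mu>" and \<phi>: "continuous_on UNIV \<phi>" "\<And>z. \<bar>\<phi> z\<bar> \<le> B"
  shows "(\<lambda>n. (\<Sum>k<n. \<integral>z. indicator test_box z *\<^sub>R \<phi> ((T ^^ k) z) \<partial>cylinder_lborel) / real n) \<longlonglongrightarrow> (\<integral>z. \<phi> z \<partial>\<mu>)"
proof -
  note sets_cylinder_lborel [measurable_cong]
  have T [measurable]: "T \<in> borel \<rightarrow>\<^sub>M borel"
    using SBR by (auto simp: is_SBR_measure_def ergodic_measure_def invariant_measure_def)
  have Tk [measurable]: "(T ^^ k) \<in> borel \<rightarrow>\<^sub>M borel" for k
    by (induction k) (auto intro: measurable_comp[unfolded o_def] simp: o_def)
  have \<phi>m [measurable]: "\<phi> \<in> borel_measurable borel" by (rule borel_measurable_continuous_onI[OF \<phi>(1)])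
  define avg where "avg = (\<lambda>n z. (\<Sum>k<n. \<phi> ((T ^^ k) z)) / real n)"
  have B: "0 \<le> B" using \<phi>(2)[of undefined] by linarith
  have avgB: "\<bar>avg n z\<bar> \<le> B" for n z
  proof -
    have "\<bar>\<Sum>k<n. \<phi> ((T ^^ k) z)\<bar> \<le> (\<Sum>k<n. B)" by (rule order_trans[OF sum_abs], rule sum_mono) (rule \<phi>(2))
    then show ?thesis using B by (cases "n = 0") (auto simp: avg_def abs_divide divide_le_eq mult.commute)
  qed
  have conv: "AE z in cylinder_lborel. (\<lambda>n. avg n z) \<longlonglongrightarrow> (\<integral>z. \<phi> z \<partial>\<mu>)"
  proof -
    have "bounded (range \<phi>)" using \<phi>(2) by (auto simp: bounded_iff)
    moreover have "AE z in cylinder_lborel. converges_weakly (empirical_measure T z) \<mu>"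
      using SBR by (simp add: is_SBR_measure_def)
    ultimately show ?thesis
      using \<phi>(1) by (auto simp: converges_weakly_def integral_empirical_measure avg_def elim!: eventually_mono)
  qed
  have "(\<lambda>n. \<integral>z. indicator test_box z *\<^sub>R avg n z \<partial>cylinder_lborel) \<longlonglongrightarrow>
      (\<integral>z. indicator test_box z *\<^sub>R (\<integral>z. \<phi> z \<partial>\<mu>) \<partial>cylinder_lborel)"
  proof (rule integral_dominated_convergence)
    show "integrable cylinder_lborel (\<lambda>z. indicator test_box z * B)"
      by (intro integrable_mult_left integrable_real_indicator) (auto simp: emeasure_test_box)
    show "AE z in cylinder_lborel. (\<lambda>n. indicator test_box z *\<^sub>R avg n z) \<longlonglongrightarrow> indicator test_box z *\<^sub>R (\<integral>z. \<phi> z \<partial>\<mu>)"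
      using conv by eventually_elim (intro tendsto_intros)
    show "AE z in cylinder_lborel. norm (indicator test_box z *\<^sub>R avg n z) \<le> indicator test_box z * B" for n
      by (rule AE_I2) (use avgB in \<open>auto simp: indicator_def\<close>)
    show "(\<lambda>z. indicator test_box z *\<^sub>R avg n z) \<in> borel_measurable cylinder_lborel" for n
      unfolding avg_def by measurable
  qed (use test_box_sets in measurable)
  moreover have "(\<integral>z. indicator test_box z *\<^sub>R (\<integral>z. \<phi> z \<partial>\<mu>) \<partial>cylinder_lborel) = (\<integral>z. \<phi> z \<partial>\<mu>)"
    by simp
  moreover have "(\<integral>z. indicator test_box z *\<^sub>R avg n z \<partial>cylinder_lborel) =
      (\<Sum>k<n. \<integral>z. indicator test_box z *\<^sub>R \<phi> ((T ^^ k) z) \<partial>cylinder_lborel) / real n" for n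
  proof -
    have "(\<integral>z. indicator test_box z *\<^sub>R avg n z \<partial>cylinder_lborel) =
        (\<integral>z. (\<Sum>k<n. indicator test_box z *\<^sub>R \<phi> ((T ^^ k) z)) / real n \<partial>cylinder_lborel)"
      by (simp add: avg_def sum_distrib_left)
    also have "\<dots> = (\<integral>z. (\<Sum>k<n. indicator test_box z *\<^sub>R \<phi> ((T ^^ k) z)) \<partial>cylinder_lborel) / real n"
      by simp
    also have "(\<integral>z. (\<Sum>k<n. indicator test_box z *\<^sub>R \<phi> ((T ^^ k) z)) \<partial>cylinder_lborel) =
        (\<Sum>k<n. \<integral>z. indicator test_box z *\<^sub>R \<phi> ((T ^^ k) z) \<partial>cylinder_lborel)"
    proof (rule Bochner_Integration.integral_sum)
      show "integrable cylinder_lborel (\<lambda>z. indicator test_box z *\<^sub>R \<phi> ((T ^^ k) z))" for k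
        by (rule integrable_test_box[of _ B]) (use \<phi>(2) in \<open>auto simp del: real_scaleR_def\<close>)
    qed
    finally show ?thesis .
  qed
  ultimately show ?thesis by simp
qed

text \<open>The finitely many terms before \<open>k0\<close> vanish from the mean in the limit. This
  is essential because the level from which the decay of \<open>J\<close> holds depends on
  \<eta>.\<close>

lemma cesaro_le:
  fixes b :: "nat \<Rightarrow> real"
  assumes lim: "(\<lambda>n. (\<Sum>k<n. b k) / real n) \<longlonglongrightarrow> x" and b: "\<And>k. k0 \<le> k \<Longrightarrow> b k \<le> B"
  shows "x \<le> B"
proof -
  have "(\<lambda>n. (\<Sum>k<k0. b k - B) / real n + B) \<longlonglongrightarrow> 0 + B"
    by (intro tendsto_intros tendsto_divide_0[OF tendsto_const] filterlim_at_top_imp_at_infinity filterlim_real_sequentially)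
  then have lim2: "(\<lambda>n. (\<Sum>k<k0. b k - B) / real n + B) \<longlonglongrightarrow> B" by simp
  show ?thesis
  proof (rule LIMSEQ_le[OF lim lim2], intro exI[of _ "Suc k0"] allI impI)
    fix n assume n: "Suc k0 \<le> n"
    have "(\<Sum>k<n. b k - B) = (\<Sum>k<k0. b k - B) + (\<Sum>k\<in>{k0..<n}. b k - B)"
      using n by (metis Suc_leD atLeast0LessThan sum.atLeastLessThan_concat zero_le)
    also have "(\<Sum>k\<in>{k0..<n}. b k - B) \<le> 0" by (rule sum_nonpos) (use b in auto)
    finally have "(\<Sum>k<n. b k) - real n * B \<le> (\<Sum>k<k0. b k - B)" by (simp add: sum_subtractf)
    then have "((\<Sum>k<n. b k) - real n * B) / real n \<le> (\<Sum>k<k0. b k - B) / real n" by (rule divide_right_mono) simp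
    then show "(\<Sum>k<n. b k) / real n \<le> (\<Sum>k<k0. b k - B) / real n + B" using n by (simp add: diff_divide_distrib)
  qed
qed

context skew
begin

lemma skew_product_funpow:
  assumes F: "F = (\<lambda>x. f (to_circle x))"
  shows "(skew_product l lam f ^^ k) (to_circle x, y) = (to_circle (real l ^ k * x), lam ^ k * y + S k (real l ^ k * x))"
proof (induction k)
  case 0 show ?case by (simp add: S_def)
next
  case (Suc k)
  have "S (Suc k) (real l ^ Suc k * x) = F (real l ^ k * x) + lam * S k (real l ^ k * x)"
    using S_add[of 1 k "real l ^ Suc k * x"] l_pos by (simp add: S_def)
  moreover have "f (to_circle u) = F u" for u by (simp add: F)
  moreover have "(skew_product l lam f ^^ Suc k) (to_circle x, y) =
      skew_product l lam f (to_circle (real l ^ k * x), lam ^ k * y + S k (real l ^ k * x))"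
    by (simp only: funpow.simps o_apply Suc)
  ultimately show ?case by (simp add: skew_product_def circle_times_eq algebra_simps)
qed

text \<open>The starting height \<open>y\<close> only shifts the phase by
  \<open>\<eta> * lam ^ k * y\<close>, so its integral is a separate factor \<gamma> of modulus at
  most one. In the base, the substitution of \<open>l ^ k * x\<close> stretches the unit interval to
  the common period of the branches, which gives the unfolded coefficient of \<psi>.\<close>

lemma integral_mode_funpow:
  assumes F: "F = (\<lambda>x. f (to_circle x))" and T: "skew_product l lam f \<in> borel \<rightarrow>\<^sub>M borel"
  shows "\<exists>\<gamma>. cmod \<gamma> \<le> 1 \<and> (\<forall>\<xi>. (\<integral>z. indicator test_box z *\<^sub>R mode \<xi> \<eta> ((skew_product l lam f ^^ k) z) \<partial>cylinder_lborel) =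
    \<gamma> * fcoef 0 (\<psi> k \<eta>) \<xi>)"
proof -
  note sets_cylinder_lborel [measurable_cong]
  let ?T = "skew_product l lam f"
  have Tk [measurable]: "(?T ^^ k) \<in> borel \<rightarrow>\<^sub>M borel" for k
    by (induction k) (use T in \<open>auto intro: measurable_comp[unfolded o_def] simp: o_def\<close>)
  define v where "v = (\<lambda>y. indicator {0..1} y *\<^sub>R cis (- (\<eta> * (lam ^ k * y))))"
  have cism: "(\<lambda>y::real. cis (- (\<eta> * (lam ^ k * y)))) \<in> borel_measurable borel"
    by (intro borel_measurable_continuous_onI continuous_intros)
  have vm [measurable]: "v \<in> borel_measurable borel" unfolding v_def using cism by measurable
  define \<gamma> where "\<gamma> = (\<integral>y. v y \<partial>lborel)"
  have \<gamma>: "cmod \<gamma> \<le> 1"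
  proof -
    have "(\<lambda>y. cmod (v y)) = indicator {0..1}" by (auto simp: v_def indicator_def fun_eq_iff)
    then have "cmod \<gamma> \<le> (\<integral>y. indicator {0..1::real} y \<partial>lborel)"
      unfolding \<gamma>_def using integral_norm_bound[of lborel v] by simp
    then show ?thesis by simp
  qed
  have main: "(\<integral>z. indicator test_box z *\<^sub>R mode \<xi> \<eta> ((?T ^^ k) z) \<partial>cylinder_lborel) = \<gamma> * fcoef 0 (\<psi> k \<eta>) \<xi>" for \<xi>
  proof -
    define u where "u = (\<lambda>c. mode \<xi> \<eta> ((?T ^^ k) (c, 0)))"
    have um [measurable]: "u \<in> borel_measurable borel" unfolding u_def
      by (rule measurable_compose[OF _ mode_measurable], rule measurable_compose[OF _ Tk])
        (intro borel_measurable_continuous_onI continuous_intros)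
    have uto: "u (to_circle x) = cis (- (2 * pi * of_int \<xi> * (real l ^ k * x))) * cis (- (\<eta> * S k (real l ^ k * x)))" for x
      by (simp add: u_def skew_product_funpow[OF F] mode_eq circle_character_eq)
    have split: "indicator test_box (c, y) *\<^sub>R mode \<xi> \<eta> ((?T ^^ k) (c, y)) = u c * v y" for c y
    proof -
      obtain x where x: "c = to_circle x" using surj_to_circle by (metis surjD)
      show ?thesis
        by (simp add: x uto skew_product_funpow[OF F] mode_eq circle_character_eq v_def test_box_def indicator_def cis_mult algebra_simps)
    qed
    have int: "integrable (circle_lborel \<Otimes>\<^sub>M lborel) (\<lambda>z. indicator test_box z *\<^sub>R mode \<xi> \<eta> ((?T ^^ k) z))"
      unfolding cylinder_lborel_def[symmetric]
      by (rule integrable_test_box[of _ 1]) auto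
    have "(\<integral>z. indicator test_box z *\<^sub>R mode \<xi> \<eta> ((?T ^^ k) z) \<partial>cylinder_lborel) = (\<integral>c. (\<integral>y. u c * v y \<partial>lborel) \<partial>circle_lborel)"
      unfolding cylinder_lborel_def by (subst cylinder.integral_fst'[OF int, symmetric]) (simp only: split)
    also have "\<dots> = (\<integral>c. u c \<partial>circle_lborel) * \<gamma>"
      by (simp add: \<gamma>_def)
    also have "(\<integral>c. u c \<partial>circle_lborel) = integral {0..1} (\<lambda>x. u (to_circle x))"
      by (rule integral_circle_lborel) (auto simp: uto mult.assoc[symmetric] intro!: continuous_intros)
    also have "\<dots> = integral {0..1} (\<lambda>x. cis (\<Phi> k \<eta> \<xi> 0 (real l ^ k * x)))"
      by (simp add: uto cis_Phi mult.commute)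
    also have "\<dots> = fcoef 0 (\<psi> k \<eta>) \<xi>"
    proof -
      define h where "h = (\<lambda>x. cis (\<Phi> k \<eta> \<xi> 0 x))"
      have L: "real l ^ k \<noteq> 0" "0 < real l ^ k" using lpow_pos by auto
      have "continuous_on {0..real l ^ k} h" unfolding h_def \<Phi>_def by (intro continuous_intros)
      then have hi: "(h has_integral integral {0..real l ^ k} h) (cbox 0 (real l ^ k))"
        unfolding cbox_interval by (intro integrable_integral integrable_continuous_interval)
      from has_integral_affinity[OF hi L(1), of 0]
      have "((\<lambda>x. h (real l ^ k * x)) has_integral (1 / real l ^ k) *\<^sub>R integral {0..real l ^ k} h) ((\<lambda>x. x / real l ^ k) ` {0..real l ^ k})"
        using L by (simp add: divide_inverse mult.commute)
      moreover have "(\<lambda>x. x / real l ^ k) ` {0..real l ^ k} = {0..1}"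
        using L image_divide_atLeastAtMost[of "real l ^ k" 0 "real l ^ k"] by simp
      ultimately have "integral {0..1} (\<lambda>x. h (real l ^ k * x)) = (1 / real l ^ k) *\<^sub>R integral {0..real l ^ k} h"
        by (simp add: integral_unique)
      then show ?thesis unfolding fcoef_psi_eq phase_integral_def h_def by (simp add: scaleR_conv_of_real)
    qed
    finally show ?thesis by (simp add: mult.commute)
  qed
  then show ?thesis using \<gamma> by blast
qed

text \<open>A duality argument: \<mu> is tested against the trigonometric polynomial whose
  coefficients are the conjugates of its own transform. The integral is the sum \<open>X\<close> to
  be bounded, while the terms of the Cesaro means are eventually at most \<open>(X + B) / 2\<close>.
  Thus the whole sum of squares passes to the limit, not only single coefficients.\<close>

lemma charfun_SBR_bound:
  assumes F: "F = (\<lambda>x. f (to_circle x))" and SBR: "is_SBR_measure (skew_product l lam f) \<mu>"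
    and I: "finite I" and B: "\<And>k. k0 \<le> k \<Longrightarrow> (\<Sum>\<xi>\<in>I. (cmod (fcoef 0 (\<psi> k \<eta>) \<xi>))\<^sup>2) \<le> B"
  shows "(\<Sum>\<xi>\<in>I. (cmod (charfun \<mu> \<xi> \<eta>))\<^sup>2) \<le> B"
proof -
  note sets_cylinder_lborel [measurable_cong]
  let ?T = "skew_product l lam f"
  have T [measurable]: "?T \<in> borel \<rightarrow>\<^sub>M borel" and P: "prob_space \<mu>" and sm: "sets \<mu> = sets borel"
    using SBR by (auto simp: is_SBR_measure_def ergodic_measure_def invariant_measure_def)
  have Tk [measurable]: "(?T ^^ k) \<in> borel \<rightarrow>\<^sub>M borel" for k
    by (induction k) (use T in \<open>auto intro: measurable_comp[unfolded o_def] simp: o_def\<close>)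
  interpret \<mu>: prob_space \<mu> by (rule P)
  have mm: "mode \<xi> \<eta> \<in> borel_measurable \<mu>" for \<xi> using mode_measurable sm measurable_cong_sets by blast
  have im: "integrable \<mu> (mode \<xi> \<eta>)" for \<xi> by (rule \<mu>.integrable_const_bound[of _ 1]) (use mm in auto)
  define c where "c = (\<lambda>\<xi>. charfun \<mu> \<xi> \<eta>)"
  define X where "X = (\<Sum>\<xi>\<in>I. (cmod (c \<xi>))\<^sup>2)"
  \<comment> \<open>The real part is taken because weak convergence is formulated for real test
    functions; the integral of the sum is real anyway.\<close>
  define \<phi> where "\<phi> = (\<lambda>z. Re (\<Sum>\<xi>\<in>I. cnj (c \<xi>) * mode \<xi> \<eta> z))"
  have cont\<phi>: "continuous_on UNIV \<phi>" unfolding \<phi>_def by (intro continuous_intros continuous_on_mode)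
  have bd\<phi>: "\<bar>\<phi> z\<bar> \<le> (\<Sum>\<xi>\<in>I. cmod (c \<xi>))" for z
  proof -
    have "\<bar>\<phi> z\<bar> \<le> cmod (\<Sum>\<xi>\<in>I. cnj (c \<xi>) * mode \<xi> \<eta> z)" unfolding \<phi>_def by (rule abs_Re_le_cmod)
    also have "\<dots> \<le> (\<Sum>\<xi>\<in>I. cmod (c \<xi>))" by (rule order_trans[OF norm_sum]) (simp add: norm_mult)
    finally show ?thesis .
  qed
  have "(\<integral>z. \<phi> z \<partial>\<mu>) = Re (\<integral>z. (\<Sum>\<xi>\<in>I. cnj (c \<xi>) * mode \<xi> \<eta> z) \<partial>\<mu>)"
    unfolding \<phi>_def by (intro integral_Re Bochner_Integration.integrable_sum integrable_mult_right im)
  also have "(\<integral>z. (\<Sum>\<xi>\<in>I. cnj (c \<xi>) * mode \<xi> \<eta> z) \<partial>\<mu>) = (\<Sum>\<xi>\<in>I. cnj (c \<xi>) * c \<xi>)"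
    using im by (subst Bochner_Integration.integral_sum) (auto simp: c_def charfun_def)
  also have "\<dots> = complex_of_real X"
    by (simp add: X_def complex_norm_square[symmetric] mult.commute del: of_real_power)
  finally have X: "(\<integral>z. \<phi> z \<partial>\<mu>) = X" by simp
  define b where "b = (\<lambda>k. \<integral>z. indicator test_box z *\<^sub>R \<phi> ((?T ^^ k) z) \<partial>cylinder_lborel)"
  have "X \<le> (X + B) / 2"
  proof (rule cesaro_le[where b = b])
    show "(\<lambda>n. (\<Sum>k<n. b k) / real n) \<longlonglongrightarrow> X"
      using SBR_cesaro[OF SBR cont\<phi> bd\<phi>] unfolding X b_def .
    fix k assume k: "k0 \<le> k"
    obtain \<gamma> where \<gamma>: "cmod \<gamma> \<le> 1" "\<And>\<xi>. (\<integral>z. indicator test_box z *\<^sub>R mode \<xi> \<eta> ((?T ^^ k) z) \<partial>cylinder_lborel) = \<gamma> * fcoef 0 (\<psi> k \<eta>) \<xi>"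
      using integral_mode_funpow[OF F T] by blast
    have imk: "integrable cylinder_lborel (\<lambda>z. indicator test_box z *\<^sub>R mode \<xi> \<eta> ((?T ^^ k) z))" for \<xi>
      by (rule integrable_test_box[of _ 1]) auto
    have "b k = (\<integral>z. Re (\<Sum>\<xi>\<in>I. cnj (c \<xi>) * (indicator test_box z *\<^sub>R mode \<xi> \<eta> ((?T ^^ k) z))) \<partial>cylinder_lborel)"
      unfolding b_def \<phi>_def by (simp add: sum_distrib_left)
    also have "\<dots> = Re (\<integral>z. (\<Sum>\<xi>\<in>I. cnj (c \<xi>) * (indicator test_box z *\<^sub>R mode \<xi> \<eta> ((?T ^^ k) z))) \<partial>cylinder_lborel)"
      by (intro integral_Re Bochner_Integration.integrable_sum integrable_mult_right imk)
    also have "(\<integral>z. (\<Sum>\<xi>\<in>I. cnj (c \<xi>) * (indicator test_box z *\<^sub>R mode \<xi> \<eta> ((?T ^^ k) z))) \<partial>cylinder_lborel) =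
        (\<Sum>\<xi>\<in>I. cnj (c \<xi>) * (\<gamma> * fcoef 0 (\<psi> k \<eta>) \<xi>))"
      by (subst Bochner_Integration.integral_sum, rule integrable_mult_right[OF imk]) (simp only: integral_mult_right_zero \<gamma>(2))
    also have "Re \<dots> \<le> (\<Sum>\<xi>\<in>I. ((cmod (c \<xi>))\<^sup>2 + (cmod (fcoef 0 (\<psi> k \<eta>) \<xi>))\<^sup>2) / 2)"
      unfolding Re_sum
    proof (rule sum_mono)
      fix \<xi>
      have "Re (cnj (c \<xi>) * (\<gamma> * fcoef 0 (\<psi> k \<eta>) \<xi>)) \<le> cmod (cnj (c \<xi>) * (\<gamma> * fcoef 0 (\<psi> k \<eta>) \<xi>))"
        by (rule complex_Re_le_cmod)
      also have "\<dots> = cmod (c \<xi>) * (cmod \<gamma> * cmod (fcoef 0 (\<psi> k \<eta>) \<xi>))" by (simp add: norm_mult)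
      also have "\<dots> \<le> cmod (c \<xi>) * (1 * cmod (fcoef 0 (\<psi> k \<eta>) \<xi>))"
        using \<gamma>(1) by (intro mult_left_mono mult_right_mono) auto
      also have "\<dots> \<le> ((cmod (c \<xi>))\<^sup>2 + (cmod (fcoef 0 (\<psi> k \<eta>) \<xi>))\<^sup>2) / 2"
        using sum_squares_bound[of "cmod (c \<xi>)" "cmod (fcoef 0 (\<psi> k \<eta>) \<xi>)"] by simp
      finally show "Re (cnj (c \<xi>) * (\<gamma> * fcoef 0 (\<psi> k \<eta>) \<xi>)) \<le> \<dots>" .
    qed
    also have "\<dots> = (X + (\<Sum>\<xi>\<in>I. (cmod (fcoef 0 (\<psi> k \<eta>) \<xi>))\<^sup>2)) / 2"
      by (simp add: X_def sum.distrib flip: sum_divide_distrib)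
    also have "\<dots> \<le> (X + B) / 2" using B[OF k] by simp
    finally show "b k \<le> (X + B) / 2" .
  qed
  then show ?thesis by (simp add: X_def c_def)
qed

end

section \<open>Square-integrable densities\<close>

text \<open>\<open>of_circle\<close> returns an unspecified representative; its fractional part is
  the one in the half-open unit interval.\<close>

definition chart :: "circle \<Rightarrow> real" where "chart c = frac (of_circle c)"

lemma to_circle_chart [simp]: "to_circle (chart c) = c"
proof -
  have "to_circle (of_circle c) = c" using Quotient3_abs_rep[OF Quotient3_circle] by metis
  moreover have "to_circle (frac (of_circle c)) = to_circle (of_circle c)" by (simp add: to_circle_eq_iff frac_def)
  ultimately show ?thesis by (simp add: chart_def)
qed

lemma chart_range: "0 \<le> chart c" "chart c < 1"
  by (auto simp: chart_def frac_ge_0 frac_lt_1)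

lemma chart_to_circle: "x \<in> {0..<1} \<Longrightarrow> chart (to_circle x) = x"
proof -
  assume x: "x \<in> {0..<1}"
  have "chart (to_circle x) - x \<in> \<int>" using to_circle_chart[of "to_circle x"] unfolding to_circle_eq_iff .
  then obtain n :: int where "chart (to_circle x) - x = of_int n" by (auto elim: Ints_cases)
  moreover have "\<bar>chart (to_circle x) - x\<bar> < 1" using chart_range[of "to_circle x"] x by auto
  ultimately have "n = 0" by linarith
  with \<open>chart (to_circle x) - x = of_int n\<close> show ?thesis by simp
qed

lemma chart_measurable [measurable]: "chart \<in> borel_measurable borel"
proof (rule borel_measurableI_greater)
  fix t :: real
  have "{c. t < chart c} = (if t < 0 then UNIV else to_circle ` {t<..<1})"
  proof (cases "t < 0")
    case True then show ?thesis using chart_range(1) by (auto intro: less_le_trans)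
  next
    case False
    have "c \<in> to_circle ` {t<..<1}" if "t < chart c" for c
      using that chart_range[of c] by (intro image_eqI[of _ _ "chart c"]) auto
    then show ?thesis using False by (auto simp: chart_to_circle)
  qed
  then show "{w \<in> space borel. t < chart w} \<in> sets borel" by (auto intro!: borel_open open_map_to_circle)
qed

definition idx :: "nat \<Rightarrow> circle \<times> real \<Rightarrow> int \<times> int" where
  "idx n z = (\<lfloor>2 ^ n * chart (fst z)\<rfloor>, \<lfloor>2 ^ n * snd z\<rfloor>)"

text \<open>Empty unless the first index lies between 0 and \<open>2 ^ n - 1\<close>; the nonempty
  cells all have measure \<open>1 / 4 ^ n\<close>.\<close>

definition cell :: "nat \<Rightarrow> int \<times> int \<Rightarrow> (circle \<times> real) set" where
  "cell n q = {z. idx n z = q}"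

lemma idx_measurable [measurable]: "idx n \<in> borel \<rightarrow>\<^sub>M count_space UNIV"
proof -
  have "(\<lambda>z :: circle \<times> real. (\<lfloor>2 ^ n * chart (fst z)\<rfloor>, \<lfloor>2 ^ n * snd z\<rfloor>)) \<in> borel \<Otimes>\<^sub>M borel \<rightarrow>\<^sub>M count_space UNIV \<Otimes>\<^sub>M count_space UNIV"
    by measurable
  then show ?thesis
    unfolding idx_def[abs_def] borel_prod by (subst (asm) pair_measure_countable) auto
qed

lemma cell_sets [measurable]: "cell n q \<in> sets borel"
proof -
  have "idx n -` {q} \<inter> space borel \<in> sets borel" by (rule measurable_sets[OF idx_measurable]) simp
  then show ?thesis by (simp add: cell_def vimage_def)
qed

lemma idx_eq_close:
  assumes "idx n z = idx n z'"
  shows "\<bar>chart (fst z) - chart (fst z')\<bar> < 1 / 2 ^ n" "\<bar>snd z - snd z'\<bar> < 1 / 2 ^ n"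
proof -
  have *: "\<bar>a - b\<bar> < 1 / 2 ^ n" if "\<lfloor>2 ^ n * a\<rfloor> = \<lfloor>2 ^ n * b\<rfloor>" for a b :: real
  proof -
    have "\<bar>2 ^ n * a - 2 ^ n * b\<bar> < 1" using that by linarith
    then have "2 ^ n * \<bar>a - b\<bar> < 1" by (simp add: abs_mult flip: right_diff_distrib)
    then show ?thesis by (simp add: field_simps)
  qed
  show "\<bar>chart (fst z) - chart (fst z')\<bar> < 1 / 2 ^ n" "\<bar>snd z - snd z'\<bar> < 1 / 2 ^ n"
    using assms by (auto simp: idx_def intro!: *)
qed

lemma circle_character_chart: "circle_character \<xi> c = cis (- (2 * pi * of_int \<xi> * chart c))"
  using circle_character_eq[of \<xi> "chart c"] by simp

lemma circle_character_measurable [measurable]: "circle_character \<xi> \<in> borel_measurable borel"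
  by (rule borel_measurable_continuous_onI[OF continuous_on_circle_character])

lemma cnj_measurable [measurable (raw)]: "f \<in> borel_measurable M \<Longrightarrow> (\<lambda>x. cnj (f x)) \<in> borel_measurable M"
  by (rule borel_measurable_continuous_on[OF linear_continuous_on[OF bounded_linear_cnj]])

text \<open>A Fejer kernel on the circle times a Gaussian of width \<open>\<epsilon>\<close> on the line. It is bounded below on pairs of points
  in a common dyadic cell, and its transform is nonnegative.\<close>

definition kernel :: "nat \<Rightarrow> real \<Rightarrow> circle \<times> real \<Rightarrow> circle \<times> real \<Rightarrow> real" where
  "kernel m \<epsilon> z z' = (cmod (\<Sum>j<m. circle_character (int j) (fst z) * cnj (circle_character (int j) (fst z'))))\<^sup>2 *
     exp (- ((snd z' - snd z) / \<epsilon>)\<^sup>2 / 2)"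

text \<open>The cell has side \<open>1 / (8 * 2 ^ k)\<close>, so the angles
  \<open>2 * pi * j * u\<close> with \<open>j < 2 ^ k\<close> stay within \<open>pi / 3\<close> of 0
  and each summand has real part at least 1/2. The Gaussian factor is at least
  \<open>exp (- 1 / 2) \<ge> 1 / 2\<close>.\<close>

lemma kernel_lower_bound:
  assumes "idx (k + 3) z = idx (k + 3) z'"
  shows "(2 ^ k)\<^sup>2 / 8 \<le> kernel (2 ^ k) (1 / 2 ^ (k + 3)) z z'"
proof -
  define u where "u = chart (fst z) - chart (fst z')"
  have u: "\<bar>u\<bar> < 1 / 2 ^ (k + 3)" using idx_eq_close(1)[OF assms] by (simp add: u_def)
  have "1 / 2 \<le> Re (circle_character (int j) (fst z) * cnj (circle_character (int j) (fst z')))" if j: "j < 2 ^ k" for j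
  proof -
    have "real j \<le> 2 ^ k" using j by (metis less_imp_le of_nat_le_iff of_nat_numeral of_nat_power)
    then have "real j * \<bar>u\<bar> \<le> 2 ^ k * (1 / 2 ^ (k + 3))" using u by (intro mult_mono) auto
    also have "\<dots> = 1 / 8" by (simp add: power_add)
    finally have "2 * pi * (real j * \<bar>u\<bar>) \<le> 2 * pi * (1 / 8)" by (intro mult_left_mono) auto
    then have le: "\<bar>2 * pi * real j * u\<bar> \<le> pi / 3" by (simp add: abs_mult)
    have "circle_character (int j) (fst z) * cnj (circle_character (int j) (fst z')) = cis (- (2 * pi * real j * u))"
      by (simp add: circle_character_chart cis_cnj cis_mult u_def algebra_simps)
    then have "Re (circle_character (int j) (fst z) * cnj (circle_character (int j) (fst z'))) = cos \<bar>2 * pi * real j * u\<bar>"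
      by simp
    also have "\<dots> \<ge> cos (pi / 3)" by (rule cos_monotone_0_pi_le) (use le in auto)
    finally show ?thesis by (simp add: cos_60)
  qed
  then have "(\<Sum>j<(2::nat) ^ k. 1 / 2 :: real) \<le> (\<Sum>j<2 ^ k. Re (circle_character (int j) (fst z) * cnj (circle_character (int j) (fst z'))))"
    by (intro sum_mono) auto
  also have "\<dots> \<le> cmod (\<Sum>j<2 ^ k. circle_character (int j) (fst z) * cnj (circle_character (int j) (fst z')))"
    unfolding Re_sum[symmetric] by (rule complex_Re_le_cmod)
  finally have 1: "(2 ^ k / 2)\<^sup>2 \<le> (cmod (\<Sum>j<2 ^ k. circle_character (int j) (fst z) * cnj (circle_character (int j) (fst z'))))\<^sup>2"
    by (intro power_mono) simp_all
  define v where "v = (snd z' - snd z) / (1 / 2 ^ (k + 3))"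
  have "\<bar>snd z - snd z'\<bar> * 2 ^ (k + 3) < 1" using idx_eq_close(2)[OF assms] by (simp add: field_simps)
  then have "\<bar>v\<bar> \<le> 1" by (simp add: v_def abs_mult abs_minus_commute)
  then have "v\<^sup>2 \<le> 1" by (simp add: abs_square_le_1)
  then have "1 + (- v\<^sup>2 / 2) \<ge> 1 / 2" by simp
  then have 2: "1 / 2 \<le> exp (- v\<^sup>2 / 2)" using exp_ge_add_one_self[of "- v\<^sup>2 / 2"] by linarith
  have "(2 ^ k / 2)\<^sup>2 * (1 / 2) \<le> kernel (2 ^ k) (1 / 2 ^ (k + 3)) z z'"
    unfolding kernel_def v_def[symmetric] by (rule mult_mono[OF 1 2]) auto
  then show ?thesis by (simp add: power_divide)
qed

lemma kernel_nonneg: "0 \<le> kernel m \<epsilon> z z'"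
  by (simp add: kernel_def)

lemma kernel_le: "kernel m \<epsilon> z z' \<le> (real m)\<^sup>2"
proof -
  have "cmod (\<Sum>j<m. circle_character (int j) (fst z) * cnj (circle_character (int j) (fst z'))) \<le> (\<Sum>j<m. 1)"
    by (rule sum_norm_le) (simp add: norm_mult)
  then have "(cmod (\<Sum>j<m. circle_character (int j) (fst z) * cnj (circle_character (int j) (fst z'))))\<^sup>2 \<le> (real m)\<^sup>2"
    by (intro power_mono) auto
  then have "kernel m \<epsilon> z z' \<le> (real m)\<^sup>2 * 1" unfolding kernel_def by (intro mult_mono) auto
  then show ?thesis by simp
qed

interpretation gauss: prob_space std_normal_distribution
  by (simp add: prob_space_normal_density)

text \<open>The squared exponential sum unfolds into characters of frequency \<open>j - j'\<close>,
  and the Gaussian is the characteristic function of the normal distribution. Each term is a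
  function of \<open>z\<close> times its conjugate at \<open>z'\<close>, so integration against
  \<mu> in both variables gives squared moduli of \<open>charfun \<mu>\<close>.\<close>

lemma kernel_eq:
  assumes "0 < \<epsilon>"
  shows "complex_of_real (kernel m \<epsilon> z z') = (\<Sum>j<m. \<Sum>j'<m. \<integral>t. mode (int j - int j') (t / \<epsilon>) z * cnj (mode (int j - int j') (t / \<epsilon>) z') \<partial>std_normal_distribution)"
proof -
  define w where "w = (\<lambda>j. circle_character (int j) (fst z) * cnj (circle_character (int j) (fst z')))"
  define s where "s = (snd z' - snd z) / \<epsilon>"
  have "(\<integral>t. mode (int j - int j') (t / \<epsilon>) z * cnj (mode (int j - int j') (t / \<epsilon>) z') \<partial>std_normal_distribution) =
      w j * cnj (w j') * complex_of_real (exp (- s\<^sup>2 / 2))" for j j'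
  proof -
    have "circle_character (int j - int j') c = circle_character (int j) c * cnj (circle_character (int j') c)" for c
      by (simp add: circle_character_chart cis_cnj cis_mult algebra_simps)
    then have w: "circle_character (int j - int j') (fst z) * cnj (circle_character (int j - int j') (fst z')) = w j * cnj (w j')"
      by (simp add: w_def mult_ac)
    have "mode (int j - int j') (t / \<epsilon>) z * cnj (mode (int j - int j') (t / \<epsilon>) z') = w j * cnj (w j') * iexp (s * t)" for t
    proof -
      have "mode (int j - int j') (t / \<epsilon>) z * cnj (mode (int j - int j') (t / \<epsilon>) z') =
         (circle_character (int j - int j') (fst z) * cnj (circle_character (int j - int j') (fst z'))) *
         (cis (- (t / \<epsilon> * snd z)) * cis (t / \<epsilon> * snd z'))"
        by (cases z; cases z') (simp add: mode_eq cis_cnj mult_ac)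
      also have "cis (- (t / \<epsilon> * snd z)) * cis (t / \<epsilon> * snd z') = cis (- (t / \<epsilon> * snd z) + t / \<epsilon> * snd z')"
        by (rule cis_mult)
      also have "- (t / \<epsilon> * snd z) + t / \<epsilon> * snd z' = s * t"
        using assms by (simp add: s_def field_simps)
      also have "cis (s * t) = iexp (s * t)" by (simp add: cis_conv_exp)
      finally show ?thesis unfolding w .
    qed
    then have "(\<integral>t. mode (int j - int j') (t / \<epsilon>) z * cnj (mode (int j - int j') (t / \<epsilon>) z') \<partial>std_normal_distribution) =
       w j * cnj (w j') * char std_normal_distribution s"
      by (simp add: char_def)
    then show ?thesis by (simp add: char_std_normal_distribution)
  qed
  then have "(\<Sum>j<m. \<Sum>j'<m. \<integral>t. mode (int j - int j') (t / \<epsilon>) z * cnj (mode (int j - int j') (t / \<epsilon>) z') \<partial>std_normal_distribution) =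
     (\<Sum>j<m. \<Sum>j'<m. w j * cnj (w j')) * complex_of_real (exp (- s\<^sup>2 / 2))"
    by (simp add: sum_distrib_right)
  also have "(\<Sum>j<m. \<Sum>j'<m. w j * cnj (w j')) = (\<Sum>j<m. w j) * cnj (\<Sum>j<m. w j)" by (simp add: sum_product)
  also have "\<dots> = complex_of_real ((cmod (\<Sum>j<m. w j))\<^sup>2)" by (rule complex_norm_square[symmetric])
  finally show ?thesis by (simp add: kernel_def w_def s_def)
qed

lemma mode_joint_measurable [measurable (raw)]:
  assumes [measurable]: "f \<in> borel_measurable M" "g \<in> M \<rightarrow>\<^sub>M borel \<Otimes>\<^sub>M borel"
  shows "(\<lambda>x. mode \<xi> (f x) (g x)) \<in> borel_measurable M"
  unfolding mode_def by measurable

lemma integral_kernel: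
  fixes \<mu> :: "(circle \<times> real) measure"
  assumes \<mu>: "prob_space \<mu>" "sets \<mu> = sets borel" and \<epsilon>: "0 < \<epsilon>"
  shows "(\<integral>z. kernel m \<epsilon> (fst z) (snd z) \<partial>(\<mu> \<Otimes>\<^sub>M \<mu>)) =
    (\<integral>t. (\<Sum>j<m. \<Sum>j'<m. (cmod (charfun \<mu> (int j - int j') (t / \<epsilon>)))\<^sup>2) \<partial>std_normal_distribution)"
proof -
  interpret \<mu>: prob_space \<mu> by fact
  interpret P: pair_prob_space \<mu> \<mu> ..
  interpret PN: pair_prob_space "\<mu> \<Otimes>\<^sub>M \<mu>" std_normal_distribution ..
  have sm [measurable_cong]: "sets \<mu> = sets (borel \<Otimes>\<^sub>M borel)" unfolding borel_prod by (rule \<mu>(2))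
  have sN [measurable_cong]: "sets std_normal_distribution = sets borel" by simp
  define g where "g = (\<lambda>d t z. mode d (t / \<epsilon>) (fst z) * cnj (mode d (t / \<epsilon>) (snd z)))"
  have cg: "cmod (g d t z) = 1" for d t z by (simp add: g_def norm_mult)
  have meas: "(\<lambda>x. g d (snd x) (fst x)) \<in> borel_measurable ((\<mu> \<Otimes>\<^sub>M \<mu>) \<Otimes>\<^sub>M std_normal_distribution)" for d
    unfolding g_def by measurable
  have intPN: "integrable ((\<mu> \<Otimes>\<^sub>M \<mu>) \<Otimes>\<^sub>M std_normal_distribution) (\<lambda>(z, t). g d t z)" for d
    by (rule PN.integrable_const_bound[of _ 1]) (use meas[of d] cg in \<open>auto simp: case_prod_unfold\<close>)
  have Fub: "(\<integral>z. (\<integral>t. g d t z \<partial>std_normal_distribution) \<partial>(\<mu> \<Otimes>\<^sub>M \<mu>)) = (\<integral>t. (\<integral>z. g d t z \<partial>(\<mu> \<Otimes>\<^sub>M \<mu>)) \<partial>std_normal_distribution)" for d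
    by (rule PN.Fubini_integral[OF intPN, symmetric])
  have inner: "(\<integral>z. g d t z \<partial>(\<mu> \<Otimes>\<^sub>M \<mu>)) = complex_of_real ((cmod (charfun \<mu> d (t / \<epsilon>)))\<^sup>2)" for d t
  proof -
    have "g d t \<in> borel_measurable (\<mu> \<Otimes>\<^sub>M \<mu>)" unfolding g_def by measurable
    then have int: "integrable (\<mu> \<Otimes>\<^sub>M \<mu>) (g d t)"
      by (intro P.integrable_const_bound[of _ 1]) (use cg in auto)
    have "(\<integral>z. g d t z \<partial>(\<mu> \<Otimes>\<^sub>M \<mu>)) = (\<integral>z. (\<integral>z'. g d t (z, z') \<partial>\<mu>) \<partial>\<mu>)"
      by (rule P.integral_fst'[OF int, symmetric])
    also have "\<dots> = charfun \<mu> d (t / \<epsilon>) * cnj (charfun \<mu> d (t / \<epsilon>))"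
      by (simp add: g_def charfun_def)
    finally show ?thesis by (simp add: complex_norm_square[symmetric])
  qed
  have intP: "integrable (\<mu> \<Otimes>\<^sub>M \<mu>) (\<lambda>z. \<integral>t. g d t z \<partial>std_normal_distribution)" for d
    using PN.integrable_fst'[OF intPN[of d]] by simp
  have intN: "integrable std_normal_distribution (\<lambda>t. complex_of_real ((cmod (charfun \<mu> d (t / \<epsilon>)))\<^sup>2))" for d
    using PN.integrable_snd[OF intPN[of d]] by (simp add: inner)
  then have intN': "integrable std_normal_distribution (\<lambda>t. (cmod (charfun \<mu> d (t / \<epsilon>)))\<^sup>2)" for d
    by (simp only: complex_of_real_integrable_eq)
  have "complex_of_real (\<integral>z. kernel m \<epsilon> (fst z) (snd z) \<partial>(\<mu> \<Otimes>\<^sub>M \<mu>)) = (\<integral>z. complex_of_real (kernel m \<epsilon> (fst z) (snd z)) \<partial>(\<mu> \<Otimes>\<^sub>M \<mu>))"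
    by simp
  also have "\<dots> = (\<integral>z. (\<Sum>j<m. \<Sum>j'<m. \<integral>t. g (int j - int j') t z \<partial>std_normal_distribution) \<partial>(\<mu> \<Otimes>\<^sub>M \<mu>))"
    unfolding kernel_eq[OF \<epsilon>] g_def by simp
  also have "\<dots> = (\<Sum>j<m. \<Sum>j'<m. \<integral>t. complex_of_real ((cmod (charfun \<mu> (int j - int j') (t / \<epsilon>)))\<^sup>2) \<partial>std_normal_distribution)"
    by (simp only: Bochner_Integration.integral_sum Bochner_Integration.integrable_sum intP Fub inner)
  also have "\<dots> = complex_of_real (\<Sum>j<m. \<Sum>j'<m. \<integral>t. (cmod (charfun \<mu> (int j - int j') (t / \<epsilon>)))\<^sup>2 \<partial>std_normal_distribution)"
    by (simp del: of_real_power)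
  finally have "(\<integral>z. kernel m \<epsilon> (fst z) (snd z) \<partial>(\<mu> \<Otimes>\<^sub>M \<mu>)) = (\<Sum>j<m. \<Sum>j'<m. \<integral>t. (cmod (charfun \<mu> (int j - int j') (t / \<epsilon>)))\<^sup>2 \<partial>std_normal_distribution)"
    by (simp only: of_real_eq_iff)
  also have "\<dots> = (\<integral>t. (\<Sum>j<m. \<Sum>j'<m. (cmod (charfun \<mu> (int j - int j') (t / \<epsilon>)))\<^sup>2) \<partial>std_normal_distribution)"
    by (simp only: Bochner_Integration.integral_sum Bochner_Integration.integrable_sum intN')
  finally show ?thesis .
qed

text \<open>The left side is \<open>4 ^ (k + 3)\<close> times the product measure of the pairs of
  points in a common cell, which the kernel dominates. For fixed \<open>j\<close> the differences
  \<open>j - j'\<close> are distinct, so the double sum is at most \<open>m\<close> times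
  \<open>Jb\<close>; bounding the normal density by 1 and rescaling gives the integral of
  \<open>Jb\<close>.\<close>

lemma energy_bound:
  fixes \<mu> :: "(circle \<times> real) measure"
  assumes \<mu>: "prob_space \<mu>" "sets \<mu> = sets borel"
    and Jb: "Jb \<in> borel_measurable borel" "\<And>\<eta>. 0 \<le> Jb \<eta> \<and> Jb \<eta> \<le> B"
    and bound: "\<And>I \<eta>. finite I \<Longrightarrow> (\<Sum>\<xi>\<in>I. (cmod (charfun \<mu> \<xi> \<eta>))\<^sup>2) \<le> Jb \<eta>"
  shows "(\<integral>\<^sup>+z. ennreal (4 ^ (k + 3) * measure \<mu> (cell (k + 3) (idx (k + 3) z))) \<partial>\<mu>) \<le> 64 * (\<integral>\<^sup>+\<eta>. ennreal (Jb \<eta>) \<partial>lborel)"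
proof -
  interpret \<mu>: prob_space \<mu> by fact
  interpret P: pair_prob_space \<mu> \<mu> ..
  have sm [measurable_cong]: "sets \<mu> = sets (borel \<Otimes>\<^sub>M borel)" unfolding borel_prod by (rule \<mu>(2))
  define n where "n = k + 3"
  define m :: nat where "m = 2 ^ k"
  define \<epsilon> :: real where "\<epsilon> = 1 / 2 ^ n"
  have \<epsilon>: "0 < \<epsilon>" by (simp add: \<epsilon>_def)
  have m: "0 < real m" by (simp add: m_def)
  have idxm [measurable]: "idx n \<in> borel \<Otimes>\<^sub>M borel \<rightarrow>\<^sub>M count_space UNIV" using idx_measurable by (simp add: borel_prod)
  define D where "D = {x \<in> space (\<mu> \<Otimes>\<^sub>M \<mu>). idx n (fst x) = idx n (snd x)}"
  have D [measurable]: "D \<in> sets (\<mu> \<Otimes>\<^sub>M \<mu>)" unfolding D_def by measurable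
  have spm: "space \<mu> = UNIV" using \<mu>(2) sets_eq_imp_space_eq by fastforce
  have [measurable]: "(\<lambda>z. kernel m \<epsilon> (fst z) (snd z)) \<in> borel_measurable (\<mu> \<Otimes>\<^sub>M \<mu>)"
    unfolding kernel_def by measurable
  have "(\<integral>\<^sup>+z. ennreal (measure \<mu> (cell n (idx n z))) \<partial>\<mu>) = (\<integral>\<^sup>+z. (\<integral>\<^sup>+z'. indicator D (z, z') \<partial>\<mu>) \<partial>\<mu>)"
  proof (rule nn_integral_cong)
    fix z
    have "(\<lambda>z'. indicator D (z, z') :: ennreal) = indicator (cell n (idx n z))"
      by (auto simp: D_def cell_def indicator_def space_pair_measure spm fun_eq_iff)
    then show "ennreal (measure \<mu> (cell n (idx n z))) = (\<integral>\<^sup>+z'. indicator D (z, z') \<partial>\<mu>)"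
      by (simp add: \<mu>.emeasure_eq_measure \<mu>(2))
  qed
  also have "\<dots> = (\<integral>\<^sup>+x. indicator D x \<partial>(\<mu> \<Otimes>\<^sub>M \<mu>))"
    by (rule \<mu>.nn_integral_fst) measurable
  also have "\<dots> \<le> (\<integral>\<^sup>+x. ennreal (8 / (real m)\<^sup>2 * kernel m \<epsilon> (fst x) (snd x)) \<partial>(\<mu> \<Otimes>\<^sub>M \<mu>))"
  proof (rule nn_integral_mono)
    fix x
    show "indicator D x \<le> ennreal (8 / (real m)\<^sup>2 * kernel m \<epsilon> (fst x) (snd x))"
    proof (cases "x \<in> D")
      case True
      then have "(2 ^ k)\<^sup>2 / 8 \<le> kernel m \<epsilon> (fst x) (snd x)"
        unfolding m_def \<epsilon>_def n_def by (intro kernel_lower_bound) (simp add: D_def n_def)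
      then have "1 \<le> 8 / (real m)\<^sup>2 * kernel m \<epsilon> (fst x) (snd x)" by (simp add: m_def field_simps)
      then show ?thesis using True by (simp flip: ennreal_1)
    qed simp
  qed
  also have "\<dots> = ennreal (\<integral>x. 8 / (real m)\<^sup>2 * kernel m \<epsilon> (fst x) (snd x) \<partial>(\<mu> \<Otimes>\<^sub>M \<mu>))"
  proof (rule nn_integral_eq_integral)
    have "integrable (\<mu> \<Otimes>\<^sub>M \<mu>) (\<lambda>x. kernel m \<epsilon> (fst x) (snd x))"
      by (rule P.integrable_const_bound[of _ "(real m)\<^sup>2"]) (auto simp: kernel_nonneg kernel_le)
    then show "integrable (\<mu> \<Otimes>\<^sub>M \<mu>) (\<lambda>x. 8 / (real m)\<^sup>2 * kernel m \<epsilon> (fst x) (snd x))" by (rule integrable_mult_right)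
  qed (simp add: kernel_nonneg)
  also have "(\<integral>x. 8 / (real m)\<^sup>2 * kernel m \<epsilon> (fst x) (snd x) \<partial>(\<mu> \<Otimes>\<^sub>M \<mu>)) =
      8 / (real m)\<^sup>2 * (\<integral>t. (\<Sum>j<m. \<Sum>j'<m. (cmod (charfun \<mu> (int j - int j') (t / \<epsilon>)))\<^sup>2) \<partial>std_normal_distribution)"
    by (simp only: integral_mult_right_zero integral_kernel[OF \<mu> \<epsilon>])
  also have "ennreal \<dots> \<le> ennreal (8 / (real m)\<^sup>2 * (real m * (\<integral>t. Jb (t / \<epsilon>) \<partial>std_normal_distribution)))"
  proof (intro ennreal_leI mult_left_mono)
    have Jbi: "integrable std_normal_distribution (\<lambda>t. Jb (t / \<epsilon>))"
      by (rule gauss.integrable_const_bound[of _ B]) (use Jb in auto)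
    have le: "(\<Sum>j<m. \<Sum>j'<m. (cmod (charfun \<mu> (int j - int j') (t / \<epsilon>)))\<^sup>2) \<le> real m * Jb (t / \<epsilon>)" for t
    proof -
      have "(\<Sum>j'<m. (cmod (charfun \<mu> (int j - int j') (t / \<epsilon>)))\<^sup>2) \<le> Jb (t / \<epsilon>)" for j
      proof -
        have "(\<Sum>j'<m. (cmod (charfun \<mu> (int j - int j') (t / \<epsilon>)))\<^sup>2) = (\<Sum>\<xi>\<in>(\<lambda>j'. int j - int j') ` {..<m}. (cmod (charfun \<mu> \<xi> (t / \<epsilon>)))\<^sup>2)"
          by (subst sum.reindex) (auto simp: inj_on_def)
        also have "\<dots> \<le> Jb (t / \<epsilon>)" by (rule bound) simp
        finally show ?thesis .
      qed
      then have "(\<Sum>j<m. \<Sum>j'<m. (cmod (charfun \<mu> (int j - int j') (t / \<epsilon>)))\<^sup>2) \<le> (\<Sum>j<m. Jb (t / \<epsilon>))" by (rule sum_mono)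
      then show ?thesis by simp
    qed
    have "(\<integral>t. (\<Sum>j<m. \<Sum>j'<m. (cmod (charfun \<mu> (int j - int j') (t / \<epsilon>)))\<^sup>2) \<partial>std_normal_distribution) \<le>
        (\<integral>t. real m * Jb (t / \<epsilon>) \<partial>std_normal_distribution)"
      by (rule integral_mono') (use Jbi le Jb in \<open>auto intro!: sum_nonneg\<close>)
    then show "(\<integral>t. (\<Sum>j<m. \<Sum>j'<m. (cmod (charfun \<mu> (int j - int j') (t / \<epsilon>)))\<^sup>2) \<partial>std_normal_distribution) \<le>
        real m * (\<integral>t. Jb (t / \<epsilon>) \<partial>std_normal_distribution)" by simp
  qed simp
  also have "8 / (real m)\<^sup>2 * (real m * (\<integral>t. Jb (t / \<epsilon>) \<partial>std_normal_distribution)) = 8 / real m * (\<integral>t. Jb (t / \<epsilon>) \<partial>std_normal_distribution)"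
    using m by (simp add: power2_eq_square)
  also have "ennreal \<dots> = ennreal (8 / real m) * ennreal (\<integral>t. Jb (t / \<epsilon>) \<partial>std_normal_distribution)"
    by (rule ennreal_mult) (auto intro!: integral_nonneg_AE simp: Jb)
  also have "ennreal (\<integral>t. Jb (t / \<epsilon>) \<partial>std_normal_distribution) = (\<integral>\<^sup>+t. ennreal (Jb (t / \<epsilon>)) \<partial>std_normal_distribution)"
    by (rule nn_integral_eq_integral[symmetric], rule gauss.integrable_const_bound[of _ B]) (use Jb in auto)
  also have "\<dots> \<le> (\<integral>\<^sup>+t. ennreal (Jb (t / \<epsilon>)) \<partial>lborel)"
  proof -
    have "(\<integral>\<^sup>+t. ennreal (Jb (t / \<epsilon>)) \<partial>std_normal_distribution) = (\<integral>\<^sup>+t. ennreal (std_normal_density t) * ennreal (Jb (t / \<epsilon>)) \<partial>lborel)"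
      by (rule nn_integral_density) (use Jb(1) in auto)
    also have "\<dots> \<le> (\<integral>\<^sup>+t. ennreal (Jb (t / \<epsilon>)) \<partial>lborel)"
    proof (rule nn_integral_mono)
      fix t :: real
      have "std_normal_density t \<le> 1"
      proof -
        have "1 \<le> sqrt (2 * pi)" using pi_gt3 by simp
        moreover have "exp (- t\<^sup>2 / 2) \<le> 1" by simp
        ultimately have "1 / sqrt (2 * pi) * exp (- t\<^sup>2 / 2) \<le> 1 * 1" by (intro mult_mono) auto
        then show ?thesis by (simp add: std_normal_density_def)
      qed
      then have "ennreal (std_normal_density t) * ennreal (Jb (t / \<epsilon>)) \<le> 1 * ennreal (Jb (t / \<epsilon>))"
        by (intro mult_right_mono) (auto simp flip: ennreal_1)
      then show "ennreal (std_normal_density t) * ennreal (Jb (t / \<epsilon>)) \<le> ennreal (Jb (t / \<epsilon>))" by simp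
    qed
    finally show ?thesis .
  qed
  also have "(\<integral>\<^sup>+t. ennreal (Jb (t / \<epsilon>)) \<partial>lborel) = ennreal \<epsilon> * (\<integral>\<^sup>+\<eta>. ennreal (Jb \<eta>) \<partial>lborel)"
    using nn_integral_real_affine[of "\<lambda>t. ennreal (Jb (t / \<epsilon>))" \<epsilon> 0] Jb(1) \<epsilon> by simp
  finally have main: "(\<integral>\<^sup>+z. ennreal (measure \<mu> (cell n (idx n z))) \<partial>\<mu>) \<le> ennreal (8 / real m) * (ennreal \<epsilon> * (\<integral>\<^sup>+\<eta>. ennreal (Jb \<eta>) \<partial>lborel))"
    by (simp add: mult_left_mono)
  have meas: "(\<lambda>z. measure \<mu> (cell n (idx n z))) \<in> borel_measurable \<mu>"
    by (rule measurable_compose[of "idx n" _ "count_space UNIV"]) (use idxm sm in \<open>auto simp: measurable_cong_sets\<close>)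
  have "(\<integral>\<^sup>+z. ennreal (4 ^ n * measure \<mu> (cell n (idx n z))) \<partial>\<mu>) = ennreal (4 ^ n) * (\<integral>\<^sup>+z. ennreal (measure \<mu> (cell n (idx n z))) \<partial>\<mu>)"
    using meas by (simp add: ennreal_mult nn_integral_cmult)
  also have "\<dots> \<le> ennreal (4 ^ n) * (ennreal (8 / real m) * (ennreal \<epsilon> * (\<integral>\<^sup>+\<eta>. ennreal (Jb \<eta>) \<partial>lborel)))"
    using main by (rule mult_left_mono) simp
  also have "\<dots> = ennreal (4 ^ n * (8 / real m) * \<epsilon>) * (\<integral>\<^sup>+\<eta>. ennreal (Jb \<eta>) \<partial>lborel)"
  proof -
    have "ennreal (4 ^ n * (8 / real m) * \<epsilon>) = ennreal (4 ^ n) * ennreal (8 / real m) * ennreal \<epsilon>"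
      using \<epsilon> m by (simp only: ennreal_mult zero_le_mult_iff zero_le_divide_iff zero_le_power zero_le_numeral less_imp_le simp_thms)
    then show ?thesis by (simp only: mult.assoc)
  qed
  \<comment> \<open>\<open>4 ^ n\<close> is the inverse area of a cell, \<open>8 / m\<close> comes
    from the kernel bound and one factor \<open>m\<close> of the double sum, and \<epsilon> from the
    rescaling: the powers of 2 depending on \<open>k\<close> cancel and leave
    \<open>8 * 8\<close>.\<close>
  also have "4 ^ n * (8 / real m) * \<epsilon> = 64"
  proof -
    have "(4::real) ^ n = 2 ^ n * 2 ^ n" by (simp flip: power_mult_distrib)
    moreover have "(2::real) ^ n = 8 * 2 ^ k" by (simp add: n_def power_add)
    ultimately show ?thesis by (simp add: m_def \<epsilon>_def)
  qed
  finally show ?thesis by (simp add: n_def)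
qed

section \<open>Averages over dyadic cells\<close>

lemma nn_integral_countable_pushforward:
  fixes X :: "'a \<Rightarrow> 'b::countable" and G :: "'b \<Rightarrow> ennreal"
  assumes X: "X \<in> N \<rightarrow>\<^sub>M count_space UNIV"
  shows "(\<integral>\<^sup>+z. G (X z) \<partial>N) = (\<integral>\<^sup>+q. emeasure N (X -` {q} \<inter> space N) * G q \<partial>count_space UNIV)"
proof -
  let ?D = "distr N (count_space UNIV) X"
  have em: "emeasure ?D {q} = emeasure N (X -` {q} \<inter> space N)" for q
    by (rule emeasure_distr[OF X]) simp
  have "?D = density (count_space UNIV) (\<lambda>q. emeasure N (X -` {q} \<inter> space N))"
  proof (rule measure_eqI_countable[of _ UNIV])
    fix q :: 'b
    have "emeasure (density (count_space UNIV) (\<lambda>q. emeasure N (X -` {q} \<inter> space N))) {q} =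
        (\<integral>\<^sup>+q'. emeasure N (X -` {q'} \<inter> space N) * indicator {q} q' \<partial>count_space UNIV)"
      by (rule emeasure_density) auto
    also have "\<dots> = emeasure ?D {q}" by (subst nn_integral_indicator_singleton) (auto simp: em)
    finally show "emeasure ?D {q} = emeasure (density (count_space UNIV) (\<lambda>q. emeasure N (X -` {q} \<inter> space N))) {q}" by simp
  qed auto
  moreover have "(\<integral>\<^sup>+z. G (X z) \<partial>N) = (\<integral>\<^sup>+q. G q \<partial>?D)"
    by (rule nn_integral_distr[OF X, symmetric]) simp
  ultimately show ?thesis by (simp add: nn_integral_density)
qed

lemma nn_integral_idx:
  assumes "sets N = sets borel"
  shows "(\<integral>\<^sup>+z. G (idx n z) \<partial>N) = (\<integral>\<^sup>+q. emeasure N (cell n q) * G q \<partial>count_space UNIV)"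
proof -
  have "space N = UNIV" using sets_eq_imp_space_eq[OF assms] by simp
  then have "idx n -` {q} \<inter> space N = cell n q" for q by (auto simp: cell_def)
  moreover have "idx n \<in> N \<rightarrow>\<^sub>M count_space UNIV" using idx_measurable by (simp add: measurable_cong_sets[OF assms refl])
  ultimately show ?thesis using nn_integral_countable_pushforward[of "idx n" N G] by simp
qed

lemma emeasure_circle_lborel:
  assumes "A \<in> sets borel"
  shows "emeasure circle_lborel A = emeasure lborel (to_circle -` A \<inter> {0..<1})"
proof -
  have "emeasure circle_lborel A = emeasure (restrict_space lborel {0..<1}) (to_circle -` A \<inter> space (restrict_space lborel {0..<1}))"
    unfolding circle_lborel_def by (rule emeasure_distr) (use assms in \<open>auto intro: measurable_restrict_space1\<close>)
  also have "\<dots> = emeasure lborel (to_circle -` A \<inter> {0..<1})"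
    by (subst emeasure_restrict_space) (auto simp: space_restrict_space)
  finally show ?thesis .
qed

lemma emeasure_cell: "emeasure cylinder_lborel (cell n (idx n z)) = ennreal (1 / 4 ^ n)"
proof -
  define i where "i = \<lfloor>2 ^ n * chart (fst z)\<rfloor>"
  define j where "j = \<lfloor>2 ^ n * snd z\<rfloor>"
  have i0: "0 \<le> i" using chart_range(1)[of "fst z"] by (simp add: i_def)
  have "2 ^ n * chart (fst z) < 2 ^ n" using chart_range(2)[of "fst z"] by simp
  then have i1: "i < 2 ^ n" by (simp add: i_def floor_less_iff)
  define A where "A = {c. \<lfloor>2 ^ n * chart c\<rfloor> = i}"
  define B where "B = {y::real. \<lfloor>2 ^ n * y\<rfloor> = j}"
  have fl: "\<lfloor>2 ^ n * x\<rfloor> = m \<longleftrightarrow> x \<in> {of_int m / 2 ^ n ..< (of_int m + 1) / 2 ^ n}" for x :: real and m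
    by (auto simp: floor_eq_iff field_simps)
  have A: "A \<in> sets borel" unfolding A_def by measurable
  have "(of_int i + 1) / 2 ^ n \<le> (1 :: real)"
  proof -
    have "i + 1 \<le> 2 ^ n" using i1 by simp
    then have "real_of_int (i + 1) \<le> real_of_int (2 ^ n)" by (simp only: of_int_le_iff)
    then show ?thesis by simp
  qed
  moreover have "0 \<le> of_int i / (2 ^ n :: real)" using i0 by simp
  ultimately have "to_circle -` A \<inter> {0..<1} = {of_int i / 2 ^ n ..< (of_int i + 1) / 2 ^ n}"
  proof -
    assume le: "(of_int i + 1) / 2 ^ n \<le> (1 :: real)" "0 \<le> of_int i / (2 ^ n :: real)"
    have "x \<in> to_circle -` A \<inter> {0..<1} \<longleftrightarrow> x \<in> {of_int i / 2 ^ n ..< (of_int i + 1) / 2 ^ n}" for x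
    proof (cases "x \<in> {0..<1}")
      case True
      then show ?thesis using chart_to_circle[OF True] by (simp only: A_def fl[symmetric] vimage_eq Int_iff mem_Collect_eq simp_thms)
    next
      case False
      have "y \<notin> {a..<b}" if "y \<notin> {0..<1}" "b \<le> 1" "0 \<le> a" for a b y :: real using that by auto
      from this[OF False le] False show ?thesis by blast
    qed
    then show ?thesis by blast
  qed
  then have eA: "emeasure circle_lborel A = ennreal (1 / 2 ^ n)"
    by (simp add: emeasure_circle_lborel[OF A] divide_right_mono flip: diff_divide_distrib)
  have "B = {of_int j / 2 ^ n ..< (of_int j + 1) / 2 ^ n}" by (auto simp: B_def fl)
  then have B: "B \<in> sets borel" "emeasure lborel B = ennreal (1 / 2 ^ n)"
    by (simp_all add: divide_right_mono flip: diff_divide_distrib)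
  have "cell n (idx n z) = A \<times> B" by (auto simp: cell_def idx_def A_def B_def i_def j_def)
  then have "emeasure cylinder_lborel (cell n (idx n z)) = ennreal (1 / 2 ^ n) * ennreal (1 / 2 ^ n)"
    using A B eA by (simp add: cylinder_lborel_def lborel.emeasure_pair_measure_Times)
  also have "\<dots> = ennreal (1 / 4 ^ n)" by (simp flip: ennreal_mult power_mult_distrib)
  finally show ?thesis .
qed

text \<open>Integer division by \<open>2 ^ d\<close> rounds down also for negative indices, as the
  floor does, so it leads to the coarser cell containing the given one.\<close>

definition coarsen :: "nat \<Rightarrow> int \<times> int \<Rightarrow> int \<times> int" where
  "coarsen d q = (fst q div 2 ^ d, snd q div 2 ^ d)"

lemma idx_coarsen:
  assumes "n \<le> m"
  shows "idx n z = coarsen (m - n) (idx m z)"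
proof -
  have "\<lfloor>2 ^ n * x\<rfloor> = \<lfloor>2 ^ m * x\<rfloor> div 2 ^ (m - n)" for x :: real
  proof -
    have "\<lfloor>2 ^ m * x / real_of_int (2 ^ (m - n))\<rfloor> = \<lfloor>2 ^ m * x\<rfloor> div 2 ^ (m - n)"
      by (rule floor_divide_real_eq_div) simp
    moreover have "2 ^ m * x / real_of_int (2 ^ (m - n)) = 2 ^ n * x"
    proof -
      have "(2 :: real) ^ m = 2 ^ (m - n) * 2 ^ n" using assms by (simp flip: power_add)
      then show ?thesis by simp
    qed
    ultimately show ?thesis by simp
  qed
  then show ?thesis by (simp add: idx_def coarsen_def)
qed

definition cell_density :: "(circle \<times> real) measure \<Rightarrow> nat \<Rightarrow> circle \<times> real \<Rightarrow> real" where
  "cell_density \<mu> n z = 4 ^ n * measure \<mu> (cell n (idx n z))"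

lemma cell_density_nonneg: "0 \<le> cell_density \<mu> n z"
  by (simp add: cell_density_def)

lemma cell_density_measurable [measurable]: "cell_density \<mu> n \<in> borel_measurable borel"
  unfolding cell_density_def[abs_def]
  by (rule measurable_compose[OF idx_measurable, of "\<lambda>q. 4 ^ n * measure \<mu> (cell n q)"]) simp

text \<open>The martingale property: the level-\<open>m\<close> density reproduces \<mu> on
  functions that are constant on the cells of a coarser level.\<close>

lemma nn_integral_cell_density:
  assumes \<mu>: "prob_space \<mu>" "sets \<mu> = sets borel" and "n \<le> m"
  shows "(\<integral>\<^sup>+z. G (idx n z) * ennreal (cell_density \<mu> m z) \<partial>cylinder_lborel) = (\<integral>\<^sup>+z. G (idx n z) \<partial>\<mu>)"
proof -
  interpret \<mu>: prob_space \<mu> by fact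
  define H where "H = (\<lambda>q. G (coarsen (m - n) q))"
  have "(\<integral>\<^sup>+z. G (idx n z) * ennreal (cell_density \<mu> m z) \<partial>cylinder_lborel) =
      (\<integral>\<^sup>+z. H (idx m z) * ennreal (4 ^ m * measure \<mu> (cell m (idx m z))) \<partial>cylinder_lborel)"
    by (simp add: H_def idx_coarsen[OF \<open>n \<le> m\<close>] cell_density_def)
  also have "\<dots> = (\<integral>\<^sup>+q. emeasure cylinder_lborel (cell m q) * (H q * ennreal (4 ^ m * measure \<mu> (cell m q))) \<partial>count_space UNIV)"
    by (rule nn_integral_idx[OF sets_cylinder_lborel])
  also have "\<dots> = (\<integral>\<^sup>+q. emeasure \<mu> (cell m q) * H q \<partial>count_space UNIV)"
  proof (rule nn_integral_cong)
    fix q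
    show "emeasure cylinder_lborel (cell m q) * (H q * ennreal (4 ^ m * measure \<mu> (cell m q))) = emeasure \<mu> (cell m q) * H q"
    proof (cases "cell m q = {}")
      case False
      then obtain z where "q = idx m z" by (auto simp: cell_def)
      then have "emeasure cylinder_lborel (cell m q) * ennreal (4 ^ m * measure \<mu> (cell m q)) = emeasure \<mu> (cell m q)"
        by (simp add: emeasure_cell \<mu>.emeasure_eq_measure flip: ennreal_mult)
      then show ?thesis by (metis mult.assoc mult.commute)
    qed simp
  qed
  also have "\<dots> = (\<integral>\<^sup>+z. H (idx m z) \<partial>\<mu>)"
    by (rule nn_integral_idx[OF \<mu>(2), symmetric])
  finally show ?thesis by (simp add: H_def idx_coarsen[OF \<open>n \<le> m\<close>])
qed

text \<open>The rate \<open>1 / 8 ^ k\<close> leaves room for the weights \<open>4 ^ k\<close>: the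
  weighted sum of the squared increments has finite integral, so almost everywhere the increments
  are \<open>O (1 / 2 ^ k)\<close> and the sequence converges.\<close>

lemma L2_Cauchy_limit:
  fixes h :: "nat \<Rightarrow> 'a \<Rightarrow> real"
  assumes h [measurable]: "\<And>k. h k \<in> borel_measurable M"
    and Cauchy: "\<And>k j. k \<le> j \<Longrightarrow> (\<integral>\<^sup>+z. ennreal ((h j z - h k z)\<^sup>2) \<partial>M) \<le> ennreal (1 / 8 ^ k)"
  shows "AE z in M. convergent (\<lambda>k. h k z)"
proof -
  define D where "D = (\<lambda>k z. ennreal (4 ^ k * (h (Suc k) z - h k z)\<^sup>2))"
  have D [measurable]: "D k \<in> borel_measurable M" for k unfolding D_def by measurable
  have "(\<integral>\<^sup>+z. (\<Sum>k. D k z) \<partial>M) = (\<Sum>k. \<integral>\<^sup>+z. D k z \<partial>M)" by (rule nn_integral_suminf) (rule D)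
  also have "\<dots> \<le> (\<Sum>k. ennreal ((1 / 2) ^ k))"
  proof (rule suminf_le)
    fix k
    have "(\<integral>\<^sup>+z. D k z \<partial>M) = ennreal (4 ^ k) * (\<integral>\<^sup>+z. ennreal ((h (Suc k) z - h k z)\<^sup>2) \<partial>M)"
      by (simp add: D_def ennreal_mult nn_integral_cmult)
    also have "\<dots> \<le> ennreal (4 ^ k) * ennreal (1 / 8 ^ k)" by (intro mult_left_mono Cauchy) auto
    also have "\<dots> = ennreal ((1 / 2) ^ k)" by (simp flip: ennreal_mult power_divide)
    finally show "(\<integral>\<^sup>+z. D k z \<partial>M) \<le> ennreal ((1 / 2) ^ k)" .
  qed auto
  also have "\<dots> = ennreal (\<Sum>k. (1 / 2) ^ k)" by (rule suminf_ennreal2) (auto intro!: summable_geometric)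
  finally have "(\<integral>\<^sup>+z. (\<Sum>k. D k z) \<partial>M) \<noteq> \<infinity>" by (auto simp: top_unique)
  then have "AE z in M. (\<Sum>k. D k z) \<noteq> \<infinity>" by (intro nn_integral_PInf_AE) auto
  then show ?thesis
  proof (rule AE_mp, intro AE_I2 impI)
    fix z assume fin: "(\<Sum>k. D k z) \<noteq> \<infinity>"
    define S where "S = enn2real (\<Sum>k. D k z)"
    have bound: "\<bar>h (Suc k) z - h k z\<bar> \<le> sqrt S * (1 / 2) ^ k" for k
    proof -
      have "D k z = (\<Sum>i\<in>{k}. D i z)" by simp
      also have "\<dots> \<le> (\<Sum>k. D k z)" by (rule sum_le_suminf) auto
      also have "\<dots> = ennreal S" using fin by (simp add: S_def less_top)
      finally have "4 ^ k * (h (Suc k) z - h k z)\<^sup>2 \<le> S"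
        by (simp add: D_def ennreal_le_iff S_def)
      moreover have "4 ^ k * (h (Suc k) z - h k z)\<^sup>2 = (2 ^ k * \<bar>h (Suc k) z - h k z\<bar>)\<^sup>2"
      proof -
        have "(2 ^ k)\<^sup>2 = (4 :: real) ^ k" by (simp add: power2_eq_square flip: power_mult_distrib)
        then show ?thesis by (simp add: power_mult_distrib)
      qed
      ultimately have "2 ^ k * \<bar>h (Suc k) z - h k z\<bar> \<le> sqrt S" by (simp add: real_le_rsqrt)
      then show ?thesis by (simp add: power_divide field_simps)
    qed
    have "summable (\<lambda>k. h (Suc k) z - h k z)"
      by (rule summable_comparison_test'[of "\<lambda>k. sqrt S * (1 / 2) ^ k" 0])
        (use bound in \<open>auto intro!: summable_mult summable_geometric\<close>)
    then have "convergent (\<lambda>n. \<Sum>k<n. h (Suc k) z - h k z)" by (simp add: summable_iff_convergent)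
    then have "convergent (\<lambda>n. h n z - h 0 z)" by (simp add: sum_lessThan_telescope[of "\<lambda>k. h k z"])
    then have "convergent (\<lambda>n. (h n z - h 0 z) + h 0 z)" by (intro convergent_add convergent_const)
    then show "convergent (\<lambda>k. h k z)" by simp
  qed
qed

lemma nn_integral_Fatou_le:
  fixes u :: "nat \<Rightarrow> 'a \<Rightarrow> real"
  assumes "\<And>k. u k \<in> borel_measurable M" "AE z in M. (\<lambda>k. u k z) \<longlonglongrightarrow> v z"
    and "\<And>k. k0 \<le> k \<Longrightarrow> (\<integral>\<^sup>+z. ennreal (u k z) \<partial>M) \<le> c"
  shows "(\<integral>\<^sup>+z. ennreal (v z) \<partial>M) \<le> c"
proof -
  have "(\<integral>\<^sup>+z. ennreal (v z) \<partial>M) = (\<integral>\<^sup>+z. liminf (\<lambda>k. ennreal (u k z)) \<partial>M)"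
  proof (rule nn_integral_cong_AE, use assms(2) in eventually_elim)
    case (elim z)
    then have "(\<lambda>k. ennreal (u k z)) \<longlonglongrightarrow> ennreal (v z)" by (rule tendsto_ennrealI)
    then show ?case by (intro lim_imp_Liminf[symmetric]) auto
  qed
  also have "\<dots> \<le> liminf (\<lambda>k. \<integral>\<^sup>+z. ennreal (u k z) \<partial>M)"
    by (rule nn_integral_liminf) (use assms(1) in measurable)
  also have "\<dots> \<le> c"
  proof -
    have "eventually (\<lambda>k. (\<integral>\<^sup>+z. ennreal (u k z) \<partial>M) \<le> c) sequentially"
      using assms(3) by (auto simp: eventually_sequentially)
    then have "liminf (\<lambda>k. \<integral>\<^sup>+z. ennreal (u k z) \<partial>M) \<le> liminf (\<lambda>k. c)" by (rule Liminf_mono)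
    then show ?thesis by (simp add: Liminf_const)
  qed
  finally show ?thesis .
qed

lemma cell_in_open:
  assumes "open S" "z \<in> S"
  obtains n where "cell n (idx n z) \<subseteq> S"
proof -
  obtain A B where AB: "open A" "open B" "z \<in> A \<times> B" "A \<times> B \<subseteq> S"
    using assms by (rule open_prod_elim)
  have "open (to_circle -` A)" using AB(1) by (simp add: open_circle_def)
  moreover have "chart (fst z) \<in> to_circle -` A" using AB(3) by auto
  ultimately obtain d where d: "0 < d" "ball (chart (fst z)) d \<subseteq> to_circle -` A" by (rule openE)
  obtain e where e: "0 < e" "ball (snd z) e \<subseteq> B" 
    by (rule openE[OF AB(2), of "snd z"]) (use AB(3) in auto)
  obtain n where n: "(1 / 2) ^ n < min d e" using real_arch_pow_inv[of "min d e" "1/2"] d(1) e(1) by auto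
  have "z' \<in> S" if "z' \<in> cell n (idx n z)" for z'
  proof -
    have c: "idx n z = idx n z'" using that by (simp add: cell_def)
    have "chart (fst z') \<in> ball (chart (fst z)) d" "snd z' \<in> ball (snd z) e"
      using idx_eq_close[OF c] n by (auto simp: dist_real_def power_divide)
    then have "to_circle (chart (fst z')) \<in> A" "snd z' \<in> B" using d e by auto
    then have "z' \<in> A \<times> B" by (simp add: mem_Times_iff)
    then show ?thesis using AB(4) by auto
  qed
  then show ?thesis by (intro that[of n]) auto
qed

lemma sets_borel_cells:
  "sets (borel :: (circle \<times> real) measure) = sigma_sets UNIV (insert {} (range (\<lambda>p. cell (fst p) (snd p))))"
proof -
  define c where "c = (\<lambda>p. cell (fst p) (snd p))"
  have "S \<in> sigma_sets UNIV (insert {} (range c))" if "open S" for S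
  proof -
    have "z \<in> \<Union> (c ` {p. c p \<subseteq> S})" if "z \<in> S" for z
    proof -
      obtain n where "cell n (idx n z) \<subseteq> S" by (rule cell_in_open[OF \<open>open S\<close> \<open>z \<in> S\<close>])
      then have "(n, idx n z) \<in> {p. c p \<subseteq> S}" by (simp add: c_def)
      moreover have "z \<in> c (n, idx n z)" by (simp add: c_def cell_def)
      ultimately show ?thesis by (rule UN_I)
    qed
    then have "S = \<Union> (c ` {p. c p \<subseteq> S})" by blast
    moreover have "\<Union> (c ` {p. c p \<subseteq> S}) \<in> sigma_sets UNIV (insert {} (range c))"
    proof (rule sigma_sets_UNION)
      show "countable (c ` {p. c p \<subseteq> S})" by (intro countable_image countableI_type)
      show "b \<in> sigma_sets UNIV (insert {} (range c))" if "b \<in> c ` {p. c p \<subseteq> S}" for b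
        by (rule sigma_sets.Basic) (use that in blast)
    qed
    ultimately show ?thesis by simp
  qed
  then have "{S :: (circle \<times> real) set. open S} \<subseteq> sigma_sets UNIV (insert {} (range c))" by blast
  then have 1: "sets (borel :: (circle \<times> real) measure) \<subseteq> sigma_sets UNIV (insert {} (range c))"
    unfolding sets_borel by (rule sigma_sets_mono)
  have "insert {} (range c) \<subseteq> sets borel" unfolding c_def by (intro insert_subsetI image_subsetI cell_sets sets.empty_sets)
  then have "sigma_sets UNIV (insert {} (range c)) \<subseteq> sets (borel :: (circle \<times> real) measure)"
    using sets.sigma_sets_subset[of "insert {} (range c)" "borel :: (circle \<times> real) measure"] by simp
  with 1 show ?thesis unfolding c_def by (rule subset_antisym)
qed

text \<open>Dyadic cells are nested or disjoint; the empty set is adjoined for the disjoint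
  case.\<close>

lemma Int_stable_cells: "Int_stable (insert {} (range (\<lambda>p. cell (fst p) (snd p))))"
proof -
  define c where "c = (\<lambda>p. cell (fst p) (snd p))"
  have nested: "c p \<inter> c q = {} \<or> c p \<inter> c q = c q" if "fst p \<le> fst q" for p q
  proof (cases "c p \<inter> c q = {}")
    case False
    then obtain z where z: "idx (fst p) z = snd p" "idx (fst q) z = snd q" by (auto simp: cell_def c_def)
    have "c q \<subseteq> c p"
    proof
      fix w assume "w \<in> c q"
      then have "idx (fst q) w = idx (fst q) z" by (simp add: c_def cell_def z)
      then have "idx (fst p) w = idx (fst p) z" by (simp add: idx_coarsen[OF that])
      then show "w \<in> c p" by (simp add: c_def cell_def z)
    qed
    then show ?thesis by blast
  qed simp
  have cc: "c p \<inter> c q \<in> insert {} (range c)" for p q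
  proof (cases "fst p \<le> fst q")
    case True
    from nested[OF this] show ?thesis by (elim disjE) simp_all
  next
    case False
    then have "fst q \<le> fst p" by simp
    from nested[OF this] show ?thesis unfolding Int_commute[of "c p"] by (elim disjE) simp_all
  qed
  show ?thesis
    unfolding c_def[symmetric] Int_stable_def
  proof (intro ballI)
    fix a b assume "a \<in> insert {} (range c)" "b \<in> insert {} (range c)"
    then have "a = {} \<or> (\<exists>p. a = c p)" "b = {} \<or> (\<exists>p. b = c p)" by blast+
    then show "a \<inter> b \<in> insert {} (range c)"
      by (elim disjE exE) (simp_all only: Int_empty_left Int_empty_right insertI1 cc)
  qed
qed

lemma measure_eqI_cells:
  fixes \<mu> \<nu> :: "(circle \<times> real) measure"
  assumes "sets \<mu> = sets borel" "sets \<nu> = sets borel" "finite_measure \<mu>"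
    and eq: "\<And>n q. emeasure \<mu> (cell n q) = emeasure \<nu> (cell n q)"
  shows "\<mu> = \<nu>"
proof (rule measure_eqI_generator_eq_countable[OF Int_stable_cells, where A = "range (cell 0)" and \<Omega> = UNIV])
  show "emeasure \<mu> X = emeasure \<nu> X" if "X \<in> insert {} (range (\<lambda>p. cell (fst p) (snd p)))" for X
    using that eq by auto
  show "\<Union> (range (cell 0)) = UNIV" by (auto simp: cell_def)
  show "range (cell 0) \<subseteq> insert {} (range (\<lambda>p. cell (fst p) (snd p)))"
    by (intro image_subsetI insertI2 image_eqI[of _ _ "(0, q)" for q]) simp_all
  show "emeasure \<mu> a \<noteq> \<infinity>" for a using finite_measure.emeasure_finite[OF assms(3)] by simp
qed (simp_all add: assms(1,2) sets_borel_cells)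

text \<open>With \<open>a n\<close> the squared norm of the level-\<open>n\<close> density, the
  martingale property makes increments orthogonal: the squared distance of levels
  \<open>n \<le> m\<close> is \<open>a m - a n\<close>. The norms increase and are bounded, hence
  converge, and the densities form a Cauchy sequence whose limit has integral \<open>\<mu> Q\<close>
  over every cell \<open>Q\<close>.\<close>

theorem density_from_energy:
  fixes \<mu> :: "(circle \<times> real) measure"
  assumes \<mu>: "prob_space \<mu>" "sets \<mu> = sets borel"
    and energy: "\<And>n. n0 \<le> n \<Longrightarrow> (\<integral>\<^sup>+z. ennreal (cell_density \<mu> n z) \<partial>\<mu>) \<le> ennreal C"
  obtains h where "h \<in> borel_measurable borel" "\<And>z. 0 \<le> h z"
    "(\<integral>\<^sup>+z. ennreal ((h z)\<^sup>2) \<partial>cylinder_lborel) \<le> ennreal C"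
    "\<mu> = density cylinder_lborel (\<lambda>z. ennreal (h z))"
proof -
  interpret \<mu>: prob_space \<mu> by fact
  let ?L = "cylinder_lborel"
  have sL [measurable_cong]: "sets ?L = sets borel" by (rule sets_cylinder_lborel)
  define g where "g = cell_density \<mu>"
  have g [measurable]: "g n \<in> borel_measurable borel" for n by (simp add: g_def)
  have g0: "0 \<le> g n z" for n z by (simp add: g_def cell_density_nonneg)
  define A where "A = (\<lambda>n. \<integral>\<^sup>+z. ennreal (g n z) \<partial>\<mu>)"
  define a where "a = (\<lambda>n. enn2real (A n))"
  have AC: "A n \<le> ennreal C" if "n0 \<le> n" for n using energy[OF that] by (simp add: A_def g_def)
  have Aa: "A n = ennreal (a n)" if "n0 \<le> n" for n
  proof -
    have "A n < top" using AC[OF that] by (rule le_less_trans) simp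
    then show ?thesis by (simp add: a_def)
  qed
  have a0: "0 \<le> a n" for n by (simp add: a_def)
  have aC: "a n \<le> max 0 C" if "n0 \<le> n" for n
    using AC[OF that] unfolding Aa[OF that] by (auto simp: ennreal_le_iff2)
  have cross: "(\<integral>\<^sup>+z. ennreal (g n z * g m z) \<partial>?L) = A n" if "n \<le> m" for n m
    using nn_integral_cell_density[OF \<mu> that, of "\<lambda>q. ennreal (4 ^ n * measure \<mu> (cell n q))"]
    by (simp add: A_def g_def cell_density_def ennreal_mult)
  \<comment> \<open>Stated as a sum because subtraction in \<open>ennreal\<close> is truncated;
    \<open>2 * A n\<close> is the cross term.\<close>
  have diff: "(\<integral>\<^sup>+z. ennreal ((g m z - g n z)\<^sup>2) \<partial>?L) + 2 * A n = A m + A n" if "n \<le> m" for n m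
  proof -
    have "(\<integral>\<^sup>+z. ennreal ((g m z - g n z)\<^sup>2) \<partial>?L) + 2 * A n = 
        (\<integral>\<^sup>+z. ennreal ((g m z - g n z)\<^sup>2) + 2 * ennreal (g n z * g m z) \<partial>?L)"
      by (simp add: nn_integral_add nn_integral_cmult cross[OF that])
    also have "\<dots> = (\<integral>\<^sup>+z. ennreal (g m z * g m z) + ennreal (g n z * g n z) \<partial>?L)"
    proof (rule nn_integral_cong)
      fix z
      have "ennreal ((g m z - g n z)\<^sup>2) + 2 * ennreal (g n z * g m z) = ennreal ((g m z - g n z)\<^sup>2 + 2 * (g n z * g m z))"
        using g0 by (simp add: ennreal_plus ennreal_mult)
      also have "(g m z - g n z)\<^sup>2 + 2 * (g n z * g m z) = g m z * g m z + g n z * g n z"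
        by (simp add: power2_eq_square algebra_simps)
      also have "ennreal \<dots> = ennreal (g m z * g m z) + ennreal (g n z * g n z)"
        using g0 by (intro ennreal_plus) auto
      finally show "ennreal ((g m z - g n z)\<^sup>2) + 2 * ennreal (g n z * g m z) = ennreal (g m z * g m z) + ennreal (g n z * g n z)" .
    qed
    also have "\<dots> = A m + A n" by (simp add: nn_integral_add cross)
    finally show ?thesis .
  qed
  have diff': "a n \<le> a m" "(\<integral>\<^sup>+z. ennreal ((g m z - g n z)\<^sup>2) \<partial>?L) = ennreal (a m - a n)" if "n0 \<le> n" "n \<le> m" for n m
  proof -
    define X where "X = (\<integral>\<^sup>+z. ennreal ((g m z - g n z)\<^sup>2) \<partial>?L)"
    have *: "X + 2 * ennreal (a n) = ennreal (a m) + ennreal (a n)"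
      using diff[OF that(2)] Aa[OF that(1)] Aa[of m] that by (simp add: X_def)
    have "X \<noteq> top"
    proof
      assume "X = top"
      then have "ennreal (a m) + ennreal (a n) = top" using *[symmetric] by simp
      then show False by simp
    qed
    then obtain x where x: "X = ennreal x" "0 \<le> x" by (cases X) auto
    have "ennreal (x + 2 * a n) = ennreal (a m + a n)"
      using * x a0 by (simp add: ennreal_mult)
    then have "x + 2 * a n = a m + a n" using x a0 by (subst (asm) ennreal_inj) auto
    then show "a n \<le> a m" "(\<integral>\<^sup>+z. ennreal ((g m z - g n z)\<^sup>2) \<partial>?L) = ennreal (a m - a n)"
      using x unfolding X_def[symmetric] by auto
  qed
  have inc: "incseq (\<lambda>n. a (n0 + n))" by (intro incseq_SucI) (simp add: diff'(1))
  have bdd: "bdd_above (range (\<lambda>n. a (n0 + n)))" by (rule bdd_aboveI[of _ "max 0 C"]) (use aC in auto)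
  have "convergent (\<lambda>n. a (n0 + n))" by (rule convergentI[OF LIMSEQ_incseq_SUP[OF bdd inc]])
  then have C: "Cauchy (\<lambda>n. a (n0 + n))" by (rule convergent_Cauchy)
  have "\<exists>N. \<forall>m\<ge>N. \<forall>n\<ge>N. \<bar>a (n0 + m) - a (n0 + n)\<bar> < 1 / 8 ^ k" for k
    using C unfolding Cauchy_def dist_real_def by simp
  then obtain N where N: "\<And>k m n. N k \<le> m \<Longrightarrow> N k \<le> n \<Longrightarrow> \<bar>a (n0 + m) - a (n0 + n)\<bar> < 1 / 8 ^ k"
    by metis
  \<comment> \<open>Past \<open>n0\<close> the index is at least every \<open>N i\<close> with
    \<open>i \<le> k\<close>; it increases with \<open>k\<close> and is at least \<open>k\<close>,
    so it eventually refines any given level.\<close>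
  define r where "r = (\<lambda>k. n0 + k + (\<Sum>i\<le>k. N i))"
  have r1: "r k \<le> r j" if "k \<le> j" for k j
    unfolding r_def using that by (intro add_mono sum_mono2) auto
  have r2: "n0 \<le> r k" "k \<le> r k" for k by (auto simp: r_def)
  have r3: "N k \<le> k + (\<Sum>i\<le>k. N i)" for k using member_le_sum[of k "{..k}" N] by simp
  have r4: "(\<integral>\<^sup>+z. ennreal ((g (r j) z - g (r k) z)\<^sup>2) \<partial>?L) \<le> ennreal (1 / 8 ^ k)" if "k \<le> j" for k j
  proof -
    have "N k \<le> j + (\<Sum>i\<le>j. N i)" using r1[OF that] r3[of k] by (simp add: r_def)
    from N[OF this r3[of k]] have "a (r j) - a (r k) \<le> 1 / 8 ^ k" by (simp add: r_def add.assoc)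
    then show ?thesis using diff'(2)[OF r2(1) r1[OF that]] by (simp add: ennreal_leI)
  qed
  \<comment> \<open>Where the sequence diverges, \<open>lim\<close> has an unspecified value; the
    maximum makes \<open>h\<close> nonnegative everywhere.\<close>
  define h where "h = (\<lambda>z. max 0 (lim (\<lambda>k. g (r k) z)))"
  have h [measurable]: "h \<in> borel_measurable borel" unfolding h_def by measurable
  have h0: "0 \<le> h z" for z by (simp add: h_def)
  have lim: "AE z in ?L. (\<lambda>k. g (r k) z) \<longlonglongrightarrow> h z"
  proof -
    have "AE z in ?L. convergent (\<lambda>k. g (r k) z)"
      by (rule L2_Cauchy_limit) (use r4 in \<open>auto simp: measurable_cong_sets[OF sL refl]\<close>)
    then show ?thesis
    proof eventually_elim
      case (elim z)
      then have l: "(\<lambda>k. g (r k) z) \<longlonglongrightarrow> lim (\<lambda>k. g (r k) z)" by (simp add: convergent_LIMSEQ_iff)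
      then have "0 \<le> lim (\<lambda>k. g (r k) z)" by (rule LIMSEQ_le_const) (use g0 in auto)
      then show ?case using l by (simp add: h_def)
    qed
  qed
  have hC: "(\<integral>\<^sup>+z. ennreal ((h z)\<^sup>2) \<partial>?L) \<le> ennreal C"
  proof (rule nn_integral_Fatou_le[where u = "\<lambda>k z. (g (r k) z)\<^sup>2" and ?k0.0 = 0])
    show "(\<lambda>z. (g (r k) z)\<^sup>2) \<in> borel_measurable ?L" for k by measurable
    show "AE z in ?L. (\<lambda>k. (g (r k) z)\<^sup>2) \<longlonglongrightarrow> (h z)\<^sup>2"
      using lim by eventually_elim (rule tendsto_power)
    show "(\<integral>\<^sup>+z. ennreal ((g (r k) z)\<^sup>2) \<partial>?L) \<le> ennreal C" for k
      using cross[of "r k" "r k"] AC[OF r2(1)[of k]] by (simp add: power2_eq_square)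
  qed
  have hd: "(\<integral>\<^sup>+z. ennreal ((h z - g (r k) z)\<^sup>2) \<partial>?L) \<le> ennreal (1 / 8 ^ k)" for k
  proof (rule nn_integral_Fatou_le[where u = "\<lambda>j z. (g (r j) z - g (r k) z)\<^sup>2" and ?k0.0 = k])
    show "(\<lambda>z. (g (r j) z - g (r k) z)\<^sup>2) \<in> borel_measurable ?L" for j by measurable
    show "AE z in ?L. (\<lambda>j. (g (r j) z - g (r k) z)\<^sup>2) \<longlonglongrightarrow> (h z - g (r k) z)\<^sup>2"
      using lim by eventually_elim (intro tendsto_power tendsto_diff tendsto_const)
    show "(\<integral>\<^sup>+z. ennreal ((g (r j) z - g (r k) z)\<^sup>2) \<partial>?L) \<le> ennreal (1 / 8 ^ k)" if "k \<le> j" for j by (rule r4[OF that])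
  qed
  have cells: "emeasure \<mu> (cell n q) = emeasure (density ?L (\<lambda>z. ennreal (h z))) (cell n q)" for n q
  proof -
    define Q where "Q = cell n q"
    have Q [measurable]: "Q \<in> sets borel" by (simp add: Q_def)
    have LQ: "emeasure ?L Q \<le> 1"
    proof (cases "Q = {}")
      case False
      then obtain z where "q = idx n z" by (auto simp: Q_def cell_def)
      then have "emeasure ?L Q = ennreal (1 / 4 ^ n)" by (simp add: Q_def emeasure_cell)
      also have "\<dots> \<le> ennreal 1" by (rule ennreal_leI) simp
      finally show ?thesis by simp
    qed simp
    have gQ: "(\<integral>\<^sup>+z. ennreal (g (r k) z) * indicator Q z \<partial>?L) = emeasure \<mu> Q" if "n \<le> k" for k
    proof -
      have "n \<le> r k" using that r2(2)[of k] by simp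
      from nn_integral_cell_density[OF \<mu> this, of "indicator {q}"]
      have "(\<integral>\<^sup>+z. indicator Q z * ennreal (g (r k) z) \<partial>?L) = (\<integral>\<^sup>+z. indicator Q z \<partial>\<mu>)"
        by (simp add: g_def Q_def cell_def indicator_def)
      then show ?thesis using \<mu>(2) by (simp add: mult.commute)
    qed
    have close: "(\<integral>\<^sup>+z. ennreal (u z) * indicator Q z \<partial>?L) \<le> (\<integral>\<^sup>+z. ennreal (v z) * indicator Q z \<partial>?L) + ennreal (2 / 2 ^ k)"
      if uv [measurable]: "u \<in> borel_measurable borel" "v \<in> borel_measurable borel" and v0: "\<And>z. 0 \<le> v z"
        and d: "(\<integral>\<^sup>+z. ennreal ((u z - v z)\<^sup>2) \<partial>?L) \<le> ennreal (1 / 8 ^ k)" for u v k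
    proof -
      have le: "u z \<le> v z + (1 / 2 ^ k + 2 ^ k * (u z - v z)\<^sup>2)" for z
      proof -
        \<comment> \<open>A substitute for the Cauchy-Schwarz inequality: either \<open>t\<close> is
          at most \<open>1 / 2 ^ k\<close>, or \<open>1 \<le> 2 ^ k * t\<close>. On a set of measure
          at most 1 the two terms integrate to at most \<open>1 / 2 ^ k\<close> and
          \<open>2 ^ k / 8 ^ k\<close>.\<close>
        have "t \<le> 1 / 2 ^ k + 2 ^ k * t\<^sup>2" for t :: real
        proof (cases "t \<le> 1 / 2 ^ k")
          case True then show ?thesis by (simp add: add_increasing2)
        next
          case False
          then have "1 \<le> 2 ^ k * t" by (simp add: field_simps)
          moreover have "0 \<le> t" using False by (meson divide_nonneg_nonneg less_imp_le linear order_trans zero_le_one zero_le_power zero_le_numeral)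
          ultimately have "1 * t \<le> (2 ^ k * t) * t" by (rule mult_right_mono)
          moreover have "0 \<le> 1 / (2 :: real) ^ k" by simp
          ultimately show ?thesis by (simp add: power2_eq_square mult.assoc add_increasing)
        qed
        from this[of "u z - v z"] show ?thesis by linarith
      qed
      have "(\<integral>\<^sup>+z. ennreal (u z) * indicator Q z \<partial>?L) \<le>
        (\<integral>\<^sup>+z. ennreal (v z) * indicator Q z + (ennreal (1 / 2 ^ k) * indicator Q z + ennreal (2 ^ k) * ennreal ((u z - v z)\<^sup>2)) \<partial>?L)"
      proof (rule nn_integral_mono)
        fix z
        show "ennreal (u z) * indicator Q z \<le> ennreal (v z) * indicator Q z + (ennreal (1 / 2 ^ k) * indicator Q z + ennreal (2 ^ k) * ennreal ((u z - v z)\<^sup>2))"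
        proof (cases "z \<in> Q")
          case True
          have "ennreal (u z) \<le> ennreal (v z + (1 / 2 ^ k + 2 ^ k * (u z - v z)\<^sup>2))" by (rule ennreal_leI[OF le])
          also have "\<dots> = ennreal (v z) + (ennreal (1 / 2 ^ k) + ennreal (2 ^ k) * ennreal ((u z - v z)\<^sup>2))"
            using v0 by (simp add: ennreal_plus ennreal_mult)
          finally show ?thesis using True by simp
        qed simp
      qed
      also have "\<dots> = (\<integral>\<^sup>+z. ennreal (v z) * indicator Q z \<partial>?L) + (ennreal (1 / 2 ^ k) * emeasure ?L Q + ennreal (2 ^ k) * (\<integral>\<^sup>+z. ennreal ((u z - v z)\<^sup>2) \<partial>?L))"
        by (simp add: nn_integral_add nn_integral_cmult sL)
      also have "\<dots> \<le> (\<integral>\<^sup>+z. ennreal (v z) * indicator Q z \<partial>?L) + (ennreal (1 / 2 ^ k) * 1 + ennreal (2 ^ k) * ennreal (1 / 8 ^ k))"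
        by (intro add_left_mono add_mono mult_left_mono LQ d) auto
      also have "ennreal (1 / 2 ^ k) * 1 + ennreal (2 ^ k) * ennreal (1 / 8 ^ k) = ennreal (1 / 2 ^ k + 2 ^ k * (1 / 8 ^ k))"
        by (subst ennreal_plus, simp, simp, subst ennreal_mult) auto
      also have "\<dots> \<le> ennreal (2 / 2 ^ k)"
      proof (rule ennreal_leI)
        have "2 ^ k * (1 / 8 ^ k) = (1 / 4 :: real) ^ k" by (simp flip: power_divide power_mult_distrib)
        also have "\<dots> \<le> (1 / 2) ^ k" by (rule power_mono) auto
        finally show "1 / 2 ^ k + 2 ^ k * (1 / 8 ^ k) \<le> 2 / (2 :: real) ^ k" by (simp add: power_divide)
      qed
      finally show ?thesis by (simp add: add_left_mono)
    qed
    have e: "\<exists>k\<ge>n. 2 / 2 ^ k \<le> (e :: real)" if "0 < e" for e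
    proof -
      have "\<exists>k. (1 / 2) ^ k < e / 2" by (rule real_arch_pow_inv) (use \<open>0 < e\<close> in auto)
      then obtain k where "(1 / 2) ^ k < e / 2" by (rule exE)
      moreover have "(1 / 2) ^ (k + n) \<le> (1 / 2 :: real) ^ k" by (rule power_decreasing) auto
      ultimately have "2 * (1 / 2) ^ (k + n) \<le> e" by linarith
      then show ?thesis
        by (intro exI[of _ "k + n"]) (simp only: power_divide power_one times_divide_eq_right mult_1_right le_add2 simp_thms)
    qed
    have "emeasure \<mu> Q = (\<integral>\<^sup>+z. ennreal (h z) * indicator Q z \<partial>?L)"
    proof (rule antisym; rule ennreal_le_epsilon)
      fix e :: real assume "0 < e"
      then obtain k where k: "n \<le> k" "2 / 2 ^ k \<le> e" using e by blast
      have "(\<integral>\<^sup>+z. ennreal ((g (r k) z - h z)\<^sup>2) \<partial>?L) \<le> ennreal (1 / 8 ^ k)" using hd[of k] by (simp add: power2_commute)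
      from close[OF g h h0 this] have "emeasure \<mu> Q \<le> (\<integral>\<^sup>+z. ennreal (h z) * indicator Q z \<partial>?L) + ennreal (2 / 2 ^ k)"
        by (simp add: gQ[OF k(1)])
      also have "\<dots> \<le> (\<integral>\<^sup>+z. ennreal (h z) * indicator Q z \<partial>?L) + ennreal e" by (intro add_left_mono ennreal_leI k)
      finally show "emeasure \<mu> Q \<le> (\<integral>\<^sup>+z. ennreal (h z) * indicator Q z \<partial>?L) + ennreal e" .
      from close[OF h g g0 hd[of k]] have "(\<integral>\<^sup>+z. ennreal (h z) * indicator Q z \<partial>?L) \<le> emeasure \<mu> Q + ennreal (2 / 2 ^ k)"
        by (simp add: gQ[OF k(1)])
      also have "\<dots> \<le> emeasure \<mu> Q + ennreal e" by (intro add_left_mono ennreal_leI k)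
      finally show "(\<integral>\<^sup>+z. ennreal (h z) * indicator Q z \<partial>?L) \<le> emeasure \<mu> Q + ennreal e" .
    qed
    then show ?thesis by (simp add: Q_def emeasure_density sL)
  qed
  have "\<mu> = density ?L (\<lambda>z. ennreal (h z))"
    by (rule measure_eqI_cells) (use \<mu>(2) cells sL \<mu>.finite_measure_axioms in auto)
  then show ?thesis using h h0 hC by (intro that[of h])
qed

section \<open>Sobolev regularity\<close>

lemma nn_integral_powr_finite:
  assumes b: "1 < (b :: real)"
  shows "(\<integral>\<^sup>+x. ennreal ((1 + \<bar>x\<bar>) powr (- b)) \<partial>lborel) < \<infinity>"
proof -
  define f where "f = (\<lambda>x::real. ennreal ((1 + \<bar>x\<bar>) powr (- b)))"
  have f [measurable]: "f \<in> borel_measurable borel" unfolding f_def by measurable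
  define I where "I = (\<integral>\<^sup>+x. f x * indicator {0..} x \<partial>lborel)"
  have "I = (\<integral>\<^sup>+x. ennreal ((1 + x) powr (- b)) * indicator {0..} x \<partial>lborel)"
    unfolding I_def f_def by (intro nn_integral_cong) (auto simp: indicator_def)
  also have "\<dots> = ennreal (0 - (1 / (1 - b) * (1 + 0) powr (1 - b)))"
  proof (rule nn_integral_FTC_atLeast)
    fix x :: real assume x: "0 \<le> x"
    show "((\<lambda>x. 1 / (1 - b) * (1 + x) powr (1 - b)) has_real_derivative (1 + x) powr (- b)) (at x)"
      using x b by (auto intro!: derivative_eq_intros)
  next
    have "((\<lambda>x. (1 + x) powr (1 - b)) \<longlongrightarrow> 0) at_top"
      using b by (intro tendsto_neg_powr filterlim_tendsto_add_at_top[OF tendsto_const] filterlim_ident) auto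
    from tendsto_mult[OF tendsto_const[of "1 / (1 - b)"] this]
    show "((\<lambda>x. 1 / (1 - b) * (1 + x) powr (1 - b)) \<longlongrightarrow> 0) at_top" by simp
  qed auto
  finally have I: "I < \<infinity>" by simp
  have "(\<integral>\<^sup>+x. f x \<partial>lborel) \<le> (\<integral>\<^sup>+x. f x * indicator {0..} x + f x * indicator {..0} x \<partial>lborel)"
    by (intro nn_integral_mono) (auto simp: indicator_def)
  also have "\<dots> = I + (\<integral>\<^sup>+x. f x * indicator {..0} x \<partial>lborel)" by (simp add: nn_integral_add I_def)
  also have "(\<integral>\<^sup>+x. f x * indicator {..0} x \<partial>lborel) = I"
  proof -
    have "(\<integral>\<^sup>+x. f x * indicator {..0} x \<partial>lborel) = ennreal \<bar>- 1\<bar> * (\<integral>\<^sup>+x. f (0 + (- 1) * x) * indicator {..0} (0 + (- 1) * x) \<partial>lborel)"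
      by (rule nn_integral_real_affine) auto
    also have "\<dots> = I" unfolding I_def by (auto simp: f_def indicator_def intro!: nn_integral_cong)
    finally show ?thesis .
  qed
  finally show ?thesis using I by (auto simp: f_def intro: le_less_trans)
qed

lemma nn_integral_count_space_int_le:
  fixes f :: "int \<Rightarrow> ennreal"
  assumes "\<And>I. finite I \<Longrightarrow> sum f I \<le> B"
  shows "(\<integral>\<^sup>+\<xi>. f \<xi> \<partial>count_space UNIV) \<le> B"
proof -
  have "(\<integral>\<^sup>+\<xi>. f \<xi> \<partial>count_space UNIV) = (\<integral>\<^sup>+n. f (int_decode n) \<partial>count_space UNIV)"
    by (rule nn_integral_bij_count_space[symmetric]) (rule bij_int_decode)
  also have "\<dots> = (\<Sum>n. f (int_decode n))" by (rule nn_integral_count_space_nat)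
  also have "\<dots> \<le> B"
  proof (rule suminf_le_const)
    fix n
    have "(\<Sum>i<n. f (int_decode i)) = sum f (int_decode ` {..<n})"
      by (simp add: sum.reindex inj_int_decode)
    also have "\<dots> \<le> B" by (rule assms) simp
    finally show "(\<Sum>i<n. f (int_decode i)) \<le> B" .
  qed simp
  finally show ?thesis .
qed

lemma sum_int_abs_le_suminf:
  fixes g :: "nat \<Rightarrow> real"
  assumes g: "summable g" "\<And>n. 0 \<le> g n" and I: "finite I"
  shows "(\<Sum>\<xi>\<in>I. g (nat \<bar>\<xi>\<bar>)) \<le> 2 * suminf g"
proof -
  have half: "(\<Sum>\<xi>\<in>A. g (nat \<bar>\<xi>\<bar>)) \<le> suminf g" if "inj_on (\<lambda>\<xi>. nat \<bar>\<xi>\<bar>) A" "finite A" for A :: "int set"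
  proof -
    have "(\<Sum>\<xi>\<in>A. g (nat \<bar>\<xi>\<bar>)) = sum g ((\<lambda>\<xi>. nat \<bar>\<xi>\<bar>) ` A)" using that(1) by (simp add: sum.reindex o_def)
    also have "\<dots> \<le> suminf g" by (rule sum_le_suminf) (use g that(2) in auto)
    finally show ?thesis .
  qed
  have "(\<Sum>\<xi>\<in>I. g (nat \<bar>\<xi>\<bar>)) = (\<Sum>\<xi>\<in>I \<inter> {0..}. g (nat \<bar>\<xi>\<bar>)) + (\<Sum>\<xi>\<in>I - {0..}. g (nat \<bar>\<xi>\<bar>))"
    by (rule sum.Int_Diff[OF I])
  also have "\<dots> \<le> suminf g + suminf g"
    by (intro add_mono half) (use I in \<open>auto simp: inj_on_def\<close>)
  finally show ?thesis by simp
qed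

text \<open>The frequencies are split at \<open>\<bar>\<xi>\<bar> = M * \<bar>\<eta>\<bar>\<close>.
  On one side the weight is \<open>O ((1 + \<bar>\<eta>\<bar>) powr (2 * s))\<close>, the sum over
  \<xi> is taken first, and the integral over \<eta> converges because
  \<open>\<sigma> - 2 * s > 1\<close>. In the cone the weight is
  \<open>O (\<bar>\<xi>\<bar> powr (2 * s))\<close> and \<eta> runs over an interval of length
  \<open>2 * \<bar>\<xi>\<bar> / M\<close>, which leaves the series of
  \<open>\<bar>\<xi>\<bar> powr (2 * s - 2 * p + 1)\<close>, convergent because
  \<open>s < p - 1\<close>.\<close>

lemma weighted_integral_finite:
  fixes c :: "int \<Rightarrow> real \<Rightarrow> real"
  assumes c [measurable]: "\<And>\<xi>. c \<xi> \<in> borel_measurable borel" and c0: "\<And>\<xi> \<eta>. 0 \<le> c \<xi> \<eta>"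
    and sum_bound: "\<And>I \<eta>. finite I \<Longrightarrow> (\<Sum>\<xi>\<in>I. c \<xi> \<eta>) \<le> C1 * (1 + \<bar>\<eta>\<bar>) powr (- \<sigma>)"
    and cone: "\<And>\<xi> \<eta>. \<xi> \<noteq> 0 \<Longrightarrow> M * \<bar>\<eta>\<bar> \<le> \<bar>of_int \<xi>\<bar> \<Longrightarrow> c \<xi> \<eta> \<le> C2 / \<bar>of_int \<xi>\<bar> ^ (2 * p)"
    and C: "0 \<le> C1" "0 \<le> C2" and M: "0 < M" and s: "0 \<le> s" "1 + 2 * s < \<sigma>" "s < real p - 1"
  shows "(\<integral>\<^sup>+\<xi>. (\<integral>\<^sup>+\<eta>. ennreal (c \<xi> \<eta> * ((2 * pi * of_int \<xi>)\<^sup>2 + \<eta>\<^sup>2) powr s) \<partial>lborel) \<partial>count_space UNIV) < \<infinity>"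
proof -
  define K1 where "K1 = (4 * pi\<^sup>2 * M\<^sup>2 + 1) powr s"
  define K2 where "K2 = (4 * pi\<^sup>2 + 1 / M\<^sup>2) powr s"
  have K: "0 \<le> K1" "0 \<le> K2" by (auto simp: K1_def K2_def)
  define w where "w = (\<lambda>\<xi> \<eta>. ((2 * pi * of_int \<xi>)\<^sup>2 + \<eta>\<^sup>2) powr s :: real)"
  have w [measurable]: "w \<xi> \<in> borel_measurable borel" for \<xi> unfolding w_def by measurable
  have w0: "0 \<le> w \<xi> \<eta>" for \<xi> \<eta> by (simp add: w_def)
  have sq_powr: "(x\<^sup>2) powr s = x powr (2 * s)" if "0 \<le> x" for x :: real
    using that by (cases "x = 0") (simp_all add: powr_powr flip: powr_numeral)
  have inside: "w \<xi> \<eta> \<le> K1 * (1 + \<bar>\<eta>\<bar>) powr (2 * s)" if "\<bar>of_int \<xi>\<bar> \<le> M * \<bar>\<eta>\<bar>" for \<xi> \<eta>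
  proof -
    have "\<bar>of_int \<xi>\<bar>\<^sup>2 \<le> (M * \<bar>\<eta>\<bar>)\<^sup>2" by (rule power_mono[OF that]) simp
    then have "4 * pi\<^sup>2 * (of_int \<xi>)\<^sup>2 \<le> 4 * pi\<^sup>2 * (M\<^sup>2 * \<eta>\<^sup>2)" by (intro mult_left_mono) (auto simp: power_mult_distrib)
    then have "(2 * pi * of_int \<xi>)\<^sup>2 + \<eta>\<^sup>2 \<le> (4 * pi\<^sup>2 * M\<^sup>2 + 1) * \<eta>\<^sup>2" by (simp add: power_mult_distrib algebra_simps)
    also have "\<eta>\<^sup>2 \<le> (1 + \<bar>\<eta>\<bar>)\<^sup>2" using power_mono[of "\<bar>\<eta>\<bar>" "1 + \<bar>\<eta>\<bar>" 2] by simp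
    finally have "(2 * pi * of_int \<xi>)\<^sup>2 + \<eta>\<^sup>2 \<le> (4 * pi\<^sup>2 * M\<^sup>2 + 1) * (1 + \<bar>\<eta>\<bar>)\<^sup>2"
      by (simp add: mult_left_mono)
    then have "w \<xi> \<eta> \<le> ((4 * pi\<^sup>2 * M\<^sup>2 + 1) * (1 + \<bar>\<eta>\<bar>)\<^sup>2) powr s"
      unfolding w_def by (intro powr_mono2 s) auto
    also have "\<dots> = K1 * (1 + \<bar>\<eta>\<bar>) powr (2 * s)" by (simp add: powr_mult K1_def sq_powr)
    finally show ?thesis .
  qed
  have outside: "w \<xi> \<eta> \<le> K2 * \<bar>of_int \<xi>\<bar> powr (2 * s)" if "M * \<bar>\<eta>\<bar> \<le> \<bar>of_int \<xi>\<bar>" for \<xi> \<eta>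
  proof -
    have "(M * \<bar>\<eta>\<bar>)\<^sup>2 \<le> \<bar>of_int \<xi>\<bar>\<^sup>2" by (rule power_mono[OF that]) (use M in simp)
    then have "\<eta>\<^sup>2 \<le> 1 / M\<^sup>2 * (of_int \<xi>)\<^sup>2" using M by (simp add: power_mult_distrib field_simps)
    then have "(2 * pi * of_int \<xi>)\<^sup>2 + \<eta>\<^sup>2 \<le> (4 * pi\<^sup>2 + 1 / M\<^sup>2) * \<bar>of_int \<xi>\<bar>\<^sup>2" by (simp add: power_mult_distrib distrib_right)
    then have "w \<xi> \<eta> \<le> ((4 * pi\<^sup>2 + 1 / M\<^sup>2) * \<bar>of_int \<xi>\<bar>\<^sup>2) powr s"
      unfolding w_def by (intro powr_mono2 s) auto
    also have "\<dots> = ((4 * pi\<^sup>2 + 1 / M\<^sup>2) powr s) * (\<bar>of_int \<xi>\<bar>\<^sup>2) powr s" by (rule powr_mult)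
    also have "\<dots> = K2 * \<bar>of_int \<xi>\<bar> powr (2 * s)" by (subst sq_powr) (auto simp: K2_def)
    finally show ?thesis .
  qed
  define e where "e = 2 * s - 2 * real p"
  define T where "T = suminf (\<lambda>n. real n powr (e + 1))"
  have e: "e + 1 < - 1" using s(3) by (simp add: e_def)
  have sumT: "summable (\<lambda>n. real n powr (e + 1))" using e by (simp add: summable_real_powr_iff)
  define G where "G = (\<integral>\<^sup>+\<eta>. ennreal (K1 * C1 * (1 + \<bar>\<eta>\<bar>) powr (2 * s - \<sigma>)) \<partial>lborel)"
  define u where "u = (\<lambda>\<xi> \<eta>. c \<xi> \<eta> * (K1 * (1 + \<bar>\<eta>\<bar>) powr (2 * s)))"
  \<comment> \<open>For \<open>\<xi> = 0\<close> this is 0, as \<open>0 powr e = 0\<close>; that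
    frequency always belongs to the first region.\<close>
  define v where "v = (\<lambda>\<xi> \<eta>. C2 * K2 * \<bar>of_int \<xi>\<bar> powr e * indicator {- (\<bar>of_int \<xi>\<bar> / M) .. \<bar>of_int \<xi>\<bar> / M} \<eta> :: real)"
  have [measurable]: "u \<xi> \<in> borel_measurable borel" "v \<xi> \<in> borel_measurable borel" for \<xi>
    unfolding u_def v_def by measurable
  have u0: "0 \<le> u \<xi> \<eta>" and v0: "0 \<le> v \<xi> \<eta>" for \<xi> \<eta> using c0 K C by (auto simp: u_def v_def)
  have pointwise: "c \<xi> \<eta> * w \<xi> \<eta> \<le> u \<xi> \<eta> + v \<xi> \<eta>" for \<xi> \<eta>
  proof (cases "\<bar>of_int \<xi>\<bar> \<le> M * \<bar>\<eta>\<bar>")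
    case True
    then have "c \<xi> \<eta> * w \<xi> \<eta> \<le> u \<xi> \<eta>" unfolding u_def by (intro mult_left_mono inside c0)
    then show ?thesis using v0[of \<xi> \<eta>] by linarith
  next
    case False
    then have le: "M * \<bar>\<eta>\<bar> \<le> \<bar>of_int \<xi>\<bar>" and \<xi>: "\<xi> \<noteq> 0" using M by auto
    have "\<bar>\<eta>\<bar> \<le> \<bar>of_int \<xi>\<bar> / M" using le M by (simp add: field_simps)
    then have ind: "\<eta> \<in> {- (\<bar>of_int \<xi>\<bar> / M) .. \<bar>of_int \<xi>\<bar> / M}" by (simp add: abs_le_iff)
    have "c \<xi> \<eta> * w \<xi> \<eta> \<le> C2 / \<bar>of_int \<xi>\<bar> ^ (2 * p) * (K2 * \<bar>of_int \<xi>\<bar> powr (2 * s))"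
      by (intro mult_mono cone[OF \<xi> le] outside[OF le] w0) (use C in auto)
    also have "\<dots> = C2 * K2 * (\<bar>of_int \<xi>\<bar> powr (2 * s) / \<bar>of_int \<xi>\<bar> ^ (2 * p))" by simp
    also have "\<bar>of_int \<xi>\<bar> powr (2 * s) / \<bar>of_int \<xi>\<bar> ^ (2 * p) = \<bar>of_int \<xi>\<bar> powr e"
      using \<xi> by (simp add: e_def powr_diff powr_realpow[of "\<bar>of_int \<xi>\<bar>" "2 * p", symmetric])
    also have "C2 * K2 * \<dots> = v \<xi> \<eta>" using ind by (simp add: v_def)
    finally show ?thesis using u0[of \<xi> \<eta>] by linarith
  qed
  have int_v: "(\<integral>\<^sup>+\<eta>. ennreal (v \<xi> \<eta>) \<partial>lborel) = ennreal (2 * C2 * K2 / M * real (nat \<bar>\<xi>\<bar>) powr (e + 1))" for \<xi>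
  proof -
    have "(\<integral>\<^sup>+\<eta>. ennreal (v \<xi> \<eta>) \<partial>lborel) =
        (\<integral>\<^sup>+\<eta>. ennreal (C2 * K2 * \<bar>of_int \<xi>\<bar> powr e) * indicator {- (\<bar>of_int \<xi>\<bar> / M) .. \<bar>of_int \<xi>\<bar> / M} \<eta> \<partial>lborel)"
      by (intro nn_integral_cong) (auto simp: v_def indicator_def)
    also have "\<dots> = ennreal (C2 * K2 * \<bar>of_int \<xi>\<bar> powr e) * ennreal (2 * \<bar>of_int \<xi>\<bar> / M)"
      using M by (simp add: nn_integral_cmult_indicator)
    also have "\<dots> = ennreal (C2 * K2 * \<bar>of_int \<xi>\<bar> powr e * (2 * \<bar>of_int \<xi>\<bar> / M))"
      using M C K by (intro ennreal_mult[symmetric]) auto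
    also have "C2 * K2 * \<bar>of_int \<xi>\<bar> powr e * (2 * \<bar>of_int \<xi>\<bar> / M) = 2 * C2 * K2 / M * (\<bar>of_int \<xi>\<bar> powr e * \<bar>of_int \<xi>\<bar>)"
      by simp
    also have "\<bar>of_int \<xi>\<bar> powr e * \<bar>of_int \<xi>\<bar> = real (nat \<bar>\<xi>\<bar>) powr (e + 1)"
      by (cases "\<xi> = 0") (simp_all add: powr_add of_nat_nat)
    finally show ?thesis .
  qed
  define V where "V = ennreal (2 * C2 * K2 / M * (2 * T))"
  have "(\<integral>\<^sup>+\<xi>. (\<integral>\<^sup>+\<eta>. ennreal (c \<xi> \<eta> * w \<xi> \<eta>) \<partial>lborel) \<partial>count_space UNIV) \<le> G + V"
  proof (rule nn_integral_count_space_int_le)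
    fix I :: "int set" assume I: "finite I"
    have "(\<Sum>\<xi>\<in>I. \<integral>\<^sup>+\<eta>. ennreal (c \<xi> \<eta> * w \<xi> \<eta>) \<partial>lborel) \<le> (\<Sum>\<xi>\<in>I. \<integral>\<^sup>+\<eta>. ennreal (u \<xi> \<eta>) + ennreal (v \<xi> \<eta>) \<partial>lborel)"
      by (intro sum_mono nn_integral_mono) (auto simp: u0 v0 pointwise ennreal_leI simp flip: ennreal_plus)
    also have "\<dots> = (\<Sum>\<xi>\<in>I. \<integral>\<^sup>+\<eta>. ennreal (u \<xi> \<eta>) \<partial>lborel) + (\<Sum>\<xi>\<in>I. \<integral>\<^sup>+\<eta>. ennreal (v \<xi> \<eta>) \<partial>lborel)"
      by (simp add: nn_integral_add sum.distrib)
    also have "\<dots> \<le> G + V"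
    proof (rule add_mono)
      have "(\<Sum>\<xi>\<in>I. \<integral>\<^sup>+\<eta>. ennreal (u \<xi> \<eta>) \<partial>lborel) = (\<integral>\<^sup>+\<eta>. (\<Sum>\<xi>\<in>I. ennreal (u \<xi> \<eta>)) \<partial>lborel)"
        by (rule nn_integral_sum[symmetric]) measurable
      also have "\<dots> \<le> G"
        unfolding G_def
      proof (rule nn_integral_mono)
        fix \<eta>
        have "(\<Sum>\<xi>\<in>I. ennreal (u \<xi> \<eta>)) = ennreal (\<Sum>\<xi>\<in>I. u \<xi> \<eta>)" by (rule sum_ennreal) (simp add: u0)
        also have "(\<Sum>\<xi>\<in>I. u \<xi> \<eta>) = (\<Sum>\<xi>\<in>I. c \<xi> \<eta>) * (K1 * (1 + \<bar>\<eta>\<bar>) powr (2 * s))" by (simp add: u_def sum_distrib_right)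
        also have "\<dots> \<le> C1 * (1 + \<bar>\<eta>\<bar>) powr (- \<sigma>) * (K1 * (1 + \<bar>\<eta>\<bar>) powr (2 * s))"
          by (intro mult_right_mono sum_bound I) (use K in auto)
        also have "\<dots> = K1 * C1 * ((1 + \<bar>\<eta>\<bar>) powr (- \<sigma>) * (1 + \<bar>\<eta>\<bar>) powr (2 * s))" by simp
        also have "(1 + \<bar>\<eta>\<bar>) powr (- \<sigma>) * (1 + \<bar>\<eta>\<bar>) powr (2 * s) = (1 + \<bar>\<eta>\<bar>) powr (2 * s - \<sigma>)"
          by (simp flip: powr_add)
        finally show "(\<Sum>\<xi>\<in>I. ennreal (u \<xi> \<eta>)) \<le> ennreal (K1 * C1 * (1 + \<bar>\<eta>\<bar>) powr (2 * s - \<sigma>))"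
          by (simp add: ennreal_leI)
      qed
      finally show "(\<Sum>\<xi>\<in>I. \<integral>\<^sup>+\<eta>. ennreal (u \<xi> \<eta>) \<partial>lborel) \<le> G" .
      have "(\<Sum>\<xi>\<in>I. \<integral>\<^sup>+\<eta>. ennreal (v \<xi> \<eta>) \<partial>lborel) = ennreal (\<Sum>\<xi>\<in>I. 2 * C2 * K2 / M * real (nat \<bar>\<xi>\<bar>) powr (e + 1))"
        unfolding int_v by (rule sum_ennreal) (use C K M in auto)
      also have "(\<Sum>\<xi>\<in>I. 2 * C2 * K2 / M * real (nat \<bar>\<xi>\<bar>) powr (e + 1)) = 2 * C2 * K2 / M * (\<Sum>\<xi>\<in>I. real (nat \<bar>\<xi>\<bar>) powr (e + 1))"
        by (rule sum_distrib_left[symmetric])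
      also have "ennreal \<dots> \<le> V"
        unfolding V_def T_def
        by (intro ennreal_leI mult_left_mono sum_int_abs_le_suminf[OF sumT _ I]) (use C K M in auto)
      finally show "(\<Sum>\<xi>\<in>I. \<integral>\<^sup>+\<eta>. ennreal (v \<xi> \<eta>) \<partial>lborel) \<le> V" .
    qed
    finally show "(\<Sum>\<xi>\<in>I. \<integral>\<^sup>+\<eta>. ennreal (c \<xi> \<eta> * w \<xi> \<eta>) \<partial>lborel) \<le> G + V" .
  qed
  also have "G + V < \<infinity>"
  proof -
    have "G = ennreal (K1 * C1) * (\<integral>\<^sup>+\<eta>. ennreal ((1 + \<bar>\<eta>\<bar>) powr (- (\<sigma> - 2 * s))) \<partial>lborel)"
      using K C by (simp add: G_def ennreal_mult nn_integral_cmult)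
    also have "\<dots> < \<infinity>" using nn_integral_powr_finite[of "\<sigma> - 2 * s"] s(2) by (simp add: ennreal_mult_less_top)
    finally show ?thesis by (simp add: V_def)
  qed
  finally show ?thesis by (simp add: w_def)
qed

context skew
begin

text \<open>Bessel's inequality carries the decay of \<open>J\<close> over to the sum over \<xi>.
  The factor \<open>2 powr \<sigma>\<close> replaces \<open>\<bar>\<eta>\<bar>\<close> by
  \<open>1 + \<bar>\<eta>\<bar>\<close>: for \<open>\<bar>\<eta>\<bar> \<le> 1\<close> it
  compensates the trivial bound 1, otherwise
  \<open>1 + \<bar>\<eta>\<bar> \<le> 2 * \<bar>\<eta>\<bar>\<close>.\<close>

lemma SBR_fourier_bounds:
  assumes F: "F = (\<lambda>x. f (to_circle x))" and SBR: "is_SBR_measure (skew_product l lam f) \<mu>"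
    and q: "0 < q" "q \<le> n0" and sep: "separated l \<tau> F' q K n0 (32 * M * \<tau> ^ n0)" and M: "0 < M"
    and \<sigma>: "0 < \<sigma>" "\<sigma> \<le> 2 * real p - 1" and gap: "real K < (real l * lam powr \<sigma>) ^ q"
  obtains C1 C2 where "0 \<le> C1" "0 \<le> C2"
    "\<And>I \<eta>. finite I \<Longrightarrow> (\<Sum>\<xi>\<in>I. (cmod (charfun \<mu> \<xi> \<eta>))\<^sup>2) \<le> C1 * (1 + \<bar>\<eta>\<bar>) powr (- \<sigma>)"
    "\<And>\<xi> \<eta>. \<xi> \<noteq> 0 \<Longrightarrow> M * \<bar>\<eta>\<bar> \<le> \<bar>of_int \<xi>\<bar> \<Longrightarrow> (cmod (charfun \<mu> \<xi> \<eta>))\<^sup>2 \<le> C2 / \<bar>of_int \<xi>\<bar> ^ (2 * p)"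
proof -
  obtain C where C: "0 < C" and J: "\<And>\<eta>. \<eta> \<noteq> 0 \<Longrightarrow> \<exists>k0. \<forall>k\<ge>k0. J k \<eta> \<le> C * \<bar>\<eta>\<bar> powr (- \<sigma>)"
    using separated_imp_J_decay[OF q sep M \<sigma> gap] by (elim exE conjE) metis
  obtain C' where C': "0 \<le> C'" and cone: "\<And>k \<eta> \<xi>. \<xi> \<noteq> 0 \<Longrightarrow> M * \<bar>\<eta>\<bar> \<le> \<bar>of_int \<xi>\<bar> \<Longrightarrow> cmod (fcoef 0 (\<psi> k \<eta>) \<xi>) \<le> C' / \<bar>of_int \<xi>\<bar> ^ p"
    using cone_decay by (elim exE conjE) metis
  have bessel: "(\<Sum>\<xi>\<in>I. (cmod (fcoef 0 (\<psi> k \<eta>) \<xi>))\<^sup>2) \<le> J k \<eta>" if "finite I" for I k \<eta>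
  proof -
    have "continuous_on {0..0 + 1} (\<psi> k \<eta>)" by (intro continuous_intros)
    from Bessel_inequality[OF that this] show ?thesis by (simp add: J_def)
  qed
  define C1 where "C1 = 2 powr \<sigma> * max 1 C"
  have sum: "(\<Sum>\<xi>\<in>I. (cmod (charfun \<mu> \<xi> \<eta>))\<^sup>2) \<le> C1 * (1 + \<bar>\<eta>\<bar>) powr (- \<sigma>)" if I: "finite I" for I \<eta>
  proof -
    have half: "1 \<le> 2 powr \<sigma> * ((1 + \<bar>\<eta>\<bar>) powr (- \<sigma>) * x powr \<sigma>)" if "1 + \<bar>\<eta>\<bar> \<le> 2 * x" "0 < x" for x
    proof -
      have "(1 + \<bar>\<eta>\<bar>) powr \<sigma> \<le> (2 * x) powr \<sigma>" by (rule powr_mono2) (use \<sigma> that in auto)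
      then have "1 \<le> (2 * x) powr \<sigma> / (1 + \<bar>\<eta>\<bar>) powr \<sigma>" by simp
      also have "\<dots> = 2 powr \<sigma> * ((1 + \<bar>\<eta>\<bar>) powr (- \<sigma>) * x powr \<sigma>)"
        using that by (simp add: powr_mult powr_minus divide_inverse)
      finally show ?thesis .
    qed
    show ?thesis
    proof (cases "\<bar>\<eta>\<bar> \<le> 1")
      case True
      have "(\<Sum>\<xi>\<in>I. (cmod (charfun \<mu> \<xi> \<eta>))\<^sup>2) \<le> 1"
        by (rule charfun_SBR_bound[OF F SBR I, of 0]) (rule order_trans[OF bessel[OF I] J_le_1])
      also have "1 \<le> 2 powr \<sigma> * (1 + \<bar>\<eta>\<bar>) powr (- \<sigma>)" using half[of 1] True by simp
      also have "\<dots> \<le> C1 * (1 + \<bar>\<eta>\<bar>) powr (- \<sigma>)" unfolding C1_def by (intro mult_right_mono) auto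
      finally show ?thesis .
    next
      case False
      then have "\<eta> \<noteq> 0" by auto
      from J[OF this] obtain k0 where k0: "\<And>k. k0 \<le> k \<Longrightarrow> J k \<eta> \<le> C * \<bar>\<eta>\<bar> powr (- \<sigma>)" by (elim exE) blast
      have "(\<Sum>\<xi>\<in>I. (cmod (charfun \<mu> \<xi> \<eta>))\<^sup>2) \<le> C * \<bar>\<eta>\<bar> powr (- \<sigma>)"
        by (rule charfun_SBR_bound[OF F SBR I, of k0]) (rule order_trans[OF bessel[OF I] k0])
      also have "\<dots> \<le> max 1 C * \<bar>\<eta>\<bar> powr (- \<sigma>)" by (intro mult_right_mono) auto
      also have "\<dots> \<le> max 1 C * (2 powr \<sigma> * (1 + \<bar>\<eta>\<bar>) powr (- \<sigma>))"
      proof (rule mult_left_mono)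
        have "1 \<le> 2 powr \<sigma> * ((1 + \<bar>\<eta>\<bar>) powr (- \<sigma>) * \<bar>\<eta>\<bar> powr \<sigma>)" by (rule half) (use False in auto)
        then have "1 * \<bar>\<eta>\<bar> powr (- \<sigma>) \<le> 2 powr \<sigma> * ((1 + \<bar>\<eta>\<bar>) powr (- \<sigma>) * \<bar>\<eta>\<bar> powr \<sigma>) * \<bar>\<eta>\<bar> powr (- \<sigma>)"
          by (rule mult_right_mono) simp
        also have "\<dots> = 2 powr \<sigma> * (1 + \<bar>\<eta>\<bar>) powr (- \<sigma>) * (\<bar>\<eta>\<bar> powr \<sigma> * \<bar>\<eta>\<bar> powr (- \<sigma>))" by simp
        also have "\<bar>\<eta>\<bar> powr \<sigma> * \<bar>\<eta>\<bar> powr (- \<sigma>) = 1" using \<open>\<eta> \<noteq> 0\<close> by (simp flip: powr_add)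
        finally show "\<bar>\<eta>\<bar> powr (- \<sigma>) \<le> 2 powr \<sigma> * (1 + \<bar>\<eta>\<bar>) powr (- \<sigma>)" by simp
      qed simp
      also have "\<dots> = C1 * (1 + \<bar>\<eta>\<bar>) powr (- \<sigma>)" by (simp add: C1_def)
      finally show ?thesis .
    qed
  qed
  have single: "(cmod (charfun \<mu> \<xi> \<eta>))\<^sup>2 \<le> C'\<^sup>2 / \<bar>of_int \<xi>\<bar> ^ (2 * p)" if "\<xi> \<noteq> 0" "M * \<bar>\<eta>\<bar> \<le> \<bar>of_int \<xi>\<bar>" for \<xi> \<eta>
  proof -
    have "(\<Sum>\<xi>\<in>{\<xi>}. (cmod (charfun \<mu> \<xi> \<eta>))\<^sup>2) \<le> (C' / \<bar>of_int \<xi>\<bar> ^ p)\<^sup>2"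
    proof (rule charfun_SBR_bound[OF F SBR, of _ 0])
      show "(\<Sum>\<xi>\<in>{\<xi>}. (cmod (fcoef 0 (\<psi> k \<eta>) \<xi>))\<^sup>2) \<le> (C' / \<bar>of_int \<xi>\<bar> ^ p)\<^sup>2" for k
        using power_mono[OF cone[OF that, of k] norm_ge_zero, of 2] by simp
    qed simp
    then show ?thesis by (simp add: power_divide power_mult[symmetric] mult.commute)
  qed
  show ?thesis
    by (rule that[of C1 "C'\<^sup>2"]) (use sum single in \<open>auto simp: C1_def\<close>)
qed

end

lemma charfun_measurable:
  assumes "prob_space \<mu>" "sets \<mu> = sets borel"
  shows "charfun \<mu> \<xi> \<in> borel_measurable borel"
proof -
  interpret prob_space \<mu> by fact
  have [measurable_cong]: "sets \<mu> = sets (borel \<Otimes>\<^sub>M borel)" unfolding borel_prod by (rule assms(2))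
  show ?thesis
    unfolding charfun_def[abs_def] by measurable
qed

lemma sobolev_density_from_charfun:
  fixes \<mu> :: "(circle \<times> real) measure"
  assumes \<mu>: "prob_space \<mu>" "sets \<mu> = sets borel"
    and C: "0 \<le> C1" "0 \<le> C2" and M: "0 < M" and s: "0 \<le> s" "1 + 2 * s < \<sigma>" "s < real p - 1"
    and sum_bound: "\<And>I \<eta>. finite I \<Longrightarrow> (\<Sum>\<xi>\<in>I. (cmod (charfun \<mu> \<xi> \<eta>))\<^sup>2) \<le> C1 * (1 + \<bar>\<eta>\<bar>) powr (- \<sigma>)"
    and cone: "\<And>\<xi> \<eta>. \<xi> \<noteq> 0 \<Longrightarrow> M * \<bar>\<eta>\<bar> \<le> \<bar>of_int \<xi>\<bar> \<Longrightarrow> (cmod (charfun \<mu> \<xi> \<eta>))\<^sup>2 \<le> C2 / \<bar>of_int \<xi>\<bar> ^ (2 * p)"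
  shows "\<exists>h :: circle \<times> real \<Rightarrow> real. h \<in> borel_measurable cylinder_lborel \<and> (\<forall>z. 0 \<le> h z) \<and>
     \<mu> = density cylinder_lborel (\<lambda>z. ennreal (h z)) \<and> (\<lambda>z. complex_of_real (h z)) \<in> sobolev_space s"
proof -
  interpret \<mu>: prob_space \<mu> by fact
  define Jb where "Jb = (\<lambda>\<eta>. C1 * (1 + \<bar>\<eta>\<bar>) powr (- \<sigma>))"
  have Jb [measurable]: "Jb \<in> borel_measurable borel" unfolding Jb_def by measurable
  have Jb1: "0 \<le> Jb \<eta> \<and> Jb \<eta> \<le> C1" for \<eta>
  proof -
    have "(1 + \<bar>\<eta>\<bar>) powr (- \<sigma>) \<le> (1 + \<bar>\<eta>\<bar>) powr 0" by (rule powr_mono) (use s in auto)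
    also have "(1 + \<bar>\<eta>\<bar>) powr 0 = 1"
    proof -
      have "1 + \<bar>\<eta>\<bar> \<noteq> 0" by linarith
      then show ?thesis by simp
    qed
    finally have "(1 + \<bar>\<eta>\<bar>) powr (- \<sigma>) \<le> 1" .
    then have "C1 * (1 + \<bar>\<eta>\<bar>) powr (- \<sigma>) \<le> C1 * 1" using C by (intro mult_left_mono) auto
    then show ?thesis using C by (simp add: Jb_def)
  qed
  have "(\<integral>\<^sup>+\<eta>. ennreal (Jb \<eta>) \<partial>lborel) = ennreal C1 * (\<integral>\<^sup>+\<eta>. ennreal ((1 + \<bar>\<eta>\<bar>) powr (- \<sigma>)) \<partial>lborel)"
    using C by (simp add: Jb_def ennreal_mult nn_integral_cmult)
  also have "\<dots> < \<infinity>" using nn_integral_powr_finite[of \<sigma>] s by (simp add: ennreal_mult_less_top)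
  finally have "64 * (\<integral>\<^sup>+\<eta>. ennreal (Jb \<eta>) \<partial>lborel) < top" by (simp add: ennreal_mult_less_top)
  then obtain E where E: "64 * (\<integral>\<^sup>+\<eta>. ennreal (Jb \<eta>) \<partial>lborel) = ennreal E" by (metis ennreal_enn2real)
  \<comment> \<open>Levels start at 3 because the energy bound is stated for
    \<open>k + 3\<close>.\<close>
  have energy: "(\<integral>\<^sup>+z. ennreal (cell_density \<mu> n z) \<partial>\<mu>) \<le> ennreal E" if "3 \<le> n" for n
  proof -
    have "(\<integral>\<^sup>+z. ennreal (4 ^ (n - 3 + 3) * measure \<mu> (cell (n - 3 + 3) (idx (n - 3 + 3) z))) \<partial>\<mu>) \<le> 64 * (\<integral>\<^sup>+\<eta>. ennreal (Jb \<eta>) \<partial>lborel)"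
      by (rule energy_bound[OF \<mu> Jb Jb1]) (use sum_bound in \<open>simp add: Jb_def\<close>)
    then show ?thesis using \<open>3 \<le> n\<close> by (simp add: E cell_density_def)
  qed
  obtain h where h: "h \<in> borel_measurable borel" "\<And>z. 0 \<le> h z"
    and h2: "(\<integral>\<^sup>+z. ennreal ((h z)\<^sup>2) \<partial>cylinder_lborel) \<le> ennreal E"
    and \<mu>h: "\<mu> = density cylinder_lborel (\<lambda>z. ennreal (h z))"
  proof (rule density_from_energy[OF \<mu> energy])
    fix h assume "h \<in> borel_measurable borel" "\<And>z. 0 \<le> h z"
      "(\<integral>\<^sup>+z. ennreal ((h z)\<^sup>2) \<partial>cylinder_lborel) \<le> ennreal E" "\<mu> = density cylinder_lborel (\<lambda>z. ennreal (h z))"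
    then show thesis by (rule that)
  qed
  have hL [measurable]: "h \<in> borel_measurable cylinder_lborel"
    using h(1) by (simp add: measurable_cong_sets[OF sets_cylinder_lborel refl])
  let ?\<phi> = "\<lambda>z. complex_of_real (h z)"
  have "(\<integral>\<^sup>+z. ennreal (h z) \<partial>cylinder_lborel) = emeasure \<mu> (space \<mu>)"
  proof -
    have "emeasure (density cylinder_lborel (\<lambda>z. ennreal (h z))) (space cylinder_lborel) = (\<integral>\<^sup>+z. ennreal (h z) * indicator (space cylinder_lborel) z \<partial>cylinder_lborel)"
      by (rule emeasure_density) auto
    also have "\<dots> = (\<integral>\<^sup>+z. ennreal (h z) \<partial>cylinder_lborel)" by (intro nn_integral_cong) simp
    finally show ?thesis unfolding \<mu>h by simp
  qed
  then have int_h: "integrable cylinder_lborel h"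
    by (intro integrableI_nonneg) (use h \<mu>.emeasure_space_1 in auto)
  have sq: "square_integrable ?\<phi>"
    unfolding square_integrable_def
  proof
    show "?\<phi> \<in> borel_measurable cylinder_lborel" by measurable
    have "(\<integral>\<^sup>+z. ennreal ((h z)\<^sup>2) \<partial>cylinder_lborel) < \<infinity>" by (rule le_less_trans[OF h2]) simp
    then have "integrable cylinder_lborel (\<lambda>z. (h z)\<^sup>2)" by (intro integrableI_nonneg) auto
    then show "integrable cylinder_lborel (\<lambda>z. (cmod (?\<phi> z))\<^sup>2)" by simp
  qed
  have fourier: "fourier ?\<phi> \<xi> \<eta> = complex_of_real (1 / sqrt (2 * pi)) * charfun \<mu> \<xi> \<eta>" for \<xi> \<eta>
  proof -
    have "mode \<xi> \<eta> \<in> borel_measurable cylinder_lborel"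
      using mode_measurable by (simp add: measurable_cong_sets[OF sets_cylinder_lborel refl])
    then have "charfun \<mu> \<xi> \<eta> = (\<integral>z. h z *\<^sub>R mode \<xi> \<eta> z \<partial>cylinder_lborel)"
      unfolding charfun_def by (subst \<mu>h, intro integral_density) (use h in auto)
    then show ?thesis by (simp add: fourier_def mode_def case_prod_unfold scaleR_conv_of_real)
  qed
  have meas: "fourier ?\<phi> \<xi> \<in> borel_measurable borel" for \<xi>
  proof -
    have "(\<lambda>\<eta>. complex_of_real (1 / sqrt (2 * pi)) * charfun \<mu> \<xi> \<eta>) \<in> borel_measurable borel"
      using charfun_measurable[OF \<mu>] by measurable
    then show ?thesis by (simp add: fourier cong: measurable_cong)
  qed
  \<comment> \<open>The density is integrable as well as square-integrable, so the constant sequence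
    shows that \<open>fourier\<close> itself represents the transform.\<close>
  have L2: "L2_fourier ?\<phi> (fourier ?\<phi>)"
    unfolding L2_fourier_def
  proof (intro conjI allI exI[of _ "\<lambda>n. ?\<phi>"])
    show "integrable cylinder_lborel ?\<phi>" using int_h by simp
  qed (use sq meas in auto)
  have "(\<integral>\<^sup>+\<xi>. (\<integral>\<^sup>+\<eta>. ennreal ((cmod (charfun \<mu> \<xi> \<eta>))\<^sup>2 * ((2 * pi * of_int \<xi>)\<^sup>2 + \<eta>\<^sup>2) powr s) \<partial>lborel) \<partial>count_space UNIV) < \<infinity>"
  proof (rule weighted_integral_finite[OF _ _ sum_bound cone C M s])
    show "(\<lambda>\<eta>. (cmod (charfun \<mu> \<xi> \<eta>))\<^sup>2) \<in> borel_measurable borel" for \<xi>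
      using charfun_measurable[OF \<mu>] by measurable
  qed auto
  moreover have "(cmod (fourier ?\<phi> \<xi> \<eta>))\<^sup>2 \<le> (cmod (charfun \<mu> \<xi> \<eta>))\<^sup>2" for \<xi> \<eta>
  proof (rule power_mono)
    have "1 \<le> sqrt (2 * pi)" using pi_gt3 by simp
    then have "\<bar>1 / sqrt (2 * pi)\<bar> \<le> 1" by simp
    then have "\<bar>1 / sqrt (2 * pi)\<bar> * cmod (charfun \<mu> \<xi> \<eta>) \<le> 1 * cmod (charfun \<mu> \<xi> \<eta>)" by (intro mult_right_mono) auto
    then show "cmod (fourier ?\<phi> \<xi> \<eta>) \<le> cmod (charfun \<mu> \<xi> \<eta>)" unfolding fourier norm_mult norm_of_real by simp
  qed simp
  then have "(\<integral>\<^sup>+\<xi>. (\<integral>\<^sup>+\<eta>. ennreal ((cmod (fourier ?\<phi> \<xi> \<eta>))\<^sup>2 * ((2 * pi * of_int \<xi>)\<^sup>2 + \<eta>\<^sup>2) powr s) \<partial>lborel) \<partial>count_space UNIV) \<le>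
    (\<integral>\<^sup>+\<xi>. (\<integral>\<^sup>+\<eta>. ennreal ((cmod (charfun \<mu> \<xi> \<eta>))\<^sup>2 * ((2 * pi * of_int \<xi>)\<^sup>2 + \<eta>\<^sup>2) powr s) \<partial>lborel) \<partial>count_space UNIV)"
    by (intro nn_integral_mono ennreal_leI mult_right_mono) auto
  ultimately have "(\<integral>\<^sup>+\<xi>. (\<integral>\<^sup>+\<eta>. ennreal ((cmod (fourier ?\<phi> \<xi> \<eta>))\<^sup>2 * ((2 * pi * of_int \<xi>)\<^sup>2 + \<eta>\<^sup>2) powr s) \<partial>lborel) \<partial>count_space UNIV) < \<infinity>"
    by (rule le_less_trans[rotated])
  then have "?\<phi> \<in> sobolev_space s"
    unfolding sobolev_space_def using sq L2 by blast
  then show ?thesis using hL h(2) \<mu>h by blast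
qed

theorem theorem1:
  fixes r l :: nat and lam s :: real
  assumes "r \<ge> 3" and "l \<ge> 2" and "0 < lam" and "lam < 1"
    and "0 \<le> s" and "s < real r - 2" and "lam powr (1 + 2 * s) * real l > 1"
  shows "\<exists>D. openin (Cr_topology r) D \<and> Cr_topology r closure_of D = Cr_circle r \<and>
           (\<forall>f\<in>D. \<forall>\<mu>. is_SBR_measure (skew_product l lam f) \<mu> \<longrightarrow>
              (\<exists>h :: circle \<times> real \<Rightarrow> real.
                 h \<in> borel_measurable cylinder_lborel \<and> (\<forall>z. 0 \<le> h z) \<and>
                 \<mu> = density cylinder_lborel (\<lambda>z. ennreal (h z)) \<and>
                 (\<lambda>z. complex_of_real (h z)) \<in> sobolev_space s))"
proof -
  \<comment> \<open>With \<open>lam = exp (- b)\<close>, the condition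
    \<open>1 < l * lam powr x\<close> becomes the linear one \<open>x < ln l / b\<close>.\<close>
  define b where "b = - ln lam"
  have b: "0 < b" using assms(3,4) by (simp add: b_def)
  have gt_iff: "1 < real l * lam powr x \<longleftrightarrow> b * x < ln (real l)" for x
  proof -
    have "1 < real l * lam powr x \<longleftrightarrow> 0 < ln (real l * lam powr x)" using assms(2,3) by simp
    also have "ln (real l * lam powr x) = ln (real l) - b * x" using assms(2,3) by (simp add: ln_mult b_def)
    finally show ?thesis by simp
  qed
  have "b * (1 + 2 * s) < ln (real l)" using assms(7) by (simp only: gt_iff[symmetric] mult.commute)
  then have sL: "1 + 2 * s < ln (real l) / b" using b by (simp add: field_simps)
  \<comment> \<open>\<sigma> lies above \<open>1 + 2 * s\<close>, for the Sobolev norm; below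
    \<open>ln l / b\<close>, so that \<open>\<Gamma> > 1\<close>; and at most
    \<open>2 * r - 3\<close>, the order that \<open>r - 1\<close> derivatives of \<open>f'\<close>
    allow after summation over the frequencies. The hypothesis on \<open>lam\<close> and
    \<open>s < r - 2\<close> put both upper limits above \<open>1 + 2 * s\<close>.\<close>
  define \<sigma> where "\<sigma> = min (2 * real r - 3) ((1 + 2 * s + ln (real l) / b) / 2)"
  have \<sigma>: "1 + 2 * s < \<sigma>" "\<sigma> \<le> 2 * real r - 3" "\<sigma> < ln (real l) / b"
  proof -
    have "x < min y ((x + L) / 2)" "min y ((x + L) / 2) \<le> y" "min y ((x + L) / 2) < L"
      if "x < L" "x < y" for x y L :: real using that by (auto simp: min_less_iff_disj)
    from this[OF sL, of "2 * real r - 3"] show "1 + 2 * s < \<sigma>" "\<sigma> \<le> 2 * real r - 3" "\<sigma> < ln (real l) / b"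
      using assms(6) by (simp_all add: \<sigma>_def)
  qed
  define \<Gamma> where "\<Gamma> = real l * lam powr \<sigma>"
  have \<Gamma>: "1 < \<Gamma>" unfolding \<Gamma>_def gt_iff using \<sigma>(3) b by (simp add: field_simps)
  obtain k q R where k: "1 \<le> k" "real l ^ (k + 1) * (lam / real l) ^ (k - 1) < 1"
    and q: "1 \<le> q" "q \<le> R" and R: "2 * real k * (lam / real l) ^ R \<le> (lam / real l) ^ (q - 1) / 4"
    and gap: "real ((2 * R + 1) * (k + 1)) < \<Gamma> ^ q"
    using exists_parameters[OF assms(2,3,4) \<Gamma>] by (elim exE conjE)
  define D where "D = generic_set l (lam / real l) r q ((2 * R + 1) * (k + 1))"
  have \<tau>: "0 < lam / real l" "lam / real l \<le> 1 / 2" using assms(2,3,4) by (auto simp: field_simps)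
  have "openin (Cr_topology r) D" unfolding D_def by (rule openin_generic_set) (use \<tau> assms(1) in auto)
  moreover have "Cr_topology r closure_of D = Cr_circle r"
    unfolding D_def by (rule dense_generic_set) (use assms(1-4) k q R in auto)
  moreover have "\<exists>h :: circle \<times> real \<Rightarrow> real. h \<in> borel_measurable cylinder_lborel \<and> (\<forall>z. 0 \<le> h z) \<and>
     \<mu> = density cylinder_lborel (\<lambda>z. ennreal (h z)) \<and> (\<lambda>z. complex_of_real (h z)) \<in> sobolev_space s"
    if f: "f \<in> D" and SBR: "is_SBR_measure (skew_product l lam f) \<mu>" for f \<mu>
  proof -
    obtain M n \<epsilon> where fC: "f \<in> Cr_circle r" and M: "0 < M" and n: "q \<le> n" and \<epsilon>: "0 < \<epsilon>"
      and bd: "\<And>k x. k \<le> r \<Longrightarrow> \<bar>circle_deriv k f x\<bar> \<le> M"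
      and sep: "separated l (lam / real l) (circle_deriv 1 f) q ((2 * R + 1) * (k + 1)) n (32 * M * (lam / real l) ^ n + \<epsilon>)"
      using f unfolding D_def generic_set_def by blast
    define F where "F = (\<lambda>x. f (to_circle x))"
    have F0: "F = circle_deriv 0 f" by (simp add: F_def circle_deriv_def)
    interpret skew l lam F "circle_deriv 1 f" "r - 1" M
    proof
      show "F (x + 1) = F x" for x unfolding F0 by (rule circle_deriv_periodic)
      show "(F has_real_derivative circle_deriv 1 f x) (at x)" for x
        using Cr_circle_has_deriv[OF fC, of 0] assms(1) unfolding F0 by simp
      show "bounded_derivs UNIV (r - 1) M (circle_deriv 1 f)"
        by (rule bounded_derivs_circle_deriv[OF fC bd]) (use assms(1) in auto)
    qed (use assms in auto)
    have sep': "separated l (lam / real l) (circle_deriv 1 f) q ((2 * R + 1) * (k + 1)) n (32 * M * (lam / real l) ^ n)"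
      by (rule separated_mono[OF sep]) (use \<epsilon> in simp)
    obtain C1 C2 where C: "0 \<le> C1" "0 \<le> C2"
      and sum: "\<And>I \<eta>. finite I \<Longrightarrow> (\<Sum>\<xi>\<in>I. (cmod (charfun \<mu> \<xi> \<eta>))\<^sup>2) \<le> C1 * (1 + \<bar>\<eta>\<bar>) powr (- \<sigma>)"
      and cone: "\<And>\<xi> \<eta>. \<xi> \<noteq> 0 \<Longrightarrow> M * \<bar>\<eta>\<bar> \<le> \<bar>of_int \<xi>\<bar> \<Longrightarrow> (cmod (charfun \<mu> \<xi> \<eta>))\<^sup>2 \<le> C2 / \<bar>of_int \<xi>\<bar> ^ (2 * (r - 1))"
    proof (rule SBR_fourier_bounds[OF F_def SBR _ n sep' M, of \<sigma>])
      show "0 < q" using q by simp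
      show "0 < \<sigma>" using \<sigma>(1) assms(5) by linarith
      show "\<sigma> \<le> 2 * real (r - 1) - 1" using \<sigma>(2) assms(1) by (simp add: of_nat_diff)
      show "real ((2 * R + 1) * (k + 1)) < (real l * lam powr \<sigma>) ^ q" using gap by (simp only: \<Gamma>_def)
      fix C1 C2 :: real
      assume "0 \<le> C1" "0 \<le> C2"
        "\<And>I \<eta>. finite I \<Longrightarrow> (\<Sum>\<xi>\<in>I. (cmod (charfun \<mu> \<xi> \<eta>))\<^sup>2) \<le> C1 * (1 + \<bar>\<eta>\<bar>) powr (- \<sigma>)"
        "\<And>\<xi> \<eta>. \<xi> \<noteq> 0 \<Longrightarrow> M * \<bar>\<eta>\<bar> \<le> \<bar>of_int \<xi>\<bar> \<Longrightarrow> (cmod (charfun \<mu> \<xi> \<eta>))\<^sup>2 \<le> C2 / \<bar>of_int \<xi>\<bar> ^ (2 * (r - 1))"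
      then show thesis by (rule that)
    qed
    have "prob_space \<mu>" "sets \<mu> = sets borel"
      using SBR by (auto simp: is_SBR_measure_def ergodic_measure_def invariant_measure_def)
    moreover have "s < real (r - 1) - 1" using assms(1,6) by (simp add: of_nat_diff)
    ultimately show ?thesis
      using sobolev_density_from_charfun[OF _ _ C M assms(5) \<sigma>(1) _ sum cone] by simp
  qed
  ultimately show ?thesis by blast
qed

end
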